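(* Let $d \geq 1$. If $\varphi$ is a proper edge precoloring of $Q_d$ with colors from $\{1,\dots,d\}$ and with exactly $d$ precolored edges, and $\varphi \notin \mathcal{C}$, then $\varphi$ is extendable to a proper $d$-edge coloring of $Q_d$.
   Context: $Q_d$ is the $d$-dimensional hypercube graph. All (partial) edge colorings are proper: adjacent colored edges receive distinct colors. An edge precoloring of $Q_d$ is a proper edge coloring of some subset of $E(Q_d)$; edges in this subset are called colored (or precolored), the others uncolored. A proper $d$-edge coloring is a proper edge coloring of all edges using colors from $\{1,\dots,d\}$. A precoloring $\varphi$ is extendable if there is a proper $d$-edge coloring $f$ of $Q_d$ with $f(e)=\varphi(e)$ for every edge $e$ colored under $\varphi$. Two distinct edges are adjacent if they share an endpoint. A dimensional matching of $Q_d$ is a perfect matching $M$ of $Q_d$ such that $Q_d - M$ (removing the edges of $M$) is isomorphic to two disjoint copies of $Q_{d-1}$; there are exactly $d$ of them (the $d$ coordinate directions). $\mathcal{C}$ is the set of all precolorings of $Q_d$ ($d \ge 1$) that satisfy at least one of the following conditions: (C1) there is an uncolored edge $uv$ in $Q_d$ such that $u$ is incident with edges of $k \leq d$ distinct colors and $v$ is incident with $d-k$ edges colored with $d-k$ other distinct colors (so $uv$ is adjacent to edges of $d$ distinct colors); (C2) there is a vertex $u$ and a color $c \in \{1,\dots,d\}$ such that $u$ is incident with at least one colored edge, $u$ is not incident with any edge of color $c$, and every uncolored edge incident with $u$ is adjacent to another edge colored $c$; (C3) there is a vertex $u$ and a color $c \in \{1,\dots,d\}$ such that every edge incident with $u$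 is uncolored and every edge incident with $u$ is adjacent to another edge colored $c$; (C4) $d=3$ and the three precolored edges use three different colors and form a subset of a dimensional matching. *)

theory Defs
  imports Main
begin

text \<open>Graphs are given by a vertex set and a set of two-element edges. A vertex of the hypercube is
  a 0/1-vector of length d, encoded as the set of those coordinates that are equal to 1.\<close>

definition cube_verts :: "nat \<Rightarrow> nat set set" where
  "cube_verts d = Pow {..<d}"

definition cube_edges :: "nat \<Rightarrow> nat set set set" where
  "cube_edges d = {{x, y} | x y. x \<in> cube_verts d \<and> y \<in> cube_verts d \<and> card (sym_diff x y) = 1}"

definition adjacent_edges :: "'a set \<Rightarrow> 'a set \<Rightarrow> bool" where
  "adjacent_edges e e' \<longleftrightarrow> e \<noteq> e' \<and> e \<inter> e' \<noteq> {}"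

definition incident_edges :: "nat \<Rightarrow> nat set \<Rightarrow> nat set set set" where
  "incident_edges d u = {e \<in> cube_edges d. u \<in> e}"

definition graph_isomorphic :: "'a set \<Rightarrow> 'a set set \<Rightarrow> 'b set \<Rightarrow> 'b set set \<Rightarrow> bool" where
  "graph_isomorphic V E W F \<longleftrightarrow> (\<exists>h. bij_betw h V W \<and> (\<lambda>e. h ` e) ` E = F)"

definition perfect_matching :: "'a set \<Rightarrow> 'a set set \<Rightarrow> 'a set set \<Rightarrow> bool" where
  "perfect_matching V E M \<longleftrightarrow> M \<subseteq> E \<and> (\<forall>v\<in>V. \<exists>!e. e \<in> M \<and> v \<in> e)"

definition two_copies_verts :: "'a set \<Rightarrow> (bool \<times> 'a) set" where
  "two_copies_verts V = UNIV \<times> V"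

definition two_copies_edges :: "'a set set \<Rightarrow> (bool \<times> 'a) set set" where
  "two_copies_edges E = {Pair b ` e | b e. e \<in> E}"

text \<open>Only meaningful for positive d, because of the truncated subtraction.\<close>

definition dimensional_matching :: "nat \<Rightarrow> nat set set set \<Rightarrow> bool" where
  "dimensional_matching d M \<longleftrightarrow>
     perfect_matching (cube_verts d) (cube_edges d) M \<and>
     graph_isomorphic (cube_verts d) (cube_edges d - M)
       (two_copies_verts (cube_verts (d - 1))) (two_copies_edges (cube_edges (d - 1)))"

text \<open>A partial coloring is a map whose domain is the set of colored edges. The set of
  available colors is not part of the notion of a precoloring.\<close>

definition edge_precoloring :: "nat \<Rightarrow> (nat set set \<rightharpoonup> nat) \<Rightarrow> bool" where
  "edge_precoloring d \<phi> \<longleftrightarrow>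
     dom \<phi> \<subseteq> cube_edges d \<and>
     (\<forall>e\<in>dom \<phi>. \<forall>e'\<in>dom \<phi>. adjacent_edges e e' \<longrightarrow> \<phi> e \<noteq> \<phi> e')"

definition proper_edge_coloring :: "nat \<Rightarrow> (nat set set \<rightharpoonup> nat) \<Rightarrow> bool" where
  "proper_edge_coloring d f \<longleftrightarrow>
     edge_precoloring d f \<and> dom f = cube_edges d \<and> ran f \<subseteq> {1..d}"

definition extendable :: "nat \<Rightarrow> (nat set set \<rightharpoonup> nat) \<Rightarrow> bool" where
  "extendable d \<phi> \<longleftrightarrow> (\<exists>f. proper_edge_coloring d f \<and> (\<forall>e\<in>dom \<phi>. f e = \<phi> e))"

definition colors_at :: "nat \<Rightarrow> (nat set set \<rightharpoonup> nat) \<Rightarrow> nat set \<Rightarrow> nat set" where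
  "colors_at d \<phi> u = {c. \<exists>e\<in>incident_edges d u. \<phi> e = Some c}"

definition adjacent_to_color :: "nat \<Rightarrow> (nat set set \<rightharpoonup> nat) \<Rightarrow> nat set set \<Rightarrow> nat \<Rightarrow> bool" where
  "adjacent_to_color d \<phi> e c \<longleftrightarrow>
     (\<exists>e'\<in>cube_edges d. adjacent_edges e e' \<and> \<phi> e' = Some c)"

definition cond_C1 :: "nat \<Rightarrow> (nat set set \<rightharpoonup> nat) \<Rightarrow> bool" where
  "cond_C1 d \<phi> \<longleftrightarrow>
     (\<exists>u v k. {u, v} \<in> cube_edges d \<and> {u, v} \<notin> dom \<phi> \<and> k \<le> d \<and>
        card (colors_at d \<phi> u) = k \<and>
        (\<exists>F \<subseteq> incident_edges d v \<inter> dom \<phi>.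
           card F = d - k \<and> inj_on \<phi> F \<and>
           (\<forall>e\<in>F. the (\<phi> e) \<notin> colors_at d \<phi> u)))"

definition cond_C2 :: "nat \<Rightarrow> (nat set set \<rightharpoonup> nat) \<Rightarrow> bool" where
  "cond_C2 d \<phi> \<longleftrightarrow>
     (\<exists>u\<in>cube_verts d. \<exists>c\<in>{1..d}.
        (\<exists>e\<in>incident_edges d u. e \<in> dom \<phi>) \<and>
        c \<notin> colors_at d \<phi> u \<and>
        (\<forall>e\<in>incident_edges d u. e \<notin> dom \<phi> \<longrightarrow> adjacent_to_color d \<phi> e c))"

definition cond_C3 :: "nat \<Rightarrow> (nat set set \<rightharpoonup> nat) \<Rightarrow> bool" where
  "cond_C3 d \<phi> \<longleftrightarrow>
     (\<exists>u\<in>cube_verts d. \<exists>c\<in>{1..d}.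
        \<forall>e\<in>incident_edges d u. e \<notin> dom \<phi> \<and> adjacent_to_color d \<phi> e c)"

definition cond_C4 :: "nat \<Rightarrow> (nat set set \<rightharpoonup> nat) \<Rightarrow> bool" where
  "cond_C4 d \<phi> \<longleftrightarrow>
     d = 3 \<and> card (dom \<phi>) = 3 \<and> card (ran \<phi>) = 3 \<and>
     (\<exists>M. dimensional_matching d M \<and> dom \<phi> \<subseteq> M)"

definition exceptional_precolorings :: "nat \<Rightarrow> (nat set set \<rightharpoonup> nat) set" where
  "exceptional_precolorings d =
     {\<phi>. edge_precoloring d \<phi> \<and> (cond_C1 d \<phi> \<or> cond_C2 d \<phi> \<or> cond_C3 d \<phi> \<or> cond_C4 d \<phi>)}"

end

theory Submission imports Defs
begin

text \<open>Induction on the dimension. A vertex is the set of its coordinates equal to 1, and an edge is a pair \<open>(v, i)\<close>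
  with \<open>i \<notin> v\<close>, joining \<open>v\<close> to \<open>insert i v\<close>. Cut the cube along a direction \<open>i\<close> and reserve a colour \<open>c\<close> for the
  edges of direction \<open>i\<close>. Wherever the precoloring is in conflict with this (an edge of colour \<open>c\<close> in another
  direction, or an edge of direction \<open>i\<close> with another colour), a matching \<open>T\<close> is prescribed in both
  halves with the same colours, and afterwards the colour \<open>c\<close> and the colours of \<open>T\<close> are
  interchanged on the 4-cycles over \<open>T\<close>. The two halves are then coloured by the theorem for fewer than
  \<open>d\<close> edges or by the induction hypothesis, and the choice of \<open>i\<close>, \<open>c\<close> and \<open>T\<close> depends on whether the colours are all
  different and whether some direction is unused. If no direction is unused and all colours differ,
  counting gives a good direction; conditions (C1) to (C3) are exactly the obstructions that a vertex or an edge may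
  see. Dimensions up to four, where (C4) occurs, are settled by a finite list of colorings that
  covers every pattern.\<close>

text \<open>A half has one direction less than the cube, so the theorem for fewer edges covers every
  half that has to respect at most \<open>d - 2\<close> edges. The obstacle is a cut that leaves
  \<open>d - 1\<close> edges in one half: the induction hypothesis then asks for a half without
  obstruction. By counting, an obstruction uses up every available edge, so a cut that fails
  describes the precoloring almost completely, and this description supplies another cut. A repeated
  colour leaves a spare colour for the edges between the halves; without repetition every colour
  determines its edge, which limits the clashes that a switch can cause. One family is not cut at
  all: the precolorings in which all edges outside one colour class meet a single vertex. They are
  coloured directly, by Hall's theorem together with an isoperimetric inequality for the cube. The
  induction starts in dimension four because its step may rely only on dimensions in which (C4) does
  not occur; beyond that, several choices need a fifth colour.\<close>

section \<open>Neighbours in the cube\<close>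

definition nb :: "nat set \<Rightarrow> nat \<Rightarrow> nat set" where
  "nb x i = (if i \<in> x then x - {i} else insert i x)"

lemma nb_iff [simp]: "j \<in> nb x i \<longleftrightarrow> (if j = i then i \<notin> x else j \<in> x)"
  by (auto simp: nb_def)

lemma nb_nb [simp]: "nb (nb x i) i = x"
  by (auto simp: nb_def)

lemma nb_neq [simp]: "nb x i \<noteq> x" "x \<noteq> nb x i"
  by (auto simp: nb_def)

lemma nb_comm: "nb (nb x i) j = nb (nb x j) i"
  by (auto simp: nb_def)

lemma nb_eq_iff [simp]: "nb x i = nb y i \<longleftrightarrow> x = y"
  by (metis nb_nb)

lemma nb_inj [simp]: "nb x i = nb x j \<longleftrightarrow> i = j"
  by (metis nb_iff)

lemma nb_swap: "nb x i = y \<longleftrightarrow> x = nb y i"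
  by (metis nb_nb)

lemma nb_subset [simp]: "i \<in> D \<Longrightarrow> nb x i \<subseteq> D \<longleftrightarrow> x \<subseteq> D"
  by (auto simp: nb_def)

lemma nb_Diff [simp]: "nb x i - {i} = x - {i}"
  by (auto simp: nb_def)

lemma nb_Diff_neq: "i \<noteq> j \<Longrightarrow> nb x i - {j} = nb (x - {j}) i"
  by (auto simp: nb_def)

text \<open>Parity: two flips change an even number of coordinates, one flip changes exactly one.
  Testing membership at the three coordinates involved is enough.\<close>

lemma nb_nb_neq [simp]: "nb (nb x i) j \<noteq> nb x k" "nb x k \<noteq> nb (nb x i) j"
proof -
  show "nb (nb x i) j \<noteq> nb x k"
  proof
    assume h: "nb (nb x i) j = nb x k"
    have "\<And>l. l \<in> nb (nb x i) j \<longleftrightarrow> l \<in> nb x k"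
      using h by simp
    from this[of i] this[of j] this[of k] show False
      by (simp split: if_splits)
  qed
  then show "nb x k \<noteq> nb (nb x i) j" by metis
qed

section \<open>Precolorings as sets of triples, colorings as local bijections\<close>

type_synonym precoloring = "(nat set \<times> nat \<times> nat) set"

text \<open>An edge is stored at its lower end; subtracting \<open>i\<close> makes the predicate
  independent of the end at which it is asked.\<close>

definition has :: "precoloring \<Rightarrow> nat set \<Rightarrow> nat \<Rightarrow> nat \<Rightarrow> bool" where
  "has P x i c \<longleftrightarrow> (x - {i}, i, c) \<in> P"

lemma has_nb [simp]: "has P (nb x i) i c = has P x i c"
  by (simp add: has_def)

lemma has_empty [simp]: "\<not> has {} x i c"
  by (simp add: has_def)

lemma has_Un [simp]: "has (P \<union> Q) x i c \<longleftrightarrow> has P x i c \<or> has Q x i c"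
  by (simp add: has_def)

lemma has_insert: "has (insert (v, j, e) P) x i c \<longleftrightarrow> (x - {i} = v \<and> i = j \<and> c = e) \<or> has P x i c"
  by (auto simp: has_def)

lemma has_mono: "has P x i c \<Longrightarrow> P \<subseteq> Q \<Longrightarrow> has Q x i c"
  by (auto simp: has_def)

text \<open>The equivalence at a vertex carries two facts: from left to right an edge has only one
  colour, from right to left adjacent edges have different colours. The sets \<open>D\<close> of
  directions and \<open>C\<close> of colours are arbitrary because the induction removes an element
  from each.\<close>

definition precol :: "nat set \<Rightarrow> nat set \<Rightarrow> precoloring \<Rightarrow> bool" where
  "precol D C P \<longleftrightarrow> (\<forall>(v, i, c) \<in> P. v \<subseteq> D \<and> i \<in> D \<and> i \<notin> v \<and> c \<in> C) \<and>
     (\<forall>x i j c e. has P x i c \<longrightarrow> has P x j e \<longrightarrow> (i = j \<longleftrightarrow> c = e))"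

text \<open>With as many colours as directions, properness means that each vertex sees every colour
  exactly once, hence the bijections.\<close>

definition coloring :: "nat set \<Rightarrow> nat set \<Rightarrow> (nat set \<Rightarrow> nat \<Rightarrow> nat) \<Rightarrow> bool" where
  "coloring D C f \<longleftrightarrow> (\<forall>x\<subseteq>D. bij_betw (f x) D C \<and> (\<forall>i\<in>D. f (nb x i) i = f x i))"

definition ext :: "nat set \<Rightarrow> nat set \<Rightarrow> precoloring \<Rightarrow> bool" where
  "ext D C P \<longleftrightarrow> (\<exists>f. coloring D C f \<and> (\<forall>(v, i, c) \<in> P. f v i = c))"

lemma precolD:
  assumes "precol D C P"
  shows "(v, i, c) \<in> P \<Longrightarrow> v \<subseteq> D" "(v, i, c) \<in> P \<Longrightarrow> i \<in> D" "(v, i, c) \<in> P \<Longrightarrow> i \<notin> v"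
    "(v, i, c) \<in> P \<Longrightarrow> c \<in> C"
    "has P x j d \<Longrightarrow> has P x k e \<Longrightarrow> j = k \<longleftrightarrow> d = e"
  using assms unfolding precol_def by blast+

lemma has_sub:
  assumes "precol D C P" "has P x i c" shows "x \<subseteq> D" "i \<in> D" "c \<in> C"
proof -
  have h: "(x - {i}, i, c) \<in> P" using assms(2) by (simp add: has_def)
  show "i \<in> D" "c \<in> C" using precolD(2,4)[OF assms(1) h] by auto
  then show "x \<subseteq> D" using precolD(1)[OF assms(1) h] by blast
qed

lemma in_has: "precol D C P \<Longrightarrow> (v, i, c) \<in> P \<Longrightarrow> has P v i c"
  using precolD(3) unfolding has_def by fastforce

lemma precolI:
  assumes "\<And>v i c. (v, i, c) \<in> P \<Longrightarrow> v \<subseteq> D \<and> i \<in> D \<and> i \<notin> v \<and> c \<in> C"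
    and "\<And>x i j c e. has P x i c \<Longrightarrow> has P x j e \<Longrightarrow> i = j \<longleftrightarrow> c = e"
  shows "precol D C P"
  unfolding precol_def using assms by blast

lemma precol_mono:
  assumes "precol D C P" "Q \<subseteq> P" shows "precol D C Q"
proof (rule precolI)
  fix v i c assume "(v, i, c) \<in> Q"
  then have "(v, i, c) \<in> P" using assms(2) by blast
  then show "v \<subseteq> D \<and> i \<in> D \<and> i \<notin> v \<and> c \<in> C"
    using precolD(1-4)[OF assms(1)] by simp
next
  fix x i j c e assume "has Q x i c" "has Q x j e"
  then show "i = j \<longleftrightarrow> c = e"
    using precolD(5)[OF assms(1) has_mono[OF _ assms(2)] has_mono[OF _ assms(2)]] by simp
qed

lemma precol_colors:
  assumes "precol D C P" "\<And>v i c. (v, i, c) \<in> P \<Longrightarrow> c \<in> C'" shows "precol D C' P"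
proof (rule precolI)
  fix v i c assume "(v, i, c) \<in> P"
  then show "v \<subseteq> D \<and> i \<in> D \<and> i \<notin> v \<and> c \<in> C'"
    using precolD(1-3)[OF assms(1)] assms(2) by simp
qed (rule precolD(5)[OF assms(1)])

lemma precol_empty [simp]: "precol D C {}"
  by (simp add: precol_def)

lemma precol_finite:
  assumes "finite D" "finite C" "precol D C P" shows "finite P"
proof (rule finite_subset)
  show "P \<subseteq> Pow D \<times> D \<times> C" using precolD(1,2,4)[OF assms(3)] by auto
  show "finite (Pow D \<times> D \<times> C)" using assms by simp
qed

lemma coloringD:
  assumes "coloring D C f" "x \<subseteq> D"
  shows "bij_betw (f x) D C" "i \<in> D \<Longrightarrow> f (nb x i) i = f x i"
  using assms by (auto simp: coloring_def)

lemma coloring_has: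
  assumes f: "coloring D C f" and P: "\<forall>(v, i, c) \<in> P. f v i = c" and h: "has P x i c"
    and x: "x \<subseteq> D" "i \<in> D"
  shows "f x i = c"
proof -
  have "f (x - {i}) i = c" using P h by (auto simp: has_def)
  moreover have "f (x - {i}) i = f x i"
  proof (cases "i \<in> x")
    case True
    then have "x - {i} = nb x i" by (simp add: nb_def)
    then show ?thesis using coloringD(2)[OF f x(1), of i] x(2) by simp
  next
    case False
    then show ?thesis by simp
  qed
  ultimately show ?thesis by simp
qed

section \<open>Joining two halves and switching\<close>

text \<open>The colours at a vertex over the switching matching: \<open>G\<close> comes from the
  half, the cut direction \<open>i\<close> takes over the colour of the matching direction
  \<open>l\<close>, and \<open>l\<close> receives the reserved colour \<open>c\<close>.\<close>

lemma bij_betw_swap_default: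
  assumes G: "bij_betw G (D - {i}) (C - {c})" and i: "i \<in> D" "c \<in> C" and l: "l \<in> D - {i}"
  shows "bij_betw (\<lambda>j. if j = i then G l else if j = l then c else G j) D C"
proof -
  have inj: "inj_on G (D - {i})" and im: "G ` (D - {i}) = C - {c}"
    using G by (auto simp: bij_betw_def)
  have Gc: "G x \<noteq> c" "c \<noteq> G x" if "x \<in> D" "x \<noteq> i" for x
    using im that by blast+
  have Gi: "G x = G y \<longleftrightarrow> x = y" if "x \<in> D" "x \<noteq> i" "y \<in> D" "y \<noteq> i" for x y
    using inj that by (auto simp: inj_on_def)
  have "inj_on (\<lambda>j. if j = i then G l else if j = l then c else G j) D"
    by (rule inj_onI) (use l in \<open>auto simp: Gc Gi split: if_splits\<close>)
  moreover have "(\<lambda>j. if j = i then G l else if j = l then c else G j) ` D = C"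
  proof -
    have GC: "G j \<in> C" if "j \<in> D" "j \<noteq> i" for j using im that by blast
    show ?thesis
    proof (intro equalityI subsetI)
      fix y assume "y \<in> (\<lambda>j. if j = i then G l else if j = l then c else G j) ` D"
      then show "y \<in> C" using GC i l by auto
    next
      fix y assume y: "y \<in> C"
      show "y \<in> (\<lambda>j. if j = i then G l else if j = l then c else G j) ` D"
      proof (cases "y = c")
        case True
        then show ?thesis using l by (intro image_eqI[of _ _ l]) auto
      next
        case False
        then have "y \<in> G ` (D - {i})" using im y by blast
        then obtain j where j: "j \<in> D" "j \<noteq> i" "y = G j" by blast
        show ?thesis
        proof (cases "j = l")
          case True
          then show ?thesis using i j by (intro image_eqI[of _ _ i]) auto
        next
          case False
          then show ?thesis using j by (intro image_eqI[of _ _ j]) auto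
        qed
      qed
    qed
  qed
  ultimately show ?thesis by (simp add: bij_betw_def)
qed

text \<open>The colours at a vertex that no switch touches: the cut direction has the reserved
  colour.\<close>

lemma bij_betw_default:
  assumes G: "bij_betw G (D - {i}) (C - {c})" and i: "i \<in> D" "c \<in> C"
  shows "bij_betw (\<lambda>j. if j = i then c else G j) D C"
proof -
  have inj: "inj_on G (D - {i})" and im: "G ` (D - {i}) = C - {c}"
    using G by (auto simp: bij_betw_def)
  have Gc: "G x \<noteq> c" "c \<noteq> G x" if "x \<in> D" "x \<noteq> i" for x
    using im that by blast+
  have Gi: "G x = G y \<longleftrightarrow> x = y" if "x \<in> D" "x \<noteq> i" "y \<in> D" "y \<noteq> i" for x y
    using inj that by (auto simp: inj_on_def)
  have "inj_on (\<lambda>j. if j = i then c else G j) D"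
    by (rule inj_onI) (auto simp: Gc Gi split: if_splits)
  moreover have "(\<lambda>j. if j = i then c else G j) ` D = insert c (G ` (D - {i}))"
    using i by auto
  then have "(\<lambda>j. if j = i then c else G j) ` D = C" using im i by auto
  ultimately show ?thesis by (simp add: bij_betw_def)
qed

text \<open>The two halves in direction \<open>i\<close> are coloured without \<open>c\<close> and joined by edges of colour \<open>c\<close>;
  then the 4-cycles over the edges of the matching \<open>T\<close> are switched.\<close>

lemma strat:
  assumes i: "i \<in> D" and c: "c \<in> C" and P: "precol D C P"
    and T: "precol (D - {i}) (C - {c}) T"
    and match: "\<And>x j e j' e'. has T x j e \<Longrightarrow> has T x j' e' \<Longrightarrow> j = j'"
    and g: "\<And>b::bool. coloring (D - {i}) (C - {c}) (g b)"
    and gT: "\<And>b v j e. (v, j, e) \<in> T \<Longrightarrow> g b v j = e"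
    and M: "\<And>v e. (v, i, e) \<in> P \<Longrightarrow> if e = c then \<forall>l e'. \<not> has T v l e' else \<exists>l. has T v l e"
    and N: "\<And>v j. (v, j, c) \<in> P \<Longrightarrow> j \<noteq> i \<Longrightarrow> \<exists>e'. (v - {i}, j, e') \<in> T"
    and R: "\<And>v j e. (v, j, e) \<in> P \<Longrightarrow> j \<noteq> i \<Longrightarrow> e \<noteq> c \<Longrightarrow> (\<forall>e'. (v - {i}, j, e') \<notin> T) \<and> g (i \<in> v) (v - {i}) j = e"
  shows "ext D C P"
proof -
  let ?D = "D - {i}" and ?C = "C - {c}"
  define t where "t x l \<longleftrightarrow> (\<exists>e. has T x l e)" for x l
  have tun: "t x l \<Longrightarrow> t x l' \<Longrightarrow> l = l'" for x l l'
    using match unfolding t_def by blast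
  have tnb: "t (nb x l) l = t x l" for x l by (simp add: t_def)
  have tD: "t x l \<Longrightarrow> x \<subseteq> ?D \<and> l \<in> ?D" for x l
    using has_sub[OF T] unfolding t_def by blast
  \<comment> \<open>The half that contains \<open>x\<close> supplies \<open>G\<close>. If the
    projection \<open>y\<close> of \<open>x\<close> is covered by the matching, in direction
    \<open>l\<close>, the colours of \<open>i\<close> and \<open>l\<close> are interchanged.\<close>
  define f where "f x j = (let y = x - {i}; G = g (i \<in> x) y in
      if \<exists>l. t y l then (let l = (THE l. t y l) in if j = i then G l else if j = l then c else G j)
      else if j = i then c else G j)" for x j
  have f_t: "f x = (\<lambda>j. if j = i then g (i \<in> x) (x - {i}) l else if j = l then c else g (i \<in> x) (x - {i}) j)"
    if "t (x - {i}) l" for x l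
  proof -
    have "(THE l. t (x - {i}) l) = l" using that tun by blast
    then show ?thesis using that by (auto simp: f_def fun_eq_iff Let_def)
  qed
  have f_n: "f x = (\<lambda>j. if j = i then c else g (i \<in> x) (x - {i}) j)"
    if "\<not> (\<exists>l. t (x - {i}) l)" for x
    using that by (auto simp: f_def fun_eq_iff Let_def)
  have f_j: "f y j = (if t (y - {i}) j then c else g (i \<in> y) (y - {i}) j)" if ji: "j \<noteq> i" for y j
  proof (cases "\<exists>l. t (y - {i}) l")
    case True
    then obtain l where l: "t (y - {i}) l" by blast
    then have "t (y - {i}) j \<longleftrightarrow> j = l" using tun by blast
    then show ?thesis using f_t[OF l] ji by simp
  next
    case False
    then have "\<not> t (y - {i}) j" by blast
    then show ?thesis using f_n[OF False] ji by simp
  qed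
  have gt: "g b x l = e" if "has T x l e" for b x l e
  proof -
    have "\<forall>(v, i, c) \<in> T. g b v i = c" using gT by auto
    then show ?thesis using coloring_has[OF g _ that] has_sub[OF T that] by blast
  qed
  have "coloring D C f"
    unfolding coloring_def
  proof (intro allI impI conjI ballI)
    fix x assume x: "x \<subseteq> D"
    then have x': "x - {i} \<subseteq> ?D" by auto
    have G: "bij_betw (g (i \<in> x) (x - {i})) ?D ?C" using coloringD(1)[OF g x'] .
    show "bij_betw (f x) D C"
    proof (cases "\<exists>l. t (x - {i}) l")
      case True
      then obtain l where l: "t (x - {i}) l" by blast
      then show ?thesis using bij_betw_swap_default[OF G i c, of l] tD f_t by auto
    next
      case False
      then show ?thesis using bij_betw_default[OF G i c] f_n by auto
    qed
    fix j assume j: "j \<in> D"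
    show "f (nb x j) j = f x j"
    proof (cases "j = i")
      case True
      show ?thesis
      proof (cases "\<exists>l. t (x - {i}) l")
        case T': True
        then obtain l e where l: "has T (x - {i}) l e" "t (x - {i}) l" by (auto simp: t_def)
        \<comment> \<open>Both ends of an edge of direction \<open>i\<close> have the same
          projection, and the matching has the same colours in both halves. This is the place where
          the common prescription is needed.\<close>
        then show ?thesis using f_t[of x l] f_t[of "nb x i" l] gt[OF l(1)] True by simp
      next
        case False
        then show ?thesis using f_n[of x] f_n[of "nb x i"] True by simp
      qed
    next
      case ji: False
      have nbi: "nb x j - {i} = nb (x - {i}) j" "i \<in> nb x j \<longleftrightarrow> i \<in> x"
        using ji by (auto simp: nb_def)
      have gj: "g b (nb (x - {i}) j) j = g b (x - {i}) j" for b
        using coloringD(2)[OF g x'] ji j by auto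
      show ?thesis unfolding f_j[OF ji] nbi tnb gj ..
    qed
  qed
  moreover have "f v j = e" if p: "(v, j, e) \<in> P" for v j e
  proof (cases "j = i")
    case True
    then have v: "v - {i} = v" "i \<notin> v" using precolD(3)[OF P p] by auto
    show ?thesis
    proof (cases "e = c")
      case ec: True
      then have "\<not> (\<exists>l. t (v - {i}) l)" using M[of v e] p True v(1) by (simp add: t_def)
      then show ?thesis using f_n True ec by simp
    next
      case False
      then obtain l where l: "has T v l e" using M[of v e] p True by auto
      then have "t (v - {i}) l" by (auto simp: t_def v)
      then show ?thesis using f_t gt[OF l] True v by simp
    qed
  next
    case ji: False
    have jv: "j \<notin> v" using precolD(3)[OF P p] .
    then have hv: "has T (v - {i}) j e' \<longleftrightarrow> (v - {i}, j, e') \<in> T" for e'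
      unfolding has_def by (metis Diff_empty Diff_iff Diff_insert0)
    show ?thesis
    proof (cases "e = c")
      case True
      then have "t (v - {i}) j" using N[of v j] p ji hv by (auto simp: t_def)
      then show ?thesis using f_j[OF ji] True by simp
    next
      case False
      then have nt: "\<not> t (v - {i}) j" and gg: "g (i \<in> v) (v - {i}) j = e"
        using R[OF p ji] hv by (auto simp: t_def)
      then show ?thesis using f_j[OF ji] by simp
    qed
  qed
  ultimately show ?thesis unfolding ext_def by blast
qed

section \<open>Restriction of a precoloring to the halves\<close>

text \<open>What remains to be prescribed in one half, moved to the smaller cube. Edges of colour
  \<open>c\<close> are left out because they are either edges between the halves or produced by
  switching.\<close>

definition slice :: "bool \<Rightarrow> nat \<Rightarrow> nat \<Rightarrow> precoloring \<Rightarrow> precoloring" where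
  "slice b i c P = {(v - {i}, j, e) | v j e. (v, j, e) \<in> P \<and> j \<noteq> i \<and> e \<noteq> c \<and> (i \<in> v) = b}"

lemma slice_iff: "(w, j, e) \<in> slice b i c P \<longleftrightarrow>
    j \<noteq> i \<and> e \<noteq> c \<and> i \<notin> w \<and> ((if b then insert i w else w), j, e) \<in> P"
proof -
  have *: "v = insert i (v - {i})" if "i \<in> v" for v :: "nat set" using that by auto
  show ?thesis unfolding slice_def by (cases b) (use * in \<open>auto 4 4\<close>)
qed

lemma has_slice: "has (slice b i c P) x j e \<longleftrightarrow>
    j \<noteq> i \<and> e \<noteq> c \<and> i \<notin> x \<and> has P (if b then insert i x else x) j e"
  unfolding has_def slice_iff by (auto simp: insert_Diff_if)

lemma slice_precol:
  assumes "precol D C P" shows "precol (D - {i}) (C - {c}) (slice b i c P)"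
proof (rule precolI)
  fix v j e assume "(v, j, e) \<in> slice b i c P"
  then have h: "j \<noteq> i" "e \<noteq> c" "i \<notin> v" "((if b then insert i v else v), j, e) \<in> P"
    by (auto simp: slice_iff)
  then show "v \<subseteq> D - {i} \<and> j \<in> D - {i} \<and> j \<notin> v \<and> e \<in> C - {c}"
    using precolD(1-4)[OF assms h(4)] by (auto split: if_splits)
next
  fix x j k e e' assume "has (slice b i c P) x j e" "has (slice b i c P) x k e'"
  then have "has P (if b then insert i x else x) j e" "has P (if b then insert i x else x) k e'"
    unfolding has_slice by blast+
  then show "j = k \<longleftrightarrow> e = e'" by (rule precolD(5)[OF assms])
qed

lemma slice_card:
  assumes "finite P"
  shows "finite (slice b i c P)"
    "card (slice b i c P) \<le> card {(v, j, e). (v, j, e) \<in> P \<and> j \<noteq> i \<and> e \<noteq> c \<and> (i \<in> v) = b}"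
proof -
  let ?A = "{(v, j, e). (v, j, e) \<in> P \<and> j \<noteq> i \<and> e \<noteq> c \<and> (i \<in> v) = b}"
  have im: "slice b i c P = (\<lambda>(v, j, e). (v - {i}, j, e)) ` ?A"
    unfolding slice_def by force
  have fin: "finite ?A" using assms by (rule rev_finite_subset) auto
  show "finite (slice b i c P)" unfolding im using fin by simp
  show "card (slice b i c P) \<le> card ?A" unfolding im by (rule card_image_le[OF fin])
qed

text \<open>One coloring \<open>g\<close> serves both halves, so the two copies of an edge always
  agree and any matching may be switched. The matching consists of the edges of colour
  \<open>c\<close>, with whatever colours \<open>g\<close> gives them; edges of colour
  \<open>c\<close> therefore cost nothing.\<close>

lemma copy_one_sided:
  assumes i: "i \<in> D" and c: "c \<in> C" and P: "precol D C P"
    and side: "\<And>v j e. (v, j, e) \<in> P \<Longrightarrow> j \<noteq> i \<and> (i \<in> v) = b \<or> j = i \<and> e = c"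
    and e: "ext (D - {i}) (C - {c}) (slice b i c P)"
  shows "ext D C P"
proof -
  obtain g where g: "coloring (D - {i}) (C - {c}) g" and gS: "\<forall>(v, j, e) \<in> slice b i c P. g v j = e"
    using e by (auto simp: ext_def)
  define T where "T = {(v - {i}, j, g (v - {i}) j) | v j. (v, j, c) \<in> P \<and> j \<noteq> i}"
  have T_iff: "(w, j, e) \<in> T \<longleftrightarrow> j \<noteq> i \<and> i \<notin> w \<and> e = g w j \<and> ((if b then insert i w else w), j, c) \<in> P" for w j e
  proof
    assume "(w, j, e) \<in> T"
    then obtain v where v: "w = v - {i}" "e = g w j" "(v, j, c) \<in> P" "j \<noteq> i"
      by (auto simp: T_def)
    then have "(if b then insert i w else w) = v" using side[OF v(3)] by auto
    then show "j \<noteq> i \<and> i \<notin> w \<and> e = g w j \<and> ((if b then insert i w else w), j, c) \<in> P"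
      using v by auto
  next
    assume h: "j \<noteq> i \<and> i \<notin> w \<and> e = g w j \<and> ((if b then insert i w else w), j, c) \<in> P"
    then have "(if b then insert i w else w) - {i} = w" by auto
    then show "(w, j, e) \<in> T" unfolding T_def mem_Collect_eq using h
      by (intro exI[of _ "if b then insert i w else w"] exI[of _ j]) simp
  qed
  have hasT: "has P (if b then insert i x else x) j c \<and> j \<noteq> i \<and> i \<notin> x" if "has T x j e" for x j e
    using that unfolding has_def T_iff by (auto simp: insert_Diff_if)
  have gin: "g w j \<in> C - {c}" if "w \<subseteq> D - {i}" "j \<in> D - {i}" for w j
    using coloringD(1)[OF g that(1)] that(2) by (auto simp: bij_betw_def)
  have Tm: "j = j'" if "has T x j e" "has T x j' e'" for x j e j' e'
    using hasT[OF that(1)] hasT[OF that(2)] precolD(5)[OF P] by blast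
  have Tp: "precol (D - {i}) (C - {c}) T"
  proof (rule precolI)
    fix v j e assume h: "(v, j, e) \<in> T"
    then have h': "j \<noteq> i" "i \<notin> v" "e = g v j" "((if b then insert i v else v), j, c) \<in> P"
      by (auto simp: T_iff)
    then have "v \<subseteq> D - {i}" "j \<in> D - {i}" "j \<notin> v"
      using precolD(1-3)[OF P h'(4)] by (auto split: if_splits)
    then show "v \<subseteq> D - {i} \<and> j \<in> D - {i} \<and> j \<notin> v \<and> e \<in> C - {c}" using gin h' by auto
  next
    fix x j j' e e' assume h: "has T x j e" "has T x j' e'"
    then have j: "j = j'" using Tm by blast
    have "e = e'" using h unfolding j has_def T_iff by auto
    then show "j = j' \<longleftrightarrow> e = e'" using j by simp
  qed
  show ?thesis
  proof (rule strat[where g = "\<lambda>_. g" and T = T, OF i c P Tp Tm g])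
    show "g v j = e" if "(v, j, e) \<in> T" for v j e using that by (auto simp: T_iff)
    show "if e = c then \<forall>l e'. \<not> has T v l e' else \<exists>l. has T v l e" if p: "(v, i, e) \<in> P" for v e
    proof -
      have ec: "e = c" using side[OF p] by auto
      have "\<not> has T v l e'" for l e'
      proof
        assume "has T v l e'"
        from hasT[OF this] have h: "has P (if b then insert i v else v) l c" "l \<noteq> i" "i \<notin> v" by auto
        have "has P v i c" using in_has[OF P p] ec by simp
        then have "has P (if b then insert i v else v) i c"
          using has_nb[of P v i c] h(3) by (simp add: nb_def)
        then show False using precolD(5)[OF P h(1)] h(2) by blast
      qed
      then show ?thesis using ec by simp
    qed
    show "\<exists>e'. (v - {i}, j, e') \<in> T" if "(v, j, c) \<in> P" "j \<noteq> i" for v j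
      using that unfolding T_def by blast
    fix v j e assume p: "(v, j, e) \<in> P" "j \<noteq> i" "e \<noteq> c"
    have b: "(i \<in> v) = b" using side[OF p(1)] p by auto
    have "(v - {i}, j, e') \<notin> T" for e'
    proof
      assume "(v - {i}, j, e') \<in> T"
      then have "(v, j, c) \<in> P" using b unfolding T_iff by (auto simp: insert_absorb split: if_splits)
      then show False using p in_has[OF P] precolD(5)[OF P] by blast
    qed
    moreover have "(v - {i}, j, e) \<in> slice b i c P" using p b unfolding slice_def by blast
    then have "g (v - {i}) j = e" using gS by auto
    ultimately show "(\<forall>e'. (v - {i}, j, e') \<notin> T) \<and> g (v - {i}) j = e" by blast
  qed auto
qed

text \<open>Direction \<open>i\<close> and colour \<open>c\<close> occur only together, so there is
  nothing to switch: the matching is empty and the halves are coloured independently.\<close>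

lemma split_unused:
  assumes i: "i \<in> D" and c: "c \<in> C" and P: "precol D C P"
    and side: "\<And>v j e. (v, j, e) \<in> P \<Longrightarrow> j = i \<longleftrightarrow> e = c"
    and e: "\<And>b. ext (D - {i}) (C - {c}) (slice b i c P)"
  shows "ext D C P"
proof -
  have "\<exists>g. \<forall>b. coloring (D - {i}) (C - {c}) (g b) \<and> (\<forall>(v, j, e) \<in> slice b i c P. g b v j = e)"
    using e unfolding ext_def by metis
  then obtain g where gg: "\<forall>b. coloring (D - {i}) (C - {c}) (g b) \<and> (\<forall>(v, j, e) \<in> slice b i c P. g b v j = e)"
    by (elim exE)
  have g: "\<And>b. coloring (D - {i}) (C - {c}) (g b)" using gg by simp
  have gS: "g b v j = e" if "(v, j, e) \<in> slice b i c P" for b v j e using gg that by auto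
  show ?thesis
  proof (rule strat[where g = g and T = "{}", OF i c P _ _ g])
    fix v j e assume p: "(v, j, e) \<in> P" "j \<noteq> i" "e \<noteq> c"
    then have "(v - {i}, j, e) \<in> slice (i \<in> v) i c P" unfolding slice_def by blast
    then show "(\<forall>e'. (v - {i}, j, e') \<notin> {}) \<and> g (i \<in> v) (v - {i}) j = e" using gS by simp
  qed (use side in auto)
qed

text \<open>The number of edges that a half has to respect is always estimated by exhibiting edges
  that it loses; these form \<open>X\<close>.\<close>

lemma slice_card_add:
  assumes fin: "finite P" and X: "X \<subseteq> P"
    and ex: "\<And>v j e. (v, j, e) \<in> X \<Longrightarrow> j = i \<or> e = c \<or> (i \<in> v) \<noteq> b"
  shows "card (slice b i c P) + card X \<le> card P"
proof -
  let ?A = "{(v, j, e). (v, j, e) \<in> P \<and> j \<noteq> i \<and> e \<noteq> c \<and> (i \<in> v) = b}"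
  have A: "?A \<subseteq> P" "?A \<inter> X = {}" using ex by auto
  have "card ?A + card X = card (?A \<union> X)"
    using fin A X by (intro card_Un_disjoint[symmetric]) (auto intro: finite_subset)
  also have "\<dots> \<le> card P" using fin A(1) X by (intro card_mono) auto
  finally show ?thesis using slice_card(2)[OF fin, of b i c] by linarith
qed

lemma slice_card_less:
  assumes fin: "finite P" and t: "(v, j, e) \<in> P" "j = i \<or> e = c \<or> (i \<in> v) \<noteq> b"
  shows "card (slice b i c P) < card P"
  using slice_card_add[OF fin, of "{(v, j, e)}" i c b] t by auto

lemma Diff_eq_iff_nb: "x - {j} = y - {j} \<longleftrightarrow> x = y \<or> x = nb y j"
  by (auto simp: nb_def)

lemma ext_empty_singleton: "ext {i} {c} {}"
proof -
  have "coloring {i} {c} (\<lambda>_ _. c)" by (auto simp: coloring_def bij_betw_def)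
  then show ?thesis unfolding ext_def by blast
qed

section \<open>Fewer edges than directions\<close>

lemma unused_direction:
  assumes fin: "finite P" "finite D" and "card P < card D"
  obtains i where "i \<in> D" "\<And>v e. (v, i, e) \<notin> P"
proof -
  have "card ((fst \<circ> snd) ` P) < card D" using card_image_le[OF fin(1), of "fst \<circ> snd"] assms(3) by simp
  then have "\<not> D \<subseteq> (fst \<circ> snd) ` P" using fin(1) card_mono[of "(fst \<circ> snd) ` P" D] by auto
  then obtain i where "i \<in> D" "i \<notin> (fst \<circ> snd) ` P" by blast
  then show thesis using that by force
qed

lemma unused_color:
  assumes fin: "finite P" "finite C" and "card ((snd \<circ> snd) ` P) < card C"
  obtains c where "c \<in> C" "\<And>v j. (v, j, c) \<notin> P"
proof -
  have "\<not> C \<subseteq> (snd \<circ> snd) ` P" using assms card_mono[of "(snd \<circ> snd) ` P" C] by auto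
  then obtain c where "c \<in> C" "c \<notin> (snd \<circ> snd) ` P" by blast
  then show thesis using that by force
qed

theorem ext_few:
  assumes "finite D" "finite C" "card C = card D" "precol D C P" "card P < card D"
  shows "ext D C P"
  using assms
proof (induction "card D" arbitrary: D C P)
  case 0
  then show ?case by simp
next
  case (Suc m)
  have finP: "finite P" using precol_finite[OF Suc.prems(1,2,4)] .
  obtain i where i: "i \<in> D" "\<And>v e. (v, i, e) \<notin> P"
    using unused_direction[OF finP Suc.prems(1,5)] by blast
  have "card ((snd \<circ> snd) ` P) < card C"
    using card_image_le[OF finP, of "snd \<circ> snd"] Suc.prems(3,5) by simp
  then obtain c where c: "c \<in> C" "\<And>v j. (v, j, c) \<notin> P"
    using unused_color[OF finP Suc.prems(2)] by blast
  have cD: "card (D - {i}) = m" using Suc.hyps(2) i Suc.prems(1) by simp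
  have cC: "card (C - {c}) = m" if "c \<in> C" for c using Suc.hyps(2) Suc.prems(2,3) that by simp
  have IH: "ext (D - {i}) (C - {c}) (slice b i c P)" if "card (slice b i c P) < m" "c \<in> C" for b c
    using Suc.hyps(1)[of "D - {i}" "C - {c}" "slice b i c P"] cD cC[OF that(2)] Suc.prems(1,2)
      slice_precol[OF Suc.prems(4)] that(1) by simp
  show ?case
  \<comment> \<open>The empty precoloring has no occurring colour that could be reserved, so it
    descends by itself.\<close>
  proof (cases "P = {}")
    case True
    show ?thesis
    proof (cases "m = 0")
      case m: True
      then obtain i c where "D = {i}" "C = {c}" using Suc.hyps(2) Suc.prems(3) by (metis One_nat_def card_1_singletonE)
      then show ?thesis using True ext_empty_singleton by simp
    next
      case False
      have "slice True i c P = {}" using True by (simp add: slice_def)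
      then show ?thesis using copy_one_sided[OF i(1) c(1) Suc.prems(4), of True] IH[of True c] True False c by simp
    qed
  next
    case False
    show ?thesis
    proof (cases "\<exists>b. \<forall>v j e. (v, j, e) \<in> P \<longrightarrow> (i \<in> v) = b")
      case True
      then obtain b where b: "\<And>v j e. (v, j, e) \<in> P \<Longrightarrow> (i \<in> v) = b" by blast
      obtain v j e where t: "(v, j, e) \<in> P" using False by auto
      then have e: "e \<in> C" using precolD(4)[OF Suc.prems(4)] by simp
      have "card (slice b i e P) < card P" using slice_card_less[OF finP t] by simp
      then have "ext (D - {i}) (C - {e}) (slice b i e P)" using IH[of b e] e Suc.prems(5) Suc.hyps(2) by simp
      then show ?thesis using copy_one_sided[OF i(1) e Suc.prems(4)] b i(2) by metis
    next
      case nb: False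
      have "card (slice b i c P) < m" for b
      proof -
        have "\<not> (\<forall>v j e. (v, j, e) \<in> P \<longrightarrow> (i \<in> v) = b)"
          using nb by (rule contrapos_nn) (rule exI)
        then obtain v j e where t: "(v, j, e) \<in> P" "(i \<in> v) \<noteq> b" by auto
        then have "card (slice b i c P) < card P" using slice_card_less[OF finP t(1)] by simp
        then show ?thesis using Suc.prems(5) Suc.hyps(2) by simp
      qed
      then show ?thesis using split_unused[OF i(1) c(1) Suc.prems(4)] IH c i(2) by metis
    qed
  qed
qed

section \<open>Blocked vertices and blocked edges\<close>

text \<open>Conditions (C2) and (C3) in one formula: \<open>c\<close> is missing at \<open>u\<close>
  and no direction is left for it, whether or not \<open>u\<close> meets a coloured edge.\<close>

definition badv :: "nat set \<Rightarrow> precoloring \<Rightarrow> nat set \<Rightarrow> nat \<Rightarrow> bool" where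
  "badv D P u c \<longleftrightarrow> u \<subseteq> D \<and> (\<forall>i. \<not> has P u i c) \<and>
     (\<forall>i\<in>D. (\<exists>e. has P u i e) \<or> (\<exists>j. has P (nb u i) j c))"

text \<open>Condition (C1): no colour is left for the uncoloured edge between \<open>u\<close> and
  \<open>nb u i\<close>.\<close>

definition bade :: "nat set \<Rightarrow> nat set \<Rightarrow> precoloring \<Rightarrow> nat set \<Rightarrow> nat \<Rightarrow> bool" where
  "bade D C P u i \<longleftrightarrow> u \<subseteq> D \<and> i \<in> D \<and> (\<forall>e. \<not> has P u i e) \<and>
     (\<forall>c\<in>C. \<exists>j. has P u j c \<or> has P (nb u i) j c)"

definition good :: "nat set \<Rightarrow> nat set \<Rightarrow> precoloring \<Rightarrow> bool" where
  "good D C P \<longleftrightarrow> (\<forall>u. \<forall>c\<in>C. \<not> badv D P u c) \<and> (\<forall>u i. \<not> bade D C P u i)"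

lemma bade_sym: "bade D C P u i \<Longrightarrow> bade D C P (nb u i) i"
  by (auto simp: bade_def)

text \<open>A blocked vertex needs one edge per direction, so it accounts for all edges of \<open>P\<close>.\<close>

lemma badv_all:
  assumes D: "finite D" and C: "finite C" and P: "precol D C P" and bad: "badv D P u c" and le: "card P \<le> card D"
  shows "card P = card D"
    and "(v, j, e) \<in> P \<Longrightarrow> u - {j} = v \<and> e \<noteq> c \<or>
      e = c \<and> (\<exists>l\<in>D. (\<forall>e'. \<not> has P u l e') \<and> nb u l - {j} = v)"
proof -
  have fin: "finite P" using precol_finite[OF D C P] .
  define star where "star l \<longleftrightarrow> (\<exists>e. has P u l e)" for l
  \<comment> \<open>To each direction \<open>h\<close> assigns an edge that blocks it: the coloured
    edge in this direction at \<open>u\<close>, or else an edge of colour \<open>c\<close> at the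
    neighbour.\<close>
  define h where "h l = (if star l then (u - {l}, l, SOME e. has P u l e)
      else (let j = (SOME j. has P (nb u l) j c) in (nb u l - {j}, j, c)))" for l
  have h1: "(u - {l}, l, snd (snd (h l))) = h l \<and> has P u l (snd (snd (h l)))" if "star l" for l
    using that someI_ex[of "\<lambda>e. has P u l e"] by (simp add: h_def star_def)
  have h2: "(nb u l - {fst (snd (h l))}, fst (snd (h l)), c) = h l \<and> has P (nb u l) (fst (snd (h l))) c"
    if "\<not> star l" "l \<in> D" for l
  proof -
    have "\<exists>j. has P (nb u l) j c" using bad that unfolding badv_def star_def by blast
    then show ?thesis using someI_ex[of "\<lambda>j. has P (nb u l) j c"] that(1) by (simp add: h_def Let_def)
  qed
  have hP: "h l \<in> P" if "l \<in> D" for l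
    using h1[of l] h2[OF _ that] unfolding has_def by (cases "star l") metis+
  have nc: "\<not> has P u l c" for l using bad by (simp add: badv_def)
  have inj: "inj_on h D"
  proof (rule inj_onI)
    fix l l' assume l: "l \<in> D" "l' \<in> D" and eq: "h l = h l'"
    show "l = l'"
    proof (cases "star l")
      case s: True
      show ?thesis
      proof (cases "star l'")
        case True
        then show ?thesis using h1[OF s] h1[OF True] eq by (metis fst_conv snd_conv)
      next
        case False
        then have "snd (snd (h l)) = c" using h2[OF False l(2)] eq by (metis snd_conv)
        then show ?thesis using h1[OF s] nc by metis
      qed
    next
      case s: False
      show ?thesis
      proof (cases "star l'")
        case True
        then have "snd (snd (h l')) = c" using h2[OF s l(1)] eq by (metis snd_conv)
        then show ?thesis using h1[OF True] nc by metis
      next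
        case False
        let ?j = "fst (snd (h l))"
        have "nb u l - {?j} = nb u l' - {?j}"
          using h2[OF s l(1)] h2[OF False l(2)] eq by (metis fst_conv)
        \<comment> \<open>Two different neighbours of \<open>u\<close> are at distance two, so no
          edge contains both.\<close>
        then have "nb u l = nb u l' \<or> nb u l = nb (nb u l') ?j" unfolding Diff_eq_iff_nb .
        then show ?thesis by simp
      qed
    qed
  qed
  have "card (h ` D) = card D" using card_image[OF inj] .
  moreover have sub: "h ` D \<subseteq> P" using hP by blast
  ultimately have eqP: "h ` D = P" using le fin card_seteq[OF fin sub] by simp
  then show "card P = card D" using card_image[OF inj] by simp
  assume "(v, j, e) \<in> P"
  then obtain l where l: "l \<in> D" "(v, j, e) = h l" using eqP by blast
  show "u - {j} = v \<and> e \<noteq> c \<or> e = c \<and> (\<exists>l\<in>D. (\<forall>e'. \<not> has P u l e') \<and> nb u l - {j} = v)"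
  proof (cases "star l")
    case True
    then show ?thesis using h1[OF True] l(2) nc by (metis fst_conv snd_conv)
  next
    case False
    then show ?thesis using h2[OF False l(1)] l unfolding star_def by (metis fst_conv snd_conv)
  qed
qed

text \<open>A blocked edge needs all the colours of \<open>C\<close> on edges at its two ends. With
  at most \<open>card C\<close> edges there is no room for a repeated colour or for an edge
  elsewhere.\<close>

lemma bade_all:
  assumes D: "finite D" and C: "finite C" and P: "precol D C P" and bad: "bade D C P u i" and le: "card P \<le> card C"
  shows "card P = card C" "inj_on (snd \<circ> snd) P" "(snd \<circ> snd) ` P = C"
    and "(v, j, e) \<in> P \<Longrightarrow> u - {j} = v \<or> nb u i - {j} = v"
proof -
  have fin: "finite P" using precol_finite[OF D C P] .
  have cov: "\<exists>v j. (v, j, c) \<in> P \<and> (u - {j} = v \<or> nb u i - {j} = v)" if "c \<in> C" for c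
  proof -
    from bad that obtain j where "has P u j c \<or> has P (nb u i) j c" unfolding bade_def by blast
    then show ?thesis unfolding has_def by blast
  qed
  have sub: "(snd \<circ> snd) ` P \<subseteq> C" using precolD(4)[OF P] by auto
  moreover have "C \<subseteq> (snd \<circ> snd) ` P" using cov by force
  ultimately show im: "(snd \<circ> snd) ` P = C" by blast
  then have "card C \<le> card P" using card_image_le[OF fin] by metis
  then show cc: "card P = card C" using le by simp
  then show inj: "inj_on (snd \<circ> snd) P" using im fin by (metis eq_card_imp_inj_on)
  assume p: "(v, j, e) \<in> P"
  then obtain v' j' where p': "(v', j', e) \<in> P" "u - {j'} = v' \<or> nb u i - {j'} = v'"
    using cov[of e] precolD(4)[OF P p] by blast
  then have "(v', j', e) = (v, j, e)" using inj_onD[OF inj _ p'(1) p] by simp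
  then show "u - {j} = v \<or> nb u i - {j} = v" using p'(2) by simp
qed

section \<open>Reflections of the cube\<close>

text \<open>Symmetric difference with \<open>R\<close>, that is, the automorphism of the cube that
  flips all coordinates in \<open>R\<close>.\<close>

definition rx :: "nat set \<Rightarrow> nat set \<Rightarrow> nat set" where
  "rx x R = (x - R) \<union> (R - x)"

lemma rx_iff [simp]: "i \<in> rx x R \<longleftrightarrow> (i \<in> x) \<noteq> (i \<in> R)"
  by (auto simp: rx_def)

lemma rx_rx [simp]: "rx (rx x R) R = x" by (auto simp: rx_def)
lemma rx_sub: "R \<subseteq> D \<Longrightarrow> rx x R \<subseteq> D \<longleftrightarrow> x \<subseteq> D" by (auto simp: rx_def)
lemma rx_nb: "rx (nb x i) R = nb (rx x R) i" by (auto simp: rx_def nb_def)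

lemma rx_Diff: "rx (x - {j}) R - {j} = rx x R - {j}" by (auto simp: rx_def)

text \<open>A reflection may exchange the ends of an edge; removing \<open>j\<close> returns to the
  lower end.\<close>

definition reflect :: "nat set \<Rightarrow> precoloring \<Rightarrow> precoloring" where
  "reflect R P = (\<lambda>(v, j, e). (rx v R - {j}, j, e)) ` P"

lemma has_reflect:
  assumes "precol D C P" shows "has (reflect R P) x j e \<longleftrightarrow> has P (rx x R) j e"
proof
  assume "has (reflect R P) x j e"
  then obtain v where v: "(v, j, e) \<in> P" "x - {j} = rx v R - {j}"
    unfolding has_def reflect_def by auto
  then have "j \<notin> v" using precolD(3)[OF assms] by simp
  have "rx (x - {j}) R - {j} = rx (rx v R - {j}) R - {j}" using v(2) by simp
  then have "rx x R - {j} = v - {j}" unfolding rx_Diff by simp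
  then show "has P (rx x R) j e" using v(1) \<open>j \<notin> v\<close> by (simp add: has_def)
next
  assume "has P (rx x R) j e"
  then have "(rx x R - {j}, j, e) \<in> P" by (simp add: has_def)
  then have "(rx (rx x R - {j}) R - {j}, j, e) \<in> reflect R P" unfolding reflect_def by force
  then show "has (reflect R P) x j e" unfolding rx_Diff rx_rx has_def .
qed

lemma reflect_card:
  assumes "precol D C P"
  shows "card (reflect R P) = card P"
  unfolding reflect_def
proof (rule card_image, rule inj_onI)
  fix s t assume st: "s \<in> P" "t \<in> P"
    "(\<lambda>(v, j, e). (rx v R - {j}, j, e)) s = (\<lambda>(v, j, e). (rx v R - {j}, j, e)) t"
  obtain v j e w j' e' where eq: "s = (v, j, e)" "t = (w, j', e')" by (metis prod_cases3)
  have h: "(v, j, e) \<in> P" "(w, j', e') \<in> P" "rx v R - {j} = rx w R - {j'}" "j = j'" "e = e'"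
    using st unfolding eq by auto
  have jv: "j \<notin> v" "j' \<notin> w" using precolD(3)[OF assms] h(1,2) by auto
  have "rx (rx v R - {j}) R - {j} = rx (rx w R - {j}) R - {j}" using h by simp
  then have "v - {j} = w - {j}" unfolding rx_Diff by simp
  then show "s = t" using jv h(4,5) eq by simp
qed

lemma reflect_precol:
  assumes "precol D C P" "R \<subseteq> D" shows "precol D C (reflect R P)"
proof (rule precolI)
  fix v j e assume "(v, j, e) \<in> reflect R P"
  then obtain w where w: "(w, j, e) \<in> P" "v = rx w R - {j}" by (auto simp: reflect_def)
  then show "v \<subseteq> D \<and> j \<in> D \<and> j \<notin> v \<and> e \<in> C"
    using precolD(1,2,4)[OF assms(1) w(1)] rx_sub[OF assms(2), of w] by auto
next
  fix x i j c e assume "has (reflect R P) x i c" "has (reflect R P) x j e"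
  then show "i = j \<longleftrightarrow> c = e" unfolding has_reflect[OF assms(1)] by (rule precolD(5)[OF assms(1)])
qed

lemma reflect_ext:
  assumes P: "precol D C P" and R: "R \<subseteq> D" and e: "ext D C (reflect R P)"
  shows "ext D C P"
proof -
  obtain f where f: "coloring D C f" and fP: "\<forall>(v, j, e) \<in> reflect R P. f v j = e"
    using e by (auto simp: ext_def)
  have "coloring D C (\<lambda>x. f (rx x R))"
    unfolding coloring_def rx_nb using coloringD[OF f] rx_sub[OF R] by simp
  moreover have "f (rx v R) j = e" if p: "(v, j, e) \<in> P" for v j e
  proof -
    have "has (reflect R P) (rx v R) j e"
      unfolding has_reflect[OF P] using in_has[OF P p] by simp
    then show ?thesis
      using coloring_has[OF f fP] precolD(1,2)[OF P p] rx_sub[OF R] by blast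
  qed
  ultimately show ?thesis unfolding ext_def by blast
qed

lemma reflect_good:
  assumes P: "precol D C P" and R: "R \<subseteq> D" and g: "good D C P"
  shows "good D C (reflect R P)"
proof -
  have "badv D P (rx u R) c" if "badv D (reflect R P) u c" for u c
    using that unfolding badv_def has_reflect[OF P] rx_nb rx_sub[OF R] .
  moreover have "bade D C P (rx u R) i" if "bade D C (reflect R P) u i" for u i
    using that unfolding bade_def has_reflect[OF P] rx_nb rx_sub[OF R] .
  ultimately show ?thesis using g unfolding good_def by blast
qed

section \<open>Hall's theorem\<close>

text \<open>Rado's argument: as long as some \<open>N x\<close> has two elements, one of them can be
  deleted without violating Hall's condition. Once all sets are singletons, the condition makes them
  different.\<close>

lemma hall:
  fixes N :: "'a \<Rightarrow> 'b set"
  assumes "finite X" "\<And>x. x \<in> X \<Longrightarrow> finite (N x)"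
    and "\<And>S. S \<subseteq> X \<Longrightarrow> card S \<le> card (\<Union>(N ` S))"
  shows "\<exists>h. inj_on h X \<and> (\<forall>x\<in>X. h x \<in> N x)"
  using assms(2,3)
proof (induction "\<Sum>x\<in>X. card (N x)" arbitrary: N rule: less_induct)
  case less
  note finX = assms(1)
  have finU: "finite (\<Union>(N ` S))" if "S \<subseteq> X" for S
    using less.prems(1) finite_subset[OF that finX] that by auto
  show ?case
  proof (cases "\<exists>x\<in>X. \<exists>a b. a \<in> N x \<and> b \<in> N x \<and> a \<noteq> b")
    case False
    have ne: "\<exists>a. a \<in> N x" if "x \<in> X" for x
      using less.prems(2)[of "{x}"] that by (auto simp: card_gt_0_iff Suc_le_eq)
    define h where "h x = (SOME a. a \<in> N x)" for x
    have h: "h x \<in> N x" if "x \<in> X" for x unfolding h_def using someI_ex[OF ne[OF that]] .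
    have N1: "N x = {h x}" if "x \<in> X" for x using False h that by blast
    have "inj_on h X"
    proof (rule inj_onI)
      fix x y assume xy: "x \<in> X" "y \<in> X" "h x = h y"
      have "card {x, y} \<le> card (\<Union>(N ` {x, y}))" using less.prems(2)[of "{x, y}"] xy by simp
      also have "\<Union>(N ` {x, y}) = {h x}" using N1 xy by simp
      finally show "x = y" by (cases "x = y") auto
    qed
    then show ?thesis using h by blast
  next
    case True
    then obtain x a b where x: "x \<in> X" and ab: "a \<in> N x" "b \<in> N x" "a \<noteq> b" by blast
    define M where "M d = N(x := N x - {d})" for d
    have less': "(\<Sum>y\<in>X. card (M d y)) < (\<Sum>y\<in>X. card (N y))" if "d \<in> N x" for d
    proof (rule sum_strict_mono_ex1[OF finX])
      show "\<forall>y\<in>X. card (M d y) \<le> card (N y)"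
        using less.prems(1) unfolding M_def by (auto intro: card_mono)
      show "\<exists>y\<in>X. card (M d y) < card (N y)"
        using x card_Diff1_less[OF less.prems(1)[OF x] that] unfolding M_def
        by (intro bexI[of _ x]) (simp_all del: card_Diff_singleton)
    qed
    have finM: "finite (M d y)" if "y \<in> X" for d y using less.prems(1)[OF that] x by (auto simp: M_def)
    have sub: "M d y \<subseteq> N y" for d y by (auto simp: M_def)
    show ?thesis
    proof (cases "\<exists>d\<in>{a, b}. \<forall>S. S \<subseteq> X \<longrightarrow> card S \<le> card (\<Union>(M d ` S))")
      case True
      then obtain d where d: "d \<in> {a, b}" "\<And>S. S \<subseteq> X \<Longrightarrow> card S \<le> card (\<Union>(M d ` S))" by blast
      have "\<exists>h. inj_on h X \<and> (\<forall>y\<in>X. h y \<in> M d y)"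
        using less.hyps[of "M d", OF less' finM d(2)] d(1) ab by blast
      then show ?thesis using sub by blast
    next
      case False
      \<comment> \<open>A violation caused by deleting \<open>d\<close> from \<open>N x\<close> must
        involve \<open>x\<close>; the set \<open>A\<close> is the violating set without
        \<open>x\<close>.\<close>
      have viol: "\<exists>A. A \<subseteq> X \<and> x \<notin> A \<and> card (\<Union>(N ` A) \<union> (N x - {d})) \<le> card A" if dab: "d \<in> {a, b}" for d
      proof -
        obtain S where S: "S \<subseteq> X" "card (\<Union>(M d ` S)) < card S" using False dab by (meson not_le)
        have xS: "x \<in> S"
        proof (rule ccontr)
          assume "x \<notin> S"
          then have "\<Union>(M d ` S) = \<Union>(N ` S)" by (auto simp: M_def)
          then show False using S less.prems(2)[OF S(1)] by simp
        qed
        have "\<Union>(M d ` S) = \<Union>(N ` (S - {x})) \<union> (N x - {d})"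
          using xS by (auto simp: M_def split: if_splits)
        moreover have "card S = Suc (card (S - {x}))"
          using xS finite_subset[OF S(1) finX] by (metis card.remove)
        ultimately show ?thesis using S by (intro exI[of _ "S - {x}"]) auto
      qed
      obtain A where A: "A \<subseteq> X" "x \<notin> A" "card (\<Union>(N ` A) \<union> (N x - {a})) \<le> card A" using viol by blast
      obtain B where B: "B \<subseteq> X" "x \<notin> B" "card (\<Union>(N ` B) \<union> (N x - {b})) \<le> card B" using viol by blast
      let ?U = "\<Union>(N ` A) \<union> (N x - {a})" and ?V = "\<Union>(N ` B) \<union> (N x - {b})"
      have fin: "finite ?U" "finite ?V" using finU A B less.prems(1)[OF x] by auto
      have finAB: "finite A" "finite B" using A(1) B(1) finX finite_subset by blast+
      have u: "?U \<union> ?V = \<Union>(N ` (insert x (A \<union> B)))" using ab by auto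
      have i: "\<Union>(N ` (A \<inter> B)) \<subseteq> ?U \<inter> ?V" by auto
      \<comment> \<open>Submodularity: the union of the two neighbourhoods contains all of
        \<open>N x\<close>, because \<open>a\<close> and \<open>b\<close> differ, and the
        intersection contains the neighbourhood of \<open>A \<inter> B\<close>. The extra element
        \<open>x\<close> makes the count contradictory.\<close>
      have "card (insert x (A \<union> B)) + card (A \<inter> B) \<le> card (?U \<union> ?V) + card (?U \<inter> ?V)"
      proof (rule add_mono)
        show "card (insert x (A \<union> B)) \<le> card (?U \<union> ?V)"
          unfolding u by (rule less.prems(2)) (use x A B in auto)
        have "card (A \<inter> B) \<le> card (\<Union>(N ` (A \<inter> B)))" by (rule less.prems(2)) (use A in auto)
        also have "\<dots> \<le> card (?U \<inter> ?V)" using i fin by (intro card_mono) auto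
        finally show "card (A \<inter> B) \<le> card (?U \<inter> ?V)" .
      qed
      also have "\<dots> = card ?U + card ?V" using card_Un_Int[OF fin] by simp
      also have "\<dots> \<le> card A + card B" using A B by simp
      also have "\<dots> = card (A \<union> B) + card (A \<inter> B)" using card_Un_Int[OF finAB] .
      finally have False using A(2) B(2) finAB by simp
      then show ?thesis ..
    qed
  qed
qed

section \<open>Parity classes and an isoperimetric inequality\<close>

lemma even_card_nb: "finite x \<Longrightarrow> even (card (nb x i)) \<longleftrightarrow> odd (card x)"
proof (cases "i \<in> x")
  case True
  assume "finite x"
  then have "card x = Suc (card (x - {i}))" using True by (metis card.remove)
  then show ?thesis using True by (simp add: nb_def)
qed (simp add: nb_def)

definition par :: "nat set \<Rightarrow> bool \<Rightarrow> nat set set" where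
  "par D q = {x. x \<subseteq> D \<and> even (card x) = q}"

lemma par_finite: "finite D \<Longrightarrow> finite (par D q)"
  by (simp add: par_def)

lemma nb_par: "finite D \<Longrightarrow> i \<in> D \<Longrightarrow> nb x i \<in> par D q \<longleftrightarrow> x \<in> par D (\<not> q)"
  unfolding par_def using even_card_nb[of x i] finite_subset[of x D] by auto

lemma par_flip: "finite D \<Longrightarrow> i \<in> D \<Longrightarrow> card (par D (\<not> q)) = card (par D q)"
proof -
  assume h: "finite D" "i \<in> D"
  have "bij_betw (\<lambda>x. nb x i) (par D (\<not> q)) (par D q)"
    by (rule bij_betw_byWitness[where f' = "\<lambda>x. nb x i"]) (use h nb_par[OF h] nb_par[OF h, of _ "\<not> q"] in auto)
  then show ?thesis by (rule bij_betw_same_card)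
qed

text \<open>Flipping a fixed coordinate exchanges the two parity classes. The factor two avoids a
  division.\<close>

lemma card_par:
  assumes "finite D" "D \<noteq> {}" shows "2 * card (par D q) = 2 ^ card D"
proof -
  obtain i where i: "i \<in> D" using assms(2) by blast
  have "Pow D = par D q \<union> par D (\<not> q)" "par D q \<inter> par D (\<not> q) = {}" by (auto simp: par_def)
  then have "card (Pow D) = card (par D q) + card (par D (\<not> q))"
    using par_finite[OF assms(1)] by (metis card_Un_disjoint)
  then show ?thesis using par_flip[OF assms(1) i, of q] assms(1) by (simp add: card_Pow)
qed

lemma card_nbrs:
  assumes "finite D" "A \<subseteq> D" shows "card ((\<lambda>i. nb x i) ` A) = card A"
  by (rule card_image) (auto simp: inj_on_def)

text \<open>The numbers \<open>a\<close>, \<open>b\<close> are the sizes of the parts of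
  \<open>X\<close> and \<open>Y\<close> in one half, \<open>a'\<close>, \<open>b'\<close> those in
  the other; \<open>n\<close> is the dimension of a half and \<open>N\<close> the size of its parity
  classes. The first two premises come from the edges across the cut, the next two are the size
  conditions, the others come from inside the halves.\<close>

lemma isoperimetry_arith:
  fixes a b a' b' n N :: nat
  assumes "a + b' \<le> N" "a' + b \<le> N" "2 \<le> a + a'" "2 \<le> b + b'"
    and "2 \<le> a \<Longrightarrow> 2 \<le> b \<Longrightarrow> a + b + n \<le> N" "a = 1 \<Longrightarrow> b + n \<le> N" "b = 1 \<Longrightarrow> a + n \<le> N"
    and "2 \<le> a' \<Longrightarrow> 2 \<le> b' \<Longrightarrow> a' + b' + n \<le> N" "a' = 1 \<Longrightarrow> b' + n \<le> N" "b' = 1 \<Longrightarrow> a' + n \<le> N"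
    and n: "n = 1 \<and> N = 1 \<or> n = 2 \<and> N = 2 \<or> n \<ge> 3 \<and> N \<ge> n + 1"
  shows "a + a' + (b + b') + Suc n \<le> 2 * N"
proof -
  have c: "x = 0 \<or> x = 1 \<or> 2 \<le> x" for x :: nat by linarith
  have h: "2 \<le> a \<and> 2 \<le> b \<and> a + b + n \<le> N \<or> a = 1 \<and> b + n \<le> N \<or> b = 1 \<and> a + n \<le> N \<or> a = 0 \<or> b = 0"
    using c[of a] c[of b] assms(5-7) by blast
  have h': "2 \<le> a' \<and> 2 \<le> b' \<and> a' + b' + n \<le> N \<or> a' = 1 \<and> b' + n \<le> N \<or> b' = 1 \<and> a' + n \<le> N \<or> a' = 0 \<or> b' = 0"
    using c[of a'] c[of b'] assms(8-10) by blast
  show ?thesis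
    using h h' n assms(1-4) by (elim disjE conjE) linarith+
qed

text \<open>Cut off one direction. Inside a half the induction hypothesis applies if both parts have
  two elements, and a part with a single vertex excludes the neighbours of this vertex. The size
  conditions matter: a vertex together with all its non-neighbours of opposite parity misses the
  bound by one.\<close>

lemma isoperimetry:
  assumes "finite D" "X \<subseteq> par D q" "Y \<subseteq> par D (\<not> q)" "\<And>x i. x \<in> X \<Longrightarrow> i \<in> D \<Longrightarrow> nb x i \<notin> Y"
    and "2 \<le> card X" "2 \<le> card Y"
  shows "2 * (card X + card Y + card D) \<le> 2 ^ card D"
  using assms
proof (induction D arbitrary: X Y q rule: finite_induct)
  case empty
  have "X \<subseteq> {{}}" using empty.prems(1) by (auto simp: par_def)
  then have "card X \<le> card {{} :: nat set}" by (intro card_mono) auto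
  then show ?case using empty.prems by simp
next
  case (insert i D)
  note finD = insert.hyps(1) and iD = insert.hyps(2)
  have finXY: "finite X" "finite Y"
    using insert.prems(1,2) par_finite[of "insert i D"] finD finite_subset by blast+
  define L where "L Z = {x \<in> Z. i \<notin> x}" for Z :: "nat set set"
  \<comment> \<open>The upper part is pushed down along \<open>i\<close>, so that both parts live in
    the cube over \<open>D\<close>; this reverses its parity.\<close>
  define U where "U Z = {x. i \<notin> x \<and> nb x i \<in> Z}" for Z :: "nat set set"
  have Uim: "U Z = (\<lambda>x. nb x i) ` {x \<in> Z. i \<in> x}" for Z
    unfolding U_def by (auto intro: image_eqI[where x = "nb _ i"])
  have split: "card Z = card (L Z) + card (U Z)" if "finite Z" for Z
  proof -
    have "card (U Z) = card {x \<in> Z. i \<in> x}" unfolding Uim by (rule card_image) (auto simp: inj_on_def)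
    moreover have "Z = L Z \<union> {x \<in> Z. i \<in> x}" "L Z \<inter> {x \<in> Z. i \<in> x} = {}" by (auto simp: L_def)
    ultimately show ?thesis using that by (metis card_Un_disjoint finite_Un)
  qed
  have Lp: "L Z \<subseteq> par D q" if "Z \<subseteq> par (insert i D) q" for Z q using that unfolding L_def par_def by auto
  have Up: "U Z \<subseteq> par D (\<not> q)" if "Z \<subseteq> par (insert i D) q" for Z q
  proof
    fix x assume x: "x \<in> U Z"
    then have "nb x i \<in> par (insert i D) q" "i \<notin> x" using that by (auto simp: U_def)
    then have "x \<in> par (insert i D) (\<not> q)" using nb_par[of "insert i D" i x q] finD by simp
    then show "x \<in> par D (\<not> q)" using \<open>i \<notin> x\<close> by (auto simp: par_def)
  qed
  have LXs: "L X \<subseteq> par D q" "L Y \<subseteq> par D (\<not> q)" "U X \<subseteq> par D (\<not> q)" "U Y \<subseteq> par D (\<not> \<not> q)"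
    using Lp[OF insert.prems(1)] Lp[OF insert.prems(2)] Up[OF insert.prems(1)] Up[OF insert.prems(2)] by simp_all
  have fp: "finite (par D p)" for p using par_finite[OF finD] .
  show ?case
  proof (cases "D = {}")
    case True
    have "2 * card (par {i} q) = 2" using card_par[of "{i}" q] by simp
    moreover have "card X \<le> card (par {i} q)" using insert.prems(1) True par_finite[of "{i}"] by (intro card_mono) auto
    ultimately show ?thesis using insert.prems(4) by simp
  next
    case False
    define N where "N = card (par D q)"
    have N: "card (par D p) = N" "2 * N = 2 ^ card D" for p
      using card_par[OF finD False] unfolding N_def by (metis mult_cancel1 zero_neq_numeral)+
    have noL: "nb x j \<notin> L Y" if "x \<in> L X" "j \<in> D" for x j
      using insert.prems(3)[of x j] that by (auto simp: L_def)
    have noU: "nb x j \<notin> U Y" if "x \<in> U X" "j \<in> D" for x j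
      using insert.prems(3)[of "nb x i" j] that nb_comm[of x i j] by (auto simp: U_def)
    \<comment> \<open>The edges of direction \<open>i\<close> keep the lower part of one set
      disjoint from the pushed-down upper part of the other.\<close>
    have d1: "L X \<inter> U Y = {}" using insert.prems(3)[of _ i] by (auto simp: L_def U_def)
    have d2: "U X \<inter> L Y = {}"
    proof -
      have "nb (nb x i) i \<notin> Y" if "nb x i \<in> X" for x using insert.prems(3)[OF that, of i] by blast
      then show ?thesis by (auto simp: L_def U_def)
    qed
    have b1: "card (L X) + card (U Y) \<le> N"
    proof -
      have "card (L X) + card (U Y) = card (L X \<union> U Y)"
        using d1 LXs fp by (intro card_Un_disjoint[symmetric]) (auto intro: finite_subset)
      also have "\<dots> \<le> card (par D q)" using LXs fp by (intro card_mono) auto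
      finally show ?thesis unfolding N .
    qed
    have b2: "card (U X) + card (L Y) \<le> N"
    proof -
      have "card (U X) + card (L Y) = card (U X \<union> L Y)"
        using d2 LXs fp by (intro card_Un_disjoint[symmetric]) (auto intro: finite_subset)
      also have "\<dots> \<le> card (par D (\<not> q))" using LXs fp by (intro card_mono) auto
      finally show ?thesis unfolding N .
    qed
    have IH: "card X' + card Y' + card D \<le> N"
      if "X' \<subseteq> par D p" "Y' \<subseteq> par D (\<not> p)" "\<And>x j. x \<in> X' \<Longrightarrow> j \<in> D \<Longrightarrow> nb x j \<notin> Y'" "2 \<le> card X'" "2 \<le> card Y'" for X' Y' p
      using insert.IH[OF that] N(2) by simp
    have one: "card Y' + card D \<le> N"
      if "X' \<subseteq> par D p" "Y' \<subseteq> par D (\<not> p)" "\<And>x j. x \<in> X' \<Longrightarrow> j \<in> D \<Longrightarrow> nb x j \<notin> Y'" and c1: "card X' = 1" for X' Y' p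
    proof -
      obtain x where x: "x \<in> X'" using c1 by (metis card_1_singletonE insertI1)
      have "card Y' + card ((\<lambda>j. nb x j) ` D) = card (Y' \<union> (\<lambda>j. nb x j) ` D)"
        using that(2,3) x fp finD by (intro card_Un_disjoint[symmetric]) (auto intro: finite_subset)
      also have "\<dots> \<le> card (par D (\<not> p))"
        using that(1,2) x fp nb_par[OF finD, of _ x "\<not> p"] by (intro card_mono) auto
      finally show ?thesis unfolding N card_nbrs[OF finD order_refl] .
    qed
    have rev: "nb y j \<notin> X'" if "\<And>x j. x \<in> X' \<Longrightarrow> j \<in> D \<Longrightarrow> nb x j \<notin> Y'" "y \<in> Y'" "j \<in> D" for X' Y' y j
      using that(1)[of "nb y j" j] that(2,3) by auto
    \<comment> \<open>From dimension three on a parity class is larger than the dimension; in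
      dimensions one and two both numbers agree, and the arithmetic needs these values
      exactly.\<close>
    have nN: "card D = 1 \<and> N = 1 \<or> card D = 2 \<and> N = 2 \<or> card D \<ge> 3 \<and> N \<ge> card D + 1"
    proof -
      have "card D > 0" using False finD by (simp add: card_gt_0_iff)
      moreover have "2 * (n + 1) \<le> 2 ^ n" if "n \<ge> 3" for n :: nat
        using that by (induction n rule: dec_induct) auto
      from this[of "card D"] have "card D \<ge> 3 \<Longrightarrow> N \<ge> card D + 1" using N(2) by simp
      moreover have "card D = 1 \<Longrightarrow> N = 1" "card D = 2 \<Longrightarrow> N = 2" using N(2) by auto
      ultimately show ?thesis by linarith
    qed
    have "card (L X) + card (U X) + (card (L Y) + card (U Y)) + Suc (card D) \<le> 2 * N"
    proof (rule isoperimetry_arith[OF b1 b2 _ _ _ _ _ _ _ _ nN])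
      show "2 \<le> card (L X) + card (U X)" "2 \<le> card (L Y) + card (U Y)"
        using insert.prems(4,5) split finXY by auto
      show "card (L X) + card (L Y) + card D \<le> N" if "2 \<le> card (L X)" "2 \<le> card (L Y)"
        using IH[OF LXs(1,2) noL that] .
      show "card (L Y) + card D \<le> N" if "card (L X) = 1" using one[OF LXs(1,2) noL that] .
      show "card (L X) + card D \<le> N" if "card (L Y) = 1"
        using one[OF LXs(2) _ rev[OF noL] that] LXs(1) by simp
      show "card (U X) + card (U Y) + card D \<le> N" if "2 \<le> card (U X)" "2 \<le> card (U Y)"
        using IH[OF LXs(3,4) noU that] .
      show "card (U Y) + card D \<le> N" if "card (U X) = 1" using one[OF LXs(3,4) noU that] .
      show "card (U X) + card D \<le> N" if "card (U Y) = 1"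
        using one[OF LXs(4) _ rev[OF noU] that] LXs(3) by simp
    qed
    then show ?thesis using split finXY N(2) finD iD by simp
  qed
qed

text \<open>Perfect matchings are given by the direction \<open>k x\<close> of the edge at each vertex \<open>x\<close>.\<close>

lemma hall_directions:
  assumes D: "finite D" and W: "W \<subseteq> Pow D" and bal: "card (W \<inter> par D True) = card (W \<inter> par D False)"
    and G: "\<And>x. x \<in> W \<Longrightarrow> G x \<subseteq> D" "\<And>x i. x \<in> W \<Longrightarrow> i \<in> G x \<Longrightarrow> nb x i \<in> W \<and> i \<in> G (nb x i)"
    and hc: "\<And>X. X \<subseteq> W \<inter> par D True \<Longrightarrow> card X \<le> card (\<Union>x\<in>X. nb x ` G x)"
  shows "\<exists>k. \<forall>x\<in>W. k x \<in> G x \<and> k (nb x (k x)) = k x"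
proof -
  let ?E = "W \<inter> par D True" and ?O = "W \<inter> par D False"
  have fin: "finite ?E" "finite ?O" using par_finite[OF D] by auto
  have fG: "finite (nb x ` G x)" if "x \<in> ?E" for x using G(1)[of x] that D finite_subset by blast
  obtain h where h: "inj_on h ?E" "\<forall>x\<in>?E. h x \<in> nb x ` G x" using hall[OF fin(1) fG hc] by blast
  have hO: "h ` ?E \<subseteq> ?O"
  proof
    fix y assume "y \<in> h ` ?E"
    then obtain x i where x: "x \<in> ?E" "i \<in> G x" "y = nb x i" using h(2) by blast
    then have "nb x i \<in> W" "i \<in> D" using G by auto
    then show "y \<in> ?O" using x nb_par[OF D, of i x False] by simp
  qed
  \<comment> \<open>Equally large classes turn the injection into a bijection, so the odd vertices
    are covered as well.\<close>
  have onto: "h ` ?E = ?O"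
    using card_image[OF h(1)] bal card_subset_eq[OF fin(2) hO] by simp
  define e where "e x = (SOME i. i \<in> G x \<and> h x = nb x i)" for x
  have e: "e x \<in> G x" "h x = nb x (e x)" if "x \<in> ?E" for x
  proof -
    have "\<exists>i. i \<in> G x \<and> h x = nb x i" using h(2) that by blast
    from someI_ex[OF this] show "e x \<in> G x" "h x = nb x (e x)" unfolding e_def by auto
  qed
  \<comment> \<open>Even vertices follow the injection \<open>h\<close>; an odd vertex uses the edge
    by which \<open>h\<close> reaches it.\<close>
  define k where "k x = (if x \<in> ?E then e x else e (inv_into ?E h x))" for x
  have "k x \<in> G x \<and> k (nb x (k x)) = k x" if x: "x \<in> W" for x
  proof (cases "x \<in> ?E")
    case True
    then have "nb x (e x) \<in> ?O" using e(2) hO by force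
    then have "nb x (e x) \<notin> ?E" by (auto simp: par_def)
    moreover have "inv_into ?E h (nb x (e x)) = x" using inv_into_f_f[OF h(1) True] e(2)[OF True] by simp
    ultimately show ?thesis using True e(1) by (auto simp: k_def)
  next
    case False
    then have "x \<in> ?O" using x W by (auto simp: par_def)
    then obtain y where y: "y \<in> ?E" "x = h y" using onto by blast
    then have "inv_into ?E h x = y" using inv_into_f_f[OF h(1)] by simp
    then have "k x = e y" using False by (auto simp: k_def)
    moreover have "x = nb y (e y)" using y e(2) by simp
    moreover have "e y \<in> G x" using G(2)[of y "e y"] e(1)[OF y(1)] y calculation(2) by simp
    ultimately show ?thesis using y(1) by (simp add: k_def)
  qed
  then show ?thesis by blast
qed

section \<open>Edge colorings of regular spanning subgraphs\<close>

text \<open>Koenig's theorem for regular bipartite graphs, with the graph given by its sets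
  \<open>G x\<close> of directions: Hall's condition follows by counting edges, and one perfect
  matching is removed for each colour.\<close>

lemma regular_coloring:
  assumes D: "finite D" and "finite C"
    and "\<And>x. x \<subseteq> D \<Longrightarrow> G x \<subseteq> D \<and> card (G x) = card C"
    and "\<And>x i. x \<subseteq> D \<Longrightarrow> i \<in> G x \<Longrightarrow> i \<in> G (nb x i)"
  shows "\<exists>f. \<forall>x\<subseteq>D. bij_betw (f x) (G x) C \<and> (\<forall>i\<in>G x. f (nb x i) i = (f x i :: nat))"
  using assms(2-)
proof (induction C arbitrary: G rule: finite_induct)
  case empty
  have "G x = {}" if "x \<subseteq> D" for x
    using empty(1)[OF that] finite_subset[of "G x" D] D by auto
  then show ?case by (simp add: bij_betw_def)
next
  case (insert c C)
  have fG: "finite (G x)" if "x \<subseteq> D" for x using insert.prems(1)[OF that] finite_subset[OF _ D] by blast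
  have n: "card (G x) = Suc (card C)" if "x \<subseteq> D" for x using insert.prems(1)[OF that] insert.hyps by simp
  have "card (G {}) \<noteq> 0" using n[of "{}"] by simp
  then obtain i0 where "i0 \<in> D" using insert.prems(1)[of "{}"] by fastforce
  then have bal: "card (Pow D \<inter> par D True) = card (Pow D \<inter> par D False)"
    using par_flip[OF D, of i0 False] by (simp add: par_def Int_absorb1 Collect_mono_iff Pow_def Int_def conj_commute cong: conj_cong)
  have nbD: "nb x i \<subseteq> D" if "x \<subseteq> D" "i \<in> G x" for x i
    using insert.prems(1)[OF that(1)] that nb_subset[of i D x] by blast
  have "\<exists>k. \<forall>x\<in>Pow D. k x \<in> G x \<and> k (nb x (k x)) = k x"
  proof (rule hall_directions[OF D order_refl bal])
    fix X assume X: "X \<subseteq> Pow D \<inter> par D True"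
    let ?N = "\<Union>x\<in>X. nb x ` G x"
    have XD: "x \<subseteq> D" if "x \<in> X" for x using X that by auto
    have ND: "y \<subseteq> D" if "y \<in> ?N" for y using that XD nbD by blast
    have "finite X" using X par_finite[OF D, of True] by (auto intro: finite_subset)
    moreover have "finite ?N" using calculation fG XD by (intro finite_UN_I finite_imageI) auto
    ultimately have finX: "finite X" "finite ?N" by auto
    \<comment> \<open>The edges leaving \<open>X\<close> all arrive in its neighbourhood, and every
      vertex on either side has the same degree.\<close>
    have "card X * Suc (card C) = card (Sigma X G)"
      using finX fG XD n by (subst card_SigmaI) auto
    also have "\<dots> = card ((\<lambda>(x, i). (nb x i, i)) ` Sigma X G)"
      by (rule card_image[symmetric]) (auto simp: inj_on_def)
    also have "\<dots> \<le> card (Sigma ?N G)"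
    proof (rule card_mono)
      show "finite (Sigma ?N G)" by (rule finite_SigmaI[OF finX(2)]) (rule fG, rule ND)
      show "(\<lambda>(x, i). (nb x i, i)) ` Sigma X G \<subseteq> Sigma ?N G" using insert.prems(2) XD by auto
    qed
    also have "\<dots> = (\<Sum>y\<in>?N. card (G y))"
      by (rule card_SigmaI[OF finX(2)]) (intro ballI, rule fG, rule ND)
    also have "\<dots> = (\<Sum>y\<in>?N. Suc (card C))"
      by (rule sum.cong[OF refl], rule n, rule ND)
    also have "\<dots> = card ?N * Suc (card C)" by simp
    finally show "card X \<le> card ?N" by (metis mult_le_cancel2 zero_less_Suc)
  qed (use insert.prems nbD in auto)
  then obtain k where k: "\<And>x. x \<subseteq> D \<Longrightarrow> k x \<in> G x" "\<And>x. x \<subseteq> D \<Longrightarrow> k (nb x (k x)) = k x" by auto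
  have k': "i = k (nb x i) \<longleftrightarrow> i = k x" if "x \<subseteq> D" "i \<in> G x" for x i
    using k(2)[OF that(1)] k(2)[OF nbD[OF that]] by (metis nb_nb)
  have "\<exists>f. \<forall>x\<subseteq>D. bij_betw (f x) (G x - {k x}) C \<and> (\<forall>i\<in>G x - {k x}. f (nb x i) i = (f x i :: nat))"
  proof (rule insert.IH)
    fix x assume x: "x \<subseteq> D"
    show "G x - {k x} \<subseteq> D \<and> card (G x - {k x}) = card C"
      using insert.prems(1)[OF x] n[OF x] k(1)[OF x] fG[OF x] by auto
    fix i assume "i \<in> G x - {k x}"
    then show "i \<in> G (nb x i) - {k (nb x i)}" using insert.prems(2)[OF x] k'[OF x] by auto
  qed
  then obtain f where f: "\<And>x. x \<subseteq> D \<Longrightarrow> bij_betw (f x) (G x - {k x}) C"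
    "\<And>x i. x \<subseteq> D \<Longrightarrow> i \<in> G x - {k x} \<Longrightarrow> f (nb x i) i = (f x i :: nat)" by auto
  let ?f = "\<lambda>x i. if i = k x then c else f x i"
  have "bij_betw (?f x) (G x) (insert c C) \<and> (\<forall>i\<in>G x. ?f (nb x i) i = ?f x i)" if x: "x \<subseteq> D" for x
  proof
    have "bij_betw (?f x) (G x - {k x} \<union> {k x}) (C \<union> {c})"
    proof (rule bij_betw_combine)
      show "bij_betw (?f x) (G x - {k x}) C" using f(1)[OF x] by (rule bij_betw_cong[THEN iffD1, rotated]) auto
      show "bij_betw (?f x) {k x} {c}" by (simp add: bij_betw_def)
      show "C \<inter> {c} = {}" using insert.hyps by auto
    qed
    then show "bij_betw (?f x) (G x) (insert c C)" using k(1)[OF x] by (simp add: insert_absorb)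
    show "\<forall>i\<in>G x. ?f (nb x i) i = ?f x i" using k'[OF x] f(2)[OF x] by auto
  qed
  then show ?case by (intro exI[of _ ?f] allI impI)
qed

section \<open>Precolorings consisting of one colour class and a star\<close>

text \<open>In a finite set the complements of \<open>A\<close> and of its image have the same size,
  so any bijection between them completes the permutation.\<close>

lemma extend_bij:
  assumes "finite S" "A \<subseteq> S" "inj_on h A" "h ` A \<subseteq> S"
  shows "\<exists>\<sigma>. bij_betw \<sigma> S S \<and> (\<forall>a\<in>A. \<sigma> a = h a)"
proof -
  have "card (S - A) = card (S - h ` A)"
    using assms card_image[OF assms(3)] by (simp add: card_Diff_subset finite_subset)
  then obtain t where t: "bij_betw t (S - A) (S - h ` A)"
    using assms(1) by (metis finite_Diff finite_same_card_bij)
  let ?\<sigma> = "\<lambda>a. if a \<in> A then h a else t a"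
  have "bij_betw ?\<sigma> (A \<union> (S - A)) (h ` A \<union> (S - h ` A))"
  proof (rule bij_betw_combine)
    show "bij_betw ?\<sigma> A (h ` A)" using assms(3) by (simp add: bij_betw_def inj_on_def)
    show "bij_betw ?\<sigma> (S - A) (S - h ` A)"
      using t by (rule bij_betw_cong[THEN iffD1, rotated]) auto
  qed auto
  then have "bij_betw ?\<sigma> S S" using assms(2,4) by (simp add: Un_absorb1 Un_Diff_cancel)
  then show ?thesis by (intro exI[of _ ?\<sigma>]) auto
qed

text \<open>A parity class has at least \<open>card D + 3\<close> elements; this fails in dimension
  three. The summand 3 is what the smallest case of the matching argument below consumes.\<close>

lemma double_bound:
  assumes "finite D" "4 \<le> card D" shows "2 * (card D + 3) \<le> 2 ^ card D"
proof -
  have "2 * (n + 3) \<le> 2 ^ n" if "n \<ge> 4" for n :: nat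
    using that by (induction n rule: dec_induct) auto
  then show ?thesis using assms by simp
qed

text \<open>Once the colour class of \<open>c\<close> is completed to a perfect matching, the rest is regular, and the
  colours at \<open>w\<close> can be permuted at will.\<close>

lemma ext_star_and_class:
  assumes D: "finite D" "4 \<le> card D" and C: "finite C" "card C = card D"
    and P: "precol D C P" and gd: "good D C P" and le: "card P \<le> card D"
    and w: "w \<subseteq> D" and c: "c \<in> C"
    and star: "\<And>v j e. (v, j, e) \<in> P \<Longrightarrow> e \<noteq> c \<Longrightarrow> w - {j} = v"
  shows "ext D C P"
proof -
  have finP: "finite P" using precol_finite[OF D(1) C(1) P] .
  define A where "A = {l. \<exists>e. e \<noteq> c \<and> has P w l e}"
  define V where "V = {x. \<exists>j. has P x j c}"
  define W where "W = Pow D - V"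
  define G where "G x = {l \<in> D. nb x l \<in> W \<and> \<not> (x = w \<and> l \<in> A) \<and> \<not> (nb x l = w \<and> l \<in> A)}" for x
  let ?Pc = "{t \<in> P. snd (snd t) = c}"
  have AD: "A \<subseteq> D" using has_sub[OF P] unfolding A_def by blast
  have VD: "V \<subseteq> Pow D" using has_sub[OF P] unfolding V_def by blast
  have cardA: "card A + card ?Pc \<le> card D"
  proof -
    have "A \<subseteq> (fst \<circ> snd) ` (P - ?Pc)"
    proof
      fix l assume "l \<in> A"
      then obtain e where "e \<noteq> c" "(w - {l}, l, e) \<in> P" by (auto simp: A_def has_def)
      then show "l \<in> (fst \<circ> snd) ` (P - ?Pc)" by force
    qed
    then have "card A \<le> card (P - ?Pc)" by (rule surj_card_le[rotated]) (use finP in simp)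
    moreover have "card (P - ?Pc) + card ?Pc = card P"
      using finP by (metis (no_types, lifting) card_Diff_subset card_mono finite_subset le_add_diff_inverse2 mem_Collect_eq subsetI)
    ultimately show ?thesis using le by simp
  qed
  define N where "N = card (par D True)"
  have "D \<noteq> {}" using D(2) by auto
  then have N: "card (par D q) = N" "2 * N = 2 ^ card D" for q
    using card_par[OF D(1)] unfolding N_def by (metis mult_cancel1 zero_neq_numeral)+
  define r where "r = card (V \<inter> par D True)"
  \<comment> \<open>An edge of colour \<open>c\<close> has ends of opposite parity, so equally many
    even and odd vertices are already covered.\<close>
  have Vq: "card (V \<inter> par D q) = r" for q
  proof (cases q)
    case False
    define m where "m x = nb x (SOME j. has P x j c)" for x
    have mm: "\<exists>j. has P x j c \<and> m x = nb x j" if "x \<in> V" for x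
      using that someI_ex[of "\<lambda>j. has P x j c"] unfolding V_def m_def by blast
    have un: "j = j'" if "has P x j c" "has P x j' c" for x j j' using precolD(5)[OF P that] by simp
    have m1: "m x \<in> V \<inter> par D (\<not> q) \<and> m (m x) = x" if x: "x \<in> V \<inter> par D q" for x q
    proof -
      obtain j where j: "has P x j c" "m x = nb x j" using mm x by blast
      have "has P (m x) j c" using j by simp
      then have mV: "m x \<in> V" unfolding V_def by blast
      then obtain j' where "has P (m x) j' c" "m (m x) = nb (m x) j'" using mm by blast
      then have "m (m x) = x" using un[of "m x" j' j] j by simp
      moreover have "m x \<in> par D (\<not> q)" using x nb_par[OF D(1) has_sub(2)[OF P j(1)], of x "\<not> q"] j(2) by simp
      ultimately show ?thesis using mV by simp
    qed
    have "bij_betw m (V \<inter> par D False) (V \<inter> par D True)"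
      by (rule bij_betw_byWitness[where f' = m]) (use m1[of _ True] m1[of _ False] in auto)
    then show ?thesis using False bij_betw_same_card unfolding r_def by fastforce
  qed (simp add: r_def)
  \<comment> \<open>Every edge of colour \<open>c\<close> has just one even end.\<close>
  have rle: "r \<le> card ?Pc"
  proof -
    have "V \<inter> par D True \<subseteq> (\<lambda>t. if even (card (fst t)) then fst t else insert (fst (snd t)) (fst t)) ` ?Pc"
    proof
      fix x assume x: "x \<in> V \<inter> par D True"
      then obtain j where j: "(x - {j}, j, c) \<in> P" unfolding V_def has_def by auto
      have fx: "finite x" "even (card x)" using x D(1) finite_subset unfolding par_def by auto
      have eq: "x = (if even (card (x - {j})) then x - {j} else insert j (x - {j}))"
      proof (cases "j \<in> x")
        case True
        then have "nb x j = x - {j}" by (simp add: nb_def)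
        then show ?thesis using even_card_nb[OF fx(1), of j] fx(2) True by auto
      next
        case False
        then show ?thesis using fx by simp
      qed
      show "x \<in> (\<lambda>t. if even (card (fst t)) then fst t else insert (fst (snd t)) (fst t)) ` ?Pc"
      proof (rule image_eqI[of _ _ "(x - {j}, j, c)"])
        show "x = (if even (card (fst (x - {j}, j, c))) then fst (x - {j}, j, c)
            else insert (fst (snd (x - {j}, j, c))) (fst (x - {j}, j, c)))"
          unfolding fst_conv snd_conv by (rule eq)
      qed (simp add: j)
    qed
    then show ?thesis unfolding r_def by (rule surj_card_le[rotated]) (use finP in simp)
  qed
  have Wq: "card (W \<inter> par D q) = N - r" for q
  proof -
    have "W \<inter> par D q = par D q - (V \<inter> par D q)" by (auto simp: W_def par_def)
    then show ?thesis using N Vq par_finite[OF D(1)] by (simp add: card_Diff_subset finite_subset)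
  qed
  have dN: "card D + 3 \<le> N"
  proof -
    have "2 * (card D + 3) \<le> 2 * N" unfolding N(2) by (rule double_bound[OF D])
    then show ?thesis by simp
  qed
  have Gsym: "i \<in> D \<and> nb x i \<in> W \<and> i \<in> G (nb x i)" if "x \<in> W" "i \<in> G x" for x i
    using that unfolding G_def by auto
  \<comment> \<open>A vertex of \<open>W\<close> without an allowed direction would be blocked for
    \<open>c\<close>.\<close>
  have iso: "G x \<noteq> {}" if x: "x \<in> W" for x
  proof
    assume G0: "G x = {}"
    have "badv D P x c"
      unfolding badv_def
    proof (intro conjI allI ballI)
      show "x \<subseteq> D" using x by (simp add: W_def)
      show "\<not> has P x i c" for i using x by (auto simp: W_def V_def)
      fix l assume l: "l \<in> D"
      have "nb x l \<notin> W \<or> x = w \<and> l \<in> A \<or> nb x l = w \<and> l \<in> A" using G0 l unfolding G_def by blast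
      then show "(\<exists>e. has P x l e) \<or> (\<exists>j. has P (nb x l) j c)"
      proof (elim disjE conjE)
        assume "nb x l \<notin> W"
        then show ?thesis using \<open>x \<subseteq> D\<close> l unfolding W_def V_def by auto
      next
        assume "x = w" "l \<in> A" then show ?thesis unfolding A_def by blast
      next
        assume h: "nb x l = w" "l \<in> A"
        then obtain e where "has P (nb x l) l e" unfolding A_def by blast
        then show ?thesis by auto
      qed
    qed
    then show False using gd c unfolding good_def by blast
  qed
  \<comment> \<open>The only edges of the cube between \<open>X\<close> and \<open>Y\<close> are
    forbidden edges at \<open>w\<close>. To apply isoperimetry they are destroyed by deleting
    \<open>w\<close> from \<open>X\<close>, or, if \<open>X\<close> would become too small, by
    deleting the neighbours of \<open>w\<close> along \<open>A\<close> from
    \<open>Y\<close>.\<close>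
  have two: "card X + card Y + r \<le> N"
    if X: "X \<subseteq> W \<inter> par D q" and Y: "Y \<subseteq> W \<inter> par D (\<not> q)" and no: "\<And>x i. x \<in> X \<Longrightarrow> i \<in> G x \<Longrightarrow> nb x i \<notin> Y"
      and c2: "2 \<le> card X" "2 \<le> card Y" and wY: "w \<notin> Y" for X Y q
  proof -
    have fin: "finite X" "finite Y" using X Y par_finite[OF D(1)] by (auto intro: finite_subset)
    have J: "card X' + card Y' + card D \<le> N"
      if "X' \<subseteq> X" "Y' \<subseteq> Y" "\<And>x i. x \<in> X' \<Longrightarrow> i \<in> D \<Longrightarrow> nb x i \<notin> Y'" "2 \<le> card X'" "2 \<le> card Y'" for X' Y'
    proof -
      have s: "X' \<subseteq> par D q" "Y' \<subseteq> par D (\<not> q)" using that(1,2) X Y by auto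
      have "2 * (card X' + card Y' + card D) \<le> 2 * N"
        unfolding N(2) by (rule isoperimetry[OF D(1) s that(3-5)])
      then show ?thesis by simp
    qed
    have edge: "x = w \<and> i \<in> A" if "x \<in> X" "i \<in> D" "nb x i \<in> Y" for x i
      using no[OF that(1), of i] that Y wY unfolding G_def by auto
    show ?thesis
    proof (cases "w \<in> X \<and> A \<noteq> {}")
      case False
      then have "nb x i \<notin> Y" if "x \<in> X" "i \<in> D" for x i using edge[OF that] that(1) by blast
      then show ?thesis using J[of X Y] c2 rle cardA by simp
    next
      case True
      have A1: "1 \<le> card A" using True AD D(1) finite_subset by (metis One_nat_def Suc_leI card_gt_0_iff)
      show ?thesis
      proof (cases "3 \<le> card X")
        case X3: True
        have cX: "card (X - {w}) = card X - 1" using True by simp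
        have "card (X - {w}) + card Y + card D \<le> N"
          by (rule J) (use edge X3 cX c2 in auto)
        then show ?thesis using cX X3 A1 cardA rle by simp
      next
        case False
        then have X2: "card X = 2" using c2 by simp
        let ?B = "(\<lambda>i. nb w i) ` A"
        have cB: "card ?B = card A" using card_nbrs[OF D(1) AD] .
        have cY: "card Y \<le> card (Y - ?B) + card A"
          using fin(2) cB diff_card_le_card_Diff[of ?B Y] AD D(1) finite_subset by fastforce
        show ?thesis
        proof (cases "2 \<le> card (Y - ?B)")
          case Y2: True
          have "card X + card (Y - ?B) + card D \<le> N"
            by (rule J) (use edge Y2 c2 in auto)
          then show ?thesis using cY cardA rle by linarith
        next
          case False
          \<comment> \<open>Here \<open>card X = 2\<close> and
            \<open>card Y \<le> card A + 1\<close>, so the bound \<open>card D + 3\<close> is just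
            what is needed.\<close>
          then show ?thesis using cY X2 cardA rle dN by linarith
        qed
      qed
    qed
  qed
  have "\<exists>k. \<forall>x\<in>W. k x \<in> G x \<and> k (nb x (k x)) = k x"
  proof (rule hall_directions[OF D(1)])
    show "W \<subseteq> Pow D" by (auto simp: W_def)
    show "card (W \<inter> par D True) = card (W \<inter> par D False)" using Wq by simp
    show "G x \<subseteq> D" for x by (auto simp: G_def)
    show "nb x i \<in> W \<and> i \<in> G (nb x i)" if "x \<in> W" "i \<in> G x" for x i using Gsym[OF that] by blast
    fix X assume X: "X \<subseteq> W \<inter> par D True"
    let ?N = "\<Union>x\<in>X. nb x ` G x"
    \<comment> \<open>The odd vertices of \<open>W\<close> that no allowed edge joins to
      \<open>X\<close>. If Hall's condition failed, \<open>X\<close> and \<open>?Y\<close> together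
      would have more than \<open>N - r\<close> elements.\<close>
    let ?Y = "(W \<inter> par D False) - ?N"
    have finW: "finite (W \<inter> par D q)" for q using par_finite[OF D(1)] by simp
    have finX: "finite X" using finite_subset[OF X finW] .
    have Nsub: "?N \<subseteq> W \<inter> par D False"
    proof
      fix y assume "y \<in> ?N"
      then obtain x i where x: "x \<in> X" "i \<in> G x" "y = nb x i" by blast
      then have "i \<in> D" "nb x i \<in> W" using Gsym X by auto
      then show "y \<in> W \<inter> par D False" using x X nb_par[OF D(1), of i x False] by auto
    qed
    have cY: "card ?Y + card ?N = N - r"
      using card_Diff_subset[OF finite_subset[OF Nsub finW] Nsub] card_mono[OF finW Nsub] Wq[of False] by simp
    have noXY: "nb x i \<notin> ?Y" if "x \<in> X" "i \<in> G x" for x i using that by blast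
    have noYX: "nb y i \<notin> X" if "y \<in> ?Y" "i \<in> G y" for y i
    proof
      assume h: "nb y i \<in> X"
      have "i \<in> G (nb y i)" using Gsym[of y i] that by blast
      then have "nb (nb y i) i \<notin> ?Y" by (rule noXY[OF h])
      then show False using that(1) unfolding nb_nb by (rule notE)
    qed
    show "card X \<le> card ?N"
    proof (rule ccontr)
      assume "\<not> card X \<le> card ?N"
      then have big: "N - r < card X + card ?Y" using cY by simp
      have cX: "card X \<le> N - r" using card_mono[OF finW X] Wq by simp
      have cYle: "card ?Y \<le> N - r" using cY by simp
      consider "card X = 0" | "card ?Y = 0" | "card X = 1" | "card ?Y = 1" | "2 \<le> card X" "2 \<le> card ?Y" by linarith
      then show False
      proof cases
        case 1
        then show False using big cYle by simp
      next
        case 2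
        then show False using big cX by simp
      next
        case 3
        then obtain x where x: "X = {x}" by (metis card_1_singletonE)
        have "card ?N = 0" using 3 cY big by simp
        moreover have "finite ?N" using finite_subset[OF Nsub finW] .
        ultimately have "?N = {}" by simp
        then show False using iso[of x] x X by auto
      next
        case 4
        then obtain y where y: "?Y = {y}" by (metis card_1_singletonE)
        have "card X = card (W \<inter> par D True)" using 4 big cX Wq[of True] by simp
        then have XW: "X = W \<inter> par D True" using card_subset_eq[OF finW X] by simp
        have yY: "y \<in> ?Y" using y by blast
        then obtain i where i: "i \<in> G y" using iso[of y] by blast
        then have "nb y i \<in> W" "i \<in> D" using Gsym[of y i] yY by auto
        then have "nb y i \<in> X" unfolding XW using nb_par[OF D(1), of i y True] yY by simp
        then show False using noYX[OF yY i] by blast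
      next
        case 5
        have Ys: "?Y \<subseteq> W \<inter> par D (\<not> True)" by auto
        have "card X + card ?Y + r \<le> N"
        proof (cases "w \<in> ?Y")
          case False
          show ?thesis by (rule two[of X True, OF X Ys noXY 5 False])
        next
          case True
          then have "w \<notin> X" using X by (auto simp: par_def)
          then have "card ?Y + card X + r \<le> N"
            using two[of ?Y False X] X noYX 5 by auto
          then show ?thesis by simp
        qed
        then show False using big by simp
      qed
    qed
  qed
  then obtain k where k: "\<And>x. x \<in> W \<Longrightarrow> k x \<in> G x" "\<And>x. x \<in> W \<Longrightarrow> k (nb x (k x)) = k x" by blast
  \<comment> \<open>The direction of the edge of colour \<open>c\<close> at each vertex, prescribed
    on \<open>V\<close> and newly matched elsewhere.\<close>
  define K where "K x = (if x \<in> V then (THE j. has P x j c) else k x)" for x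
  have Kc: "K x = j" if "has P x j c" for x j
  proof -
    have "(THE j. has P x j c) = j" using that precolD(5)[OF P that] by blast
    then show ?thesis using that unfolding K_def V_def by auto
  qed
  have KD: "K x \<in> D" if "x \<subseteq> D" for x
  proof (cases "x \<in> V")
    case True
    then obtain j where j: "has P x j c" by (auto simp: V_def)
    then show ?thesis using Kc[OF j] has_sub(2)[OF P j] by simp
  next
    case False
    then have "x \<in> W" using that by (simp add: W_def)
    then show ?thesis using k(1) False by (auto simp: K_def G_def)
  qed
  have Ksym: "K (nb x (K x)) = K x" if "x \<subseteq> D" for x
  proof (cases "x \<in> V")
    case True
    then obtain j where j: "has P x j c" by (auto simp: V_def)
    then show ?thesis using Kc[OF j] Kc[of "nb x j" j] by simp
  next
    case False
    then have xW: "x \<in> W" using that by (simp add: W_def)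
    then have "nb x (k x) \<in> W" using k(1) Gsym by blast
    then have "nb x (k x) \<notin> V" by (simp add: W_def)
    then show ?thesis using k(2)[OF xW] False by (simp add: K_def)
  qed
  have KA: "K w \<notin> A"
  proof (cases "w \<in> V")
    case True
    then obtain j where j: "has P w j c" by (auto simp: V_def)
    then show ?thesis using Kc[OF j] precolD(5)[OF P j] unfolding A_def by blast
  next
    case False
    then have "w \<in> W" using w by (simp add: W_def)
    then show ?thesis using k(1)[of w] False by (auto simp: K_def G_def)
  qed
  have Ki: "K (nb x i) = i \<longleftrightarrow> K x = i" if "x \<subseteq> D" "i \<in> D" for x i
    using Ksym[OF that(1)] Ksym[of "nb x i"] that by (metis nb_nb nb_subset)
  have "\<exists>f. \<forall>x\<subseteq>D. bij_betw (f x) (D - {K x}) (C - {c}) \<and> (\<forall>i\<in>D - {K x}. f (nb x i) i = (f x i :: nat))"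
  proof (rule regular_coloring[OF D(1)])
    show "D - {K x} \<subseteq> D \<and> card (D - {K x}) = card (C - {c})" if "x \<subseteq> D" for x
      using KD[OF that] D(1) C c by simp
    show "i \<in> D - {K (nb x i)}" if "x \<subseteq> D" "i \<in> D - {K x}" for x i using Ki[of x i] that by auto
  qed (use C in simp)
  then obtain f where f: "\<And>x. x \<subseteq> D \<Longrightarrow> bij_betw (f x) (D - {K x}) (C - {c})"
    "\<And>x i. x \<subseteq> D \<Longrightarrow> i \<in> D - {K x} \<Longrightarrow> f (nb x i) i = (f x i :: nat)" by blast
  have AK: "A \<subseteq> D - {K w}" using AD KA by blast
  define col where "col l = (SOME e. e \<noteq> c \<and> has P w l e)" for l
  have col: "col l \<noteq> c \<and> has P w l (col l)" if "l \<in> A" for l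
    using that someI_ex[of "\<lambda>e. e \<noteq> c \<and> has P w l e"] unfolding A_def col_def by blast
  have fw: "inj_on (f w) A" using f(1)[OF w] AK unfolding bij_betw_def by (meson inj_on_subset)
  have fwC: "f w ` A \<subseteq> C - {c}" using f(1)[OF w] AK unfolding bij_betw_def by blast
  \<comment> \<open>The other prescribed edges all meet \<open>w\<close> and have distinct colours
    there, so renaming whole colour classes puts them right.\<close>
  have "\<exists>\<sigma>. bij_betw \<sigma> (C - {c}) (C - {c}) \<and> (\<forall>a\<in>f w ` A. \<sigma> a = (col \<circ> inv_into A (f w)) a)"
  proof (rule extend_bij)
    show "finite (C - {c})" using C by simp
    show "f w ` A \<subseteq> C - {c}" by fact
    have "inj_on col A"
    proof (rule inj_onI)
      fix a b assume "a \<in> A" "b \<in> A" "col a = col b"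
      then show "a = b" using col[of a] col[of b] precolD(5)[OF P, of w a "col a" b "col b"] by simp
    qed
    then show "inj_on (col \<circ> inv_into A (f w)) (f w ` A)"
      using inv_into_f_f[OF fw] by (auto simp: inj_on_def)
    show "(col \<circ> inv_into A (f w)) ` f w ` A \<subseteq> C - {c}"
    proof -
      have "(col \<circ> inv_into A (f w)) (f w l) \<in> C - {c}" if "l \<in> A" for l
        using col[OF that] has_sub(3)[OF P, of w l "col l"] inv_into_f_f[OF fw that] by simp
      then show ?thesis by blast
    qed
  qed
  then obtain \<sigma> where \<sigma>: "bij_betw \<sigma> (C - {c}) (C - {c})" "\<And>l. l \<in> A \<Longrightarrow> \<sigma> (f w l) = col l"
    using fw by auto
  let ?F = "\<lambda>x i. if i = K x then c else \<sigma> (f x i)"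
  have "coloring D C ?F"
    unfolding coloring_def
  proof (intro allI impI conjI ballI)
    fix x assume x: "x \<subseteq> D"
    have "bij_betw (?F x) ((D - {K x}) \<union> {K x}) ((C - {c}) \<union> {c})"
    proof (rule bij_betw_combine)
      have "bij_betw (\<sigma> \<circ> f x) (D - {K x}) (C - {c})" using f(1)[OF x] \<sigma>(1) by (rule bij_betw_trans)
      then show "bij_betw (?F x) (D - {K x}) (C - {c})" by (rule bij_betw_cong[THEN iffD1, rotated]) auto
      show "bij_betw (?F x) {K x} {c}" by (simp add: bij_betw_def)
    qed auto
    then show "bij_betw (?F x) D C" using KD[OF x] c by (simp add: insert_absorb)
    fix i assume "i \<in> D"
    then show "?F (nb x i) i = ?F x i" using Ki[OF x, of i] f(2)[OF x, of i] by auto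
  qed
  moreover have "?F v j = e" if p: "(v, j, e) \<in> P" for v j e
  proof (cases "e = c")
    case True
    then have "K v = j" using Kc in_has[OF P p] by simp
    then show ?thesis using True by simp
  next
    case False
    have wv: "w - {j} = v" using star[OF p False] .
    then have h: "has P w j e" using p by (simp add: has_def)
    then have jA: "j \<in> A" using False by (auto simp: A_def)
    have "col j = e" using col[OF jA] precolD(5)[OF P _ h, of j "col j"] by simp
    moreover have "K w \<noteq> j" using KA jA by blast
    ultimately have Fw: "?F w j = e" using \<sigma>(2)[OF jA] by simp
    have jD: "j \<in> D" using has_sub(2)[OF P h] .
    show ?thesis
    proof (cases "j \<in> w")
      case True
      then have "v = nb w j" using wv by (simp add: nb_def)
      then show ?thesis using Fw f(2)[OF w, of j] Ki[OF w jD] \<open>K w \<noteq> j\<close> jD by auto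
    next
      case False
      then have vw: "v = w" using wv by simp
      show ?thesis unfolding vw by (rule Fw)
    qed
  qed
  ultimately show ?thesis unfolding ext_def by blast
qed

lemma nb_nb_eq [simp]: "nb (nb x i) j = x \<longleftrightarrow> i = j" "x = nb (nb x i) j \<longleftrightarrow> i = j"
proof -
  show "nb (nb x i) j = x \<longleftrightarrow> i = j" by (simp add: nb_swap[of _ j])
  then show "x = nb (nb x i) j \<longleftrightarrow> i = j" by metis
qed

lemma precol_insert:
  assumes "precol D C S" "v \<subseteq> D" "j \<in> D" "j \<notin> v" "c \<in> C"
    and free: "\<And>x k e. x - {j} = v \<Longrightarrow> has S x k e \<Longrightarrow> k \<noteq> j \<and> e \<noteq> c"
  shows "precol D C (insert (v, j, c) S)"
proof (rule precolI)
  fix w k e assume "(w, k, e) \<in> insert (v, j, c) S"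
  then show "w \<subseteq> D \<and> k \<in> D \<and> k \<notin> w \<and> e \<in> C" using precolD(1-4)[OF assms(1)] assms(2-5) by auto
next
  fix x k l e e' assume h: "has (insert (v, j, c) S) x k e" "has (insert (v, j, c) S) x l e'"
  then show "k = l \<longleftrightarrow> e = e'"
    unfolding has_insert using precolD(5)[OF assms(1), of x k e l e'] free[of x k e] free[of x l e'] by metis
qed

lemma card_insert_le': "finite S \<Longrightarrow> card (insert t S) \<le> Suc (card S)"
  by (simp add: card_insert_if)

text \<open>If all colours are different, a vertex blocked for \<open>c\<close> is blocked by the only edge of colour \<open>c\<close>.\<close>

lemma rainbow_bad:
  assumes D: "finite D" and C: "finite C" "card C = card D" and P: "precol D C P" and le: "card P \<le> card D"
    and rb: "inj_on (snd \<circ> snd) P" and bad: "\<not> good D C P"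
  shows "\<exists>u p. bade D C P u p"
proof -
  have fin: "finite P" using precol_finite[OF D C(1) P] .
  from bad consider "\<exists>u p. bade D C P u p" | u c where "c \<in> C" "badv D P u c" unfolding good_def by blast
  then show ?thesis
  proof cases
    case (2 u c)
    have cP: "card P = card D" using badv_all(1)[OF D C(1) P 2(2) le] .
    have "(snd \<circ> snd) ` P = C"
      using card_subset_eq[OF C(1), of "(snd \<circ> snd) ` P"] card_image[OF rb] cP C(2) precolD(4)[OF P] by force
    then have ex: "\<exists>v j. (v, j, e) \<in> P" if "e \<in> C" for e using that by force
    obtain v j where p: "(v, j, c) \<in> P" using ex[OF 2(1)] by blast
    then obtain l where l: "l \<in> D" "\<And>e'. \<not> has P u l e'" "nb u l - {j} = v"
      using badv_all(2)[OF D C(1) P 2(2) le p] by blast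
    \<comment> \<open>The direction \<open>l\<close> is the one closed by the only edge of colour
      \<open>c\<close>: its far end sees \<open>c\<close>, and all other colours occur at
      \<open>u\<close>.\<close>
    have "bade D C P u l"
      unfolding bade_def
    proof (intro conjI allI ballI)
      show "u \<subseteq> D" using 2(2) by (simp add: badv_def)
      fix e assume e: "e \<in> C"
      then obtain w k where q: "(w, k, e) \<in> P" using ex by blast
      show "\<exists>j. has P u j e \<or> has P (nb u l) j e"
      proof (cases "e = c")
        case True
        then show ?thesis using p l(3) unfolding has_def by blast
      next
        case False
        then have "u - {k} = w" using badv_all(2)[OF D C(1) P 2(2) le q] by blast
        then show ?thesis using q unfolding has_def by blast
      qed
    qed (use l in auto)
    then show ?thesis by blast
  qed blast
qed

section \<open>Common setting of the induction step\<close>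

locale step =
  fixes D C :: "nat set" and P :: precoloring
  assumes D: "finite D" and C: "finite C" "card C = card D" and P: "precol D C P"
    and cP: "card P = card D" and gd: "good D C P" and d4: "4 \<le> card D"
begin

lemma finP: "finite P" using precol_finite[OF D C(1) P] .

text \<open>Halves have \<open>card D - 1\<close> directions, so a half with at most
  \<open>card D - 2\<close> edges is extendable without a check for obstructions.\<close>

lemma few:
  assumes "i \<in> D" "c \<in> C" "precol (D - {i}) (C - {c}) Q" "card Q + 2 \<le> card D"
  shows "ext (D - {i}) (C - {c}) Q"
  using ext_few[of "D - {i}" "C - {c}" Q] assms D C by simp

lemma has_in: "has P x j e \<Longrightarrow> (x - {j}, j, e) \<in> P" by (simp add: has_def)

lemma reflect_step: "R \<subseteq> D \<Longrightarrow> step D C (reflect R P)"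
  unfolding step_def using D C P cP gd d4 reflect_card[OF P] reflect_precol[OF P] reflect_good[OF P] by simp

lemma reflect1_iff:
  assumes "j \<noteq> i" shows "(v, j, e) \<in> reflect {i} P \<longleftrightarrow> (nb v i, j, e) \<in> P"
proof -
  have rx1: "rx w {i} = nb w i" for w by (auto simp: rx_def nb_def)
  show ?thesis
  proof
    assume "(v, j, e) \<in> reflect {i} P"
    then obtain w where w: "(w, j, e) \<in> P" "v = nb w i - {j}" unfolding reflect_def rx1 by auto
    then have "nb w i - {j} = nb w i" using precolD(3)[OF P w(1)] assms by auto
    then show "(nb v i, j, e) \<in> P" using w by simp
  next
    assume p: "(nb v i, j, e) \<in> P"
    then have "j \<notin> v" using precolD(3)[OF P p] assms by simp
    then have "v = rx (nb v i) {i} - {j}" unfolding rx1 by auto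
    then show "(v, j, e) \<in> reflect {i} P" unfolding reflect_def using p by force
  qed
qed

text \<open>Direction \<open>i\<close> and colour \<open>c\<close> occur only together, so the
  halves are independent. Each of them loses the edge of direction \<open>i\<close> and an edge on
  the other side, which is enough for \<open>few\<close>.\<close>

lemma single_direction:
  assumes p: "(v, i, c) \<in> P" and uni: "\<And>v' e. (v', i, e) \<in> P \<Longrightarrow> e = c"
    and uc: "\<And>v' j. (v', j, c) \<in> P \<Longrightarrow> j = i"
    and s1: "(v1, j1, e1) \<in> P" "j1 \<noteq> i" "i \<in> v1" and s0: "(v0, j0, e0) \<in> P" "j0 \<noteq> i" "i \<notin> v0"
  shows "ext D C P"
proof (rule split_unused[OF _ _ P])
  show i: "i \<in> D" and c: "c \<in> C" using precolD[OF P] p by auto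
  show "j = i \<longleftrightarrow> e = c" if "(v, j, e) \<in> P" for v j e using uni uc that by blast
  fix b
  obtain t where t: "t \<in> P" "fst (snd t) \<noteq> i" "(i \<in> fst t) \<noteq> b"
    using s1 s0 by (cases b) force+
  have ne: "t \<noteq> (v, i, c)" using t by auto
  have "card (slice b i c P) + card {(v, i, c), t} \<le> card P"
    by (rule slice_card_add[OF finP]) (use t p in auto)
  then have "card (slice b i c P) + 2 \<le> card D" using ne cP by simp
  then show "ext (D - {i}) (C - {c}) (slice b i c P)" using few[OF i c slice_precol[OF P]] by blast
qed

end

section \<open>All colours different: how single cuts fail\<close>

text \<open>At least five dimensions keep the induction hypothesis in dimension four or more and
  leave a fifth colour besides four chosen ones.\<close>

locale rainbow = step +
  assumes rb: "inj_on (snd \<circ> snd) P" and d5: "5 \<le> card D"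
    and IH: "\<And>D' C' Q. finite D' \<Longrightarrow> finite C' \<Longrightarrow> card C' = card D' \<Longrightarrow> Suc (card D') = card D \<Longrightarrow> precol D' C' Q
      \<Longrightarrow> card Q \<le> card D' \<Longrightarrow> good D' C' Q \<Longrightarrow> ext D' C' Q"
begin

lemma same: "(v, j, e) \<in> P \<Longrightarrow> (v', j', e) \<in> P \<Longrightarrow> v = v' \<and> j = j'"
  using inj_onD[OF rb, of "(v, j, e)" "(v', j', e)"] by simp

lemma all_colors: assumes "e \<in> C" obtains v j where "(v, j, e) \<in> P"
proof -
  have "(snd \<circ> snd) ` P = C"
    using card_subset_eq[OF C(1), of "(snd \<circ> snd) ` P"] card_image[OF rb] cP C(2) precolD(4)[OF P] by force
  then show thesis using that assms by force
qed

lemma reflect_rainbow: assumes "R \<subseteq> D" shows "rainbow D C (reflect R P)"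
  unfolding rainbow_def rainbow_axioms_def
proof (intro conjI)
  show "step D C (reflect R P)" using reflect_step[OF assms] .
  have "(snd \<circ> snd) ` reflect R P = (snd \<circ> snd) ` P" unfolding reflect_def by force
  then have "card ((snd \<circ> snd) ` reflect R P) = card (reflect R P)"
    using card_image[OF rb] reflect_card[OF P] by simp
  moreover have "finite (reflect R P)" unfolding reflect_def using finP by simp
  ultimately show "inj_on (snd \<circ> snd) (reflect R P)" by (intro eq_card_imp_inj_on)
qed (use d5 IH in auto)

lemma single_rainbow:
  assumes "(v, i, c) \<in> P" "\<And>v' e. (v', i, e) \<in> P \<Longrightarrow> e = c"
    "(v1, j1, e1) \<in> P" "j1 \<noteq> i" "i \<in> v1" "(v0, j0, e0) \<in> P" "j0 \<noteq> i" "i \<notin> v0"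
  shows "ext D C P"
proof (rule single_direction[OF assms(1,2) _ assms(3-)])
  show "j = i" if "(v', j, c) \<in> P" for v' j using same[OF assms(1) that] by simp
qed

text \<open>Copying the half that carries everything fails only if this half is obstructed, and with
  all colours different an obstructed half has a blocked edge. So all edges, except perhaps that of
  colour \<open>c\<close>, gather around one edge of direction \<open>p\<close>.\<close>

lemma one_sided:
  assumes i: "i \<in> D" and c: "c \<in> C"
    and side: "\<And>v j e. (v, j, e) \<in> P \<Longrightarrow> j \<noteq> i \<and> (i \<in> v) = b \<or> j = i \<and> e = c" and ne: "\<not> ext D C P"
  obtains U p where "U \<subseteq> D" "p \<in> D" "p \<noteq> i" "\<And>e. e \<in> C \<Longrightarrow> e \<noteq> c \<Longrightarrow> \<exists>j. has P U j e \<or> has P (nb U p) j e"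
    "\<And>e. e \<noteq> c \<Longrightarrow> \<not> has P U p e"
proof -
  let ?S = "slice b i c P"
  obtain v0 j0 where t: "(v0, j0, c) \<in> P" using all_colors[OF c] by blast
  have "card ?S < card P" using slice_card_less[OF finP t] by simp
  then have cS: "card ?S \<le> card (D - {i})" using cP i D by simp
  have cc: "card (C - {c}) = card (D - {i})" "Suc (card (D - {i})) = card D" using C(2) card_Suc_Diff1[OF C(1) c] card_Suc_Diff1[OF D i] by linarith+
  have pS: "precol (D - {i}) (C - {c}) ?S" using slice_precol[OF P] .
  have "\<not> ext (D - {i}) (C - {c}) ?S" using copy_one_sided[OF i c P side] ne by blast
  then have bad: "\<not> good (D - {i}) (C - {c}) ?S" using IH[OF _ _ cc pS cS] D C by blast
  have inj: "inj_on (snd \<circ> snd) ?S"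
  proof (rule inj_onI)
    fix s t assume h: "s \<in> ?S" "t \<in> ?S" "(snd \<circ> snd) s = (snd \<circ> snd) t"
    obtain v j e where s: "s = (v - {i}, j, e)" "(v, j, e) \<in> P" using h(1) unfolding slice_def by blast
    obtain w k e' where t: "t = (w - {i}, k, e')" "(w, k, e') \<in> P" using h(2) unfolding slice_def by blast
    have "e' = e" using h(3) s(1) t(1) by simp
    then show "s = t" using same[OF s(2)] t s(1) by simp
  qed
  obtain u p where b: "bade (D - {i}) (C - {c}) ?S u p"
    using rainbow_bad[OF _ _ cc(1) pS cS inj bad] D C by blast
  let ?l = "\<lambda>x. if b then insert i x else x"
  have u: "u \<subseteq> D - {i}" "p \<in> D - {i}" using b by (auto simp: bade_def)
  have l: "?l (nb u p) = nb (?l u) p" using u by (auto simp: nb_def)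
  show thesis
  proof (rule that[of "?l u" p])
    show "?l u \<subseteq> D" "p \<in> D" "p \<noteq> i" using u i by auto
    show "\<exists>j. has P (?l u) j e \<or> has P (nb (?l u) p) j e" if "e \<in> C" "e \<noteq> c" for e
      using b that unfolding bade_def has_slice l by blast
    show "\<not> has P (?l u) p e" if "e \<noteq> c" for e
      using b that u unfolding bade_def has_slice by blast
  qed
qed

text \<open>Besides \<open>i\<close> and \<open>p\<close> there are \<open>card D - 2\<close>
  directions at \<open>U\<close>, too few for \<open>card D - 1\<close> colours.\<close>

lemma no_full_star:
  assumes "\<And>e. e \<in> C \<Longrightarrow> e \<noteq> c \<Longrightarrow> \<exists>j. has P U j e \<and> j \<noteq> i \<and> j \<noteq> p"
    and "i \<in> D" "p \<in> D" "i \<noteq> p"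
  shows False
proof -
  have "\<exists>h. \<forall>e\<in>C - {c}. has P U (h e) e \<and> h e \<noteq> i \<and> h e \<noteq> p" using assms(1) by (intro bchoice) blast
  then obtain h where h: "\<And>e. e \<in> C - {c} \<Longrightarrow> has P U (h e) e \<and> h e \<noteq> i \<and> h e \<noteq> p" by blast
  have "inj_on h (C - {c})"
    by (rule inj_onI) (use h precolD(5)[OF P] in metis)
  moreover have "h ` (C - {c}) \<subseteq> D - {i, p}" using h has_sub(2)[OF P] by blast
  ultimately have "card (C - {c}) \<le> card (D - {i, p})" using D card_inj_on_le by blast
  moreover have "card (D - {i, p}) = card D - 2" using assms(2-4) D by (simp add: card_Diff_subset)
  moreover have "card D - 1 \<le> card (C - {c})" using C by (simp add: card_Diff_singleton_if)
  ultimately show False using d5 by linarith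
qed

definition unused :: "nat \<Rightarrow> bool" where
  "unused i \<longleftrightarrow> i \<in> D \<and> (\<forall>v e. (v, i, e) \<notin> P)"

definition lopsided :: "nat \<Rightarrow> bool" where
  "lopsided i \<longleftrightarrow> (\<exists>b. \<forall>v j e. (v, j, e) \<in> P \<longrightarrow> (i \<in> v) = b)"

lemma not_lopsided:
  assumes "(v1, j1, e1) \<in> P" "i \<in> v1" "(v0, j0, e0) \<in> P" "i \<notin> v0" shows "\<not> lopsided i"
  unfolding lopsided_def using assms by blast

lemma has_unused: "unused i \<Longrightarrow> has P x j e \<Longrightarrow> j \<noteq> i"
  unfolding unused_def has_def by blast

text \<open>The edges gather around a blocked edge of direction \<open>p\<close>. Neither end can
  carry all colours but \<open>c\<close>, so both sides of \<open>p\<close> are occupied. Direction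
  \<open>p\<close> contains at most the edge of colour \<open>c\<close>, and if it did, the cut in
  direction \<open>p\<close> would succeed.\<close>

lemma lopsided_unused:
  assumes i: "unused i" "lopsided i" and ne: "\<not> ext D C P"
  shows "\<exists>p. unused p \<and> \<not> lopsided p"
proof -
  obtain b where b: "\<And>v j e. (v, j, e) \<in> P \<Longrightarrow> (i \<in> v) = b" using i(2) unfolding lopsided_def by blast
  have iD: "i \<in> D" using i by (simp add: unused_def)
  have "P \<noteq> {}" using cP d5 by auto
  then obtain v0 j0 c where t: "(v0, j0, c) \<in> P" by (metis ex_in_conv prod_cases3)
  have c: "c \<in> C" using precolD(4)[OF P t] .
  have side: "j \<noteq> i \<and> (i \<in> v) = b \<or> j = i \<and> e = c" if "(v, j, e) \<in> P" for v j e
    using b[OF that] i(1) that unfolding unused_def by blast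
  obtain U p where U: "U \<subseteq> D" "p \<in> D" "p \<noteq> i"
    and cov: "\<And>e. e \<in> C \<Longrightarrow> e \<noteq> c \<Longrightarrow> \<exists>j. has P U j e \<or> has P (nb U p) j e"
    and np: "\<And>e. e \<noteq> c \<Longrightarrow> \<not> has P U p e"
    using one_sided[OF iD c side ne] by metis
  have np': "\<not> has P (nb U p) p e" if "e \<noteq> c" for e using np[OF that] by simp
  have dirp: "(v, j, e) = (v0, j0, c)" if q: "(v, j, e) \<in> P" "j = p" for v j e
  proof (rule ccontr)
    assume ne: "(v, j, e) \<noteq> (v0, j0, c)"
    then have ec: "e \<noteq> c" using same[OF q(1)] t by blast
    then obtain k where k: "has P U k e \<or> has P (nb U p) k e" using cov precolD(4)[OF P q(1)] by blast
    then have "k = p" using same[OF q(1)] has_in q(2) by blast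
    then show False using k np[OF ec] np'[OF ec] by blast
  qed
  have star: "\<exists>j e. has P y j e \<and> e \<noteq> c \<and> j \<noteq> p" if y: "y = U \<and> z = nb U p \<or> y = nb U p \<and> z = U" for y z
  proof (rule ccontr)
    assume no: "\<not> (\<exists>j e. has P y j e \<and> e \<noteq> c \<and> j \<noteq> p)"
    show False
    proof (rule no_full_star[of c z i p])
      fix e assume e: "e \<in> C" "e \<noteq> c"
      then obtain j where j: "has P z j e \<or> has P y j e" using cov y by blast
      have "j \<noteq> p" using j np[OF e(2)] np'[OF e(2)] y by blast
      then show "\<exists>j. has P z j e \<and> j \<noteq> i \<and> j \<noteq> p" using j no e(2) has_unused[OF i(1)] by blast
    qed (use iD U in auto)
  qed
  obtain k1 e1 where h1: "has P U k1 e1" "e1 \<noteq> c" "k1 \<noteq> p" using star[of U "nb U p"] by blast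
  obtain k2 e2 where h2: "has P (nb U p) k2 e2" "e2 \<noteq> c" "k2 \<noteq> p" using star[of "nb U p" U] by blast
  have m1: "(U - {k1}, k1, e1) \<in> P" "p \<in> U - {k1} \<longleftrightarrow> p \<in> U" using has_in[OF h1(1)] h1(3) by auto
  have m2: "(nb U p - {k2}, k2, e2) \<in> P" "p \<in> nb U p - {k2} \<longleftrightarrow> p \<notin> U" using has_in[OF h2(1)] h2(3) by auto
  have j0p: "j0 \<noteq> p"
  proof
    assume j0: "j0 = p"
    have t': "(v0, p, c) \<in> P" using t j0 by simp
    have u: "e = c" if "(v', p, e) \<in> P" for v' e using dirp[OF that refl] by simp
    show False
    proof (cases "p \<in> U")
      case True
      have "ext D C P"
        by (rule single_rainbow[OF t' u m1(1) h1(3) _ m2(1) h2(3)]) (use m1(2) m2(2) True in simp_all)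
      then show False using ne by simp
    next
      case False
      have "ext D C P"
        by (rule single_rainbow[OF t' u m2(1) h2(3) _ m1(1) h1(3)]) (use m1(2) m2(2) False in simp_all)
      then show False using ne by simp
    qed
  qed
  have "unused p" unfolding unused_def
  proof (intro conjI allI notI)
    fix v e assume "(v, p, e) \<in> P"
    then show False using dirp[of v p e] j0p by simp
  qed (rule U(2))
  moreover have "\<not> lopsided p"
  proof (cases "p \<in> U")
    case True
    show ?thesis by (rule not_lopsided[OF m1(1) _ m2(1)]) (use m1(2) m2(2) True in simp_all)
  next
    case False
    show ?thesis by (rule not_lopsided[OF m2(1) _ m1(1)]) (use m1(2) m2(2) False in simp_all)
  qed
  ultimately show ?thesis by blast
qed

text \<open>If all directions are used, each is used once. The cut in direction \<open>i\<close>,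
  with the colour of its edge reserved, succeeds unless all other edges lie on one side of
  \<open>i\<close>. These sides are the coordinates of a vertex \<open>u\<close> that every edge
  meets, so \<open>P\<close> is a star.\<close>

lemma exists_unused:
  assumes ne: "\<not> ext D C P" shows "\<exists>i. unused i"
proof (rule ccontr)
  assume no: "\<not> (\<exists>i. unused i)"
  have sub: "(fst \<circ> snd) ` P \<subseteq> D" using precolD(2)[OF P] by auto
  have "D \<subseteq> (fst \<circ> snd) ` P" using no unfolding unused_def by force
  then have "(fst \<circ> snd) ` P = D" using sub by blast
  then have inj: "inj_on (fst \<circ> snd) P" using cP finP by (intro eq_card_imp_inj_on) simp_all
  have dir: "v = v' \<and> e = e'" if "(v, j, e) \<in> P" "(v', j, e') \<in> P" for v v' j e e'
    using inj_onD[OF inj _ that] by simp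
  define u where "u = {i \<in> D. \<forall>v j e. (v, j, e) \<in> P \<longrightarrow> j \<noteq> i \<longrightarrow> i \<in> v}"
  have uv: "i \<in> v \<longleftrightarrow> i \<in> u" if q: "(v, j, e) \<in> P" "i \<in> D" "i \<noteq> j" for v j e i
  proof
    assume iv: "i \<in> v"
    obtain w c where w: "(w, i, c) \<in> P" using no q(2) unfolding unused_def by blast
    have "i \<in> v'" if "(v', j', e') \<in> P" "j' \<noteq> i" for v' j' e'
    proof (rule ccontr)
      assume "i \<notin> v'"
      with that have "ext D C P"
        by (intro single_rainbow[OF w _ q(1) q(3)[symmetric] iv]) (use dir[OF w] in auto)
      then show False using ne by simp
    qed
    then show "i \<in> u" using q(2) by (auto simp: u_def)
  next
    assume "i \<in> u"
    then show "i \<in> v" using q by (auto simp: u_def)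
  qed
  have "card C \<noteq> 0" using C d5 by simp
  then obtain c where c: "c \<in> C" by fastforce
  have "ext D C P"
  proof (rule ext_star_and_class[OF D d4 C P gd _ _ c])
    show "card P \<le> card D" using cP by simp
    show "u \<subseteq> D" by (auto simp: u_def)
    fix v j e assume p: "(v, j, e) \<in> P"
    have "i \<in> u - {j} \<longleftrightarrow> i \<in> v" for i
      using uv[OF p, of i] precolD(1,3)[OF P p] unfolding u_def by blast
    then show "u - {j} = v" by blast
  qed
  then show False using ne by blast
qed

text \<open>The projection of the lone edge has ends \<open>x\<close> and \<open>?y\<close>. An edge
  away from them could be switched, so all others touch \<open>x\<close> or \<open>?y\<close>. If
  the projection is uncoloured, the cut in direction \<open>l\<close> succeeds. If it is coloured, a
  cut in a further direction produces a blocked edge that cannot meet the two parallel edges and the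
  remaining ones at the same time.\<close>

lemma one_off_side:
  assumes i: "unused i" and p': "(W', l, c1) \<in> P" "i \<in> W'"
    and off: "\<And>v j e. (v, j, e) \<in> P \<Longrightarrow> i \<in> v \<Longrightarrow> e = c1"
  shows "ext D C P"
proof (rule ccontr)
  assume ne: "\<not> ext D C P"
  define x where "x = W' - {i}"
  let ?y = "nb x l"
  have iD: "i \<in> D" using i by (simp add: unused_def)
  have l: "l \<noteq> i" "l \<in> D" "l \<notin> W'" "l \<notin> x" "i \<notin> x" "x \<subseteq> D" "c1 \<in> C"
    using precolD[OF P] p'(1) i unfolding unused_def x_def by auto
  have W': "nb x i = W'" using p'(2) unfolding x_def nb_def by auto
  have yl: "?y - {l} = x" "x - {l} = x" using l by auto
  have hx: "has P (nb x i) l c1" "has P (nb ?y i) l c1"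
    using in_has[OF P p'(1)] W' nb_comm[of x l i] by simp_all
  have side: "i \<notin> v" if "(v, j, e) \<in> P" "e \<noteq> c1" for v j e using off[OF that(1)] that(2) by blast
  have dirne: "j \<noteq> i" if "(v, j, e) \<in> P" for v j e using i that by (auto simp: unused_def)
  have touch: "x - {j} = v \<or> ?y - {j} = v" if p: "(v, j, e) \<in> P" and ec: "e \<noteq> c1" for v j e
  proof (rule ccontr)
    assume nt: "\<not> (x - {j} = v \<or> ?y - {j} = v)"
    have e: "e \<in> C" and v: "v \<subseteq> D - {i}" "j \<in> D - {i}" "j \<notin> v"
      using precolD(1-4)[OF P p] side[OF p ec] dirne[OF p] by auto
    have "card (slice False i e P) + card {(v, j, e), (W', l, c1)} \<le> card P"
      by (rule slice_card_add[OF finP]) (use p p' in auto)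
    then have "card (slice False i e P) + 2 \<le> card D" using ec cP by simp
    then obtain g0 where g0: "coloring (D - {i}) (C - {e}) g0" "\<forall>(v, j, e) \<in> slice False i e P. g0 v j = e"
      using few[OF iD e slice_precol[OF P]] unfolding ext_def by blast
    \<comment> \<open>The half without the lone edge is coloured first, and \<open>\<gamma>\<close>
      is the colour that it happens to give to the edge to be switched. The other half then has only
      two edges to respect.\<close>
    define \<gamma> where "\<gamma> = g0 v j"
    have \<gamma>: "\<gamma> \<in> C - {e}" using coloringD(1)[OF g0(1) v(1)] v(2) unfolding \<gamma>_def by (auto simp: bij_betw_def)
    define T where "T = {(v, j, \<gamma>)}"
    have T: "precol (D - {i}) (C - {e}) T" unfolding T_def by (rule precol_insert) (use v \<gamma> in auto)
    have Q: "precol (D - {i}) (C - {e}) (insert (x, l, c1) T)"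
    proof (rule precol_insert[OF T])
      fix z k f assume z: "z - {l} = x" "has T z k f"
      then have "z - {j} = v" by (auto simp: T_def has_def)
      moreover have "z = x \<or> z = ?y" using z(1) yl(2) Diff_eq_iff_nb[of z l x] by metis
      ultimately show "k \<noteq> l \<and> f \<noteq> c1" using nt by blast
    qed (use l ec iD in auto)
    have "card (insert (x, l, c1) T) \<le> 2" unfolding T_def by (simp add: card_insert_if)
    then obtain g1 where g1: "coloring (D - {i}) (C - {e}) g1" "\<forall>(v, j, e) \<in> insert (x, l, c1) T. g1 v j = e"
      using few[OF iD e Q] d5 unfolding ext_def by auto
    have "ext D C P"
    proof (rule strat[where g = "\<lambda>b. if b then g1 else g0", OF iD e P T])
      show "j = j'" if "has T x j e" "has T x j' e'" for x j e j' e' using that by (auto simp: T_def has_def)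
      show "coloring (D - {i}) (C - {e}) (if b then g1 else g0)" for b using g0 g1 by simp
      show "(if b then g1 else g0) w k = f" if "(w, k, f) \<in> T" for b w k f
        using that g1(2) unfolding T_def \<gamma>_def by auto
      show "if f = e then \<forall>l e'. \<not> has T w l e' else \<exists>l. has T w l f" if "(w, i, f) \<in> P" for w f
        using that dirne by blast
      show "\<exists>e'. (w - {i}, k, e') \<in> T" if "(w, k, e) \<in> P" for w k
        using same[OF that p] side[OF p ec] unfolding T_def by auto
      fix w k f assume q: "(w, k, f) \<in> P" "f \<noteq> e"
      show "(\<forall>e'. (w - {i}, k, e') \<notin> T) \<and> (if i \<in> w then g1 else g0) (w - {i}) k = f"
      proof (cases "f = c1")
        case True
        then have w: "w = W'" "k = l" using same[OF q(1)] p'(1) by auto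
        have "(x, l) \<noteq> (v, j)" using nt l by auto
        then show ?thesis using w p'(2) g1(2) True unfolding T_def x_def by auto
      next
        case False
        then have iw: "i \<notin> w" using side[OF q(1)] by blast
        have "(w, k) \<noteq> (v, j)"
        proof
          assume "(w, k) = (v, j)"
          then have "has P v j f" "has P v j e" using in_has[OF P q(1)] in_has[OF P p] by auto
          then show False using precolD(5)[OF P] q(2) by blast
        qed
        moreover have "(w, k, f) \<in> slice False i e P" unfolding slice_iff using q iw dirne by simp
        ultimately show ?thesis using g0(2) iw unfolding T_def by auto
      qed
    qed
    then show False using ne by blast
  qed
  have touch': "\<exists>j. has P x j e \<or> has P ?y j e" if ec: "e \<in> C" "e \<noteq> c1" for e
  proof -
    obtain v j where "(v, j, e) \<in> P" using all_colors[OF ec(1)] by blast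
    then show ?thesis using touch ec(2) unfolding has_def by blast
  qed
  have sx: "(z - {k}, k, e) \<in> P" "k \<noteq> i" if "has P z k e" for z k e
    using has_in[OF that] has_unused[OF i that] by auto
  show False
  proof (cases "\<exists>f. (x, l, f) \<in> P")
    case False
    have u: "e = c1" if "(v, l, e) \<in> P" for v e
    proof (rule ccontr)
      assume ec: "e \<noteq> c1"
      show False using touch[OF that ec] yl False that by auto
    qed
    have ex: "\<exists>k e. has P z k e \<and> k \<noteq> l" if z: "z = x \<and> z' = ?y \<or> z = ?y \<and> z' = x" for z z'
    proof (rule ccontr)
      assume no: "\<not> (\<exists>k e. has P z k e \<and> k \<noteq> l)"
      show False
      proof (rule no_full_star[of c1 z' i l])
        fix e assume e: "e \<in> C" "e \<noteq> c1"
        then obtain j where j: "has P z j e \<or> has P z' j e" using touch' z by blast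
        then have "j \<noteq> l" using u e(2) sx(1) by blast
        then show "\<exists>j. has P z' j e \<and> j \<noteq> i \<and> j \<noteq> l" using j no sx(2) by blast
      qed (use iD l in auto)
    qed
    obtain k1 e1 where h1: "has P x k1 e1" "k1 \<noteq> l" using ex[of x ?y] by blast
    obtain k2 e2 where h2: "has P ?y k2 e2" "k2 \<noteq> l" using ex[of ?y x] by blast
    have "ext D C P"
      by (rule single_rainbow[OF p'(1) u sx(1)[OF h2(1)] h2(2) _ sx(1)[OF h1(1)] h1(2)]) (use h2(2) l in auto)
    then show False using ne by simp
  next
    case True
    then obtain f where f: "(x, l, f) \<in> P" by blast
    have fc: "f \<noteq> c1" using same[OF f] p' l by blast
    have fl: "e = f" if "(v, l, e) \<in> P" "e \<noteq> c1" for v e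
    proof -
      have "v = x" using touch[OF that] yl by auto
      then show ?thesis using in_has[OF P f] in_has[OF P that(1)] precolD(5)[OF P] by blast
    qed
    have ex: "\<exists>k e. has P z k e \<and> k \<noteq> l" if z: "z = x \<and> z' = ?y \<or> z = ?y \<and> z' = x" for z z'
    proof (rule ccontr)
      assume no: "\<not> (\<exists>k e. has P z k e \<and> k \<noteq> l)"
      \<comment> \<open>If \<open>z\<close> carried nothing but the projection, every colour would
        occur at \<open>z'\<close> or at its neighbour across the cut, against goodness.\<close>
      have "bade D C P z' i"
        unfolding bade_def
      proof (intro conjI allI ballI)
        show "z' \<subseteq> D" using z l(2,6) by (elim disjE conjE) simp_all
        show "i \<in> D" by (rule iD)
        show "\<not> has P z' i e" for e using sx(2) by blast
        fix e assume e: "e \<in> C"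
        show "\<exists>j. has P z' j e \<or> has P (nb z' i) j e"
        proof (cases "e = c1")
          case True
          then show ?thesis using hx z by blast
        next
          case False
          obtain j where j: "has P z j e \<or> has P z' j e" using touch'[OF e False] z by blast
          have "has P z' l e" if "has P z l e" using that z by auto
          then show ?thesis using j no by blast
        qed
      qed
      then show False using gd unfolding good_def by blast
    qed
    have ex2: "\<exists>k e. has P z k e \<and> k \<noteq> l \<and> e \<noteq> e0" if z: "z = x \<and> z' = ?y \<or> z = ?y \<and> z' = x"
      and e0: "has P z' k0 e0" "k0 \<noteq> l" for z z' k0 e0
    proof -
      obtain k e where k: "has P z k e" "k \<noteq> l" using ex[OF z] by blast
      have "e \<noteq> e0"
      proof
        assume "e = e0"
        then have "z - {k} = z' - {k0}" "k = k0" using same[OF has_in[OF k(1)]] has_in[OF e0(1)] by blast+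
        then have "z = z' \<or> z = nb z' k0" using Diff_eq_iff_nb[of z k0 z'] by simp
        then show False using z e0(2) by (auto simp: nb_swap)
      qed
      then show ?thesis using k by blast
    qed
    \<comment> \<open>With five colours some \<open>e0\<close> differs from the two parallel edges
      and from one further edge at each of \<open>x\<close> and \<open>?y\<close>; both ends keep a
      further edge when \<open>e0\<close> is set aside.\<close>
    obtain e0 k0 where e0: "has P x k0 e0 \<or> has P ?y k0 e0" "k0 \<noteq> l" "k0 \<noteq> i" "e0 \<noteq> c1" "e0 \<noteq> f"
      and rx: "\<exists>k e. has P x k e \<and> k \<noteq> l \<and> e \<noteq> e0" and ry: "\<exists>k e. has P ?y k e \<and> k \<noteq> l \<and> e \<noteq> e0"
    proof -
      obtain k1 e1 where h1: "has P x k1 e1" "k1 \<noteq> l" using ex[of x ?y] by blast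
      obtain k2 e2 where h2: "has P ?y k2 e2" "k2 \<noteq> l" using ex[of ?y x] by blast
      have nf: "e \<noteq> f \<and> e \<noteq> c1" if "has P z k e" "k \<noteq> l" for z k e
        using same[OF has_in[OF that(1)]] that(2) f p'(1) by blast
      have "card {c1, f, e1, e2} < card C" using C d5 by (simp add: card_insert_if)
      then obtain e where e: "e \<in> C" "e \<notin> {c1, f, e1, e2}"
        using card_mono[of "{c1, f, e1, e2}" C] by fastforce
      then obtain k where k: "has P x k e \<or> has P ?y k e" using touch' by blast
      have kl: "k \<noteq> l" using fl[of "_" e] e k sx(1) by blast
      have ki: "k \<noteq> i" using k sx(2) by blast
      show thesis
        by (rule that[of k e]) (use k kl ki e h1 h2 in blast)+
    qed
    have e0C: "e0 \<in> C" using e0(1) has_sub(3)[OF P] by blast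
    \<comment> \<open>There are \<open>card D - 2\<close> directions besides \<open>i\<close> and
      \<open>l\<close>, but only \<open>card D - 3\<close> edges besides those of colours
      \<open>c1\<close>, \<open>f\<close> and \<open>e0\<close>. So some direction contains no edge
      of another colour than \<open>e0\<close>.\<close>
    have dir0: "\<exists>m. m \<in> D \<and> m \<noteq> i \<and> m \<noteq> l \<and> (\<forall>v e. (v, m, e) \<in> P \<longrightarrow> e = e0)"
    proof (rule ccontr)
      assume no: "\<not> ?thesis"
      let ?P' = "P - {t \<in> P. snd (snd t) \<in> {c1, f, e0}}"
      have "D - {i, l} \<subseteq> (fst \<circ> snd) ` ?P'"
      proof
        fix m assume m: "m \<in> D - {i, l}"
        then obtain v e where q: "(v, m, e) \<in> P" "e \<noteq> e0" using no by blast
        then have "e \<noteq> c1" "e \<noteq> f" using same[OF q(1)] p'(1) f m by blast+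
        then show "m \<in> (fst \<circ> snd) ` ?P'" using q by force
      qed
      then have "card (D - {i, l}) \<le> card ?P'" using finP by (intro surj_card_le) auto
      moreover have "card (D - {i, l}) = card D - 2" using iD l D by (simp add: card_Diff_subset)
      moreover have "card {(W', l, c1), (x, l, f), SOME t. t \<in> P \<and> snd (snd t) = e0} = 3"
      proof -
        have "\<exists>t. t \<in> P \<and> snd (snd t) = e0" using e0(1) has_in by force
        from someI_ex[OF this] have "snd (snd (SOME t. t \<in> P \<and> snd (snd t) = e0)) = e0" by blast
        then show ?thesis using e0(4,5) fc by (metis (no_types, lifting) card_3_iff snd_conv)
      qed
      moreover have "{(W', l, c1), (x, l, f), SOME t. t \<in> P \<and> snd (snd t) = e0} \<subseteq> {t \<in> P. snd (snd t) \<in> {c1, f, e0}}"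
      proof -
        have "\<exists>t. t \<in> P \<and> snd (snd t) = e0" using e0(1) has_in by force
        from someI_ex[OF this] show ?thesis using p'(1) f by auto
      qed
      then have "card {(W', l, c1), (x, l, f), SOME t. t \<in> P \<and> snd (snd t) = e0} \<le> card {t \<in> P. snd (snd t) \<in> {c1, f, e0}}"
        using finP by (intro card_mono) auto
      moreover have "card ?P' = card P - card {t \<in> P. snd (snd t) \<in> {c1, f, e0}}"
        using finP by (intro card_Diff_subset) auto
      ultimately show False using cP d5 by linarith
    qed
    then obtain m where m: "m \<in> D" "m \<noteq> i" "m \<noteq> l" "\<And>v e. (v, m, e) \<in> P \<Longrightarrow> e = e0" by blast
    have side': "j \<noteq> m \<and> (m \<in> v) = (m \<in> x) \<or> j = m \<and> e = e0" if q: "(v, j, e) \<in> P" for v j e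
    proof (cases "j = m")
      case True
      then show ?thesis using m(4) q by blast
    next
      case False
      show ?thesis
      proof (cases "e = c1")
        case True
        then have "v = W'" using same[OF q] p'(1) by blast
        then show ?thesis using False m(2) unfolding x_def by auto
      next
        case ec: False
        have "v = x - {j} \<or> v = ?y - {j}" using touch[OF q ec] by blast
        then show ?thesis using False m(3) by auto
      qed
    qed
    obtain U p where U: "U \<subseteq> D" "p \<in> D" "p \<noteq> m"
      and cov: "\<And>e. e \<in> C \<Longrightarrow> e \<noteq> e0 \<Longrightarrow> \<exists>j. has P U j e \<or> has P (nb U p) j e"
      using one_sided[OF m(1) e0C side' ne] by metis
    have at: "z = y \<or> z = nb y j" if "(y, j, e) \<in> P" "has P z k e" for y j e z k
    proof -
      have "z - {j} = y" using same[OF has_in[OF that(2)] that(1)] by blast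
      then have "z - {j} = y - {j}" using precolD(3)[OF P that(1)] by auto
      then show ?thesis using Diff_eq_iff_nb by blast
    qed
    \<comment> \<open>A blocked edge meeting both parallel edges at different ends joins them in
      direction \<open>i\<close>. It then misses the further edge at \<open>nb A l\<close>.\<close>
    have main: False if A: "has P A k f" "has P B k' c1" "B = nb A p"
      and cov: "\<And>e. e \<in> C \<Longrightarrow> e \<noteq> e0 \<Longrightarrow> \<exists>j. has P A j e \<or> has P B j e" for A B k k'
    proof -
      have A1: "A = x \<or> A = ?y" using at[OF f A(1)] .
      have B1: "B = nb x i \<or> B = nb (nb x l) i" using at[OF p'(1) A(2)] unfolding W'[symmetric] nb_comm[of x i l] .
      have BA: "B = nb A i" using A1 B1 A(3) nb_comm[of x i l] by (metis nb_nb nb_nb_neq(1))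
      have "\<exists>k e. has P (nb A l) k e \<and> k \<noteq> l \<and> e \<noteq> e0"
        using A1
      proof
        assume "A = x" then show ?thesis using ry by blast
      next
        assume "A = ?y" then show ?thesis unfolding \<open>A = ?y\<close> nb_nb using rx by blast
      qed
      then obtain k2 e2 where h: "has P (nb A l) k2 e2" "k2 \<noteq> l" "e2 \<noteq> e0" by blast
      obtain j where "has P A j e2 \<or> has P B j e2" using cov[OF has_sub(3)[OF P h(1)] h(3)] by blast
      moreover have "\<not> has P z j e2" if "z = A \<or> z = nb A i" for z
      proof
        assume "has P z j e2"
        then have "z - {k2} = nb A l - {k2}" using same[OF has_in has_in[OF h(1)]] by blast
        then have "z = nb A l \<or> z = nb (nb A l) k2" unfolding Diff_eq_iff_nb .
        then show False using that h(2) l(1) by (elim disjE) simp_all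
      qed
      ultimately show False using BA by blast
    qed
    have fC: "f \<in> C" "f \<noteq> e0" "c1 \<noteq> e0" using precolD(4)[OF P f] e0 by auto
    obtain k where k: "has P U k f \<or> has P (nb U p) k f" using cov[OF fC(1,2)] by blast
    obtain k' where k': "has P U k' c1 \<or> has P (nb U p) k' c1" using cov[OF l(7) fC(3)] by blast
    have no2: "\<not> (has P A k f \<and> has P A k' c1)" for A
    proof
      assume a: "has P A k f \<and> has P A k' c1"
      have A1: "A = x \<or> A = ?y" using at[OF f] a by blast
      have B1: "A = nb x i \<or> A = nb (nb x l) i" using at[OF p'(1)] a unfolding W'[symmetric] nb_comm[of x i l] by blast
      show False using A1 B1 l(1) by (auto simp: nb_swap)
    qed
    have no3: "has P U k f \<and> has P (nb U p) k' c1 \<or> has P (nb U p) k f \<and> has P U k' c1"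
      using k k' no2 by blast
    have UV: "U = nb (nb U p) p" by simp
    have cov': "\<exists>j. has P (nb U p) j e \<or> has P U j e" if "e \<in> C" "e \<noteq> e0" for e using cov[OF that] by blast
    from no3 show False
    proof (elim disjE conjE)
      assume "has P U k f" "has P (nb U p) k' c1"
      from main[OF this refl cov] show False .
    next
      assume "has P (nb U p) k f" "has P U k' c1"
      from main[OF this UV cov'] show False .
    qed
  qed
qed

end

context step begin

definition side :: "nat \<Rightarrow> bool \<Rightarrow> precoloring" where
  "side i b = {t \<in> P. (i \<in> fst t) = b}"

lemma side_card: "card (side i b) + card (side i (\<not> b)) = card D"
proof -
  have "P = side i b \<union> side i (\<not> b)" "side i b \<inter> side i (\<not> b) = {}" by (auto simp: side_def)
  moreover have "finite (side i b)" "finite (side i (\<not> b))" using finP by (auto simp: side_def)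
  ultimately show ?thesis using cP by (metis card_Un_disjoint)
qed

end

context rainbow begin

text \<open>Reserve \<open>e\<close> and switch its edge with the colour \<open>\<gamma>\<close> of
  another edge. As colours are not repeated, this works as soon as the projections of the two edges
  do not touch. So all projections touch that of the first edge, and then the cut in its direction
  \<open>j\<close> succeeds.\<close>

lemma two_sides:
  assumes i: "unused i" and p: "(v, j, e) \<in> P" "(i \<in> v) = b" and np: "\<And>f. (nb v i, j, f) \<notin> P"
    and n: "card (side i (\<not> b)) \<le> card (side i b)" "2 \<le> card (side i (\<not> b))"
  shows "ext D C P"
proof (rule ccontr)
  assume ne: "\<not> ext D C P"
  define u where "u = v - {i}"
  have iD: "i \<in> D" using i by (simp add: unused_def)
  have dirne: "k \<noteq> i" if "(w, k, f) \<in> P" for w k f using i that by (auto simp: unused_def)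
  have eC: "e \<in> C" and u: "u \<subseteq> D - {i}" "j \<in> D - {i}" "j \<notin> u" "j \<noteq> i" "i \<notin> u"
    using precolD(1-4)[OF P p(1)] dirne[OF p(1)] by (auto simp: u_def)
  have uv: "v = u \<or> v = nb u i" by (auto simp: u_def nb_def)
  have np': "f = e" if q: "(w, j, f) \<in> P" "w - {i} = u" for w f
  proof -
    have "w = v \<or> w = nb v i" using q(2) Diff_eq_iff_nb unfolding u_def by blast
    then have "(v, j, f) \<in> P" using q(1) np by auto
    then show ?thesis using in_has[OF P p(1)] in_has[OF P] precolD(5)[OF P] by blast
  qed
  have touch: "\<exists>x. x - {j} = u \<and> x - {j2} = v2 - {i}" if q: "(v2, j2, \<gamma>) \<in> P" "\<gamma> \<noteq> e" for v2 j2 \<gamma>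
  proof (rule ccontr)
    assume nt: "\<not> ?thesis"
    define T where "T = {(u, j, \<gamma>)}"
    have \<gamma>: "\<gamma> \<in> C - {e}" using precolD(4)[OF P q(1)] q(2) by simp
    have T: "precol (D - {i}) (C - {e}) T" unfolding T_def by (rule precol_insert) (use u \<gamma> in auto)
    have Q: "precol (D - {i}) (C - {e}) (insert (u, j, \<gamma>) (slice b' i e P))" for b'
    proof (rule precol_insert[OF slice_precol[OF P]])
      fix x k f assume x: "x - {j} = u" "has (slice b' i e P) x k f"
      then have h: "k \<noteq> i" "f \<noteq> e" "i \<notin> x" "has P (if b' then insert i x else x) k f" unfolding has_slice by auto
      have in': "((if b' then insert i x else x) - {k}, k, f) \<in> P" using has_in[OF h(4)] .
      have m: "(if b' then insert i x else x) - {k} - {i} = x - {k}" using h(3) by auto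
      have "k \<noteq> j"
      proof
        assume "k = j"
        then show False using np'[of _ f] in' m x(1) h(2) by metis
      qed
      moreover have "f \<noteq> \<gamma>"
      proof
        assume "f = \<gamma>"
        then have "((if b' then insert i x else x) - {k}, k, \<gamma>) \<in> P" using in' by simp
        from same[OF this q(1)] have "x - {j2} = v2 - {i}" using m by blast
        then show False using nt x(1) by blast
      qed
      ultimately show "k \<noteq> j \<and> f \<noteq> \<gamma>" ..
    qed (use u \<gamma> in auto)
    \<comment> \<open>On side \<open>b\<close> the edge of colour \<open>e\<close> and the two or
      more edges of the other side are lost; on the other side the edges of side \<open>b\<close>
      are lost, at least three since \<open>card D \<ge> 5\<close>. The switch adds one
      edge.\<close>
    have small: "card (insert (u, j, \<gamma>) (slice b' i e P)) + 2 \<le> card D" for b'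
    proof -
      have fs: "finite (side i c')" for c' using finP by (simp add: side_def)
      have "card (slice b' i e P) + (if b' = b then 3 else 3) \<le> card D"
      proof (cases "b' = b")
        case True
        have nin: "(v, j, e) \<notin> side i (\<not> b)" using p by (simp add: side_def)
        have "card (slice b' i e P) + card (insert (v, j, e) (side i (\<not> b))) \<le> card P"
          by (rule slice_card_add[OF finP]) (use p True in \<open>auto simp: side_def\<close>)
        then show ?thesis using nin fs n(2) cP by simp
      next
        case False
        have "card (slice b' i e P) + card (side i b) \<le> card P"
          by (rule slice_card_add[OF finP]) (use False in \<open>auto simp: side_def\<close>)
        moreover have "3 \<le> card (side i b)" using side_card[of i b] n d5 by linarith
        ultimately show ?thesis using cP by simp
      qed
      moreover have "card (insert (u, j, \<gamma>) (slice b' i e P)) \<le> Suc (card (slice b' i e P))"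
        using card_insert_le'[OF slice_card(1)[OF finP]] .
      ultimately show ?thesis by (simp split: if_splits)
    qed
    have "\<exists>g. \<forall>b'. coloring (D - {i}) (C - {e}) (g b') \<and> (\<forall>(w, k, f) \<in> insert (u, j, \<gamma>) (slice b' i e P). g b' w k = f)"
      using few[OF iD eC Q small] unfolding ext_def by (intro choice) blast
    then obtain g where gg: "\<forall>b'. coloring (D - {i}) (C - {e}) (g b') \<and> (\<forall>(w, k, f) \<in> insert (u, j, \<gamma>) (slice b' i e P). g b' w k = f)"
      by (elim exE)
    have g: "g b' w k = f" if "(w, k, f) \<in> slice b' i e P \<or> (w, k, f) \<in> T" for b' w k f
      using gg that unfolding T_def by auto
    have "ext D C P"
    proof (rule strat[where g = g, OF iD eC P T])
      show "j = j'" if "has T x j e" "has T x j' e'" for x j e j' e' using that by (auto simp: T_def has_def)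
      show "coloring (D - {i}) (C - {e}) (g b)" for b using gg by simp
      show "g b w k = f" if "(w, k, f) \<in> T" for b w k f using g that by blast
      show "if f = e then \<forall>l e'. \<not> has T w l e' else \<exists>l. has T w l f" if "(w, i, f) \<in> P" for w f
        using that dirne by blast
      show "\<exists>e'. (w - {i}, k, e') \<in> T" if "(w, k, e) \<in> P" for w k
        using same[OF that p(1)] unfolding T_def u_def by auto
      fix w k f assume q': "(w, k, f) \<in> P" "f \<noteq> e"
      have "(w - {i}, k) \<noteq> (u, j)" using np'[of w f] q' by auto
      then have 1: "\<forall>e'. (w - {i}, k, e') \<notin> T" unfolding T_def by auto
      have "(w - {i}, k, f) \<in> slice (i \<in> w) i e P"
        unfolding slice_def using q' dirne[OF q'(1)] by blast
      then have "g (i \<in> w) (w - {i}) k = f" by (intro g disjI1)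
      with 1 show "(\<forall>e'. (w - {i}, k, e') \<notin> T) \<and> g (i \<in> w) (w - {i}) k = f" ..
    qed
    then show False using ne by blast
  qed
  have at: "\<exists>k. has P x k f \<or> has P (nb x i) k f" if q: "(w, k, f) \<in> P" "x - {k} = w - {i}" "i \<notin> x" for x w k f
  proof -
    have "x - {k} - {i} = w - {i}" using q(2) by auto
    then have "w = x - {k} \<or> w = nb (x - {k}) i" using Diff_eq_iff_nb[of w i "x - {k}"] by metis
    moreover have "nb (x - {k}) i = nb x i - {k}" using dirne[OF q(1)] by (auto simp: nb_def)
    ultimately show ?thesis using q(1) unfolding has_def by metis
  qed
  let ?y = "nb u j"
  have xs: "x = u \<or> x = ?y" if "x - {j} = u" for x
    using that u(3) Diff_eq_iff_nb[of x j u] by simp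
  have iy: "i \<notin> ?y" using u by simp
  have covered: "\<exists>k. has P z k e \<or> has P (nb z i) k e" if "z = u \<or> z = ?y" for z
  proof -
    have "has P u j e \<or> has P (nb u i) j e" using in_has[OF P p(1)] uv by blast
    then have "has P ?y j e \<or> has P (nb ?y i) j e" using nb_comm[of u j i] by simp
    then show ?thesis using \<open>has P u j e \<or> has P (nb u i) j e\<close> that by blast
  qed
  have only: "\<exists>w k f. (w, k, f) \<in> P \<and> f \<noteq> e \<and> z - {k} = w - {i}" if z: "z = u \<and> z' = ?y \<or> z = ?y \<and> z' = u" for z z'
  proof (rule ccontr)
    assume no: "\<not> ?thesis"
    \<comment> \<open>If no other edge projects to \<open>z\<close>, all colours lie over
      \<open>z'\<close> and block the edge of direction \<open>i\<close> there.\<close>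
    have "bade D C P z' i"
      unfolding bade_def
    proof (intro conjI allI ballI)
      show "z' \<subseteq> D"
        using z u(1,2) nb_subset[of j D u] by blast
      show "i \<in> D" by (rule iD)
      show "\<not> has P z' i f" for f using has_unused[OF i] by blast
      fix f assume f: "f \<in> C"
      show "\<exists>k. has P z' k f \<or> has P (nb z' i) k f"
      proof (cases "f = e")
        case True
        then show ?thesis using covered z by blast
      next
        case False
        obtain w k where w: "(w, k, f) \<in> P" using all_colors[OF f] by blast
        obtain x where x: "x - {j} = u" "x - {k} = w - {i}" using touch[OF w False] by blast
        have "x = z'" using xs[OF x(1)] no w False x(2) z by blast
        then show ?thesis using at[OF w x(2)] z iy u(5) by blast
      qed
    qed
    then show False using gd unfolding good_def by blast
  qed
  have nj: "k \<noteq> j" if q: "(w, k, f) \<in> P" "f \<noteq> e" for w k f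
  proof
    assume k: "k = j"
    obtain x where "x - {j} = u" "x - {k} = w - {i}" using touch[OF q] by blast
    then show False using np'[of w f] q k by simp
  qed
  obtain w0 k0 f0 where h0: "(w0, k0, f0) \<in> P" "f0 \<noteq> e" "u - {k0} = w0 - {i}" using only[of u ?y] by blast
  obtain w1 k1 f1 where h1: "(w1, k1, f1) \<in> P" "f1 \<noteq> e" "?y - {k1} = w1 - {i}" using only[of ?y u] by blast
  have "j \<notin> w0"
  proof -
    have "j \<notin> w0 - {i}" using h0(3) u(3) by (metis DiffD1)
    then show ?thesis using u(4) by simp
  qed
  moreover have "j \<in> w1"
  proof -
    have "j \<in> ?y - {k1}" using nj[OF h1(1,2)] u(3) by simp
    then show ?thesis using h1(3) by simp
  qed
  ultimately have "ext D C P"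
    by (intro single_rainbow[OF p(1) _ h1(1) nj[OF h1(1,2)] _ h0(1) nj[OF h0(1,2)]]) (use nj in blast)+
  then show False using ne by blast
qed

text \<open>A lone edge on the lower side is moved to the upper side by the reflection in
  \<open>i\<close>.\<close>

lemma not_single_side:
  assumes i: "unused i" and ne: "\<not> ext D C P" shows "card (side i b) \<noteq> 1"
proof
  assume "card (side i b) = 1"
  then obtain t where t: "side i b = {t}" by (metis card_1_singletonE)
  obtain W l c1 where tt: "t = (W, l, c1)" by (cases t)
  have "(W, l, c1) \<in> side i b" using t tt by simp
  then have p: "(W, l, c1) \<in> P" "(i \<in> W) = b" by (simp_all add: side_def)
  have off: "e = c1" if "(v, j, e) \<in> P" "(i \<in> v) = b" for v j e
  proof -
    have "(v, j, e) \<in> side i b" using that by (simp add: side_def)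
    then show ?thesis using t tt by simp
  qed
  show False
  proof (cases b)
    case True
    then show False using one_off_side[OF i p(1)] p(2) off ne by blast
  next
    case False
    have iD: "i \<in> D" using i by (simp add: unused_def)
    interpret R: rainbow D C "reflect {i} P" using reflect_rainbow iD by simp
    have dir: "j \<noteq> i" if "(v, j, e) \<in> reflect {i} P" for v j e
      using that i unfolding reflect_def unused_def by auto
    have "ext D C (reflect {i} P)"
    proof (rule R.one_off_side[of i "nb W i" l c1])
      show "R.unused i" using dir iD unfolding R.unused_def by blast
      have "l \<noteq> i" using i p(1) unfolding unused_def by blast
      then show "(nb W i, l, c1) \<in> reflect {i} P" using p(1) by (simp add: reflect1_iff)
      show "i \<in> nb W i" using p(2) False by simp
      show "e = c1" if q: "(v, j, e) \<in> reflect {i} P" "i \<in> v" for v j e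
        using off[of "nb v i" j e] q dir[OF q(1)] False by (simp add: reflect1_iff)
    qed
    then have "ext D C P" by (intro reflect_ext[OF P, of "{i}"]) (simp add: iD)
    then show False using ne by simp
  qed
qed

text \<open>By \<open>two_sides\<close> an edge without a mirror image lies on the strictly smaller
  side. The larger side would then be mirrored completely into the smaller one.\<close>

lemma invariant:
  assumes i: "unused i" "\<not> lopsided i" and ne: "\<not> ext D C P" and p: "(v, j, e) \<in> P"
  shows "\<exists>f. (nb v i, j, f) \<in> P"
proof (rule ccontr)
  assume no: "\<not> ?thesis"
  have n2: "2 \<le> card (side i b)" for b
  proof -
    have "side i b \<noteq> {}"
    proof
      assume 0: "side i b = {}"
      have "(i \<in> w) = (\<not> b)" if "(w, k, f) \<in> P" for w k f
      proof (rule ccontr)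
        assume "(i \<in> w) \<noteq> (\<not> b)"
        then have "(w, k, f) \<in> side i b" using that by (simp add: side_def)
        then show False using 0 by simp
      qed
      then have "lopsided i" unfolding lopsided_def by blast
      then show False using i(2) by simp
    qed
    moreover have "finite (side i b)" using finP by (simp add: side_def)
    ultimately have "card (side i b) \<noteq> 0" by simp
    then show ?thesis using not_single_side[OF i(1) ne, of b] by linarith
  qed
  have lt: "card (side i b) < card (side i (\<not> b))" if q: "(w, k, f) \<in> P" "(i \<in> w) = b" "\<And>f. (nb w i, k, f) \<notin> P" for w k f b
  proof (rule ccontr)
    assume "\<not> ?thesis"
    then have "card (side i (\<not> b)) \<le> card (side i b)" by simp
    then show False using two_sides[OF i(1) q _ n2] ne by blast
  qed
  define b where "b \<longleftrightarrow> i \<in> v"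
  have 1: "card (side i b) < card (side i (\<not> b))" using lt[OF p] no b_def by blast
  have "side i (\<not> b) \<subseteq> (\<lambda>(w, k, f). (nb w i, k, SOME f'. (nb w i, k, f') \<in> P)) ` side i b"
  proof
    fix s assume s: "s \<in> side i (\<not> b)"
    obtain w k f where sw: "s = (w, k, f)" by (cases s)
    have w: "(w, k, f) \<in> P" "(i \<in> w) = (\<not> b)" using s sw by (auto simp: side_def)
    have "\<exists>f'. (nb w i, k, f') \<in> P"
    proof (rule ccontr)
      assume "\<not> ?thesis"
      then have "card (side i (\<not> b)) < card (side i (\<not> \<not> b))" using lt[OF w] by blast
      then show False using 1 by simp
    qed
    then obtain f' where f': "(nb w i, k, f') \<in> P" by blast
    have "(w, k, SOME g. (w, k, g) \<in> P) \<in> P" using someI[of "\<lambda>g. (w, k, g) \<in> P", OF w(1)] .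
    then have "(SOME g. (w, k, g) \<in> P) = f" using in_has[OF P w(1)] in_has[OF P] precolD(5)[OF P] by blast
    moreover have "(nb w i, k, f') \<in> side i b" using f' w(2) by (simp add: side_def)
    ultimately show "s \<in> (\<lambda>(w, k, f). (nb w i, k, SOME f'. (nb w i, k, f') \<in> P)) ` side i b"
      unfolding sw by (intro image_eqI[of _ _ "(nb w i, k, f')"]) simp_all
  qed
  then have "card (side i (\<not> b)) \<le> card (side i b)"
    by (rule surj_card_le[rotated]) (use finP in \<open>simp add: side_def\<close>)
  then show False using 1 by simp
qed

text \<open>A lopsided direction yields a blocked edge met by all colours but \<open>c\<close>. It
  meets some edge together with the mirror image of that edge in \<open>i\<close>, so its direction
  is \<open>i\<close>. The edge of colour \<open>c\<close> is the mirror image of an edge that meets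
  it, so \<open>c\<close> meets it too, against goodness.\<close>

lemma none_lopsided:
  assumes i: "unused i" "\<not> lopsided i" and ne: "\<not> ext D C P" and i0: "unused i0"
  shows "\<not> lopsided i0"
proof
  assume lop: "lopsided i0"
  have inv: "\<exists>f. (nb v i, j, f) \<in> P" if "(v, j, e) \<in> P" for v j e using invariant[OF i ne that] .
  have iD: "i \<in> D" "i0 \<in> D" using i i0 by (auto simp: unused_def)
  obtain b where b: "\<And>v j e. (v, j, e) \<in> P \<Longrightarrow> (i0 \<in> v) = b" using lop unfolding lopsided_def by blast
  have "P \<noteq> {}" using cP d5 by auto
  then obtain v0 j0 c where t: "(v0, j0, c) \<in> P" by (metis ex_in_conv prod_cases3)
  have c: "c \<in> C" using precolD(4)[OF P t] .
  have s: "j \<noteq> i0 \<and> (i0 \<in> v) = b \<or> j = i0 \<and> e = c" if "(v, j, e) \<in> P" for v j e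
    using b[OF that] i0 that unfolding unused_def by blast
  obtain U p where U: "U \<subseteq> D" "p \<in> D"
    and cov: "\<And>e. e \<in> C \<Longrightarrow> e \<noteq> c \<Longrightarrow> \<exists>j. has P U j e \<or> has P (nb U p) j e"
    using one_sided[OF iD(2) c s ne] by metis
  obtain c' where t': "(nb v0 i, j0, c') \<in> P" using inv[OF t] by blast
  have c'C: "c' \<in> C" using precolD(4)[OF P t'] .
  have cc': "c' \<noteq> c"
  proof
    assume "c' = c"
    then have "v0 = nb v0 i" using same[OF t] t' by blast
    then show False by simp
  qed
  have "card {c, c'} < card C" using C d5 by (simp add: card_insert_if)
  \<comment> \<open>Neither the edge of this colour nor its mirror image has colour
    \<open>c\<close>, so both must meet the blocked edge.\<close>
  then obtain e where e: "e \<in> C" "e \<notin> {c, c'}" using card_mono[of "{c, c'}" C] by fastforce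
  obtain v j where f: "(v, j, e) \<in> P" using all_colors[OF e(1)] by blast
  obtain e' where f': "(nb v i, j, e') \<in> P" using inv[OF f] by blast
  have ji: "j \<noteq> i" using i(1) f unfolding unused_def by blast
  have ec: "e' \<noteq> c"
  proof
    assume "e' = c"
    then have "nb v i = v0" "j = j0" using same[OF f'] t by blast+
    then have "(v, j, c') \<in> P" using t' by auto
    then show False using in_has[OF P f] in_has[OF P] precolD(5)[OF P] e by blast
  qed
  have at: "z - {j} = v" if "(v, j, e) \<in> P" "has P z k e" for z k v j e
    using same[OF that(1)] has_in[OF that(2)] by blast
  have key: "B = nb A i" if "A - {j} = v" "B - {j} = nb v i" "B = nb A p \<or> B = A" for A B
  proof -
    have "B - {j} = nb A i - {j}" using that(1,2) ji by (auto simp: nb_def)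
    then have "B = nb A i \<or> B = nb (nb A i) j" unfolding Diff_eq_iff_nb .
    then show ?thesis using that(3) ji by (metis nb_nb_neq(1) nb_nb_eq(1))
  qed
  obtain k where k: "has P U k e \<or> has P (nb U p) k e" using cov[OF e(1)] e(2) by blast
  obtain k' where k': "has P U k' e' \<or> has P (nb U p) k' e'" using cov[OF precolD(4)[OF P f'] ec] by blast
  have UVi: "nb U p = nb U i"
  proof -
    consider "U - {j} = v" | "nb U p - {j} = v" using k at[OF f] by blast
    then show ?thesis
    proof cases
      case 1
      consider "U - {j} = nb v i" | "nb U p - {j} = nb v i" using k' at[OF f'] by blast
      then show ?thesis using key[OF 1, of U] key[OF 1, of "nb U p"] by cases auto
    next
      case 2
      consider "U - {j} = nb v i" | "nb U p - {j} = nb v i" using k' at[OF f'] by blast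
      then show ?thesis
      proof cases
        case 1
        have "U = nb (nb U p) i" by (rule key[OF 2 1]) simp
        then show ?thesis by simp
      next
        case 22: 2
        have "nb U p = nb (nb U p) i" by (rule key[OF 2 22]) simp
        then show ?thesis by simp
      qed
    qed
  qed
  have "bade D C P U i"
    unfolding bade_def
  proof (intro conjI allI ballI)
    show "U \<subseteq> D" "i \<in> D" using U iD by auto
    show "\<not> has P U i f" for f using has_unused[OF i(1)] by blast
    fix g assume g: "g \<in> C"
    show "\<exists>j. has P U j g \<or> has P (nb U i) j g"
    proof (cases "g = c")
      case True
      obtain k where k: "has P U k c' \<or> has P (nb U i) k c'" using cov[OF c'C cc'] UVi by auto
      have j0i: "j0 \<noteq> i" using i(1) t unfolding unused_def by blast
      have tr: "has P (nb z i) j0 c" if "has P z k c'" for z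
      proof -
        have "z - {j0} = nb v0 i" using at[OF t' that] .
        then have "nb z i - {j0} = v0" using j0i nb_Diff_neq[of i j0 z] by simp
        then show ?thesis using t by (simp add: has_def)
      qed
      show ?thesis using k tr[of U] tr[of "nb U i"] True by auto
    next
      case False
      then show ?thesis using cov[OF g] UVi by simp
    qed
  qed
  then show False using gd unfolding good_def by blast
qed

theorem rainbow_ext: "ext D C P"
proof (rule ccontr)
  assume ne: "\<not> ext D C P"
  obtain i where i: "unused i" "\<not> lopsided i"
    using exists_unused[OF ne] lopsided_unused[OF _ _ ne] by blast
  define F where "F = {i. unused i}"
  have FD: "F \<subseteq> D" by (auto simp: F_def unused_def)
  have finF: "finite F" using FD D finite_subset by blast
  have inv: "\<exists>f. (nb v l, j, f) \<in> P" if "l \<in> F" "(v, j, e) \<in> P" for v j e l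
    using invariant[OF _ none_lopsided[OF i ne] ne that(2), of l] that(1) by (simp add: F_def)
  have invS: "\<exists>f. (rx v S, j, f) \<in> P" if "(v, j, e) \<in> P" "S \<subseteq> F" for v j e S
    using finite_subset[OF that(2) finF] that(2)
  proof (induction S rule: finite_induct)
    case empty
    have "rx v {} = v" by (auto simp: rx_def)
    then show ?case using that(1) by auto
  next
    case (insert l S)
    then obtain f where f: "(rx v S, j, f) \<in> P" by auto
    have "rx v (insert l S) = nb (rx v S) l" using insert.hyps(2) by (auto simp: rx_def nb_def)
    then show ?case using inv[OF _ f, of l] insert.prems by simp
  qed
  \<comment> \<open>One coloured edge in each used direction, the base point of its orbit under the
    reflections.\<close>
  define w where "w j = (SOME v. \<exists>e. (v, j, e) \<in> P)" for j
  have w: "\<exists>e. (w j, j, e) \<in> P" if "j \<in> D - F" for j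
  proof -
    have "\<exists>v e. (v, j, e) \<in> P" using that unfolding F_def unused_def by blast
    then show ?thesis unfolding w_def by (rule someI_ex)
  qed
  have "Pow F \<times> (D - F) \<subseteq> (\<lambda>(v, j, e). (rx v (w j) \<inter> F, j)) ` P"
  proof
    fix s assume "s \<in> Pow F \<times> (D - F)"
    then obtain S j where s: "s = (S, j)" "S \<subseteq> F" "j \<in> D - F" by blast
    obtain e where e: "(rx (w j) S, j, e) \<in> P" using w[OF s(3)] invS[OF _ s(2)] by blast
    have "rx (rx (w j) S) (w j) \<inter> F = S" using s(2) by auto
    then show "s \<in> (\<lambda>(v, j, e). (rx v (w j) \<inter> F, j)) ` P"
      using e s(1) by (intro image_eqI[of _ _ "(rx (w j) S, j, e)"]) simp_all
  qed
  then have "card (Pow F \<times> (D - F)) \<le> card P" by (rule surj_card_le[OF finP])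
  then have "2 ^ card F * (card D - card F) \<le> card D"
    using cP finF FD D by (simp add: card_cartesian_product card_Pow card_Diff_subset)
  moreover have "card F < card D"
  proof (rule psubset_card_mono[OF D])
    have "P \<noteq> {}" using cP d5 by auto
    then obtain v j e where p: "(v, j, e) \<in> P" by (metis ex_in_conv prod_cases3)
    then have "j \<in> D" "j \<notin> F" using precolD(2)[OF P p] by (auto simp: F_def unused_def)
    then show "F \<subset> D" using FD by blast
  qed
  moreover have "card F \<noteq> 0" using i(1) finF by (auto simp: F_def)
  moreover obtain f q where fq: "f = card F" "card D = f + q" using \<open>card F < card D\<close> by (metis less_imp_add_positive)
  ultimately have h: "2 ^ f * q \<le> f + q" "q \<ge> 1" "f \<ge> 1" "f + q \<ge> 5" using d5 by simp_all
  show False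
  proof (cases "f = 1")
    case True
    then show False using h by simp
  next
    case False
    have "n + 2 \<le> 2 ^ n" if "n \<ge> 2" for n :: nat
      using that by (induction n rule: dec_induct) auto
    then have "f + 2 \<le> 2 ^ f" using False h(3) by simp
    then have "(f + 2) * q \<le> f + q" using h(1) by (meson le_trans mult_le_mono1)
    then have "f * q + q \<le> f" by (simp add: algebra_simps)
    moreover have "f \<le> f * q" using h(2) by simp
    ultimately show False using h(2) by linarith
  qed
qed

end

lemma in_slice: "(v, j, e) \<in> P \<Longrightarrow> j \<noteq> i \<Longrightarrow> e \<noteq> c \<Longrightarrow> (v - {i}, j, e) \<in> slice (i \<in> v) i c P"
  unfolding slice_def by blast

section \<open>A repeated colour: first consequences\<close>

locale nonrainbow = step +
  assumes nrb: "\<not> inj_on (snd \<circ> snd) P" and d5: "5 \<le> card D"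
    and IH: "\<And>D' C' Q. finite D' \<Longrightarrow> finite C' \<Longrightarrow> card C' = card D' \<Longrightarrow> Suc (card D') = card D \<Longrightarrow> precol D' C' Q
      \<Longrightarrow> card Q \<le> card D' \<Longrightarrow> good D' C' Q \<Longrightarrow> ext D' C' Q"
begin

lemma almost:
  assumes "i \<in> D" "c \<in> C" "precol (D - {i}) (C - {c}) Q" "card Q < card D" "good (D - {i}) (C - {c}) Q"
  shows "ext (D - {i}) (C - {c}) Q"
proof -
  have "card (C - {c}) = card (D - {i})" "Suc (card (D - {i})) = card D"
    using C(2) card_Suc_Diff1[OF C(1) assms(2)] card_Suc_Diff1[OF D assms(1)] by linarith+
  then show ?thesis using IH[of "D - {i}" "C - {c}" Q] assms C D by simp
qed

lemma cards: "i \<in> D \<Longrightarrow> card (D - {i}) = card D - 1" "c \<in> C \<Longrightarrow> card (C - {c}) = card D - 1"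
  using C D by simp_all

lemma repeated:
  obtains v1 j1 v2 j2 c where "(v1, j1, c) \<in> P" "(v2, j2, c) \<in> P" "(v1, j1) \<noteq> (v2, j2)"
proof -
  obtain s t where st: "s \<in> P" "t \<in> P" "snd (snd s) = snd (snd t)" "s \<noteq> t"
    using nrb unfolding inj_on_def comp_def by blast
  obtain v1 j1 c where s: "s = (v1, j1, c)" by (cases s)
  obtain v2 j2 c2 where t: "t = (v2, j2, c2)" by (cases t)
  show thesis by (rule that[of v1 j1 c v2 j2]) (use st s t in auto)
qed

text \<open>There are as many edges as colours and one colour is repeated, so another is absent. It
  will serve for the edges between the halves.\<close>

lemma spare_color: obtains c where "c \<in> C" "\<And>v j. (v, j, c) \<notin> P"
proof -
  have "card ((snd \<circ> snd) ` P) \<noteq> card P" using nrb finP eq_card_imp_inj_on by blast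
  then have "card ((snd \<circ> snd) ` P) < card C"
    using card_image_le[OF finP, of "snd \<circ> snd"] cP C(2) by linarith
  then show thesis using unused_color[OF finP C(1)] that by blast
qed

text \<open>If one side is empty, reserving a repeated colour removes two edges from the half that
  is copied. If both sides have at least two edges, each half loses two, and the spare colour joins
  them.\<close>

lemma unused_balanced:
  assumes i: "i \<in> D" "\<And>v e. (v, i, e) \<notin> P" and n1: "\<And>b. card (side i b) \<noteq> 1"
  shows "ext D C P"
proof (cases "\<exists>b. side i b = {}")
  case True
  then obtain b where b: "side i b = {}" by blast
  obtain v1 j1 v2 j2 c where r: "(v1, j1, c) \<in> P" "(v2, j2, c) \<in> P" "(v1, j1) \<noteq> (v2, j2)"
    by (rule repeated)
  have c: "c \<in> C" using precolD(4)[OF P r(1)] .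
  have s: "(i \<in> v) = (\<not> b)" if "(v, j, e) \<in> P" for v j e
  proof (rule ccontr)
    assume "(i \<in> v) \<noteq> (\<not> b)"
    then have "(v, j, e) \<in> side i b" using that by (simp add: side_def)
    then show False using b by simp
  qed
  have "card (slice (\<not> b) i c P) + card {(v1, j1, c), (v2, j2, c)} \<le> card P"
    by (rule slice_card_add[OF finP]) (use r in auto)
  moreover have "card {(v1, j1, c), (v2, j2, c)} = 2" using r(3) by simp
  ultimately have "ext (D - {i}) (C - {c}) (slice (\<not> b) i c P)"
    using few[OF i(1) c slice_precol[OF P]] cP by simp
  then show ?thesis using copy_one_sided[OF i(1) c P, of "\<not> b"] s i(2) by blast
next
  case False
  obtain c where c: "c \<in> C" "\<And>v j. (v, j, c) \<notin> P" using spare_color by blast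
  have "ext (D - {i}) (C - {c}) (slice b i c P)" for b
  proof -
    have "card (side i (\<not> b)) \<noteq> 0" using False finP by (auto simp: side_def)
    then have "2 \<le> card (side i (\<not> b))" using n1[of "\<not> b"] by linarith
    moreover have "card (slice b i c P) + card (side i (\<not> b)) \<le> card P"
      by (rule slice_card_add[OF finP]) (auto simp: side_def)
    ultimately show ?thesis using few[OF i(1) c(1) slice_precol[OF P]] cP by simp
  qed
  then show ?thesis using split_unused[OF i(1) c(1) P] i(2) c(2) by blast
qed

lemma star_class:
  assumes "w \<subseteq> D" "c \<in> C" "\<And>v j e. (v, j, e) \<in> P \<Longrightarrow> e \<noteq> c \<Longrightarrow> w - {j} = v"
  shows "ext D C P"
  using ext_star_and_class[OF D d4 C P gd _ assms] cP by simp

section \<open>A repeated colour: every direction used once\<close>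

context
  assumes dir: "\<And>v j e v' e'. (v, j, e) \<in> P \<Longrightarrow> (v', j, e') \<in> P \<Longrightarrow> v = v' \<and> e = e'"
begin

text \<open>Cut in the direction of one edge of colour \<open>c\<close> and switch the other edges
  of this colour. Their projections have to form a matching, which \<open>nc\<close> provides. If
  all other edges lie in one half, the copied coloring determines the colours of the matching;
  otherwise the matching gets the spare colour \<open>c'\<close>.\<close>

lemma conflict_free:
  assumes p: "(x, i, c) \<in> P" and q: "(y, k0, c) \<in> P" "k0 \<noteq> i"
    and nc: "\<And>z j1 j2. has P z j1 c \<Longrightarrow> has P (nb z i) j2 c \<Longrightarrow> j1 \<noteq> i \<Longrightarrow> j2 \<noteq> i \<Longrightarrow> False"
  shows "ext D C P"
proof -
  have i: "i \<in> D" and c: "c \<in> C" using precolD(2,4)[OF P p] by auto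
  define B where "B = {(v, j). (v, j, c) \<in> P \<and> j \<noteq> i}"
  have hB: "has P y j c \<or> has P (nb y i) j c" "j \<noteq> i" if "(v, j) \<in> B" "y - {j} = v - {i}" for y v j
  proof -
    show "j \<noteq> i" using that(1) by (simp add: B_def)
    have "y - {j} - {i} = v - {i}" using that(2) by auto
    then have "v = y - {j} \<or> v = nb (y - {j}) i" using Diff_eq_iff_nb[of v i "y - {j}"] by metis
    then have "v = y - {j} \<or> v = nb y i - {j}" using nb_Diff_neq[of i j y] \<open>j \<noteq> i\<close> by auto
    then show "has P y j c \<or> has P (nb y i) j c" using that(1) unfolding B_def has_def by auto
  qed
  have match: "j = j'" if "(v, j) \<in> B" "y - {j} = v - {i}" "(v', j') \<in> B" "y - {j'} = v' - {i}" for y v v' j j'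
  proof -
    have h: "has P y j c \<or> has P (nb y i) j c" "j \<noteq> i" "has P y j' c \<or> has P (nb y i) j' c" "j' \<noteq> i"
      using hB[OF that(1,2)] hB[OF that(3,4)] by auto
    have a: "\<not> (has P y j c \<and> has P (nb y i) j' c)" "\<not> (has P y j' c \<and> has P (nb y i) j c)"
      using nc[of y j j'] nc[of y j' j] h(2,4) by blast+
    have "has P y j c \<and> has P y j' c \<or> has P (nb y i) j c \<and> has P (nb y i) j' c" using h(1,3) a by blast
    then show ?thesis using precolD(5)[OF P, of y j c j' c] precolD(5)[OF P, of "nb y i" j c j' c] by blast
  qed
  \<comment> \<open>The colours \<open>h\<close> of the matching are left open: they come from a
    coloring in one case and are constantly \<open>c'\<close> in the other.\<close>
  define Tg where "Tg h = {(v - {i}, j, h (v - {i}) j) | v j. (v, j) \<in> B}" for h :: "nat set \<Rightarrow> nat \<Rightarrow> nat"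
  have hasT: "\<exists>v. (v, j) \<in> B \<and> y - {j} = v - {i} \<and> e = h (y - {j}) j" if "has (Tg h) y j e" for h y j e
    using that unfolding has_def Tg_def by auto
  have Tmatch: "j = j'" if th: "has (Tg h) y j e" "has (Tg h) y j' e'" for h y j e j' e'
  proof -
    obtain v where v: "(v, j) \<in> B" "y - {j} = v - {i}" using hasT[OF th(1)] by blast
    obtain v' where v': "(v', j') \<in> B" "y - {j'} = v' - {i}" using hasT[OF th(2)] by blast
    show ?thesis by (rule match[OF v v'])
  qed
  have TD: "v \<subseteq> D - {i} \<and> j \<in> D - {i} \<and> j \<notin> v" if "(v, j, e) \<in> Tg h" for v j e h
    using that precolD(1-3)[OF P] unfolding Tg_def B_def by blast
  have untouched: "\<not> has (Tg h) x l e" for h l e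
  proof
    assume "has (Tg h) x l e"
    then obtain v where v: "(v, l) \<in> B" "x - {l} = v - {i}" using hasT by blast
    have "has P x i c" using in_has[OF P p] .
    then show False using hB[OF v] precolD(5)[OF P, of x i c l c] precolD(5)[OF P, of "nb x i" i c l c] by auto
  qed
  have fin: "ext D C P"
    if T: "precol (D - {i}) (C - {c}) (Tg h)" and g: "\<And>b. coloring (D - {i}) (C - {c}) (g b)"
      and gT: "\<And>b v j e. (v, j, e) \<in> Tg h \<Longrightarrow> g b v j = e"
      and gS: "\<And>v j e. (v, j, e) \<in> P \<Longrightarrow> j \<noteq> i \<Longrightarrow> e \<noteq> c \<Longrightarrow> g (i \<in> v) (v - {i}) j = e" for h and g :: "bool \<Rightarrow> nat set \<Rightarrow> nat \<Rightarrow> nat"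
  proof (rule strat[where g = g, OF i c P T Tmatch g gT])
    show "if e = c then \<forall>l e'. \<not> has (Tg h) v l e' else \<exists>l. has (Tg h) v l e" if "(v, i, e) \<in> P" for v e
      using dir[OF that p] untouched by simp
    show "\<exists>e'. (v - {i}, j, e') \<in> Tg h" if "(v, j, c) \<in> P" "j \<noteq> i" for v j
      using that unfolding Tg_def B_def by blast
    fix v j e assume h: "(v, j, e) \<in> P" "j \<noteq> i" "e \<noteq> c"
    have "(v - {i}, j, e') \<notin> Tg h" for e'
      using dir[OF h(1)] h(3) unfolding Tg_def B_def by blast
    then show "(\<forall>e'. (v - {i}, j, e') \<notin> Tg h) \<and> g (i \<in> v) (v - {i}) j = e" using gS[OF h] by blast
  qed auto
  let ?Pc = "{t \<in> P. snd (snd t) = c}"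
  have "{(x, i, c), (y, k0, c)} \<subseteq> ?Pc" using p q by auto
  moreover have finPc: "finite ?Pc" using finP by simp
  ultimately have Pc2: "2 \<le> card ?Pc" using card_mono[of ?Pc "{(x, i, c), (y, k0, c)}"] q(2) by simp
  show ?thesis
  proof (cases "\<exists>b. \<forall>v j e. (v, j, e) \<in> P \<longrightarrow> e \<noteq> c \<longrightarrow> (i \<in> v) = b")
    case True
    then obtain b where b: "\<And>v j e. (v, j, e) \<in> P \<Longrightarrow> e \<noteq> c \<Longrightarrow> (i \<in> v) = b" by blast
    have "card (slice b i c P) + card ?Pc \<le> card P" by (rule slice_card_add[OF finP]) auto
    then have "ext (D - {i}) (C - {c}) (slice b i c P)"
      using few[OF i c slice_precol[OF P]] Pc2 cP by simp
    then obtain g where g: "coloring (D - {i}) (C - {c}) g" "\<forall>(v, j, e) \<in> slice b i c P. g v j = e"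
      unfolding ext_def by blast
    show ?thesis
    proof (rule fin[of g "\<lambda>_. g"])
      show "precol (D - {i}) (C - {c}) (Tg g)"
      proof (rule precolI)
        fix v j e assume t: "(v, j, e) \<in> Tg g"
        then have "e = g v j" unfolding Tg_def by blast
        moreover have "g v j \<in> C - {c}" using coloringD(1)[OF g(1), of v] TD[OF t] by (auto simp: bij_betw_def)
        ultimately show "v \<subseteq> D - {i} \<and> j \<in> D - {i} \<and> j \<notin> v \<and> e \<in> C - {c}" using TD[OF t] by simp
      next
        fix y j j' e e' assume h: "has (Tg g) y j e" "has (Tg g) y j' e'"
        have "j = j'" using Tmatch[OF h] .
        then show "j = j' \<longleftrightarrow> e = e'" using hasT[OF h(1)] hasT[OF h(2)] by auto
      qed
      show "coloring (D - {i}) (C - {c}) g" by (rule g(1))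
      show "g v j = e" if "(v, j, e) \<in> Tg g" for v j e using that unfolding Tg_def by blast
      fix v j e assume h: "(v, j, e) \<in> P" "j \<noteq> i" "e \<noteq> c"
      then have "(v - {i}, j, e) \<in> slice b i c P" using b[OF h(1,3)] unfolding slice_def by blast
      then show "g (v - {i}) j = e" using g(2) by auto
    qed
  next
    case False
    obtain c' where c': "c' \<in> C" "\<And>v j. (v, j, c') \<notin> P" using spare_color by blast
    have cc': "c' \<noteq> c" using c'(2) p by blast
    let ?T = "Tg (\<lambda>_ _. c')"
    have T: "precol (D - {i}) (C - {c}) ?T"
    proof (rule precolI)
      fix v j e assume t: "(v, j, e) \<in> ?T"
      then show "v \<subseteq> D - {i} \<and> j \<in> D - {i} \<and> j \<notin> v \<and> e \<in> C - {c}"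
        using TD[OF t] c'(1) cc' unfolding Tg_def by auto
    next
      fix y j j' e e' assume h: "has ?T y j e" "has ?T y j' e'"
      show "j = j' \<longleftrightarrow> e = e'" using Tmatch[OF h] hasT[OF h(1)] hasT[OF h(2)] by auto
    qed
    have Q: "precol (D - {i}) (C - {c}) (slice b i c P \<union> ?T)" for b
    proof (rule precolI)
      fix v j e assume "(v, j, e) \<in> slice b i c P \<union> ?T"
      then show "v \<subseteq> D - {i} \<and> j \<in> D - {i} \<and> j \<notin> v \<and> e \<in> C - {c}"
        using precolD(1-4)[OF T, of v j e] precolD(1-4)[OF slice_precol[OF P, where i = i and c = c and b = b], of v j e] by blast
    next
      have cross: "j \<noteq> j' \<and> e \<noteq> e'" if h: "has (slice b i c P) y j e" "has ?T y j' e'" for y j j' e e'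
      proof -
        have s: "e \<noteq> c" "has P (if b then insert i y else y) j e" using h(1) unfolding has_slice by auto
        obtain v where v: "(v, j') \<in> B" "e' = c'" using hasT[OF h(2)] by blast
        have "j \<noteq> j'" using dir[OF has_in[OF s(2)]] v(1) s(1) unfolding B_def by blast
        moreover have "e \<noteq> c'" using has_in[OF s(2)] c'(2) by blast
        ultimately show ?thesis using v(2) by simp
      qed
      fix y j j' e e'
      assume h: "has (slice b i c P \<union> ?T) y j e" "has (slice b i c P \<union> ?T) y j' e'"
      show "j = j' \<longleftrightarrow> e = e'"
        using h unfolding has_Un
        using cross[of y j e j' e'] cross[of y j' e' j e] precolD(5)[OF T, of y j e j' e']
          precolD(5)[OF slice_precol[OF P, where i = i and c = c and b = b], of y j e j' e'] by blast
    qed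
    \<comment> \<open>Each half loses all edges of colour \<open>c\<close> and an edge of the other
      half; the matching gives back one edge for each edge of colour \<open>c\<close> other than
      that of direction \<open>i\<close>.\<close>
    have "card (slice b i c P \<union> ?T) + 2 \<le> card D" for b
    proof -
      have "\<not> (\<forall>v j e. (v, j, e) \<in> P \<longrightarrow> e \<noteq> c \<longrightarrow> (i \<in> v) = b)"
        using False by (rule contrapos_nn) (rule exI)
      then obtain v1 j1 e1 where r: "(v1, j1, e1) \<in> P" "e1 \<noteq> c" "(i \<in> v1) \<noteq> b" by auto
      have "card (slice b i c P) + card (insert (v1, j1, e1) ?Pc) \<le> card P"
        by (rule slice_card_add[OF finP]) (use r in auto)
      then have 1: "card (slice b i c P) + card ?Pc + 1 \<le> card D" using r(2) finPc cP by simp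
      have "?T \<subseteq> (\<lambda>(v, j, e). (v - {i}, j, c')) ` (?Pc - {(x, i, c)})"
        unfolding Tg_def B_def by force
      then have "card ?T \<le> card (?Pc - {(x, i, c)})"
        by (rule surj_card_le[rotated]) (use finPc in simp)
      also have "\<dots> = card ?Pc - 1" using p finPc by simp
      finally have "card ?T + 1 \<le> card ?Pc" using Pc2 by linarith
      then show ?thesis using 1 card_Un_le[of "slice b i c P" ?T] by linarith
    qed
    then have "\<exists>g. coloring (D - {i}) (C - {c}) g \<and> (\<forall>(v, j, e) \<in> slice b i c P \<union> ?T. g v j = e)" for b
      using few[OF i c Q] unfolding ext_def by blast
    then have "\<exists>g. \<forall>b. coloring (D - {i}) (C - {c}) (g b) \<and> (\<forall>(v, j, e) \<in> slice b i c P \<union> ?T. g b v j = e)"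
      by (intro choice) blast
    then obtain g where g: "\<forall>b. coloring (D - {i}) (C - {c}) (g b) \<and> (\<forall>(v, j, e) \<in> slice b i c P \<union> ?T. g b v j = e)"
      by (elim exE)
    have gu: "g b v j = e" if "(v, j, e) \<in> slice b i c P \<union> ?T" for b v j e
      using bspec[OF conjunct2[OF spec[OF g, of b]] that] by simp
    show ?thesis
    proof (rule fin[of "\<lambda>_ _. c'" g, OF T])
      show "coloring (D - {i}) (C - {c}) (g b)" for b using g by simp
      show "g b v j = e" if "(v, j, e) \<in> ?T" for b v j e using gu that by simp
      fix v j e assume h: "(v, j, e) \<in> P" "j \<noteq> i" "e \<noteq> c"
      then have "(v - {i}, j, e) \<in> slice (i \<in> v) i c P" unfolding slice_def by blast
      then show "g (i \<in> v) (v - {i}) j = e" using gu by simp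
    qed
  qed
qed

text \<open>When projections collide, the spare colour \<open>c'\<close> is reserved instead, and
  the edge of direction \<open>i\<close> gets its colour \<open>c\<close> from a single switch along
  a free direction \<open>l\<close>. The collision helps the count, as it shows an edge of colour
  \<open>c\<close> on either side.\<close>

lemma unblocked:
  assumes p: "(x, i, c) \<in> P" and cf: "has P z j1 c" "has P (nb z i) j2 c" "j1 \<noteq> i" "j2 \<noteq> i"
    and l: "l \<in> D" "l \<noteq> i" "\<And>e. \<not> has P x l e" "\<And>e. \<not> has P (nb x i) l e"
      "\<And>k. \<not> has P (nb x l) k c" "\<And>k. \<not> has P (nb (nb x l) i) k c"
  shows "ext D C P"
proof (rule ccontr)
  assume ne: "\<not> ext D C P"
  have i: "i \<in> D" and c: "c \<in> C" and x: "x \<subseteq> D" "i \<notin> x" using precolD(1-4)[OF P p] by auto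
  obtain c' where c': "c' \<in> C" "\<And>v j. (v, j, c') \<notin> P" using spare_color by blast
  have cc': "c' \<noteq> c" using c'(2) p by blast
  define s where "s = (x - {l}, l, c)"
  define Q where "Q b = insert s (slice b i c' P)" for b
  have hx: "has P x i c" "has P (nb x i) i c" using in_has[OF P p] by auto
  have free: "k \<noteq> l \<and> f \<noteq> c" if h: "y - {l} = x - {l}" "has (slice b i c' P) y k f" for y k f b
  proof -
    have hs: "k \<noteq> i" "i \<notin> y" "has P (if b then insert i y else y) k f" using h(2) unfolding has_slice by auto
    have y: "y = x \<or> y = nb x l" using h(1) Diff_eq_iff_nb by blast
    have "insert i y = nb y i" using hs(2) by (simp add: nb_def)
    then have hy: "has P y k f \<or> has P (nb y i) k f" using hs(3) by (auto split: if_splits)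
    have "k \<noteq> l" using hy y l(3,4) nb_comm[of x l i] by (metis has_nb)
    moreover have "f \<noteq> c"
    proof
      assume "f = c"
      then have "has P x k c \<or> has P (nb x i) k c" using hy y l(5,6) by blast
      then show False using hx hs(1) precolD(5)[OF P] by blast
    qed
    ultimately show ?thesis ..
  qed
  have Qp: "precol (D - {i}) (C - {c'}) (Q b)" for b
    unfolding Q_def s_def
    by (rule precol_insert[OF slice_precol[OF P]]) (use x l(1,2) c cc' free in auto)
  have sn: "s \<notin> slice b i c' P" for b
  proof
    assume "s \<in> slice b i c' P"
    then have "has (slice b i c' P) x l c" by (simp add: s_def has_def)
    then show False using free[OF refl] by blast
  qed
  define b where "b \<longleftrightarrow> i \<in> z"
  have t1: "(z - {j1}, j1, c) \<in> side i b" using has_in[OF cf(1)] cf(3) by (simp add: side_def b_def)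
  have t2: "(nb z i - {j2}, j2, c) \<in> side i (\<not> b)" using has_in[OF cf(2)] cf(4) by (auto simp: side_def b_def)
  define R where "R b = {t \<in> side i b. fst (snd t) \<noteq> i}" for b
  have finR: "finite (R b)" for b using finP by (simp add: R_def side_def)
  have tR: "(z - {j1}, j1, c) \<in> R b" "(nb z i - {j2}, j2, c) \<in> R (\<not> b)" using t1 t2 cf(3,4) by (auto simp: R_def)
  \<comment> \<open>The switch adds one edge to each half, and both halves lose the edge of
    direction \<open>i\<close>.\<close>
  have sz: "card (Q b') + card (R (\<not> b')) \<le> card D" for b'
  proof -
    have "card (slice b' i c' P) + card (insert (x, i, c) (R (\<not> b'))) \<le> card P"
      by (rule slice_card_add[OF finP]) (use p in \<open>auto simp: R_def side_def\<close>)
    moreover have "(x, i, c) \<notin> R (\<not> b')" by (simp add: R_def)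
    ultimately have "card (slice b' i c' P) + card (R (\<not> b')) + 1 \<le> card D" using finR cP by simp
    then show ?thesis using card_insert_le'[OF slice_card(1)[OF finP], of s b' i c'] unfolding Q_def by linarith
  qed
  have cR: "\<exists>t. t \<in> R b' \<and> snd (snd t) = c" for b'
  proof (cases "b' = b")
    case True
    then show ?thesis using tR(1) by (intro exI[of _ "(z - {j1}, j1, c)"]) simp
  next
    case False
    then have "b' = (\<not> b)" by auto
    then show ?thesis using tR(2) by (intro exI[of _ "(nb z i - {j2}, j2, c)"]) simp
  qed
  have Qe: "ext (D - {i}) (C - {c'}) (Q b')" for b'
  proof (cases "2 \<le> card (R (\<not> b'))")
    case True
    then show ?thesis using few[OF i c'(1) Qp] sz[of b'] by simp
  next
    case False
    obtain t where t: "t \<in> R (\<not> b')" "snd (snd t) = c" using cR by blast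
    have "card (R (\<not> b')) \<noteq> 0" using t finR by auto
    then have R1: "card (R (\<not> b')) = 1" using False by linarith
    then have Rt: "R (\<not> b') = {t}" using t(1) by (metis card_1_singletonE singletonD)
    have le: "card (Q b') \<le> card (D - {i})" "card (Q b') \<le> card (C - {c'})"
      using sz[of b'] R1 cards i c'(1) by simp_all
    obtain t' where t': "t' \<in> R b'" "snd (snd t') = c" using cR by blast
    obtain v' k' where tv: "t' = (v', k', c)" using t'(2) by (metis prod.collapse)
    have q': "(v' - {i}, k', c) \<in> slice b' i c' P"
      using t' tv cc' unfolding R_def side_def slice_def by auto
    have inQ: "(v' - {i}, k', c) \<in> Q b'" "s \<in> Q b'" "(v' - {i}, k', c) \<noteq> s" using q' sn by (auto simp: Q_def)
    \<comment> \<open>\<open>Q b'\<close> contains two edges of colour \<open>c\<close>, whereas a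
      blocked edge requires distinct colours. At a blocked vertex the edges outside the missing
      colour form a star: either it would contain both edges of colour \<open>c\<close>, or
      \<open>c\<close> itself is missing and \<open>star_class\<close> applies.\<close>
    have "good (D - {i}) (C - {c'}) (Q b')"
    proof (rule ccontr)
      assume "\<not> ?thesis"
      then consider a m where "bade (D - {i}) (C - {c'}) (Q b') a m"
        | w e where "e \<in> C - {c'}" "badv (D - {i}) (Q b') w e" unfolding good_def by blast
      then show False
      proof cases
        case 1
        have "inj_on (snd \<circ> snd) (Q b')" using bade_all(2)[OF _ _ Qp 1 le(2)] D C by simp
        then show False using inj_onD[of "snd \<circ> snd" "Q b'", OF _ _ inQ(1,2)] inQ(3) by (simp add: s_def)
      next
        case (2 w e)
        have st: "w - {j} = v \<and> f \<noteq> e \<or> f = e" if "(v, j, f) \<in> Q b'" for v j f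
          using badv_all(2)[OF _ _ Qp 2(2) le(1) that] D C by blast
        show False
        proof (cases "e = c")
          case False
          have "w - {k'} = v' - {i}" "w - {l} = x - {l}"
            using st[OF inQ(1)] st[of "x - {l}" l c] inQ(2) False unfolding s_def by auto
          then have "has (Q b') w k' c" "has (Q b') w l c" using inQ unfolding has_def s_def by auto
          then have "k' = l" using precolD(5)[OF Qp] by blast
          then show False using inQ(3) \<open>w - {k'} = v' - {i}\<close> \<open>w - {l} = x - {l}\<close> unfolding s_def by simp
        next
          case True
          have w: "w \<subseteq> D - {i}" using 2(2) by (simp add: badv_def)
          have "ext D C P"
          proof (rule star_class[OF _ c])
            show "(if b' then insert i w else w) \<subseteq> D" using w i by auto
            fix v j f assume q: "(v, j, f) \<in> P" "f \<noteq> c"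
            have ji: "j \<noteq> i" using dir[OF q(1)] p q(2) by blast
            have iv: "(i \<in> v) = b'"
            proof (rule ccontr)
              assume "(i \<in> v) \<noteq> b'"
              then have "(v, j, f) \<in> R (\<not> b')" using q(1) ji by (auto simp: R_def side_def)
              then show False using Rt t(2) q(2) by auto
            qed
            have "f \<noteq> c'" using c'(2) q(1) by blast
            then have "(v - {i}, j, f) \<in> slice b' i c' P" using in_slice[OF q(1) ji] iv by simp
            then have "(v - {i}, j, f) \<in> Q b'" by (simp add: Q_def)
            then have "w - {j} = v - {i}" using st[of "v - {i}" j f] True q(2) by blast
            then show "(if b' then insert i w else w) - {j} = v" using iv ji w by auto
          qed
          then show False using ne by simp
        qed
      qed
    qed
    then show ?thesis using almost[OF i c'(1) Qp] sz[of b'] R1 by simp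
  qed
  have "\<exists>g. coloring (D - {i}) (C - {c'}) g \<and> (\<forall>(v, j, e) \<in> Q b'. g v j = e)" for b'
    using Qe[of b'] unfolding ext_def by blast
  then have "\<exists>g. \<forall>b. coloring (D - {i}) (C - {c'}) (g b) \<and> (\<forall>(v, j, e) \<in> Q b. g b v j = e)"
    by (intro choice) blast
  then obtain g where g: "\<forall>b. coloring (D - {i}) (C - {c'}) (g b) \<and> (\<forall>(v, j, e) \<in> Q b. g b v j = e)"
    by (elim exE)
  have gu: "g b v j = e" if "(v, j, e) \<in> Q b" for b v j e using g that by auto
  have sp: "precol (D - {i}) (C - {c'}) {s}" using precol_mono[OF Qp, of "{s}"] by (simp add: Q_def)
  have "ext D C P"
  proof (rule strat[where g = g, OF i c'(1) P sp])
    show "j = j'" if "has {s} y j e" "has {s} y j' e'" for y j e j' e' using that by (auto simp: s_def has_def)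
    show "coloring (D - {i}) (C - {c'}) (g b)" for b using g by simp
    show "g b v j = e" if "(v, j, e) \<in> {s}" for b v j e using gu that by (simp add: Q_def)
    show "if e = c' then \<forall>l e'. \<not> has {s} v l e' else \<exists>l. has {s} v l e" if q: "(v, i, e) \<in> P" for v e
    proof -
      have "v = x" "e = c" using dir[OF q p] by auto
      then show ?thesis using cc' unfolding has_def s_def by auto
    qed
    show "\<exists>e'. (v - {i}, j, e') \<in> {s}" if "(v, j, c') \<in> P" for v j using that c'(2) by blast
    fix v j e assume h: "(v, j, e) \<in> P" "j \<noteq> i" "e \<noteq> c'"
    then have q: "(v - {i}, j, e) \<in> slice (i \<in> v) i c' P" unfolding slice_def by blast
    have "(v - {i}, j, e') \<noteq> s" for e'
    proof
      assume eq: "(v - {i}, j, e') = s"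
      then have "has (slice (i \<in> v) i c' P) x l e" using q by (simp add: s_def has_def)
      then show False using free[OF refl] by blast
    qed
    moreover have "g (i \<in> v) (v - {i}) j = e" using gu q by (simp add: Q_def)
    ultimately show "(\<forall>e'. (v - {i}, j, e') \<notin> {s}) \<and> g (i \<in> v) (v - {i}) j = e" by blast
  qed
  then show False using ne by simp
qed

text \<open>If every switch at the edge \<open>(x, i)\<close> is blocked, each other edge blocks exactly one direction.\<close>

lemma blocked:
  assumes p: "(x, i, c) \<in> P"
    and bl: "\<And>l. l \<in> D \<Longrightarrow> l \<noteq> i \<Longrightarrow> (\<exists>e. has P x l e \<or> has P (nb x i) l e) \<or> (\<exists>k. has P (nb x l) k c \<or> has P (nb (nb x l) i) k c)"
    and q: "(v, j, f) \<in> P" "f \<noteq> c"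
  shows "x - {j} = v \<or> nb x i - {j} = v"
proof -
  have i: "i \<in> D" using precolD(2)[OF P p] .
  have hx: "has P x i c" "has P (nb x i) i c" using in_has[OF P p] by auto
  define R where "R l t \<longleftrightarrow> t \<in> P \<and> fst (snd t) \<noteq> i \<and> (snd (snd t) \<noteq> c \<and> fst (snd t) = l \<and> (x - {l} = fst t \<or> nb x i - {l} = fst t) \<or>
     snd (snd t) = c \<and> (nb x l - {fst (snd t)} = fst t \<or> nb (nb x l) i - {fst (snd t)} = fst t))" for l t
  have ex: "\<exists>t. R l t" if l: "l \<in> D - {i}" for l
  proof -
    have li: "l \<in> D" "l \<noteq> i" using l by auto
    from bl[OF li] show ?thesis
    proof
      assume "\<exists>e. has P x l e \<or> has P (nb x i) l e"
      then obtain e where e: "has P x l e \<or> has P (nb x i) l e" by blast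
      have "e \<noteq> c" using e hx li(2) precolD(5)[OF P] by blast
      then have "R l (x - {l}, l, e) \<or> R l (nb x i - {l}, l, e)" using e li(2) unfolding R_def has_def by auto
      then show ?thesis by blast
    next
      assume "\<exists>k. has P (nb x l) k c \<or> has P (nb (nb x l) i) k c"
      then obtain k where k: "has P (nb x l) k c \<or> has P (nb (nb x l) i) k c" by blast
      have "k \<noteq> i"
      proof
        assume "k = i"
        then have "has P (nb x l) i c" using k by auto
        then have "nb x l - {i} = x" using has_in dir[OF _ p] by blast
        then have "nb x l - {i} = x - {i}" using precolD(3)[OF P p] by auto
        then show False using li(2) unfolding Diff_eq_iff_nb by simp
      qed
      then have "R l (nb x l - {k}, k, c) \<or> R l (nb (nb x l) i - {k}, k, c)" using k unfolding R_def has_def by auto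
      then show ?thesis by blast
    qed
  qed
  have uni: "l = l'" if r: "R l t" "R l' t" and ll: "l \<in> D - {i}" "l' \<in> D - {i}" for l l' t
  proof (cases "snd (snd t) = c")
    case False
    then show ?thesis using r unfolding R_def by auto
  next
    case True
    let ?k = "fst (snd t)"
    have ki: "?k \<noteq> i" using r unfolding R_def by blast
    have "\<exists>y\<in>{nb x l, nb (nb x l) i}. \<exists>y'\<in>{nb x l', nb (nb x l') i}. y - {?k} = y' - {?k}"
      using r True unfolding R_def by auto
    then obtain y y' where y: "y \<in> {nb x l, nb (nb x l) i}" "y' \<in> {nb x l', nb (nb x l') i}" "y = y' \<or> y = nb y' ?k"
      unfolding Diff_eq_iff_nb by blast
    have iy: "i \<in> y \<longleftrightarrow> i \<in> y'" using y(3) ki by auto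
    have li: "l \<noteq> i" "l' \<noteq> i" using ll by auto
    have "y = nb x l \<and> y' = nb x l' \<or> y = nb (nb x i) l \<and> y' = nb (nb x i) l'"
      using y(1,2) iy li nb_comm[of x l i] nb_comm[of x l' i] by auto
    then obtain X where X: "y = nb X l" "y' = nb X l'" by blast
    from y(3) show ?thesis
    proof
      assume "y = y'"
      then show ?thesis using X by simp
    next
      assume "y = nb y' ?k"
      then show ?thesis using X nb_nb_neq(2)[of X l l' ?k] by simp
    qed
  qed
  define h where "h l = (SOME t. R l t)" for l
  have h: "R l (h l)" if "l \<in> D - {i}" for l using someI_ex[OF ex[OF that]] unfolding h_def .
  have inj: "inj_on h (D - {i})" by (rule inj_onI) (use uni h in metis)
  have sub: "h ` (D - {i}) \<subseteq> P - {(x, i, c)}"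
  proof
    fix t assume "t \<in> h ` (D - {i})"
    then obtain l where "R l t" using h by blast
    then have "t \<in> P" "fst (snd t) \<noteq> i" unfolding R_def by blast+
    then show "t \<in> P - {(x, i, c)}" by auto
  qed
  \<comment> \<open>There are as many directions besides \<open>i\<close> as edges besides
    \<open>(x, i, c)\<close>, so every such edge is needed as a reason, and a reason of another
    colour than \<open>c\<close> touches the given edge.\<close>
  have "card (h ` (D - {i})) = card (P - {(x, i, c)})"
    using card_image[OF inj] i p cP finP D by simp
  then have "h ` (D - {i}) = P - {(x, i, c)}" using card_subset_eq[OF _ sub] finP by simp
  moreover have "(v, j, f) \<in> P - {(x, i, c)}" using q by auto
  ultimately obtain l where "l \<in> D - {i}" "(v, j, f) = h l" by blast
  then have "R l (v, j, f)" using h by metis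
  then show ?thesis using q(2) unfolding R_def by auto
qed

text \<open>By \<open>blocked\<close>, each edge of another colour than \<open>c\<close> touches
  both of two edges of colour \<open>c\<close>. By \<open>star_class\<close> neither end of the
  first one carries all of them, so the second one contains neighbours of both ends, reached in
  directions other than \<open>i\<close>. Its ends would differ in coordinate \<open>i\<close>, but
  its direction is \<open>k0\<close>.\<close>

lemma all_used:
  assumes p: "(x, i, c) \<in> P" and q: "(y, k0, c) \<in> P" "k0 \<noteq> i"
  shows "ext D C P"
proof (rule ccontr)
  assume ne: "\<not> ext D C P"
  have c: "c \<in> C" using precolD(4)[OF P p] .
  have near: "x - {j} = v \<or> nb x i - {j} = v"
    if p: "(x, i, c) \<in> P" and q: "(y, k0, c) \<in> P" "k0 \<noteq> i" and r: "(v, j, f) \<in> P" "f \<noteq> c" for x i y k0 v j f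
  proof -
    have "\<exists>z j1 j2. has P z j1 c \<and> has P (nb z i) j2 c \<and> j1 \<noteq> i \<and> j2 \<noteq> i"
      using conflict_free[OF p q] ne by blast
    then obtain z j1 j2 where cf: "has P z j1 c" "has P (nb z i) j2 c" "j1 \<noteq> i" "j2 \<noteq> i" by blast
    have "(\<exists>e. has P x l e \<or> has P (nb x i) l e) \<or> (\<exists>k. has P (nb x l) k c \<or> has P (nb (nb x l) i) k c)"
      if "l \<in> D" "l \<noteq> i" for l
      using unblocked[OF p cf that] ne by blast
    then show ?thesis by (rule blocked[OF p _ r])
  qed
  have i: "i \<in> D" "x \<subseteq> D" using precolD(1,2)[OF P p] by auto
  have "\<exists>v j f. (v, j, f) \<in> P \<and> f \<noteq> c \<and> z - {j} \<noteq> v" if "z \<subseteq> D" for z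
    using star_class[OF that c] ne by blast
  then obtain v0 j0 f0 v1 a1 f1 where 0: "(v0, j0, f0) \<in> P" "f0 \<noteq> c" "nb x i - {j0} \<noteq> v0"
    and 1: "(v1, a1, f1) \<in> P" "f1 \<noteq> c" "x - {a1} \<noteq> v1" using i by (metis nb_subset)
  have n0: "x - {j0} = v0" using near[OF p q 0(1,2)] 0(3) by blast
  have n1: "nb x i - {a1} = v1" using near[OF p q 1(1,2)] 1(3) by blast
  have ji: "j0 \<noteq> i" "a1 \<noteq> i" using dir[OF 0(1)] dir[OF 1(1)] p 0(2) 1(2) by blast+
  have m0: "y - {j0} = v0 \<or> nb y k0 - {j0} = v0" using near[OF q(1) p q(2)[symmetric] 0(1,2)] .
  have m1: "y - {a1} = v1 \<or> nb y k0 - {a1} = v1" using near[OF q(1) p q(2)[symmetric] 1(1,2)] .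
  have hy: "has P y k0 c" "has P (nb y k0) k0 c" using in_has[OF P q(1)] by auto
  have hx: "has P x i c" "has P (nb x i) i c" using in_has[OF P p] by auto
  have nx: "z \<noteq> x" "z \<noteq> nb x i" if "z = y \<or> z = nb y k0" for z
  proof -
    have hz: "has P z k0 c" using that hy by blast
    show "z \<noteq> x" using hz hx(1) precolD(5)[OF P, of x k0 c i c] q(2) by blast
    show "z \<noteq> nb x i" using hz hx(2) precolD(5)[OF P, of "nb x i" k0 c i c] q(2) by blast
  qed
  obtain z0 where z0: "z0 = y \<or> z0 = nb y k0" "z0 - {j0} = x - {j0}" using m0 n0 by blast
  obtain z1 where z1: "z1 = y \<or> z1 = nb y k0" "z1 - {a1} = nb x i - {a1}" using m1 n1 by blast
  have e0: "z0 = nb x j0" using z0(2) nx(1)[OF z0(1)] unfolding Diff_eq_iff_nb by blast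
  have e1: "z1 = nb (nb x i) a1" using z1(2) nx(2)[OF z1(1)] unfolding Diff_eq_iff_nb by blast
  have "i \<in> z0 \<longleftrightarrow> i \<notin> z1" unfolding e0 e1 using ji by simp
  moreover have "i \<in> z0 \<longleftrightarrow> i \<in> z1" using z0(1) z1(1) q(2) by auto
  ultimately show False by blast
qed

end

lemma no_unused:
  assumes "\<And>i. i \<in> D \<Longrightarrow> \<exists>v e. (v, i, e) \<in> P" shows "ext D C P"
proof -
  have sub: "(fst \<circ> snd) ` P \<subseteq> D" using precolD(2)[OF P] by auto
  have "D \<subseteq> (fst \<circ> snd) ` P" using assms by force
  then have "(fst \<circ> snd) ` P = D" using sub by blast
  then have inj: "inj_on (fst \<circ> snd) P" using cP finP by (intro eq_card_imp_inj_on) simp_all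
  have dir: "v = v' \<and> e = e'" if "(v, j, e) \<in> P" "(v', j, e') \<in> P" for v v' j e e'
    using inj_onD[OF inj _ that] by simp
  obtain v1 j1 v2 j2 c where r: "(v1, j1, c) \<in> P" "(v2, j2, c) \<in> P" "(v1, j1) \<noteq> (v2, j2)"
    by (rule repeated)
  have "j2 \<noteq> j1"
  proof
    assume "j2 = j1"
    then have "v1 = v2" using dir[OF r(1), of v2 c] r(2) by simp
    then show False using r(3) \<open>j2 = j1\<close> by simp
  qed
  show ?thesis by (rule all_used[OF _ r(1,2) \<open>j2 \<noteq> j1\<close>]) (erule dir, assumption)
qed

end

text \<open>Different colours at a vertex have different directions; if there are as many colours as
  directions in \<open>J\<close>, all of \<open>J\<close> is used.\<close>

lemma star_colors:
  assumes S: "precol D C S" and A: "\<And>e. e \<in> A \<Longrightarrow> \<exists>j\<in>J. has S x j e" and J: "finite J"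
  shows "card A \<le> card J" "card A = card J \<Longrightarrow> j \<in> J \<Longrightarrow> \<exists>e. has S x j e"
proof -
  have "\<exists>h. \<forall>e\<in>A. h e \<in> J \<and> has S x (h e) e" using A by (intro bchoice) blast
  then obtain h where h: "\<forall>e\<in>A. h e \<in> J \<and> has S x (h e) e" by (elim exE)
  have inj: "inj_on h A"
  proof (rule inj_onI)
    fix e f assume "e \<in> A" "f \<in> A" "h e = h f"
    then show "e = f" using h precolD(5)[OF S, of x "h e" e "h f" f] by simp
  qed
  have sub: "h ` A \<subseteq> J" using h by blast
  show "card A \<le> card J" using card_inj_on_le[OF inj sub J] .
  assume "card A = card J" "j \<in> J"
  then have "h ` A = J" using card_subset_eq[OF J sub] card_image[OF inj] by simp
  then show "\<exists>e. has S x j e" using h \<open>j \<in> J\<close> by blast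
qed

lemma pick_new:
  assumes "length xs < card A" shows "\<exists>x\<in>A. x \<notin> set xs"
proof (rule ccontr)
  assume "\<not> ?thesis"
  then have "A \<subseteq> set xs" by blast
  then have "card A \<le> card (set xs)" by (intro card_mono) simp_all
  then show False using assms card_length[of xs] by linarith
qed

context nonrainbow begin

context
  fixes i W j1 c1
  assumes iD: "i \<in> D" and iu: "\<And>v e. (v, i, e) \<notin> P" and p': "(W, j1, c1) \<in> P" and iW: "i \<in> W"
    and off: "\<And>v j e. (v, j, e) \<in> P \<Longrightarrow> i \<in> v \<Longrightarrow> v = W \<and> j = j1 \<and> e = c1"
begin

definition R where "R = P - {(W, j1, c1)}"

lemma R_iff: "(v, j, e) \<in> R \<longleftrightarrow> (v, j, e) \<in> P \<and> i \<notin> v"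
  using off iW unfolding R_def by auto

lemma dirne: "(v, j, e) \<in> P \<Longrightarrow> j \<noteq> i" using iu by blast

lemma has_R: "has R x k e \<longleftrightarrow> has P x k e \<and> i \<notin> x"
proof (cases "k = i")
  case True
  then show ?thesis using iu unfolding has_def R_iff by blast
next
  case False
  then show ?thesis unfolding has_def R_iff by auto
qed

lemma sF: "(v, j, e) \<in> slice False i c P \<longleftrightarrow> (v, j, e) \<in> R \<and> e \<noteq> c"
  unfolding slice_iff R_iff using dirne by auto

lemma sT: "slice True i c P \<subseteq> {(W - {i}, j1, c1)}"
  unfolding slice_def using off by auto

lemma R_precol: "precol (D - {i}) C R"
proof (rule precolI)
  fix v j e assume "(v, j, e) \<in> R"
  then have h: "(v, j, e) \<in> P" "i \<notin> v" by (auto simp: R_iff)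
  then show "v \<subseteq> D - {i} \<and> j \<in> D - {i} \<and> j \<notin> v \<and> e \<in> C" using precolD(1-4)[OF P h(1)] dirne[OF h(1)] by auto
next
  fix x j k e f assume "has R x j e" "has R x k f"
  then show "j = k \<longleftrightarrow> e = f" unfolding has_R using precolD(5)[OF P] by blast
qed

lemma finR: "finite R" using finP by (simp add: R_def)
lemma cR: "card R = card D - 1" using p' finP cP by (simp add: R_def)

lemma w_facts: "W - {i} \<subseteq> D - {i}" "j1 \<in> D - {i}" "j1 \<notin> W - {i}" "c1 \<in> C" "j1 \<noteq> i" "W = insert i (W - {i})"
  using precolD(1-4)[OF P p'] dirne[OF p'] iW by auto

text \<open>The form that \<open>strat\<close> takes here: the upper half has to respect only the
  matching and the lone edge.\<close>

lemma combine:
  assumes c: "c \<in> C" "c1 \<noteq> c" and T: "precol (D - {i}) (C - {c}) T"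
    and match: "\<And>x j e j' e'. has T x j e \<Longrightarrow> has T x j' e' \<Longrightarrow> j = j'"
    and N: "\<And>v j. (v, j, c) \<in> R \<Longrightarrow> \<exists>e'. (v, j, e') \<in> T"
    and free: "\<And>v j e e'. (v, j, e) \<in> R \<Longrightarrow> e \<noteq> c \<Longrightarrow> (v, j, e') \<notin> T" "\<And>e'. (W - {i}, j1, e') \<notin> T"
    and ext0: "ext (D - {i}) (C - {c}) (slice False i c P \<union> T)"
    and ext1: "ext (D - {i}) (C - {c}) (insert (W - {i}, j1, c1) T)"
  shows "ext D C P"
proof -
  obtain g0 where g0: "coloring (D - {i}) (C - {c}) g0" "\<forall>(v, j, e) \<in> slice False i c P \<union> T. g0 v j = e"
    using ext0 unfolding ext_def by blast
  obtain g1 where g1: "coloring (D - {i}) (C - {c}) g1" "\<forall>(v, j, e) \<in> insert (W - {i}, j1, c1) T. g1 v j = e"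
    using ext1 unfolding ext_def by blast
  show ?thesis
  proof (rule strat[where g = "\<lambda>b. if b then g1 else g0", OF iD c(1) P T match])
    show "coloring (D - {i}) (C - {c}) (if b then g1 else g0)" for b using g0 g1 by simp
    show "(if b then g1 else g0) v j = e" if "(v, j, e) \<in> T" for b v j e
      using bspec[OF g0(2), of "(v, j, e)"] bspec[OF g1(2), of "(v, j, e)"] that by simp
    show "if e = c then \<forall>l e'. \<not> has T v l e' else \<exists>l. has T v l e" if "(v, i, e) \<in> P" for v e
      using that iu by blast
    show "\<exists>e'. (v - {i}, j, e') \<in> T" if q: "(v, j, c) \<in> P" for v j
    proof -
      have "i \<notin> v" using off[OF q] c(2) by blast
      then show ?thesis using N[of v j] q by (simp add: R_iff)
    qed
    fix v j e assume q: "(v, j, e) \<in> P" "j \<noteq> i" "e \<noteq> c"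
    show "(\<forall>e'. (v - {i}, j, e') \<notin> T) \<and> (if i \<in> v then g1 else g0) (v - {i}) j = e"
    proof (cases "i \<in> v")
      case True
      then have "v = W" "j = j1" "e = c1" using off[OF q(1)] by auto
      then show ?thesis using True free(2) bspec[OF g1(2), of "(W - {i}, j1, c1)"] by simp
    next
      case False
      then have r: "(v, j, e) \<in> R" using q by (simp add: R_iff)
      then have "(v, j, e) \<in> slice False i c P" using q(3) by (simp add: sF)
      then show ?thesis using False free(1)[OF r q(3)] bspec[OF g0(2), of "(v, j, e)"] by simp
    qed
  qed auto
qed

text \<open>An edge of colour \<open>cs\<close> at one end of the blocked edge gets the colour
  \<open>ct\<close> of an edge at the other end, and \<open>cs\<close> is reserved. The repetition
  of \<open>ct\<close> removes the obstruction from the lower half. The last two premises keep the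
  recoloured edge different from the projection of the lone edge and, if \<open>ct = c1\<close>, not
  adjacent to it.\<close>

lemma swap:
  assumes c': "c' \<in> C" "\<And>v j. (v, j, c') \<notin> P" and bad: "bade (D - {i}) (C - {c'}) R u p"
    and hs: "has R u k cs" and ht: "has R (nb u p) k' ct" and cs: "cs \<noteq> c1" and nQ: "\<not> (k = j1 \<and> u - {k} = W - {i})"
    and nt: "ct = c1 \<Longrightarrow> (\<And>y. y - {j1} = W - {i} \<Longrightarrow> y - {k} \<noteq> u - {k})"
  shows "ext D C P"
proof -
  have Rp: "precol (D - {i}) (C - {c'}) R"
    by (rule precol_colors[OF R_precol]) (use precolD(4)[OF R_precol] c'(2) in \<open>auto simp: R_iff\<close>)
  have Rle: "card R \<le> card (C - {c'})" using cR cards(2)[OF c'(1)] by simp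
  have fins: "finite (D - {i})" "finite (C - {c})" for c using D C by auto
  note ba = bade_all[OF fins Rp bad Rle]
  have inj: "v = v' \<and> j = j'" if "(v, j, e) \<in> R" "(v', j', e) \<in> R" for v j v' j' e
    using inj_onD[OF ba(2) _ that] by simp
  have unc: "\<not> has R u p e" "\<not> has R (nb u p) p e" for e using bad by (auto simp: bade_def)
  have kp: "k \<noteq> p" "k' \<noteq> p" using hs ht unc by blast+
  have s: "(u - {k}, k, cs) \<in> R" "(nb u p - {k'}, k', ct) \<in> R" using hs ht by (auto simp: has_def)
  have csct: "cs \<noteq> ct"
  proof
    assume "cs = ct"
    then have "u - {k} = nb u p - {k}" using inj[OF s(1)] s(2) by metis
    then show False unfolding Diff_eq_iff_nb using kp by auto
  qed
  have csC: "cs \<in> C" "ct \<in> C" "cs \<noteq> c'" using precolD(4)[OF Rp s(1)] precolD(4)[OF Rp s(2)] by auto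
  have sD: "u - {k} \<subseteq> D - {i}" "k \<in> D - {i}" "k \<notin> u - {k}" "ct \<in> C - {cs}"
    using precolD(1-3)[OF R_precol s(1)] csC csct by auto
  let ?s = "(u - {k}, k, ct)"
  let ?S = "slice False i cs P"
  \<comment> \<open>Colours are not repeated in \<open>R\<close>, and the edge of colour
    \<open>ct\<close> cannot touch the recoloured edge, because neither has direction
    \<open>p\<close>.\<close>
  have free: "l \<noteq> k \<and> f \<noteq> ct" if h: "x - {k} = u - {k}" "has ?S x l f" for x l f
  proof -
    have hR: "has R x l f" "f \<noteq> cs" using h(2) unfolding has_def sF by auto
    have "l \<noteq> k"
    proof
      assume "l = k"
      then have "(u - {k}, k, f) \<in> R" using hR(1) h(1) by (simp add: has_def)
      then have "has R u k f" by (simp add: has_def)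
      then show False using precolD(5)[OF R_precol hs, of k f] hR(2) by simp
    qed
    moreover have "f \<noteq> ct"
    proof
      assume "f = ct"
      then have "x - {l} = nb u p - {k'} \<and> l = k'" using inj[OF _ s(2)] hR(1) unfolding has_def by blast
      then have "x = nb u p \<or> x = nb (nb u p) k'" using Diff_eq_iff_nb by blast
      moreover have "x = u \<or> x = nb u k" using h(1) Diff_eq_iff_nb by blast
      ultimately show False using kp by auto
    qed
    ultimately show ?thesis ..
  qed
  have Q0: "precol (D - {i}) (C - {cs}) (insert ?s ?S)"
    by (rule precol_insert[OF slice_precol[OF P]]) (use sD free in auto)
  have W1: "precol (D - {i}) (C - {cs}) {(W - {i}, j1, c1)}"
    by (rule precol_insert) (use w_facts cs in auto)
  have Q1: "precol (D - {i}) (C - {cs}) (insert ?s {(W - {i}, j1, c1)})"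
  proof (rule precol_insert[OF W1])
    fix x l f assume h: "x - {k} = u - {k}" "has {(W - {i}, j1, c1)} x l f"
    then have l: "l = j1" "f = c1" "x - {j1} = W - {i}" by (auto simp: has_def)
    show "l \<noteq> k \<and> f \<noteq> ct" using l nQ nt[OF _ l(3)] h(1) by auto
  qed (use sD in auto)
  have cS: "card ?S + 2 \<le> card D"
  proof -
    have "card ?S + card {(W, j1, c1), (u - {k}, k, cs)} \<le> card P"
      by (rule slice_card_add[OF finP]) (use p' iW s(1) in \<open>auto simp: R_iff\<close>)
    moreover have "(W, j1, c1) \<noteq> (u - {k}, k, cs)" using cs by simp
    ultimately show ?thesis using cP by simp
  qed
  have cQ: "card (insert ?s ?S) < card D" using card_insert_le'[OF slice_card(1)[OF finP], of ?s False i cs] cS by linarith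
  have cQ': "card (insert ?s ?S) \<le> card (D - {i})" "card (insert ?s ?S) \<le> card (C - {cs})"
    using cQ cards(1)[OF iD] cards(2)[OF csC(1)] by linarith+
  have inQ: "?s \<in> insert ?s ?S" "(nb u p - {k'}, k', ct) \<in> insert ?s ?S" using s(2) csct by (auto simp: sF)
  have neq: "?s \<noteq> (nb u p - {k'}, k', ct)"
  proof
    assume "?s = (nb u p - {k'}, k', ct)"
    then have a: "u - {k} = nb u p - {k'}" and b: "k = k'" by blast+
    have "u - {k} = nb u p - {k}" using a unfolding b[symmetric] .
    then show False unfolding Diff_eq_iff_nb using kp by auto
  qed
  \<comment> \<open>Two edges of colour \<open>ct\<close> exclude a blocked edge, and they cannot
    both be at one blocked vertex. If \<open>ct\<close> itself is missing at the blocked vertex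
    \<open>y\<close>, then \<open>y\<close> carries two edges of further colours leading to ends of
    the blocked edge of \<open>R\<close>, which is impossible for a third vertex.\<close>
  have gd0: "good (D - {i}) (C - {cs}) (insert ?s ?S)"
  proof (rule ccontr)
    assume "\<not> ?thesis"
    then consider a m where "bade (D - {i}) (C - {cs}) (insert ?s ?S) a m"
      | y e where "e \<in> C - {cs}" "badv (D - {i}) (insert ?s ?S) y e" unfolding good_def by blast
    then show False
    proof cases
      case 1
      have "inj_on (snd \<circ> snd) (insert ?s ?S)" using bade_all(2)[OF fins Q0 1 cQ'(2)] .
      then have "?s = (nb u p - {k'}, k', ct)" by (rule inj_onD[OF _ _ inQ]) (simp add: csct)
      then show False using neq by contradiction
    next
      case (2 y e)
      have st: "y - {j} = v \<or> f = e" if "(v, j, f) \<in> insert ?s ?S" for v j f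
        using badv_all(2)[OF fins Q0 2(2) cQ'(1) that] by blast
      show False
      proof (cases "e = ct")
        case False
        have y: "y - {k} = u - {k}" "y - {k'} = nb u p - {k'}" using st[OF inQ(1)] st[OF inQ(2)] False by auto
        have "has (insert ?s ?S) y k ct" "has (insert ?s ?S) y k' ct" using inQ y unfolding has_def by simp_all
        then have "k = k'" using precolD(5)[OF Q0] by blast
        then show False using neq y by simp
      next
        case True
        have ny: "\<not> has (insert ?s ?S) y l ct" for l using 2(2) True by (simp add: badv_def)
        have yu: "y \<noteq> u"
        proof
          assume "y = u"
          then show False using ny[of k] by (simp add: has_def)
        qed
        have yv: "y \<noteq> nb u p"
        proof
          assume yy: "y = nb u p"
          show False using ny[of k'] inQ(2) unfolding has_def yy by contradiction
        qed
        \<comment> \<open>Five colours leave two besides \<open>c'\<close>, \<open>cs\<close> and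
          \<open>ct\<close>.\<close>
        have "length [c', cs, ct] < card C" using C d5 by simp
        from pick_new[OF this]
        obtain e2 where e2: "e2 \<in> C" "e2 \<notin> {c', cs, ct}" unfolding list.set by (elim bexE)
        have "length [c', cs, ct, e2] < card C" using C d5 by simp
        from pick_new[OF this]
        obtain e3 where e3: "e3 \<in> C" "e3 \<notin> {c', cs, ct, e2}" unfolding list.set by (elim bexE)
        have loc: "\<exists>A a. (A = u \<or> A = nb u p) \<and> has R A a f \<and> y = nb A a"
          if f: "f \<in> C" "f \<noteq> c'" "f \<noteq> cs" "f \<noteq> ct" for f
        proof -
          have "\<exists>a. has R u a f \<or> has R (nb u p) a f" using bad f by (auto simp: bade_def)
          then obtain A a where A: "A = u \<or> A = nb u p" "has R A a f" by blast
          have "(A - {a}, a, f) \<in> insert ?s ?S" using A(2) f(3) by (simp add: has_def sF)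
          then have "y - {a} = A - {a}" using st True f(4) by blast
          then have "y = A \<or> y = nb A a" using Diff_eq_iff_nb by blast
          then show ?thesis using A yu yv by blast
        qed
        obtain A a where A: "A = u \<or> A = nb u p" "has R A a e2" "y = nb A a" using loc[of e2] e2 by blast
        obtain B b where B: "B = u \<or> B = nb u p" "has R B b e3" "y = nb B b" using loc[of e3] e3 by blast
        show False
        proof (cases "A = B")
          case True
          then have "a = b" using A(3) B(3) by simp
          then show False using precolD(5)[OF R_precol A(2), of b e3] B(2) True e3 by simp
        next
          case False
          then have "B = nb A p" using A(1) B(1) by auto
          then show False using A(3) B(3) by auto
        qed
      qed
    qed
  qed
  have T: "precol (D - {i}) (C - {cs}) {?s}" using precol_mono[OF Q0, of "{?s}"] by simp
  show ?thesis
  proof (rule combine[OF csC(1) cs[symmetric] T])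
    show "j = j'" if "has {?s} x j e" "has {?s} x j' e'" for x j e j' e' using that by (auto simp: has_def)
    show "\<exists>e'. (v, j, e') \<in> {?s}" if "(v, j, cs) \<in> R" for v j using inj[OF s(1) that] by auto
    show "(v, j, e') \<notin> {?s}" if "(v, j, e) \<in> R" "e \<noteq> cs" for v j e e'
    proof
      assume "(v, j, e') \<in> {?s}"
      then have "has R u k e" using that(1) by (auto simp: has_def)
      then show False using precolD(5)[OF R_precol hs, of k e] that(2) by simp
    qed
    show "(W - {i}, j1, e') \<notin> {?s}" for e' using nQ by auto
    have "slice False i cs P \<union> {?s} = insert ?s ?S" by simp
    then show "ext (D - {i}) (C - {cs}) (slice False i cs P \<union> {?s})"
      using almost[OF iD csC(1) Q0 cQ gd0] by simp
    have "insert (W - {i}, j1, c1) {?s} = insert ?s {(W - {i}, j1, c1)}" by auto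
    moreover have "card (insert ?s {(W - {i}, j1, c1)}) \<le> 2" by (simp add: card_insert_if)
    ultimately show "ext (D - {i}) (C - {cs}) (insert (W - {i}, j1, c1) {?s})"
      using few[OF iD csC(1) Q1] d5 by simp
  qed
qed

text \<open>One end \<open>u\<close> of the blocked edge sees \<open>c1\<close>. Where
  \<open>swap\<close> does not apply, \<open>u\<close> carries no other edge, the other colours all
  occur at \<open>?v\<close>, and every edge there touches the projection of the lone edge. Two
  directions force this projection to contain \<open>?v\<close>, and then \<open>c1\<close> is
  blocked at \<open>?v\<close> in \<open>P\<close> itself.\<close>

lemma bad_edge:
  assumes c': "c' \<in> C" "\<And>v j. (v, j, c') \<notin> P" and bad: "bade (D - {i}) (C - {c'}) R u p"
  shows "ext D C P"
proof -
  have main: "ext D C P" if bad: "bade (D - {i}) (C - {c'}) R u p" and h1: "has R u k1 c1" for u k1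
  proof (rule ccontr)
    assume ne: "\<not> ext D C P"
    let ?v = "nb u p"
    have Rp: "precol (D - {i}) (C - {c'}) R"
      by (rule precol_colors[OF R_precol]) (use precolD(4)[OF R_precol] c'(2) in \<open>auto simp: R_iff\<close>)
    have Rle: "card R \<le> card (C - {c'})" using cR cards(2)[OF c'(1)] by simp
    have fins: "finite (D - {i})" "finite (C - {c})" for c using D C by auto
    note ba = bade_all[OF fins Rp bad Rle]
    have inj: "v = v' \<and> j = j'" if "(v, j, e) \<in> R" "(v', j', e) \<in> R" for v j v' j' e
      using inj_onD[OF ba(2) _ that] by simp
    have unc: "\<not> has R u p e" "\<not> has R ?v p e" for e using bad by (auto simp: bade_def)
    have u: "u \<subseteq> D - {i}" "p \<in> D" "p \<noteq> i" using bad by (auto simp: bade_def)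
    have cov: "\<exists>k. has R u k e \<or> has R ?v k e" if "e \<in> C" "e \<noteq> c'" for e using bad that by (auto simp: bade_def)
    have dirs: "k \<in> D - {i, p}" if "has R y k e" "y = u \<or> y = ?v" for y k e
      using has_sub(2)[OF R_precol that(1)] that unc by blast
    have cJ: "card (D - {i, p}) = card D - 2" using iD u(2,3) D by (simp add: card_Diff_subset)
    have c1c': "c1 \<noteq> c'" using c'(2) p' by blast
    have cA: "card (C - {c', c1}) = card D - 2" using c'(1) w_facts(4) c1c' C by (simp add: card_Diff_subset)
    have twice: False if "has R u k e" "has R ?v l e" for k l e
    proof -
      have "u - {k} = ?v - {k}" "k = l" using inj[of "u - {k}" k e "?v - {l}" l] that unfolding has_def by auto
      then show False using unc(1)[of e] that(1) unfolding Diff_eq_iff_nb by auto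
    qed
    have exv: "\<exists>k e. has R ?v k e"
    proof (rule ccontr)
      assume no: "\<not> ?thesis"
      have "card (C - {c'}) \<le> card (D - {i, p})"
        by (rule star_colors(1)[OF R_precol, of _ _ u]) (use cov no dirs D in blast)+
      then show False using cJ cards(2)[OF c'(1)] d5 by linarith
    qed
    have bad': "bade (D - {i}) (C - {c'}) R ?v p" using bade_sym[OF bad] .
    have a1: "k = j1 \<and> u - {k} = W - {i}" if "has R u k e" "e \<noteq> c1" for k e
    proof (rule ccontr)
      assume nq: "\<not> ?thesis"
      obtain l f where l: "has R ?v l f" using exv by blast
      have "f \<noteq> c1" using twice[OF h1] l by blast
      then show False using swap[OF c' bad that(1) l that(2) nq] ne by blast
    qed
    have only: "e = c1" if h: "has R u k e" for k e
    proof (rule ccontr)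
      assume ec: "e \<noteq> c1"
      have q: "k = j1" "u - {k} = W - {i}" using a1[OF h ec] by auto
      obtain l f where l: "has R ?v l f" using exv by blast
      have f1: "f \<noteq> c1" using twice[OF h1] l by blast
      have "\<not> (l = j1 \<and> ?v - {l} = W - {i})"
      proof
        assume "l = j1 \<and> ?v - {l} = W - {i}"
        then have "?v - {k} = u - {k}" using q by metis
        then show False using dirs[OF h] unfolding Diff_eq_iff_nb by auto
      qed
      then show False using swap[OF c' bad' l _ f1, of k e] h ec ne by simp
    qed
    have atv: "\<exists>k\<in>D - {i, p}. has R ?v k e" if "e \<in> C - {c', c1}" for e
    proof -
      obtain k where k: "has R u k e \<or> has R ?v k e" using cov[of e] \<open>e \<in> C - {c', c1}\<close> by blast
      then have "has R ?v k e" using only[of k e] \<open>e \<in> C - {c', c1}\<close> by blast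
      then show ?thesis using dirs by blast
    qed
    have full: "\<exists>e. has R ?v l e" if "l \<in> D - {i, p}" for l
      by (rule star_colors(2)[OF R_precol atv _ _ that]) (use D cA cJ in simp_all)
    have tq: "\<exists>y. y - {j1} = W - {i} \<and> y - {l} = ?v - {l}" if h: "has R ?v l f" for l f
    proof (rule ccontr)
      assume nt: "\<not> ?thesis"
      have f1: "f \<noteq> c1" using twice[OF h1] h by blast
      have "\<not> (l = j1 \<and> ?v - {l} = W - {i})" using nt by blast
      then show False using swap[OF c' bad' h _ f1, of k1 c1] h1 nt ne by auto
    qed
    have "card (D - {i, p}) \<ge> 2" using cJ d5 by linarith
    then obtain l l' where l: "l \<in> D - {i, p}" "l' \<in> D - {i, p}" "l \<noteq> l'"
      using D by (metis card_le_Suc0_iff_eq finite_Diff not_less_eq_eq numeral_2_eq_2)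
    obtain f where "has R ?v l f" using full[OF l(1)] by (elim exE)
    from tq[OF this] obtain y where y: "y - {j1} = W - {i}" "y - {l} = ?v - {l}" by (elim exE conjE)
    obtain f' where "has R ?v l' f'" using full[OF l(2)] by (elim exE)
    from tq[OF this] obtain y' where y': "y' - {j1} = W - {i}" "y' - {l'} = ?v - {l'}" by (elim exE conjE)
    have vW: "?v - {j1} = W - {i}"
    proof (rule ccontr)
      assume no: "\<not> ?thesis"
      have "y = nb ?v l" using y(2)[unfolded Diff_eq_iff_nb] y(1) no by metis
      moreover have "y' = nb ?v l'" using y'(2)[unfolded Diff_eq_iff_nb] y'(1) no by metis
      moreover have "y = y' \<or> y = nb y' j1" using y(1) y'(1) Diff_eq_iff_nb by metis
      ultimately have "nb ?v l = nb ?v l' \<or> nb ?v l = nb (nb ?v l') j1" by metis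
      then show False using l(3) by auto
    qed
    have vD: "?v \<subseteq> D - {i}" using u by simp
    \<comment> \<open>Direction \<open>i\<close> is closed for \<open>c1\<close> by the lone edge,
      direction \<open>p\<close> by the edge at \<open>u\<close>, and every other direction by a
      coloured edge at \<open>?v\<close>.\<close>
    have "badv D P ?v c1"
      unfolding badv_def
    proof (intro conjI allI ballI)
      show "?v \<subseteq> D" using vD by blast
      show "\<not> has P ?v k c1" for k
      proof
        assume "has P ?v k c1"
        then have "has R ?v k c1" unfolding has_R using vD by blast
        then show False using twice[OF h1] by blast
      qed
      fix l assume lD: "l \<in> D"
      consider "l = i" | "l = p" | "l \<in> D - {i, p}" using lD by blast
      then show "(\<exists>e. has P ?v l e) \<or> (\<exists>j. has P (nb ?v l) j c1)"
      proof cases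
        case 1
        have "nb ?v i - {j1} = W"
        proof -
          have "nb ?v i = insert i ?v" using vD by (auto simp: nb_def)
          then have "nb ?v i - {j1} = insert i (?v - {j1})" using w_facts(5) by auto
          then show ?thesis using vW w_facts(6) by simp
        qed
        then have "has P (nb ?v i) j1 c1" using p' by (simp add: has_def)
        then show ?thesis using 1 by blast
      next
        case 2
        then show ?thesis using h1 by (auto simp: has_R)
      next
        case 3
        then show ?thesis using full by (auto simp: has_R)
      qed
    qed
    then show False using gd w_facts(4) unfolding good_def by blast
  qed
  have "c1 \<in> C - {c'}" using w_facts(4) c'(2) p' by blast
  then have "\<exists>k. has R u k c1 \<or> has R (nb u p) k c1" using bad unfolding bade_def by blast
  then obtain k where "has R u k c1 \<or> has R (nb u p) k c1" by (elim exE)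
  then show ?thesis
  proof
    assume "has R u k c1"
    then show ?thesis by (rule main[OF bad])
  next
    assume "has R (nb u p) k c1"
    then show ?thesis by (rule main[OF bade_sym[OF bad]])
  qed
qed

text \<open>The blocked vertex makes the edges of \<open>R\<close> outside the colour
  \<open>c\<close> a star at \<open>u\<close>, so the repetition is in colour \<open>c\<close>.
  Reserve \<open>c\<close> and recolour its edges with distinct colours. The exception is a lone
  edge that projects onto an edge of colour \<open>c\<close>; then the cut is made in the direction
  \<open>a\<close> of a star edge.\<close>

lemma bad_vertex:
  assumes c': "c' \<in> C" "\<And>v j. (v, j, c') \<notin> P" and bad: "badv (D - {i}) R u c" and cC: "c \<in> C"
    and rep: "\<not> inj_on (snd \<circ> snd) R"
  shows "ext D C P"
proof (rule ccontr)
  assume ne: "\<not> ext D C P"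
  have fins: "finite (D - {i})" "finite (C - {c})" for c using D C by auto
  have Rle: "card R \<le> card (D - {i})" using cR cards(1)[OF iD] by simp
  have bv: "u - {j} = v \<and> e \<noteq> c \<or> e = c \<and> (\<exists>l\<in>D - {i}. (\<forall>e'. \<not> has R u l e') \<and> nb u l - {j} = v)"
    if "(v, j, e) \<in> R" for v j e
    using badv_all(2)[OF fins(1) C(1) R_precol bad Rle that] .
  have u: "u \<subseteq> D - {i}" "\<And>k. \<not> has R u k c" using bad by (auto simp: badv_def)
  have iu': "i \<notin> u" using u(1) by blast
  have star: "u - {j} = v \<and> has R u j e" if "(v, j, e) \<in> R" "e \<noteq> c" for v j e
    using bv[OF that(1)] that unfolding has_def by auto
  have PR: "(v, j, e) \<in> R \<or> v = W \<and> j = j1 \<and> e = c1" if "(v, j, e) \<in> P" for v j e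
    using off[OF that] that by (auto simp: R_iff)
  have c1c: "c1 \<noteq> c"
  proof
    assume c1: "c1 = c"
    have "ext D C P"
    proof (rule star_class[OF _ cC])
      show "u \<subseteq> D" using u(1) by blast
      fix v j e assume "(v, j, e) \<in> P" "e \<noteq> c"
      then show "u - {j} = v" using PR star c1 by blast
    qed
    then show False using ne by simp
  qed
  obtain a ca where a: "has R u a ca"
  proof (rule ccontr)
    assume no: "\<not> thesis"
    have "ext D C P"
    proof (rule star_class[OF _ cC])
      show "W \<subseteq> D" using precolD(1)[OF P p'] .
      fix v j e assume q: "(v, j, e) \<in> P" "e \<noteq> c"
      have "(v, j, e) \<notin> R" using star[of v j e] q(2) no that by blast
      then have "v = W" "j = j1" using PR[OF q(1)] by auto
      then show "W - {j} = v" using precolD(3)[OF P p'] by simp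
    qed
    then show False using ne by simp
  qed
  have cac: "ca \<noteq> c" using a u(2) by blast
  have noc: False if h: "has R u l f" "has R (nb u l) k c" for l f k
  proof -
    have "(nb u l - {k}, k, c) \<in> R" using h(2) by (simp add: has_def)
    then obtain m where m: "\<forall>e'. \<not> has R u m e'" "nb u m - {k} = nb u l - {k}" using bv by blast
    have "nb u m = nb u l \<or> nb u m = nb (nb u l) k" using m(2) Diff_eq_iff_nb by blast
    then have "m = l" by auto
    then show False using m(1) h(1) by blast
  qed
  have SD: False if h: "has R x k f" "f \<noteq> c" "has R x j c" for x k f j
  proof -
    have "(x - {k}, k, f) \<in> R" using h(1) by (simp add: has_def)
    from star[OF this h(2)] have s: "u - {k} = x - {k}" "has R u k f" by auto
    have "x = u \<or> x = nb u k" using s(1) Diff_eq_iff_nb by metis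
    then show False using u(2) noc[OF s(2)] h(3) by blast
  qed
  let ?Pc = "{t \<in> R. snd (snd t) = c}"
  have finPc: "finite ?Pc" using finR by simp
  \<comment> \<open>A star has distinct colours, so the repeated colour can only be
    \<open>c\<close>.\<close>
  obtain v1 k1 v2 k2 where two: "(v1, k1, c) \<in> R" "(v2, k2, c) \<in> R" "(v1, k1) \<noteq> (v2, k2)"
  proof -
    obtain s t where st: "s \<in> R" "t \<in> R" "snd (snd s) = snd (snd t)" "s \<noteq> t"
      using rep unfolding inj_on_def comp_def by blast
    obtain v1 k1 e where s: "s = (v1, k1, e)" by (cases s)
    obtain v2 k2 e2 where t: "t = (v2, k2, e2)" by (cases t)
    have e2: "e2 = e" using st(3) s t by simp
    have "e = c"
    proof (rule ccontr)
      assume ec: "e \<noteq> c"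
      have 1: "u - {k1} = v1" "has R u k1 e" using star[of v1 k1 e] st(1) s ec by auto
      have 2: "u - {k2} = v2" "has R u k2 e" using star[of v2 k2 e] st(2) t e2 ec by auto
      have "k1 = k2" using precolD(5)[OF R_precol 1(2) 2(2)] by simp
      then show False using st(4) s t e2 1(1) 2(1) by simp
    qed
    then show thesis using that[of v1 k1 v2 k2] st s t e2 by auto
  qed
  have Pc2: "2 \<le> card ?Pc"
  proof -
    have "card {(v1, k1, c), (v2, k2, c)} \<le> card ?Pc" using two finPc by (intro card_mono) auto
    then show ?thesis using two(3) by simp
  qed
  have aR: "(u - {a}, a, ca) \<in> R" using a by (simp add: has_def)
  have Pc_le: "card ?Pc + 2 \<le> card D"
  proof -
    have "(u - {a}, a, ca) \<notin> ?Pc" using cac by simp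
    moreover have "?Pc \<subseteq> R" by blast
    ultimately have "?Pc \<subset> R" using aR by blast
    then have "card ?Pc < card R" using psubset_card_mono finR by blast
    then show ?thesis using cR d5 by linarith
  qed
  show False
  proof (cases "(W - {i}, j1, c) \<in> R")
    case nz: False
    have cA: "card (C - {c, c1}) = card D - 2" using cC w_facts(4) c1c C by (simp add: card_Diff_subset)
    \<comment> \<open>As the star is not empty, at most \<open>card D - 2\<close> edges of
      \<open>R\<close> have colour \<open>c\<close>, and this is the number of colours besides
      \<open>c\<close> and \<open>c1\<close>.\<close>
    obtain \<gamma> where \<gamma>: "inj_on \<gamma> ?Pc" "\<gamma> ` ?Pc \<subseteq> C - {c, c1}"
      using inj_on_iff_card_le[OF finPc, of "C - {c, c1}"] C(1) cA Pc_le by auto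
    define T where "T = (\<lambda>t. (fst t, fst (snd t), \<gamma> t)) ` ?Pc"
    have T_iff: "(v, j, e) \<in> T \<longleftrightarrow> (v, j, c) \<in> R \<and> e = \<gamma> (v, j, c)" for v j e
      unfolding T_def by (auto simp: image_iff)
    have hasT: "has T x j e \<longleftrightarrow> has R x j c \<and> e = \<gamma> (x - {j}, j, c)" for x j e
      unfolding has_def T_iff ..
    have gin: "\<gamma> (v, j, c) \<in> C \<and> \<gamma> (v, j, c) \<noteq> c \<and> \<gamma> (v, j, c) \<noteq> c1" if "(v, j, c) \<in> R" for v j
      using \<gamma>(2) that by force
    have gne: "\<gamma> (v, j, c) \<noteq> \<gamma> (v', j', c)" if "(v, j, c) \<in> R" "(v', j', c) \<in> R" "(v, j) \<noteq> (v', j')" for v j v' j'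
      using inj_onD[OF \<gamma>(1), of "(v, j, c)" "(v', j', c)"] that by auto
    have Tm: "j = j' \<and> e = e'" if h: "has T x j e" "has T x j' e'" for x j e j' e'
    proof -
      have "j = j'" using h precolD(5)[OF R_precol, of x j c j' c] by (auto simp: hasT)
      then show ?thesis using h by (auto simp: hasT)
    qed
    have Tp: "precol (D - {i}) (C - {c}) T"
    proof (rule precolI)
      fix v j e assume "(v, j, e) \<in> T"
      then have h: "(v, j, c) \<in> R" "e = \<gamma> (v, j, c)" by (auto simp: T_iff)
      then show "v \<subseteq> D - {i} \<and> j \<in> D - {i} \<and> j \<notin> v \<and> e \<in> C - {c}"
        using precolD(1-3)[OF R_precol h(1)] gin[OF h(1)] by simp
    next
      fix x j e j' e' assume h: "has T x j e" "has T x j' e'"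
      show "j = j' \<longleftrightarrow> e = e'" using Tm[OF h] by simp
    qed
    let ?S = "slice False i c P"
    have hS: "has R x j e \<and> e \<noteq> c" if "has ?S x j e" for x j e using that unfolding has_def sF .
    have Q0: "precol (D - {i}) (C - {c}) (?S \<union> T)"
    proof (rule precolI)
      fix v j e assume "(v, j, e) \<in> ?S \<union> T"
      then show "v \<subseteq> D - {i} \<and> j \<in> D - {i} \<and> j \<notin> v \<and> e \<in> C - {c}"
        using precolD(1-4)[OF Tp, of v j e] precolD(1-4)[OF slice_precol[OF P, where i = i and c = c and b = False], of v j e]
        by blast
    next
      have cross: False if "has ?S x j e" "has T x j' e'" for x j e j' e'
        using SD[of x j e j'] hS[OF that(1)] that(2) by (simp add: hasT)
      fix x j j' e e' assume h: "has (?S \<union> T) x j e" "has (?S \<union> T) x j' e'"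
      show "j = j' \<longleftrightarrow> e = e'"
        using h unfolding has_Un
        using cross[of x j e j' e'] cross[of x j' e' j e] precolD(5)[OF Tp, of x j e j' e']
          precolD(5)[OF slice_precol[OF P, where i = i and c = c and b = False], of x j e j' e'] by blast
    qed
    have Q1: "precol (D - {i}) (C - {c}) (insert (W - {i}, j1, c1) T)"
    proof (rule precol_insert[OF Tp])
      fix x k f assume h: "x - {j1} = W - {i}" "has T x k f"
      have Rk: "has R x k c" and f: "f = \<gamma> (x - {k}, k, c)" using h(2) unfolding hasT by simp_all
      have "f \<noteq> c1" using conjunct2[OF conjunct2[OF gin[OF Rk[unfolded has_def]]]] unfolding f .
      moreover have "k \<noteq> j1"
      proof
        assume "k = j1"
        then show False using Rk nz unfolding has_def h(1)[symmetric] by blast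
      qed
      ultimately show "k \<noteq> j1 \<and> f \<noteq> c1" by blast
    qed (use w_facts c1c in auto)
    have cT: "card T \<le> card ?Pc" unfolding T_def using card_image_le[OF finPc] by blast
    have finT: "finite T" unfolding T_def using finPc by simp
    have cS: "card ?S + card ?Pc < card D"
    proof -
      have "card ?S + card (insert (W, j1, c1) ?Pc) \<le> card P"
        by (rule slice_card_add[OF finP]) (use p' iW R_def in auto)
      moreover have "(W, j1, c1) \<notin> ?Pc" using c1c by simp
      ultimately show ?thesis using finPc cP by simp
    qed
    have cQ0: "card (?S \<union> T) < card D" using card_Un_le[of ?S T] cS cT by linarith
    have cQ1: "card (insert (W - {i}, j1, c1) T) \<le> Suc (card ?Pc)" using card_insert_le'[OF finT] cT by (meson Suc_le_mono le_trans)
    define t1 where "t1 = (v1, k1, \<gamma> (v1, k1, c))"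
    define t2 where "t2 = (v2, k2, \<gamma> (v2, k2, c))"
    have t12: "(v1, k1, \<gamma> (v1, k1, c)) \<in> T" "(v2, k2, \<gamma> (v2, k2, c)) \<in> T" using two by (auto simp: T_iff)
    have apart: "x \<noteq> y" if h: "(v, j, c) \<in> R" "(v', j', c) \<in> R" "(v, j) \<noteq> (v', j')" "x - {j} = v" "y - {j'} = v'" for v j v' j' x y
    proof
      assume "x = y"
      then have "has R x j c" "has R x j' c" using h unfolding has_def by auto
      then have "j = j'" using precolD(5)[OF R_precol] by blast
      then show False using h \<open>x = y\<close> by auto
    qed
    have apart': "x \<noteq> y" if h: "(v, j, c) \<in> R" "(v', j', f) \<in> R" "f \<noteq> c" "x - {j} = v" "y - {j'} = v'" for v j v' j' f x y
      using SD[of y j' f j] h unfolding has_def by auto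
    \<comment> \<open>Since \<open>card R \<ge> 4\<close>, there is an edge besides the chosen star
      edge and the two chosen edges of colour \<open>c\<close>.\<close>
    have "length [(u - {a}, a, ca), (v1, k1, c), (v2, k2, c)] < card R" using cR d5 by simp
    from pick_new[OF this]
    obtain r3 where r3: "r3 \<in> R" "r3 \<notin> {(u - {a}, a, ca), (v1, k1, c), (v2, k2, c)}"
      unfolding list.set by (elim bexE)
    obtain v3 k3 f3 where r3': "r3 = (v3, k3, f3)" by (cases r3)
    \<comment> \<open>Two recoloured edges and a star edge are pairwise disjoint and cannot all
      touch one edge. A blocked vertex is excluded by the further edge \<open>r3\<close>, whether it
      is recoloured or belongs to the star.\<close>
    have e0: "ext (D - {i}) (C - {c}) (?S \<union> T)"
    proof (rule almost[OF iD cC Q0 cQ0], rule ccontr)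
      assume "\<not> good (D - {i}) (C - {c}) (?S \<union> T)"
      then consider y m where "bade (D - {i}) (C - {c}) (?S \<union> T) y m"
        | y e where "badv (D - {i}) (?S \<union> T) y e" unfolding good_def by blast
      then show False
      proof cases
        case (1 y m)
        have le: "card (?S \<union> T) \<le> card (C - {c})" using cQ0 cards(2)[OF cC] by linarith
        note at = bade_all(4)[OF fins Q0 1 le]
        obtain x1 where x1: "x1 = y \<or> x1 = nb y m" "x1 - {k1} = v1" using at[OF UnI2[OF t12(1)]] by metis
        obtain x2 where x2: "x2 = y \<or> x2 = nb y m" "x2 - {k2} = v2" using at[OF UnI2[OF t12(2)]] by metis
        have "(u - {a}, a, ca) \<in> ?S" using aR cac by (simp add: sF)
        then obtain x3 where x3: "x3 = y \<or> x3 = nb y m" "x3 - {a} = u - {a}" using at by (metis UnI1)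
        have "x1 \<noteq> x2" using apart[OF two x1(2) x2(2)] .
        moreover have "x1 \<noteq> x3" using apart'[OF two(1) aR cac x1(2) x3(2)] .
        moreover have "x2 \<noteq> x3" using apart'[OF two(2) aR cac x2(2) x3(2)] .
        ultimately show False using x1(1) x2(1) x3(1) by blast
      next
        case (2 y e)
        have le: "card (?S \<union> T) \<le> card (D - {i})" using cQ0 cards(1)[OF iD] by linarith
        have st: "y - {j} = v" if "(v, j, f) \<in> ?S \<union> T" "f \<noteq> e" for v j f
          using badv_all(2)[OF fins Q0 2 le that(1)] that(2) by blast
        have stT: "y - {j} = v" if "(v, j, c) \<in> R" "\<gamma> (v, j, c) \<noteq> e" for v j
          using st[of v j "\<gamma> (v, j, c)"] that by (simp add: T_iff)
        have stS: "y - {j} = v" if "(v, j, f) \<in> R" "f \<noteq> c" "f \<noteq> e" for v j f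
          using st[of v j f] that by (simp add: sF)
        have one: "\<gamma> (v, j, c) = e \<or> \<gamma> (v', j', c) = e" if "(v, j, c) \<in> R" "(v', j', c) \<in> R" "(v, j) \<noteq> (v', j')" for v j v' j'
          using apart[OF that, of y y] stT[OF that(1)] stT[OF that(2)] by blast
        have 12: "\<gamma> (v1, k1, c) \<noteq> \<gamma> (v2, k2, c)" using gne[OF two] .
        show False
        proof (cases "f3 = c")
          case True
          have r: "(v3, k3, c) \<in> R" "(v3, k3) \<noteq> (v1, k1)" "(v3, k3) \<noteq> (v2, k2)" using r3 r3' True by auto
          show False
            using one[OF two] one[OF r(1) two(1) r(2)] one[OF r(1) two(2) r(3)] 12
              gne[OF r(1) two(1) r(2)] gne[OF r(1) two(2) r(3)] by metis
        next
          case False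
          have r: "(v3, k3, f3) \<in> R" using r3 r3' by simp
          have f3: "f3 \<noteq> ca"
          proof
            assume eq: "f3 = ca"
            have s: "u - {k3} = v3" "has R u k3 f3" using star[OF r False] by auto
            have "k3 = a" using precolD(5)[OF R_precol s(2) a] eq by simp
            then show False using r3(2) r3' s(1) eq by simp
          qed
          have "\<exists>v j f. (v, j, f) \<in> R \<and> f \<noteq> c \<and> y - {j} = v"
            using stS[OF r False] stS[OF aR cac] r aR False cac f3 by metis
          then obtain v j f where f: "(v, j, f) \<in> R" "f \<noteq> c" "y - {j} = v" by blast
          have "\<gamma> (v1, k1, c) = e" using stT[OF two(1)] apart'[OF two(1) f(1,2) _ f(3)] by blast
          moreover have "\<gamma> (v2, k2, c) = e" using stT[OF two(2)] apart'[OF two(2) f(1,2) _ f(3)] by blast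
          ultimately show False using 12 by simp
        qed
      qed
    qed
    \<comment> \<open>If \<open>r3\<close> belongs to the star, there are few enough recoloured
      edges. Otherwise there are three of them, pairwise disjoint and of distinct colours, which
      rules out any obstruction.\<close>
    have e1: "ext (D - {i}) (C - {c}) (insert (W - {i}, j1, c1) T)"
    proof (cases "f3 = c")
      case False
      have "(v3, k3, f3) \<in> R" using r3 r3' by simp
      then have "?Pc \<subseteq> R - {(u - {a}, a, ca), (v3, k3, f3)}" using cac False by auto
      then have "card ?Pc \<le> card (R - {(u - {a}, a, ca), (v3, k3, f3)})" using finR by (intro card_mono) auto
      also have "\<dots> = card R - 2"
      proof -
        have "(u - {a}, a, ca) \<noteq> (v3, k3, f3)" using r3(2) unfolding r3' by blast
        then have "card {(u - {a}, a, ca), (v3, k3, f3)} = 2" by (rule card_2_iff[THEN iffD2, OF exI, OF exI, OF conjI, OF refl])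
        moreover have "{(u - {a}, a, ca), (v3, k3, f3)} \<subseteq> R" using aR r3(1) unfolding r3' by blast
        ultimately show ?thesis by (simp only: card_Diff_subset finite.emptyI finite.insertI)
      qed
      finally show ?thesis using few[OF iD cC Q1] cQ1 cR d5 by linarith
    next
      case True
      have r: "(v3, k3, c) \<in> R" "(v3, k3) \<noteq> (v1, k1)" "(v3, k3) \<noteq> (v2, k2)" using r3 r3' True by auto
      have t3: "(v3, k3, \<gamma> (v3, k3, c)) \<in> T" using r by (auto simp: T_iff)
      have cQ1': "card (insert (W - {i}, j1, c1) T) < card D" using cQ1 Pc_le by linarith
      show ?thesis
      proof (rule almost[OF iD cC Q1 cQ1'], rule ccontr)
        assume "\<not> good (D - {i}) (C - {c}) (insert (W - {i}, j1, c1) T)"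
        then consider y m where "bade (D - {i}) (C - {c}) (insert (W - {i}, j1, c1) T) y m"
          | y e where "badv (D - {i}) (insert (W - {i}, j1, c1) T) y e" unfolding good_def by blast
        then show False
        proof cases
          case (1 y m)
          have le: "card (insert (W - {i}, j1, c1) T) \<le> card (C - {c})" using cQ1' cards(2)[OF cC] by linarith
          note at = bade_all(4)[OF fins Q1 1 le]
          obtain x1 where x1: "x1 = y \<or> x1 = nb y m" "x1 - {k1} = v1" using at[OF insertI2[OF t12(1)]] by metis
          obtain x2 where x2: "x2 = y \<or> x2 = nb y m" "x2 - {k2} = v2" using at[OF insertI2[OF t12(2)]] by metis
          obtain x3 where x3: "x3 = y \<or> x3 = nb y m" "x3 - {k3} = v3" using at[OF insertI2[OF t3]] by metis
          have "x1 \<noteq> x2" using apart[OF two x1(2) x2(2)] .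
          moreover have "x3 \<noteq> x1" using apart[OF r(1) two(1) r(2) x3(2) x1(2)] .
          moreover have "x3 \<noteq> x2" using apart[OF r(1) two(2) r(3) x3(2) x2(2)] .
          ultimately show False using x1(1) x2(1) x3(1) by blast
        next
          case (2 y e)
          have le: "card (insert (W - {i}, j1, c1) T) \<le> card (D - {i})" using cQ1' cards(1)[OF iD] by linarith
          have st: "y - {j} = v" if "(v, j, f) \<in> insert (W - {i}, j1, c1) T" "f \<noteq> e" for v j f
            using badv_all(2)[OF fins Q1 2 le that(1)] that(2) by blast
          have stT: "y - {j} = v" if "(v, j, c) \<in> R" "\<gamma> (v, j, c) \<noteq> e" for v j
            using st[of v j "\<gamma> (v, j, c)"] that by (simp add: T_iff)
          have one: "\<gamma> (v, j, c) = e \<or> \<gamma> (v', j', c) = e" if "(v, j, c) \<in> R" "(v', j', c) \<in> R" "(v, j) \<noteq> (v', j')" for v j v' j'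
            using apart[OF that, of y y] stT[OF that(1)] stT[OF that(2)] by blast
          show False
            using one[OF two] one[OF r(1) two(1) r(2)] one[OF r(1) two(2) r(3)] gne[OF two]
              gne[OF r(1) two(1) r(2)] gne[OF r(1) two(2) r(3)] by metis
        qed
      qed
    qed
    have "ext D C P"
    proof (rule combine[OF cC c1c Tp _ _ _ _ e0 e1])
      show "j = j'" if "has T x j e" "has T x j' e'" for x j e j' e' using Tm[OF that] by simp
      show "\<exists>e'. (v, j, e') \<in> T" if "(v, j, c) \<in> R" for v j using that by (simp add: T_iff)
      show "(v, j, e') \<notin> T" if q: "(v, j, e) \<in> R" "e \<noteq> c" for v j e e'
      proof
        assume "(v, j, e') \<in> T"
        then have "has R v j c" "has R v j e" using in_has[OF R_precol] q(1) by (auto simp: T_iff)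
        then show False using precolD(5)[OF R_precol] q(2) by blast
      qed
      show "(W - {i}, j1, e') \<notin> T" for e' using nz by (simp add: T_iff)
    qed
    then show False using ne by simp
  next
    case z: True
    have aD: "a \<in> D" "a \<noteq> i" using precolD(2)[OF R_precol aR] by auto
    \<comment> \<open>From here on the cube is cut in direction \<open>a\<close>, with
      \<open>c\<close> reserved and one coloring \<open>g\<close> for both halves.\<close>
    define u' where "u' = u - {a}"
    have PcR: "(v, j, c) \<in> R" if "(v, j, c) \<in> P" for v j using PR[OF that] c1c by blast
    have hc: "has R x k c \<and> i \<notin> x" if "has P x k c" for x k
      using that PcR has_R unfolding has_def by blast
    have Z: "\<not> has P x k c" if x: "x - {a} = u'" for x k
    proof
      assume "has P x k c"
      then have "has R x k c" using hc by blast
      moreover have "x = u \<or> x = nb u a" using x unfolding u'_def Diff_eq_iff_nb .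
      ultimately show False using u(2) noc[OF a] by blast
    qed
    \<comment> \<open>An edge of colour \<open>c\<close> contains a neighbour of \<open>u\<close> in
      a direction other than \<open>a\<close>. If its own direction is not \<open>a\<close> either,
      it lies on the same side as \<open>u\<close>, so the projections of these edges remain a
      matching.\<close>
    have Za: "(a \<in> x) = (a \<in> u)" if h: "has P x k c" "k \<noteq> a" for x k
    proof -
      have "(x - {k}, k, c) \<in> R" using hc[OF h(1)] by (simp add: has_def)
      then obtain m where m: "\<forall>e'. \<not> has R u m e'" "nb u m - {k} = x - {k}" using bv by blast
      have "nb u m = x \<or> nb u m = nb x k" using m(2) Diff_eq_iff_nb by blast
      moreover have "m \<noteq> a" using m(1) a by blast
      moreover have "(a \<in> nb x k) = (a \<in> x)" using h(2) by (auto simp: nb_def)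
      ultimately have "(a \<in> nb u m) = (a \<in> x)" by metis
      then show ?thesis using \<open>m \<noteq> a\<close> by simp
    qed
    have hw: "has P (W - {i}) j1 c" "has P (nb (W - {i}) j1) j1 c"
      using in_has[OF P, of "W - {i}" j1 c] z by (auto simp: R_iff)
    have Wi: "nb (W - {i}) i = W" using iW by (auto simp: nb_def)
    \<comment> \<open>The direction \<open>l\<close> has to avoid \<open>a\<close>, \<open>i\<close>
      and the at most one direction that leads from \<open>W\<close> to \<open>nb u' i\<close>; then
      the auxiliary edges \<open>E\<close> and \<open>s\<close> do not meet.\<close>
    have "card {x \<in> D. nb W x = nb u' i} \<le> 1"
      by (rule card_le_Suc0_iff_eq[THEN iffD2, unfolded One_nat_def[symmetric]]) (use D in \<open>auto, metis nb_inj\<close>)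
    then have "Suc (Suc (card {x \<in> D. nb W x = nb u' i})) < card D" using d5 by linarith
    moreover have "finite {x \<in> D. nb W x = nb u' i}" using D by simp
    ultimately have "card (insert a (insert i {x \<in> D. nb W x = nb u' i})) < card D"
      using card_insert_le'[of "{x \<in> D. nb W x = nb u' i}" i] card_insert_le'[of "insert i {x \<in> D. nb W x = nb u' i}" a] finite.insertI[of "{x \<in> D. nb W x = nb u' i}" i] by linarith
    then obtain l where l: "l \<in> D" "l \<noteq> a" "l \<noteq> i" "nb W l \<noteq> nb u' i"
      using card_mono[of "insert a (insert i {x \<in> D. nb W x = nb u' i})" D] D by fastforce
    \<comment> \<open>The star edge of direction \<open>a\<close> gets its colour from a switch over
      \<open>s\<close>. If the lone edge has direction \<open>a\<close>, it gets its colour from a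
      switch over \<open>E\<close>.\<close>
    define E where "E = (if j1 = a then {(W - {l}, l, c1)} else {})"
    define s where "s = (u', i, ca)"
    let ?S = "slice False a c P \<union> slice True a c P"
    let ?Q = "?S \<union> {s} \<union> E"
    have iu2: "i \<notin> u'" "a \<notin> u'" using iu' by (auto simp: u'_def)
    have caC: "ca \<in> C" using precolD(4)[OF R_precol aR] .
    have hua: "has P u a ca" using a by (simp add: has_R)
    have hasS: "k \<noteq> a \<and> k \<noteq> i \<and> f \<noteq> c \<and> (has P u k f \<and> i \<notin> x \<and> (x = u' \<or> x = nb u' k) \<or>
        k = j1 \<and> f = c1 \<and> i \<in> x \<and> x - {j1} = W - {a})"
      if h: "has (slice b a c P) x k f" for b x k f
    proof -
      have hh: "k \<noteq> a" "f \<noteq> c" "a \<notin> x" "has P (if b then insert a x else x) k f" using h unfolding has_slice by auto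
      define y where "y = (if b then insert a x else x)"
      have y: "has P y k f" "y - {a} = x" using hh by (auto simp: y_def)
      have q: "(y - {k}, k, f) \<in> P" using y(1) by (simp add: has_def)
      have ki: "k \<noteq> i" using dirne[OF q] .
      from PR[OF q] show ?thesis
      proof
        assume "(y - {k}, k, f) \<in> R"
        from star[OF this hh(2)] have st: "u - {k} = y - {k}" "has R u k f" by auto
        have yy: "y = u \<or> y = nb u k" using st(1) Diff_eq_iff_nb by metis
        have "nb u k - {a} = nb u' k" using nb_Diff_neq[OF hh(1)] unfolding u'_def by blast
        then have "x = u' \<or> x = nb u' k" using yy y(2) unfolding u'_def by auto
        moreover have "i \<notin> x" using calculation iu2 ki by auto
        ultimately show ?thesis using hh ki st(2) by (simp add: has_R)
      next
        assume e: "y - {k} = W \<and> k = j1 \<and> f = c1"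
        then have "x - {j1} = W - {a}" using y(2) by auto
        moreover have "i \<in> x" using e iW y(2) aD(2) by auto
        ultimately show ?thesis using e hh ki by simp
      qed
    qed
    have hss: "k = i \<and> f = ca \<and> (x = u' \<or> x = nb u' i)" if "has {s} x k f" for x k f
    proof -
      have "x - {i} = u'" "k = i" "f = ca" using that unfolding has_def s_def by auto
      then show ?thesis using iu2(1) Diff_eq_iff_nb[of x i u'] by simp
    qed
    have hasE: "j1 = a \<and> k = l \<and> f = c1 \<and> i \<in> x \<and> (x = W \<or> x = nb W l)" if "has E x k f" for x k f
    proof -
      have e: "j1 = a" "x - {l} = W - {l}" "k = l" "f = c1" using that unfolding has_def E_def by (auto split: if_splits)
      then have "x = W \<or> x = nb W l" using Diff_eq_iff_nb by blast
      then show ?thesis using e iW l(3) by auto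
    qed
    have sE: False if x: "x = u' \<or> x = nb u' i" "x = W \<or> x = nb W l" "j1 = a" "i \<in> x" for x
    proof -
      have "x = nb u' i" using x(1,4) iu2 by auto
      then have "W = nb u' i" using x(2) l(4) by auto
      then have "W - {i} = u'" using iu2 by (auto simp: nb_def)
      then have "(W - {i}) - {a} = u'" using iu2 by simp
      then show False using Z hw(1) by blast
    qed
    have sS: False if x: "x = nb u' i" "x - {j1} = W - {a}" for x
    proof -
      have ji: "j1 \<noteq> i" using w_facts(5) .
      have "nb u' i - {j1} - {i} = W - {a} - {i}" using x by simp
      then have "u' - {j1} = (W - {i}) - {a}" using iu2 ji by (auto simp: nb_def)
      moreover have "(W - {i}) - {a} = (W - {i}) - {a} - {j1}" using w_facts(3) by auto
      ultimately have "u' - {j1} = (W - {i}) - {a} - {j1}" by simp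
      then have uu: "u' = (W - {i}) - {a} \<or> u' = nb ((W - {i}) - {a}) j1" unfolding Diff_eq_iff_nb .
      show False
      proof (cases "j1 = a")
        case True
        then have "(W - {i}) - {a} = u'" using uu iu2 by auto
        then show False using Z hw(1) by blast
      next
        case False
        then have "nb (W - {i}) j1 - {a} = nb ((W - {i}) - {a}) j1" by (rule nb_Diff_neq)
        then show False using uu Z hw by metis
      qed
    qed
    have Qcross: "has ?Q x k f \<Longrightarrow> has ?Q x k' f' \<Longrightarrow> k = k' \<longleftrightarrow> f = f'" for x k f k' f'
    proof -
      \<comment> \<open>The four sources of an edge of \<open>?Q\<close>: the star, the lone edge,
        \<open>s\<close> and \<open>E\<close>.\<close>
      define A where "A k f \<longleftrightarrow> k \<noteq> a \<and> k \<noteq> i \<and> has P u k f \<and> i \<notin> x \<and> (x = u' \<or> x = nb u' k)" for k f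
      define B where "B k f \<longleftrightarrow> k = j1 \<and> f = c1 \<and> j1 \<noteq> a \<and> i \<in> x \<and> x - {j1} = W - {a}" for k f
      define S where "S k f \<longleftrightarrow> k = i \<and> f = ca \<and> (x = u' \<or> x = nb u' i)" for k f
      define F where "F k f \<longleftrightarrow> j1 = a \<and> k = l \<and> f = c1 \<and> i \<in> x \<and> (x = W \<or> x = nb W l)" for k f
      have cl: "A k f \<or> B k f \<or> S k f \<or> F k f" if "has ?Q x k f" for k f
      proof -
        have "has (slice False a c P) x k f \<or> has (slice True a c P) x k f \<or> has {s} x k f \<or> has E x k f"
          using that unfolding has_Un by blast
        then show ?thesis
        proof (elim disjE)
          assume "has (slice False a c P) x k f"
          from hasS[OF this] show ?thesis unfolding A_def B_def by metis
        next
          assume "has (slice True a c P) x k f"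
          from hasS[OF this] show ?thesis unfolding A_def B_def by metis
        next
          assume "has {s} x k f"
          from hss[OF this] show ?thesis unfolding S_def by metis
        next
          assume "has E x k f"
          from hasE[OF this] show ?thesis unfolding F_def by metis
        qed
      qed
      have AA: "k = k' \<longleftrightarrow> f = f'" if h: "A k f" "A k' f'" for k f k' f'
        using precolD(5)[OF P, of u k f k' f'] h unfolding A_def by blast
      have AS: "k \<noteq> k' \<and> f \<noteq> f'" if h: "A k f" "S k' f'" for k f k' f'
        using precolD(5)[OF P, of u k f a ca] h hua unfolding A_def S_def by blast
      have BS: "\<not> (B k f \<and> S k' f')" for k f k' f'
        using sS[of x] iu2 unfolding B_def S_def by blast
      have FS: "\<not> (F k f \<and> S k' f')" for k f k' f'
        using sE[of x] unfolding F_def S_def by blast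
      assume "has ?Q x k f" "has ?Q x k' f'"
      from cl[OF this(1)] cl[OF this(2)] show "k = k' \<longleftrightarrow> f = f'"
      proof (elim disjE)
        assume "A k f" "A k' f'" then show ?thesis by (rule AA)
      next
        assume "A k f" "S k' f'" then show ?thesis using AS by blast
      next
        assume "S k f" "A k' f'" then show ?thesis using AS by blast
      next
        assume "B k f" "B k' f'" then show ?thesis by (simp add: B_def)
      next
        assume "S k f" "S k' f'" then show ?thesis by (simp add: S_def)
      next
        assume "F k f" "F k' f'" then show ?thesis by (simp add: F_def)
      qed (use BS FS in \<open>blast | simp add: A_def B_def F_def\<close>)+
    qed
    have Q: "precol (D - {a}) (C - {c}) ?Q"
    proof (rule precolI)
      fix v j e assume "(v, j, e) \<in> ?Q"
      then consider "(v, j, e) \<in> slice False a c P" | "(v, j, e) \<in> slice True a c P" | "(v, j, e) = s" | "(v, j, e) \<in> E" by blast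
      then show "v \<subseteq> D - {a} \<and> j \<in> D - {a} \<and> j \<notin> v \<and> e \<in> C - {c}"
      proof cases
        case 1
        then show ?thesis using precolD(1-4)[OF slice_precol[OF P, where i = a and c = c and b = False] 1] by blast
      next
        case 2
        then show ?thesis using precolD(1-4)[OF slice_precol[OF P, where i = a and c = c and b = True] 2] by blast
      next
        case 3
        then show ?thesis using u(1) iD aD iu2 caC cac unfolding s_def u'_def by auto
      next
        case 4
        then have "j1 = a" "v = W - {l}" "j = l" "e = c1" unfolding E_def by (auto split: if_splits)
        moreover have "W \<subseteq> D" "j1 \<notin> W" using precolD(1,3)[OF P p'] by auto
        ultimately show ?thesis using l w_facts(4) c1c by auto
      qed
    qed (rule Qcross)
    \<comment> \<open>The slices lose at least two edges of colour \<open>c\<close>. The star edge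
      of direction \<open>a\<close>, and the lone edge if it has this direction, are replaced by
      \<open>s\<close> and \<open>E\<close>.\<close>
    have cQ: "card ?Q + 2 \<le> card D"
    proof -
      let ?X = "{t \<in> P. snd (snd t) \<noteq> c \<and> fst (snd t) \<noteq> a}"
      let ?Y = "insert (u - {a}, a, ca) (if j1 = a then {(W, j1, c1)} else {})"
      have Sx: "?S \<subseteq> (\<lambda>(v, j, e). (v - {a}, j, e)) ` ?X" unfolding slice_def by force
      have "card ?S \<le> card ?X" using surj_card_le[OF _ Sx] finP by simp
      moreover have "card ?X + card (?Pc \<union> ?Y) \<le> card P"
      proof -
        have "?X \<inter> (?Pc \<union> ?Y) = {}" by auto
        then have "card ?X + card (?Pc \<union> ?Y) = card (?X \<union> (?Pc \<union> ?Y))"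
          using finP finPc by (intro card_Un_disjoint[symmetric]) auto
        also have "\<dots> \<le> card P" using finP aR p' by (intro card_mono) (auto simp: R_def)
        finally show ?thesis .
      qed
      moreover have "card (?Pc \<union> ?Y) = card ?Pc + card ?Y"
        using finPc cac c1c by (intro card_Un_disjoint) auto
      moreover have "card ?Y = Suc (card E)"
      proof -
        have "(u - {a}, a, ca) \<notin> (if j1 = a then {(W, j1, c1)} else {})" using aR unfolding R_def by simp
        moreover have "finite (if j1 = a then {(W, j1, c1)} else {})" by simp
        ultimately have "card ?Y = Suc (card (if j1 = a then {(W, j1, c1)} else {}))" by (rule card_insert_disjoint[rotated])
        then show ?thesis by (simp add: E_def)
      qed
      moreover have "card ?Q \<le> card ?S + 1 + card E"
        using card_Un_le[of "?S \<union> {s}" E] card_Un_le[of ?S "{s}"] by simp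
      ultimately show ?thesis using Pc2 cP by linarith
    qed
    obtain g where g: "coloring (D - {a}) (C - {c}) g" "\<forall>(v, j, e) \<in> ?Q. g v j = e"
      using few[OF aD(1) cC Q cQ] unfolding ext_def by blast
    \<comment> \<open>Edges of colour \<open>c\<close> in directions other than \<open>a\<close> are
      switched with the colours that \<open>g\<close> gives them.\<close>
    define Tc where "Tc = {(v - {a}, j, g (v - {a}) j) | v j. (v, j, c) \<in> P \<and> j \<noteq> a}"
    define T where "T = {s} \<union> E \<union> Tc"
    have hasTc: "\<exists>y. has P y k c \<and> k \<noteq> a \<and> y - {a} = x \<and> f = g (x - {k}) k" if h: "has Tc x k f" for x k f
    proof -
      obtain v where v: "x - {k} = v - {a}" "(v, k, c) \<in> P" "k \<noteq> a" "f = g (v - {a}) k"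
        using h unfolding has_def Tc_def by auto
      have "a \<notin> x" using v(1,3) by auto
      define y where "y = (if a \<in> v then insert a x else x)"
      have "y - {k} = v - {k}" using v(1) v(3) unfolding y_def by auto
      then have "y - {k} = v" using precolD(3)[OF P v(2)] by simp
      then have "has P y k c" using v(2) by (simp add: has_def)
      moreover have "y - {a} = x" using \<open>a \<notin> x\<close> by (auto simp: y_def)
      ultimately show ?thesis using v by metis
    qed
    have cs: False if h: "has Tc x k f" "x = u' \<or> x = nb u' i" for x k f
    proof -
      obtain y where y: "has P y k c" "y - {a} = x" using hasTc[OF h(1)] by blast
      have "i \<notin> x" using hc[OF y(1)] y(2) by auto
      then have "x = u'" using h(2) iu2 by auto
      then show False using Z y by blast
    qed
    have cE: False if h: "has Tc x k f" "i \<in> x" for x k f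
    proof -
      obtain y where y: "has P y k c" "y - {a} = x" using hasTc[OF h(1)] by blast
      then show False using hc[OF y(1)] h(2) by auto
    qed
    have Tm: "k = k' \<and> f = f'" if h: "has T x k f" "has T x k' f'" for x k f k' f'
    proof -
      have cc: "k = k' \<and> f = f'" if h: "has Tc x k f" "has Tc x k' f'"
      proof -
        obtain y where y: "has P y k c" "k \<noteq> a" "y - {a} = x" "f = g (x - {k}) k" using hasTc[OF h(1)] by blast
        obtain y' where y': "has P y' k' c" "k' \<noteq> a" "y' - {a} = x" "f' = g (x - {k'}) k'" using hasTc[OF h(2)] by blast
        have "(a \<in> y) = (a \<in> y')" using Za[OF y(1,2)] Za[OF y'(1,2)] by simp
        moreover have "y = y' \<or> y = nb y' a" using y(3) y'(3) Diff_eq_iff_nb by metis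
        ultimately have "y = y'" by auto
        then have "k = k'" using precolD(5)[OF P y(1), of k' c] y'(1) by simp
        then show ?thesis using y(4) y'(4) by simp
      qed
      have "has {s} x k f \<or> has E x k f \<or> has Tc x k f" "has {s} x k' f' \<or> has E x k' f' \<or> has Tc x k' f'"
        using h unfolding T_def has_Un by blast+
      then show ?thesis
      proof (elim disjE)
        assume "has {s} x k f" "has {s} x k' f'"
        from this[THEN hss] show ?thesis by simp
      next
        assume "has {s} x k f" "has E x k' f'"
        from hss[OF this(1)] hasE[OF this(2)] show ?thesis using sE[of x] by metis
      next
        assume "has {s} x k f" "has Tc x k' f'"
        from hss[OF this(1)] cs[OF this(2)] show ?thesis by metis
      next
        assume "has E x k f" "has {s} x k' f'"
        from hss[OF this(2)] hasE[OF this(1)] show ?thesis using sE[of x] by metis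
      next
        assume "has E x k f" "has E x k' f'"
        from this[THEN hasE] show ?thesis by simp
      next
        assume "has E x k f" "has Tc x k' f'"
        from hasE[OF this(1)] cE[OF this(2)] show ?thesis by metis
      next
        assume "has Tc x k f" "has {s} x k' f'"
        from hss[OF this(2)] cs[OF this(1)] show ?thesis by metis
      next
        assume "has Tc x k f" "has E x k' f'"
        from hasE[OF this(2)] cE[OF this(1)] show ?thesis by metis
      qed (rule cc)
    qed
    have Tp: "precol (D - {a}) (C - {c}) T"
    proof (rule precolI)
      fix v j e assume "(v, j, e) \<in> T"
      then consider "(v, j, e) \<in> ?Q" | "(v, j, e) \<in> Tc" unfolding T_def by blast
      then show "v \<subseteq> D - {a} \<and> j \<in> D - {a} \<and> j \<notin> v \<and> e \<in> C - {c}"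
      proof cases
        case 1
        then show ?thesis using precolD(1-4)[OF Q 1] by blast
      next
        case 2
        then obtain y where y: "v = y - {a}" "(y, j, c) \<in> P" "j \<noteq> a" "e = g v j" unfolding Tc_def by blast
        then have v: "v \<subseteq> D - {a}" "j \<in> D - {a}" "j \<notin> v" using precolD(1-3)[OF P y(2)] by auto
        then have "e \<in> C - {c}" using coloringD(1)[OF g(1) v(1)] y(4) by (auto simp: bij_betw_def)
        then show ?thesis using v by blast
      qed
    next
      fix x k f k' f' assume h: "has T x k f" "has T x k' f'"
      show "k = k' \<longleftrightarrow> f = f'" using Tm[OF h] by simp
    qed
    have "ext D C P"
    proof (rule strat[where g = "\<lambda>_. g", OF aD(1) cC P Tp _ g(1)])
      show "j = j'" if "has T x j e" "has T x j' e'" for x j e j' e' using Tm[OF that] by simp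
      show "g v j = e" if "(v, j, e) \<in> T" for v j e
      proof -
        from that consider "(v, j, e) \<in> ?Q" | "(v, j, e) \<in> Tc" unfolding T_def by blast
        then show ?thesis
        proof cases
          case 1
          then show ?thesis using bspec[OF g(2) 1] by simp
        next
          case 2
          then show ?thesis unfolding Tc_def by blast
        qed
      qed
      show "if e = c then \<forall>l e'. \<not> has T v l e' else \<exists>l. has T v l e" if q: "(v, a, e) \<in> P" for v e
      proof (cases "e = c")
        case True
        have hv: "has P v a c" "has P (nb v a) a c" using in_has[OF P q] True by auto
        have av: "v - {a} = v" using precolD(3)[OF P q] by simp
        have "\<not> has T v k f" for k f
        proof
          assume "has T v k f"
          then consider "has {s} v k f" | "has E v k f" | "has Tc v k f" unfolding T_def has_Un by blast
          then show False
          proof cases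
            case 1
            have "i \<notin> v" using hc[OF hv(1)] by simp
            moreover have "i \<in> nb u' i" using iu2(1) by (simp add: nb_def)
            ultimately have "v = u'" using hss[OF 1] by metis
            then show False using Z[of v a] av hv(1) by simp
          next
            case 2
            then show False using hasE[OF 2] hc[OF hv(1)] by blast
          next
            case 3
            then obtain y where y: "has P y k c" "k \<noteq> a" "y - {a} = v" using hasTc[OF 3] by blast
            have "y - {a} = v - {a}" using y(3) av by simp
            then have "y = v \<or> y = nb v a" unfolding Diff_eq_iff_nb .
            then have "has P y a c" using hv by blast
            then show False using precolD(5)[OF P y(1), of a c] y(2) by simp
          qed
        qed
        then show ?thesis using True by simp
      next
        case False
        from PR[OF q] have "has T u' i ca \<and> v = u' \<and> e = ca \<or> has T W l c1 \<and> v = W \<and> e = c1"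
        proof
          assume r: "(v, a, e) \<in> R"
          have st: "u - {a} = v" "has R u a e" using star[OF r False] by auto
          have "e = ca" using precolD(5)[OF R_precol st(2) a] by simp
          moreover have "has T u' i ca" unfolding has_def T_def s_def using iu2 by simp
          ultimately show ?thesis using st(1) by (simp add: u'_def)
        next
          assume e: "v = W \<and> a = j1 \<and> e = c1"
          then have "has T W l c1" unfolding has_def T_def E_def by simp
          then show ?thesis using e by blast
        qed
        then show ?thesis using False by auto
      qed
      show "\<exists>e'. (v - {a}, j, e') \<in> T" if "(v, j, c) \<in> P" "j \<noteq> a" for v j
        using that unfolding T_def Tc_def by blast
      fix v j e assume q: "(v, j, e) \<in> P" "j \<noteq> a" "e \<noteq> c"
      have jv: "j \<notin> v" "j \<noteq> i" using precolD(3)[OF P q(1)] dirne[OF q(1)] by auto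
      have "(v - {a}, j, e') \<notin> T" for e'
      proof
        assume "(v - {a}, j, e') \<in> T"
        then consider "(v - {a}, j, e') = s" | "(v - {a}, j, e') \<in> E" | "(v - {a}, j, e') \<in> Tc" unfolding T_def by blast
        then show False
        proof cases
          case 1
          then show False using jv(2) by (simp add: s_def)
        next
          case 2
          then have e: "j1 = a" "v - {a} = W - {l}" unfolding E_def by (auto split: if_splits)
          then have "i \<in> v" using iW l(3) by auto
          then show False using off[OF q(1)] q(2) e(1) by blast
        next
          case 3
          then obtain y where y: "v - {a} = y - {a}" "(y, j, c) \<in> P" unfolding Tc_def by blast
          have hy: "has P y j c" using in_has[OF P y(2)] .
          have "y = v \<or> y = nb v a" using y(1) Diff_eq_iff_nb by metis
          then show False
          proof
            assume "y = v"
            then show False using precolD(5)[OF P hy, of j e] in_has[OF P q(1)] q(3) by simp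
          next
            assume yv: "y = nb v a"
            from PR[OF q(1)] show False
            proof
              assume "(v, j, e) \<in> R"
              then have uv: "u - {j} = v" using star q(3) by blast
              then have "nb u a - {j} = y" using yv nb_Diff_neq[of a j u] q(2) by simp
              then have "has P (nb u a) j c" using y(2) by (simp add: has_def)
              then show False using Z[of "nb u a" j] by (simp add: u'_def)
            next
              assume "v = W \<and> j = j1 \<and> e = c1"
              then have "i \<in> y" using yv iW aD(2) by simp
              then show False using hc[OF hy] by blast
            qed
          qed
        qed
      qed
      moreover have "g (v - {a}) j = e"
      proof -
        have "(v - {a}, j, e) \<in> slice (a \<in> v) a c P" by (rule in_slice[OF q])
        then have "(v - {a}, j, e) \<in> ?Q" by (cases "a \<in> v") auto
        then show ?thesis using bspec[OF g(2), of "(v - {a}, j, e)"] by simp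
      qed
      ultimately show "(\<forall>e'. (v - {a}, j, e') \<notin> T) \<and> g (v - {a}) j = e" by blast
    qed
    then show False using ne by simp
  qed
qed

text \<open>If the lower half without the lone edge is good, the spare colour joins the halves. If
  not, it has a blocked edge, or else it has a repeated colour and a blocked vertex.\<close>

lemma single_side: "ext D C P"
proof (rule ccontr)
  assume ne: "\<not> ext D C P"
  obtain c' where c': "c' \<in> C" "\<And>v j. (v, j, c') \<notin> P" using spare_color by blast
  have c1c': "c1 \<noteq> c'" using c'(2) p' by blast
  have fins: "finite (D - {i})" "finite (C - {c'})" using D C by auto
  have cc: "card (C - {c'}) = card (D - {i})" using cards(1)[OF iD] cards(2)[OF c'(1)] by simp
  have Rp: "precol (D - {i}) (C - {c'}) R"
    by (rule precol_colors[OF R_precol]) (use precolD(4)[OF R_precol] c'(2) in \<open>auto simp: R_iff\<close>)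
  have Rle: "card R \<le> card (D - {i})" "card R < card D" using cR cards(1)[OF iD] d5 by simp_all
  have SR: "slice False i c' P = R"
    using sF c'(2) by (auto simp: R_iff)
  show False
  proof (cases "good (D - {i}) (C - {c'}) R")
    case True
    have "ext (D - {i}) (C - {c'}) (slice b i c' P)" for b
    proof (cases b)
      case b: True
      have "card (slice b i c' P) \<le> 1" using card_mono[OF _ sT, of c'] b by simp
      then show ?thesis using few[OF iD c'(1) slice_precol[OF P]] d5 by simp
    next
      case False
      then show ?thesis using almost[OF iD c'(1) Rp Rle(2) True] SR by simp
    qed
    note sl = this
    have "ext D C P"
    proof (rule split_unused[OF iD c'(1) P])
      fix v j e assume "(v, j, e) \<in> P"
      then show "j = i \<longleftrightarrow> e = c'" using iu c'(2) by metis
    qed (rule sl)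
    then show False using ne by contradiction
  next
    case False
    show False
    proof (cases "\<exists>u p. bade (D - {i}) (C - {c'}) R u p")
      case True
      then obtain u p where "bade (D - {i}) (C - {c'}) R u p" by metis
      then show False using bad_edge[OF c'(1) c'(2)] ne by metis
    next
      case nob: False
      then obtain u c where b: "c \<in> C" "badv (D - {i}) R u c" using False unfolding good_def by auto
      have "\<not> inj_on (snd \<circ> snd) R"
        using rainbow_bad[OF fins cc Rp Rle(1) _ False] nob by metis
      then show False using bad_vertex[OF c'(1) c'(2) b(2) b(1)] ne by metis
    qed
  qed
qed

end

end

section \<open>Dimensions up to four: a search through all patterns\<close>

text \<open>The standard colours used in the rows, as opposed to the natural numbers that name the
  colours of a pattern.\<close>

datatype hue = k0 | k1 | k2 | k3

text \<open>Both ends and the direction of an edge; with both ends stored, adjacency is a comparison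
  of lists.\<close>

type_synonym link = "bool list \<times> bool list \<times> nat"

fun shr :: "link \<Rightarrow> link \<Rightarrow> bool" where
  "shr (x, y, _) (z, w, _) = (x = z \<or> x = w \<or> y = z \<or> y = w)"

fun impr :: "link \<Rightarrow> 'c \<Rightarrow> (link \<times> 'c) list \<Rightarrow> bool" where
  "impr e c [] = False"
| "impr e c ((e', c') # ch) = ((c = c' \<and> shr e e') \<or> impr e c ch)"

fun get :: "hue list \<Rightarrow> nat \<Rightarrow> hue" where
  "get [] n = k0"
| "get (x # xs) 0 = x"
| "get (x # xs) (Suc n) = get xs n"

fun keep :: "bool \<Rightarrow> 'a \<Rightarrow> 'a list \<Rightarrow> 'a list" where
  "keep True s t = s # t"
| "keep False s t = t"

fun nin :: "hue \<Rightarrow> hue list \<Rightarrow> bool" where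
  "nin x [] = True"
| "nin x (y # ys) = (x \<noteq> y \<and> nin x ys)"

text \<open>\<open>same\<close>, \<open>fresh\<close> and \<open>skip\<close> filter the candidates
  for the three choices at the next edge: the old colour \<open>c\<close>, a new colour, or no
  colour.\<close>

fun same :: "nat \<Rightarrow> (hue list \<times> hue list) list \<Rightarrow> (hue list \<times> hue list) list" where
  "same c [] = []"
| "same c ((h, []) # fs) = same c fs"
| "same c ((h, x # r) # fs) = keep (get h c = x) (h, r) (same c fs)"

fun fresh :: "(hue list \<times> hue list) list \<Rightarrow> (hue list \<times> hue list) list" where
  "fresh [] = []"
| "fresh ((h, []) # fs) = fresh fs"
| "fresh ((h, x # r) # fs) = keep (nin x h) (h @ [x], r) (fresh fs)"

fun skip :: "(hue list \<times> hue list) list \<Rightarrow> (hue list \<times> hue list) list" where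
  "skip [] = []"
| "skip ((h, []) # fs) = skip fs"
| "skip ((h, x # r) # fs) = (h, r) # skip fs"

text \<open>For an improper pattern \<open>bump\<close> keeps the number of missing edges positive
  while \<open>cut\<close> empties the list of edges, which ends the branch successfully.\<close>

fun bump :: "bool \<Rightarrow> nat \<Rightarrow> nat" where
  "bump True k = Suc k"
| "bump False k = k"

fun cut :: "bool \<Rightarrow> 'a list \<Rightarrow> 'a list" where
  "cut True es = []"
| "cut False es = es"

lemma cut_length [termination_simp]: "length (cut b es) \<le> length es" by (cases b) auto

fun at :: "bool list \<Rightarrow> link \<Rightarrow> bool" where
  "at u (x, y, _) = (u = x \<or> u = y)"

fun starred :: "bool list \<Rightarrow> nat \<Rightarrow> (link \<times> nat) list \<Rightarrow> bool" where
  "starred u j [] = False"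
| "starred u j (((x, y, i), c) # ch) = ((i = j \<and> at u (x, y, i)) \<or> starred u j ch)"

fun seen :: "bool list \<Rightarrow> nat \<Rightarrow> (link \<times> nat) list \<Rightarrow> bool" where
  "seen u c [] = False"
| "seen u c ((e, c') # ch) = ((c' = c \<and> at u e) \<or> seen u c ch)"

fun flip :: "bool list \<Rightarrow> nat \<Rightarrow> bool list" where
  "flip [] j = []"
| "flip (b # u) 0 = (\<not> b) # u"
| "flip (b # u) (Suc j) = b # flip u j"

fun blocked :: "bool list \<Rightarrow> nat \<Rightarrow> (link \<times> nat) list \<Rightarrow> nat list \<Rightarrow> bool" where
  "blocked u c ch [] = True"
| "blocked u c ch (j # js) = ((starred u j ch \<or> seen (flip u j) c ch) \<and> blocked u c ch js)"

fun bad1 :: "bool list \<Rightarrow> (link \<times> nat) list \<Rightarrow> nat list \<Rightarrow> nat list \<Rightarrow> bool" where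
  "bad1 u ch js [] = False"
| "bad1 u ch js (c # cs) = ((\<not> seen u c ch \<and> blocked u c ch js) \<or> bad1 u ch js cs)"

fun badv1 :: "(link \<times> nat) list \<Rightarrow> nat list \<Rightarrow> nat list \<Rightarrow> bool list list \<Rightarrow> bool" where
  "badv1 ch js cs [] = False"
| "badv1 ch js cs (u # us) = (bad1 u ch js cs \<or> badv1 ch js cs us)"

text \<open>With \<open>d\<close> coloured edges of \<open>d\<close> different colours, an
  uncoloured edge touched by all of them is blocked; no search over colours is needed.\<close>

fun allnear :: "link \<Rightarrow> (link \<times> nat) list \<Rightarrow> bool" where
  "allnear e [] = True"
| "allnear e ((e', _) # ch) = (e \<noteq> e' \<and> shr e e' \<and> allnear e ch)"

fun bade1 :: "(link \<times> nat) list \<Rightarrow> link list \<Rightarrow> bool" where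
  "bade1 ch [] = False"
| "bade1 ch (e # es) = (allnear e ch \<or> bade1 ch es)"

fun along :: "nat \<Rightarrow> (link \<times> nat) list \<Rightarrow> bool" where
  "along j [] = True"
| "along j (((_, _, i), _) # ch) = (i = j \<and> along j ch)"

definition verts :: "nat \<Rightarrow> bool list list" where
  "verts d = List.n_lists d [False, True]"

definition links :: "nat \<Rightarrow> link list" where
  "links d = [(x, x[j := True], j). x \<leftarrow> verts d, j \<leftarrow> [0..<d], \<not> x ! j]"

text \<open>A leaf is accepted if a candidate has survived or if the pattern is excluded: by a
  blocked vertex or, with all \<open>d\<close> colours present, by a blocked edge or (C4). Direction
  0 suffices there because the first edge of every pattern has direction 0.\<close>

fun lf :: "nat \<Rightarrow> nat list \<Rightarrow> (link \<times> nat) list \<Rightarrow> 'a list \<Rightarrow> bool" where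
  "lf d cs ch (s # fs) = True"
| "lf d cs ch [] = (badv1 ch [0..<d] cs (verts d) \<or> (length cs = d \<and> (bade1 ch (links d) \<or> d = 3 \<and> along 0 ch)))"

text \<open>\<open>chk\<close> runs through all patterns on the remaining edges, up to renaming of the colours: \<open>rest\<close> lists the old
  colours still to be tried on the next edge, and every candidate in \<open>fs\<close> is a coloring that fits the pattern so far,
  stored as its values on the colours of the pattern and on the remaining edges. An improper pattern is abandoned by
  \<open>bump\<close> and \<open>cut\<close>. There are no conditionals, since the simplifier would traverse their large arguments again.\<close>

fun chk :: "nat \<Rightarrow> nat list \<Rightarrow> (link \<times> nat) list \<Rightarrow> nat list \<Rightarrow> nat \<Rightarrow>
    (hue list \<times> hue list) list \<Rightarrow> link list \<Rightarrow> bool" where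
  "chk d rest ch cs 0 fs es = lf d cs ch fs"
| "chk d rest ch cs (Suc k) fs [] = True"
| "chk d (c # rest) ch cs (Suc k) fs (e # es) =
    (chk d cs ((e, c) # ch) cs (bump (impr e c ch) k) (same c fs) (cut (impr e c ch) es) \<and>
     chk d rest ch cs (Suc k) fs (e # es))"
| "chk d [] ch cs (Suc k) fs (e # es) =
    (chk d (cs @ [length cs]) ((e, length cs) # ch) (cs @ [length cs]) k (fresh fs) es \<and>
     chk d cs ch cs (Suc k) (skip fs) es)"

fun okr :: "(link \<times> hue) list \<Rightarrow> link list \<Rightarrow> hue list \<Rightarrow> bool" where
  "okr ch [] [] = True"
| "okr ch (e # es) (x # r) = (\<not> impr e x ch \<and> okr ((e, x) # ch) es r)"
| "okr ch _ _ = False"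

fun inits :: "hue list list \<Rightarrow> (hue list \<times> hue list) list" where
  "inits [] = []"
| "inits ((x # r) # rs) = ([x], r) # inits rs"
| "inits ([] # rs) = inits rs"

text \<open>Up to a reflection and a permutation of the directions the first link is coloured, and
  up to renaming its colour is 0; \<open>d - 1\<close> edges remain.\<close>

definition total :: "nat \<Rightarrow> hue list list \<Rightarrow> bool" where
  "total d rs \<longleftrightarrow> chk d [0] [(hd (links d), 0)] [0] (d - 1) (inits rs) (tl (links d))"

definition rows_ok :: "nat \<Rightarrow> hue list list \<Rightarrow> bool" where
  "rows_ok d rs \<longleftrightarrow> list_all (\<lambda>r. okr [] (links d) r \<and> list_all (\<lambda>x. List.member (take d [k0, k1, k2, k3]) x) r) rs"

lemma keep_iff: "s \<in> set (keep b t fs) \<longleftrightarrow> b \<and> s = t \<or> s \<in> set fs"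
  by (cases b) auto

lemma get_nth: "c < length h \<Longrightarrow> get h c = h ! c"
  by (induction h c rule: get.induct) auto

lemma nin_iff: "nin x h \<longleftrightarrow> x \<notin> set h"
  by (induction h) auto

lemma in_same: "(h, r) \<in> set (same c fs) \<Longrightarrow> \<exists>x. (h, x # r) \<in> set fs \<and> get h c = x"
  by (induction c fs rule: same.induct) (auto simp: keep_iff)

lemma in_fresh: "(h, r) \<in> set (fresh fs) \<Longrightarrow> \<exists>x h'. (h', x # r) \<in> set fs \<and> h = h' @ [x] \<and> x \<notin> set h'"
  by (induction fs rule: fresh.induct) (auto simp: keep_iff nin_iff)

lemma in_skip: "(h, r) \<in> set (skip fs) \<Longrightarrow> \<exists>x. (h, x # r) \<in> set fs"
  by (induction fs rule: skip.induct) auto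

lemma in_inits: "(h, r) \<in> set (inits rs) \<Longrightarrow> \<exists>x. x # r \<in> set rs \<and> h = [x]"
  by (induction rs rule: inits.induct) auto

lemma impr_iff: "impr e c ch \<longleftrightarrow> (\<exists>e'. (e', c) \<in> set ch \<and> shr e e')"
  by (induction e c ch rule: impr.induct) auto

lemma seen_iff: "seen u c ch \<longleftrightarrow> (\<exists>e. (e, c) \<in> set ch \<and> at u e)"
  by (induction u c ch rule: seen.induct) (auto simp del: at.simps)

lemma starred_iff: "starred u j ch \<longleftrightarrow> (\<exists>x y c. ((x, y, j), c) \<in> set ch \<and> at u (x, y, j))"
  by (induction u j ch rule: starred.induct) auto

lemma blocked_iff: "blocked u c ch js \<longleftrightarrow> (\<forall>j\<in>set js. starred u j ch \<or> seen (flip u j) c ch)"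
  by (induction js) auto

lemma bad1_iff: "bad1 u ch js cs \<longleftrightarrow> (\<exists>c\<in>set cs. \<not> seen u c ch \<and> blocked u c ch js)"
  by (induction cs) auto

lemma badv1_iff: "badv1 ch js cs us \<longleftrightarrow> (\<exists>u\<in>set us. bad1 u ch js cs)"
  by (induction us) auto

lemma allnear_iff: "allnear e ch \<longleftrightarrow> (\<forall>(e', c)\<in>set ch. e \<noteq> e' \<and> shr e e')"
  by (induction e ch rule: allnear.induct) auto

lemma bade1_iff: "bade1 ch es \<longleftrightarrow> (\<exists>e\<in>set es. allnear e ch)"
  by (induction es) auto

lemma along_iff: "along j ch \<longleftrightarrow> (\<forall>((x, y, i), c)\<in>set ch. i = j)"
  by (induction j ch rule: along.induct) auto

lemma lf_iff: "lf d cs ch fs \<longleftrightarrow> fs \<noteq> [] \<or> badv1 ch [0..<d] cs (verts d) \<or>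
    length cs = d \<and> (bade1 ch (links d) \<or> d = 3 \<and> along 0 ch)"
  by (cases fs) auto

lemma flip_nth: "j < length u \<Longrightarrow> flip u j = u[j := \<not> u ! j]"
  by (induction u j rule: flip.induct) auto

section \<open>Soundness of the search\<close>

text \<open>The pattern \<open>ch\<close> arises from the actual precoloring \<open>col\<close> by
  the renaming \<open>\<rho>\<close> of the colours \<open>X\<close> met so far.\<close>

definition traced :: "(link \<Rightarrow> hue) set \<Rightarrow> (link \<Rightarrow> nat option) \<Rightarrow> (nat \<Rightarrow> nat) \<Rightarrow> nat set \<Rightarrow>
    (link \<times> nat) list \<Rightarrow> nat list \<Rightarrow> bool" where
  "traced Fs col \<rho> X ch cs \<longleftrightarrow> inj_on \<rho> X \<and> \<rho> ` X = set cs \<and> cs = [0..<length cs] \<and>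
     (\<forall>x\<in>X. \<exists>e. col e = Some x) \<and> (\<forall>(e, c)\<in>set ch. \<exists>x\<in>X. col e = Some x \<and> c = \<rho> x)"

text \<open>\<open>F\<close> is the full coloring behind the stored candidate. Distinctness of the
  stored values makes different pattern colours different in \<open>F\<close>.\<close>

definition follows :: "(link \<Rightarrow> hue) set \<Rightarrow> (link \<times> nat) list \<Rightarrow> nat list \<Rightarrow> hue list \<times> hue list \<Rightarrow> link list \<Rightarrow> bool" where
  "follows Fs ch cs s es \<longleftrightarrow> length (fst s) = length cs \<and> distinct (fst s) \<and>
     (\<exists>F\<in>Fs. snd s = map F es \<and> (\<forall>(e, c)\<in>set ch. c < length cs \<and> F e = fst s ! c))"

text \<open>Follow the branch that agrees with \<open>col\<close>. It is never abandoned as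
  improper, because \<open>col\<close> is proper, and it ends in a leaf whose pattern contains every
  coloured edge.\<close>

lemma chk_sound:
  assumes sep: "\<And>e e' x. col e = Some x \<Longrightarrow> col e' = Some x \<Longrightarrow> e \<noteq> e' \<Longrightarrow> \<not> shr e e'"
  shows "chk d rest ch cs k fs es \<Longrightarrow> traced Fs col \<rho> X ch cs \<Longrightarrow> \<forall>s\<in>set fs. follows Fs ch cs s es \<Longrightarrow>
    distinct es \<Longrightarrow> set es \<inter> fst ` set ch = {} \<Longrightarrow> length (filter (\<lambda>e. col e \<noteq> None) es) = k \<Longrightarrow>
    (\<And>e es' x. es = e # es' \<Longrightarrow> col e = Some x \<Longrightarrow> x \<in> X \<Longrightarrow> \<rho> x \<in> set rest) \<Longrightarrow>
    \<exists>\<rho> X ch' cs' fs' es'. traced Fs col \<rho> X ch' cs' \<and> (\<forall>s\<in>set fs'. follows Fs ch' cs' s es') \<and> lf d cs' ch' fs' \<and>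
      fst ` set ch' = fst ` set ch \<union> {e \<in> set es. col e \<noteq> None}"
proof (induction d rest ch cs k fs es arbitrary: \<rho> X rule: chk.induct)
  case (1 d rest ch cs fs es)
  have "{e \<in> set es. col e \<noteq> None} = {}" using 1(6) by (auto simp: filter_empty_conv)
  then show ?case using 1(1,2,3) by (metis chk.simps(1) Un_empty_right)
next
  case (2 d rest ch cs k fs)
  then show ?case by simp
next
  case (3 d c rest ch cs k fs e es)
  show ?case
  proof (cases "\<exists>x\<in>X. col e = Some x \<and> \<rho> x = c")
    case True
    then obtain x where x: "x \<in> X" "col e = Some x" "\<rho> x = c" by blast
    have en: "e \<notin> fst ` set ch" using 3(7) by auto
    have ni: "\<not> impr e c ch"
    proof
      assume "impr e c ch"
      then obtain e' where e': "(e', c) \<in> set ch" "shr e e'" unfolding impr_iff by blast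
      then obtain y where y: "y \<in> X" "col e' = Some y" "c = \<rho> y" using 3(4) unfolding traced_def by fastforce
      have "y = x" using 3(4) x y unfolding traced_def by (metis inj_onD)
      moreover have "e \<noteq> e'" using en e'(1) by force
      ultimately show False using sep[OF x(2), of e'] y(2) e'(2) by simp
    qed
    have cl: "c < length cs"
      using 3(4) x unfolding traced_def by (metis atLeastLessThan_iff image_eqI set_upt)
    have tr: "traced Fs col \<rho> X ((e, c) # ch) cs" using 3(4) x unfolding traced_def by auto
    have fo: "\<forall>s\<in>set (same c fs). follows Fs ((e, c) # ch) cs s es"
    proof
      fix s assume s: "s \<in> set (same c fs)"
      obtain h r where hr: "s = (h, r)" by (cases s)
      obtain z where z: "(h, z # r) \<in> set fs" "get h c = z" using in_same s hr by blast
      have f: "follows Fs ch cs (h, z # r) (e # es)" using 3(5) z(1) by blast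
      then obtain F where F: "F \<in> Fs" "z # r = map F (e # es)" "\<forall>(e, c)\<in>set ch. c < length cs \<and> F e = h ! c"
        unfolding follows_def by auto
      have "F e = h ! c" using F(2) z(2) get_nth[of c h] f cl unfolding follows_def by simp
      then show "follows Fs ((e, c) # ch) cs s es" using f F cl unfolding follows_def hr by auto
    qed
    have "\<exists>\<rho> X ch' cs' fs' es'. traced Fs col \<rho> X ch' cs' \<and> (\<forall>s\<in>set fs'. follows Fs ch' cs' s es') \<and> lf d cs' ch' fs' \<and>
      fst ` set ch' = fst ` set ((e, c) # ch) \<union> {e' \<in> set (cut (impr e c ch) es). col e' \<noteq> None}"
    proof (rule 3(1)[OF _ tr])
      show "chk d cs ((e, c) # ch) cs (bump (impr e c ch) k) (same c fs) (cut (impr e c ch) es)" using 3(3) by simp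
      show "\<forall>s\<in>set (same c fs). follows Fs ((e, c) # ch) cs s (cut (impr e c ch) es)" using fo ni by simp
      show "distinct (cut (impr e c ch) es)" using 3(6) ni by simp
      show "set (cut (impr e c ch) es) \<inter> fst ` set ((e, c) # ch) = {}" using 3(6,7) ni by auto
      show "length (filter (\<lambda>e. col e \<noteq> None) (cut (impr e c ch) es)) = bump (impr e c ch) k" using 3(8) x(2) ni by simp
      show "\<rho> z \<in> set cs" if "z \<in> X" for z using 3(4) that unfolding traced_def by blast
    qed
    moreover have "fst ` set ((e, c) # ch) \<union> {e' \<in> set (cut (impr e c ch) es). col e' \<noteq> None} =
        fst ` set ch \<union> {e' \<in> set (e # es). col e' \<noteq> None}" using ni x(2) by auto
    ultimately show ?thesis by simp
  next
    case False
    show ?thesis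
    proof (rule 3(2)[OF _ 3(4,5,6,7,8)])
      show "chk d rest ch cs (Suc k) fs (e # es)" using 3(3) by simp
      fix e' es' x assume "e # es = e' # es'" "col e' = Some x" "x \<in> X"
      then show "\<rho> x \<in> set rest" using 3(9)[of e' es' x] False by auto
    qed
  qed
next
  case (4 d ch cs k fs e es)
  show ?case
  proof (cases "col e")
    case None
    have fo: "\<forall>s\<in>set (skip fs). follows Fs ch cs s es"
    proof
      fix s assume s: "s \<in> set (skip fs)"
      obtain h r where hr: "s = (h, r)" by (cases s)
      obtain z where "(h, z # r) \<in> set fs" using in_skip s hr by blast
      then have "follows Fs ch cs (h, z # r) (e # es)" using 4(5) by blast
      then show "follows Fs ch cs s es" unfolding follows_def hr by auto
    qed
    have "\<exists>\<rho> X ch' cs' fs' es'. traced Fs col \<rho> X ch' cs' \<and> (\<forall>s\<in>set fs'. follows Fs ch' cs' s es') \<and> lf d cs' ch' fs' \<and>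
      fst ` set ch' = fst ` set ch \<union> {e' \<in> set es. col e' \<noteq> None}"
    proof (rule 4(2)[OF _ 4(4) fo])
      show "chk d cs ch cs (Suc k) (skip fs) es" using 4(3) by simp
      show "distinct es" "set es \<inter> fst ` set ch = {}" using 4(6,7) by auto
      show "length (filter (\<lambda>e. col e \<noteq> None) es) = Suc k" using 4(8) None by simp
      show "\<rho> z \<in> set cs" if "z \<in> X" for z using 4(4) that unfolding traced_def by blast
    qed
    moreover have "{e' \<in> set (e # es). col e' \<noteq> None} = {e' \<in> set es. col e' \<noteq> None}" using None by auto
    ultimately show ?thesis by simp
  next
    case (Some x)
    let ?n = "length cs"
    \<comment> \<open>All old colours have been tried, so the colour of \<open>e\<close> is new and
      gets the next number.\<close>
    have xX: "x \<notin> X" using 4(9)[of e es x] Some by auto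
    define \<rho>' where "\<rho>' = \<rho>(x := ?n)"
    have old: "\<rho>' z = \<rho> z" if "z \<in> X" for z using that xX unfolding \<rho>'_def by auto
    have im: "\<rho> ` X = set cs" and cs: "cs = [0..<?n]" and inj: "inj_on \<rho> X"
      using 4(4) unfolding traced_def by auto
    have sc: "set cs = {0..<?n}" using cs by (metis set_upt)
    have nn: "?n \<notin> \<rho> ` X" unfolding im sc by simp
    have tr: "traced Fs col \<rho>' (insert x X) ((e, ?n) # ch) (cs @ [?n])"
      unfolding traced_def
    proof (intro conjI)
      have "inj_on \<rho>' X" using inj old by (auto simp: inj_on_def)
      moreover have "\<rho>' ` X = \<rho> ` X" using old by auto
      moreover have "\<rho>' x = ?n" by (simp add: \<rho>'_def)
      ultimately show "inj_on \<rho>' (insert x X)" "\<rho>' ` insert x X = set (cs @ [?n])" using nn im xX by auto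
      show "cs @ [?n] = [0..<length (cs @ [?n])]" using cs by simp
      have "\<forall>y\<in>X. \<exists>e. col e = Some y" using 4(4) unfolding traced_def by (elim conjE)
      then show "\<forall>y\<in>insert x X. \<exists>e. col e = Some y" using Some by blast
      show "\<forall>(e, c)\<in>set ((e, ?n) # ch). \<exists>y\<in>insert x X. col e = Some y \<and> c = \<rho>' y"
      proof (clarify)
        fix f c assume "(f, c) \<in> set ((e, ?n) # ch)"
        then consider "f = e" "c = ?n" | "(f, c) \<in> set ch" by auto
        then show "\<exists>y\<in>insert x X. col f = Some y \<and> c = \<rho>' y"
        proof cases
          case 1
          then show ?thesis using Some by (auto simp: \<rho>'_def)
        next
          case 2
          then obtain y where "y \<in> X" "col f = Some y" "c = \<rho> y" using 4(4) unfolding traced_def by blast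
          then show ?thesis using old by auto
        qed
      qed
    qed
    have fo: "\<forall>s\<in>set (fresh fs). follows Fs ((e, ?n) # ch) (cs @ [?n]) s es"
    proof
      fix s assume s: "s \<in> set (fresh fs)"
      obtain h r where hr: "s = (h, r)" by (cases s)
      obtain z h' where z: "(h', z # r) \<in> set fs" "h = h' @ [z]" "z \<notin> set h'" using in_fresh s hr by blast
      have f: "follows Fs ch cs (h', z # r) (e # es)" using 4(5) z(1) by blast
      then obtain F where F: "F \<in> Fs" "z # r = map F (e # es)" "\<forall>(e, c)\<in>set ch. c < length cs \<and> F e = h' ! c"
        unfolding follows_def by auto
      have l: "length h' = ?n" "distinct h'" using f unfolding follows_def by auto
      have "\<forall>(f, c)\<in>set ((e, ?n) # ch). c < length (cs @ [?n]) \<and> F f = h ! c"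
      proof (clarify)
        fix f c assume "(f, c) \<in> set ((e, ?n) # ch)"
        then consider "f = e" "c = ?n" | "(f, c) \<in> set ch" by auto
        then show "c < length (cs @ [?n]) \<and> F f = h ! c"
        proof cases
          case 1
          then show ?thesis using F(2) z(2) l by (simp add: nth_append)
        next
          case 2
          then have "c < ?n \<and> F f = h' ! c" using F(3) by blast
          then show ?thesis using z(2) l by (simp add: nth_append)
        qed
      qed
      then show "follows Fs ((e, ?n) # ch) (cs @ [?n]) s es"
        unfolding follows_def hr using F(1,2) z l by auto
    qed
    have "\<exists>\<rho> X ch' cs' fs' es'. traced Fs col \<rho> X ch' cs' \<and> (\<forall>s\<in>set fs'. follows Fs ch' cs' s es') \<and> lf d cs' ch' fs' \<and>
      fst ` set ch' = fst ` set ((e, ?n) # ch) \<union> {e' \<in> set es. col e' \<noteq> None}"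
    proof (rule 4(1)[OF _ tr fo])
      show "chk d (cs @ [?n]) ((e, ?n) # ch) (cs @ [?n]) k (fresh fs) es" using 4(3) by simp
      show "distinct es" "set es \<inter> fst ` set ((e, ?n) # ch) = {}" using 4(6,7) by auto
      show "length (filter (\<lambda>e. col e \<noteq> None) es) = k" using 4(8) Some by simp
      show "\<rho>' z \<in> set (cs @ [?n])" if "z \<in> insert x X" for z using tr that unfolding traced_def by blast
    qed
    moreover have "fst ` set ((e, ?n) # ch) \<union> {e' \<in> set es. col e' \<noteq> None} =
        fst ` set ch \<union> {e' \<in> set (e # es). col e' \<noteq> None}" using Some by auto
    ultimately show ?thesis by simp
  qed
qed

lemma okr_length: "okr ch es r \<Longrightarrow> length r = length es"
  by (induction ch es r rule: okr.induct) auto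

text \<open>The list \<open>ch\<close> collects the edges already passed, so two edges are compared
  when the later one is reached.\<close>

lemma okr_proper:
  "okr ch es r \<Longrightarrow> p \<in> set (zip es r) \<Longrightarrow> q \<in> set ch \<union> set (zip es r) \<Longrightarrow> fst p \<noteq> fst q \<Longrightarrow>
    shr (fst p) (fst q) \<Longrightarrow> snd p \<noteq> snd q"
proof (induction ch es r arbitrary: p q rule: okr.induct)
  case (2 ch e es x r)
  have ni: "\<not> impr e x ch" and ok: "okr ((e, x) # ch) es r" using 2(2) by auto
  have sym: "shr e1 e2 = shr e2 e1" for e1 e2 by (cases e1; cases e2) auto
  consider "p = (e, x)" "q \<in> set ch" | "p = (e, x)" "q \<in> set (zip es r)"
    | "p \<in> set (zip es r)" "q \<in> set ((e, x) # ch) \<union> set (zip es r)" using 2(3,4,5) by auto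
  then show ?case
  proof cases
    case 1
    then show ?thesis using ni 2(6) unfolding impr_iff by (metis fst_conv prod.collapse snd_conv)
  next
    case 2
    then show ?thesis using "2.IH"[OF ok 2(2), of "(e, x)"] "2.prems"(4,5) sym by auto
  next
    case 3
    then show ?thesis using "2.IH"[OF ok 3] "2.prems"(4,5) by blast
  qed
qed auto

section \<open>From sets of coordinates to lists\<close>

lemma set_verts: "set (verts d) = {xs. length xs = d}"
  by (auto simp: verts_def set_n_lists)

lemma set_links: "set (links d) = {(x, x[j := True], j) | x j. length x = d \<and> j < d \<and> \<not> x ! j}"
  unfolding links_def by (auto simp: set_verts)

lemma distinct_concat_map:
  "distinct xs \<Longrightarrow> (\<And>x. x \<in> set xs \<Longrightarrow> distinct (f x)) \<Longrightarrow>
    (\<And>x y z. x \<in> set xs \<Longrightarrow> y \<in> set xs \<Longrightarrow> z \<in> set (f x) \<Longrightarrow> z \<in> set (f y) \<Longrightarrow> x = y) \<Longrightarrow> distinct (concat (map f xs))"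
proof (induction xs)
  case (Cons x xs)
  have "distinct (concat (map f xs))"
  proof (rule Cons.IH)
    show "distinct xs" using Cons.prems(1) by simp
    show "distinct (f x)" if "x \<in> set xs" for x using Cons.prems(2)[of x] that by simp
    show "x = y" if "x \<in> set xs" "y \<in> set xs" "z \<in> set (f x)" "z \<in> set (f y)" for x y z
      using Cons.prems(3)[of x y z] that by simp
  qed
  moreover have "set (f x) \<inter> set (f y) = {}" if "y \<in> set xs" for y
    using Cons.prems(1) Cons.prems(3)[of x y] that by auto
  ultimately show ?case using Cons.prems(2)[of x] by auto
qed simp

lemma distinct_links: "distinct (links d)"
  unfolding links_def verts_def
  by (intro distinct_concat_map distinct_n_lists) (auto split: if_splits)

lemma Diff_singleton_eqD:
  assumes h: "u - {b} = x - {b}" shows "u = x - {b} \<or> u = insert b x"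
proof (cases "b \<in> u")
  case True
  have "insert b (u - {b}) = insert b (x - {b})" by (simp only: h)
  then show ?thesis using True by (simp add: insert_absorb)
next
  case False
  then have "u - {b} = u" by simp
  then show ?thesis using h by metis
qed

text \<open>The numbering \<open>a\<close> of the directions turns the subsets of \<open>D\<close>
  into the Boolean lists of the search.\<close>

locale grid =
  fixes a :: "nat \<Rightarrow> nat" and d :: nat and D C :: "nat set" and P :: precoloring
  assumes a: "inj_on a {..<d}" and D: "D = a ` {..<d}" and C: "finite C" "card C = d" and P: "precol D C P"
begin

definition vl :: "nat set \<Rightarrow> bool list" where "vl x = map (\<lambda>j. a j \<in> x) [0..<d]"

definition mk :: "nat set \<Rightarrow> nat \<Rightarrow> link" where "mk x j = (vl (x - {a j}), vl (insert (a j) x), j)"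

lemma vl_length [simp]: "length (vl x) = d" by (simp add: vl_def)

lemma vl_nth [simp]: "j < d \<Longrightarrow> vl x ! j \<longleftrightarrow> a j \<in> x" by (simp add: vl_def)

lemma a_eq: "i < d \<Longrightarrow> j < d \<Longrightarrow> a i = a j \<longleftrightarrow> i = j" using a by (auto simp: inj_on_def)

lemma vl_eq: "x \<subseteq> D \<Longrightarrow> y \<subseteq> D \<Longrightarrow> vl x = vl y \<longleftrightarrow> x = y"
proof
  assume h: "x \<subseteq> D" "y \<subseteq> D" "vl x = vl y"
  have "a j \<in> x \<longleftrightarrow> a j \<in> y" if "j < d" for j using h(3) vl_nth[OF that] by metis
  then show "x = y" using h(1,2) D by blast
qed simp

lemma vl_update: "j < d \<Longrightarrow> (vl x)[j := b] = vl (if b then insert (a j) x else x - {a j})"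
  by (rule nth_equalityI) (auto simp: nth_list_update a_eq)

lemma vl_surj: assumes l: "length xs = d" shows "\<exists>x\<subseteq>D. xs = vl x"
proof -
  let ?x = "{a i | i. i < d \<and> xs ! i}"
  have "xs = vl ?x"
  proof (rule nth_equalityI)
    show "length xs = length (vl ?x)" using l by simp
    fix i assume "i < length xs"
    then have i: "i < d" using l by simp
    have "a i \<in> ?x \<longleftrightarrow> xs ! i" using i a_eq by auto
    then show "xs ! i = vl ?x ! i" unfolding vl_nth[OF i] by (rule sym)
  qed
  moreover have "?x \<subseteq> D" using D by auto
  ultimately show ?thesis by blast
qed

lemma aD: "j < d \<Longrightarrow> a j \<in> D" using D by auto

lemma mk_links: "j < d \<Longrightarrow> mk x j \<in> set (links d)"
  unfolding set_links mk_def
  using vl_update[of j "x - {a j}" True] by (auto intro!: exI[of _ "vl (x - {a j})"])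

lemma links_mk: assumes "e \<in> set (links d)" shows "\<exists>x j. x \<subseteq> D \<and> j < d \<and> a j \<notin> x \<and> e = mk x j"
proof -
  obtain xs j where e: "e = (xs, xs[j := True], j)" "length xs = d" "j < d" "\<not> xs ! j" using assms unfolding set_links by blast
  obtain x where x: "x \<subseteq> D" "xs = vl x" using vl_surj[OF e(2)] by blast
  have "a j \<notin> x" using e(3,4) x(2) by simp
  then show ?thesis using x e vl_update[OF e(3), of x True] by (intro exI[of _ x] exI[of _ j]) (simp add: mk_def)
qed

lemma mk_eq: "x \<subseteq> D \<Longrightarrow> y \<subseteq> D \<Longrightarrow> j < d \<Longrightarrow> k < d \<Longrightarrow> mk x j = mk y k \<longleftrightarrow> j = k \<and> x - {a j} = y - {a k}"
  using aD[of j] unfolding mk_def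
  by (auto simp: vl_eq subset_insertI2 insert_absorb)

lemma at_mk: assumes h: "x \<subseteq> D" "u \<subseteq> D" "j < d"
  shows "at (vl u) (mk x j) \<longleftrightarrow> u - {a j} = x - {a j}"
proof -
  have s: "x - {a j} \<subseteq> D" "insert (a j) x \<subseteq> D" using h aD[OF h(3)] by blast+
  have "at (vl u) (mk x j) \<longleftrightarrow> u = x - {a j} \<or> u = insert (a j) x"
    unfolding mk_def at.simps vl_eq[OF h(2) s(1)] vl_eq[OF h(2) s(2)] by (rule refl)
  also have "\<dots> \<longleftrightarrow> u - {a j} = x - {a j}"
  proof
    assume "u - {a j} = x - {a j}"
    then show "u = x - {a j} \<or> u = insert (a j) x" by (rule Diff_singleton_eqD)
  qed auto
  finally show ?thesis .
qed

lemma shr_mk: assumes "x \<subseteq> D" "y \<subseteq> D" "j < d" "k < d"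
  shows "shr (mk x j) (mk y k) \<longleftrightarrow> (\<exists>u\<subseteq>D. u - {a j} = x - {a j} \<and> u - {a k} = y - {a k})"
proof -
  have s: "x - {a j} \<subseteq> D" "insert (a j) x \<subseteq> D" "y - {a k} \<subseteq> D" "insert (a k) y \<subseteq> D"
    using assms aD[OF assms(3)] aD[OF assms(4)] by blast+
  have "shr (mk x j) (mk y k) \<longleftrightarrow> at (vl (x - {a j})) (mk y k) \<or> at (vl (insert (a j) x)) (mk y k)"
    unfolding mk_def by auto
  also have "\<dots> \<longleftrightarrow> x - {a j} - {a k} = y - {a k} \<or> insert (a j) x - {a k} = y - {a k}"
    unfolding at_mk[OF assms(2) s(1) assms(4)] at_mk[OF assms(2) s(2) assms(4)] by (rule refl)
  also have "\<dots> \<longleftrightarrow> (\<exists>u\<subseteq>D. u - {a j} = x - {a j} \<and> u - {a k} = y - {a k})"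
  proof
    assume "\<exists>u\<subseteq>D. u - {a j} = x - {a j} \<and> u - {a k} = y - {a k}"
    then obtain u where u: "u - {a j} = x - {a j}" "u - {a k} = y - {a k}" by blast
    have "u = x - {a j} \<or> u = insert (a j) x" by (rule Diff_singleton_eqD[OF u(1)])
    then show "x - {a j} - {a k} = y - {a k} \<or> insert (a j) x - {a k} = y - {a k}" using u(2) by metis
  next
    assume "x - {a j} - {a k} = y - {a k} \<or> insert (a j) x - {a k} = y - {a k}"
    then consider "x - {a j} - {a k} = y - {a k}" | "insert (a j) x - {a k} = y - {a k}" by metis
    then show "\<exists>u\<subseteq>D. u - {a j} = x - {a j} \<and> u - {a k} = y - {a k}"
    proof cases
      case 1
      then show ?thesis using s(1) by (intro exI[of _ "x - {a j}"]) simp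
    next
      case 2
      then show ?thesis using s(2) by (intro exI[of _ "insert (a j) x"]) simp
    qed
  qed
  finally show ?thesis .
qed

definition col :: "link \<Rightarrow> nat option" where
  "col e = (if \<exists>v j c. j < d \<and> (v, a j, c) \<in> P \<and> e = mk v j
     then Some (SOME c. \<exists>v j. j < d \<and> (v, a j, c) \<in> P \<and> e = mk v j) else None)"

lemma col_iff: "col e = Some c \<longleftrightarrow> (\<exists>v j. j < d \<and> (v, a j, c) \<in> P \<and> e = mk v j)"
proof -
  have un: "c = c'" if h: "j < d" "(v, a j, c) \<in> P" "k < d" "(w, a k, c') \<in> P" "mk v j = mk w k" for v j c w k c'
  proof -
    have "j = k" "v = w" using h mk_eq[of v w j k] precolD(1,3)[OF P h(2)] precolD(1,3)[OF P h(4)] by auto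
    then show ?thesis using in_has[OF P h(2)] in_has[OF P h(4)] precolD(5)[OF P] by blast
  qed
  have "col e = Some c" if h: "j < d" "(v, a j, c) \<in> P" "e = mk v j" for v j
  proof -
    have "(SOME c. \<exists>v j. j < d \<and> (v, a j, c) \<in> P \<and> e = mk v j) = c"
      by (rule some_equality) (use h un in metis)+
    then show ?thesis unfolding col_def using h by auto
  qed
  moreover have "\<exists>v j. j < d \<and> (v, a j, c) \<in> P \<and> e = mk v j" if h: "col e = Some c"
    using h someI_ex[of "\<lambda>c. \<exists>v j. j < d \<and> (v, a j, c) \<in> P \<and> e = mk v j"]
    unfolding col_def by (auto split: if_splits)
  ultimately show ?thesis by blast
qed

lemma col_mk: "x \<subseteq> D \<Longrightarrow> j < d \<Longrightarrow> col (mk x j) = Some c \<longleftrightarrow> has P x (a j) c"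
proof -
  assume h: "x \<subseteq> D" "j < d"
  have "v = x - {a j}" if "(v, a k, c) \<in> P" "k < d" "mk x j = mk v k" for v k
    using mk_eq[of x v j k] that precolD(1,3)[OF P that(1)] h by auto
  moreover have "mk x j = mk (x - {a j}) j" using h mk_eq[of x "x - {a j}" j j] by auto
  ultimately show ?thesis unfolding col_iff has_def
    using h mk_eq[of x _ j] precolD(1)[OF P] by metis
qed

lemma dirs: "(v, i, c) \<in> P \<Longrightarrow> \<exists>j<d. i = a j" using precolD(2)[OF P] D by blast

lemma has_at: "has P x i c \<Longrightarrow> \<exists>j<d. i = a j" using dirs unfolding has_def by blast

lemma col_proper: assumes "col e = Some x" "col e' = Some x" "e \<noteq> e'" shows "\<not> shr e e'"
proof
  assume s: "shr e e'"
  obtain v j where e: "j < d" "(v, a j, x) \<in> P" "e = mk v j" using assms(1) col_iff by blast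
  obtain w k where e': "k < d" "(w, a k, x) \<in> P" "e' = mk w k" using assms(2) col_iff by blast
  have vw: "v \<subseteq> D" "w \<subseteq> D" "a j \<notin> v" "a k \<notin> w" using precolD(1,3)[OF P] e(2) e'(2) by blast+
  obtain u where u: "u \<subseteq> D" "u - {a j} = v - {a j}" "u - {a k} = w - {a k}" using s shr_mk[OF vw(1,2) e(1) e'(1)] e(3) e'(3) by blast
  have "has P u (a j) x" "has P u (a k) x" using u vw e(2) e'(2) unfolding has_def by simp_all
  then have "a j = a k" using precolD(5)[OF P] by blast
  then have "j = k" "v = w" using a_eq[OF e(1) e'(1)] u vw by auto
  then show False using assms(3) e(3) e'(3) by simp
qed

lemma col_count: "length (filter (\<lambda>e. col e \<noteq> None) (links d)) = card P"
proof -
  have "length (filter (\<lambda>e. col e \<noteq> None) (links d)) = card {e \<in> set (links d). col e \<noteq> None}"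
    using distinct_card[OF distinct_filter[OF distinct_links, of "\<lambda>e. col e \<noteq> None" d]] by simp
  also have "{e \<in> set (links d). col e \<noteq> None} = (\<lambda>(v, i, c). mk v (inv_into {..<d} a i)) ` P"
  proof (intro equalityI subsetI)
    fix e assume "e \<in> {e \<in> set (links d). col e \<noteq> None}"
    then obtain v j c where h: "j < d" "(v, a j, c) \<in> P" "e = mk v j" using col_iff by blast
    then have "inv_into {..<d} a (a j) = j" using a by (simp add: inv_into_f_f)
    then show "e \<in> (\<lambda>(v, i, c). mk v (inv_into {..<d} a i)) ` P" using h by (intro image_eqI[OF _ h(2)]) simp
  next
    fix e assume "e \<in> (\<lambda>(v, i, c). mk v (inv_into {..<d} a i)) ` P"
    then obtain v i c where h: "(v, i, c) \<in> P" "e = mk v (inv_into {..<d} a i)" by auto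
    obtain j where j: "j < d" "i = a j" using dirs[OF h(1)] by blast
    then have "inv_into {..<d} a i = j" using a by (simp add: inv_into_f_f)
    then have "e = mk v j" "col e = Some c" using h j col_iff by auto
    then show "e \<in> {e \<in> set (links d). col e \<noteq> None}" using mk_links[OF j(1)] by simp
  qed
  also have "card \<dots> = card P"
  proof (rule card_image, rule inj_onI)
    fix s t assume st: "s \<in> P" "t \<in> P"
      "(\<lambda>(v, i, c). mk v (inv_into {..<d} a i)) s = (\<lambda>(v, i, c). mk v (inv_into {..<d} a i)) t"
    obtain v i c w k f where eq: "s = (v, i, c)" "t = (w, k, f)" by (metis prod_cases3)
    have p: "(v, i, c) \<in> P" "(w, k, f) \<in> P" using st eq by auto
    obtain j l where jl: "j < d" "i = a j" "l < d" "k = a l" using dirs p by blast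
    have iv: "inv_into {..<d} a i = j" "inv_into {..<d} a k = l" using jl a by (simp_all add: inv_into_f_f)
    have m: "mk v j = mk w l" using st(3) unfolding eq by (simp add: iv)
    have vw: "v \<subseteq> D" "w \<subseteq> D" "i \<notin> v" "k \<notin> w" using precolD(1,3)[OF P] p by blast+
    have "j = l" "v = w" using m mk_eq[OF vw(1,2) jl(1,3)] vw jl by auto
    moreover have "col (mk v j) = Some c" unfolding col_iff using p(1) jl(1,2) by blast
    moreover have "col (mk v j) = Some f" unfolding col_iff m using p(2) jl(3,4) by blast
    ultimately show "s = t" using eq jl by simp
  qed
  finally show ?thesis .
qed

text \<open>The bijection from the four standard colours to \<open>C\<close> is chosen to agree with \<open>P\<close> on the colours that \<open>P\<close> uses.\<close>

lemma ext_of_row: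
  assumes d4: "d \<le> 4" and r: "okr [] (links d) r" "set r \<subseteq> set (take d [k0, k1, k2, k3])"
    and F: "\<And>e. F e = the (map_of (zip (links d) r) e)"
    and m: "\<And>e e' x y. col e = Some x \<Longrightarrow> col e' = Some y \<Longrightarrow> F e = F e' \<longleftrightarrow> x = y"
  shows "ext D C P"
proof -
  let ?H = "set (take d [k0, k1, k2, k3])"
  have len: "length r = length (links d)" using okr_length[OF r(1)] .
  have Fz: "(e, F e) \<in> set (zip (links d) r)" if "e \<in> set (links d)" for e
  proof -
    have "\<exists>y. map_of (zip (links d) r) e = Some y" using that map_of_zip_is_Some[OF len[symmetric]] by blast
    then show ?thesis unfolding F using map_of_SomeD by fastforce
  qed
  have FH: "F e \<in> ?H" if "e \<in> set (links d)" for e using Fz[OF that] r(2) by (meson set_zip_rightD subsetD)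
  have Fp: "F e \<noteq> F e'" if "e \<in> set (links d)" "e' \<in> set (links d)" "e \<noteq> e'" "shr e e'" for e e'
    using okr_proper[OF r(1) Fz[OF that(1)], of "(e', F e')"] Fz[OF that(2)] that(3,4) by simp
  have cH: "card ?H = d"
  proof -
    have "distinct (take d [k0, k1, k2, k3])" by (rule distinct_take) simp
    then show ?thesis using d4 by (simp add: distinct_card)
  qed
  obtain \<beta> where \<beta>: "bij_betw \<beta> ?H C" using cH C finite_same_card_bij[of ?H C] by auto
  define A where "A = {\<beta> (F e) | e x. col e = Some x}"
  define h where "h y = (SOME x. \<exists>e. col e = Some x \<and> \<beta> (F e) = y)" for y
  have cl: "e \<in> set (links d)" if "col e = Some x" for e x using that mk_links unfolding col_iff by blast
  have cC: "x \<in> C" if "col e = Some x" for e x using that precolD(4)[OF P] unfolding col_iff by blast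
  have hh: "h (\<beta> (F e)) = x" if "col e = Some x" for e x
    unfolding h_def
  proof (rule some_equality)
    show "\<exists>e'. col e' = Some x \<and> \<beta> (F e') = \<beta> (F e)" using that by blast
    fix y assume "\<exists>e'. col e' = Some y \<and> \<beta> (F e') = \<beta> (F e)"
    then obtain e' where e': "col e' = Some y" "\<beta> (F e') = \<beta> (F e)" by blast
    then have "F e' = F e" using bij_betw_imp_inj_on[OF \<beta>] FH[OF cl[OF that]] FH[OF cl[OF e'(1)]] by (metis inj_onD)
    then show "y = x" using m[OF e'(1) that] by simp
  qed
  have "\<exists>\<sigma>. bij_betw \<sigma> C C \<and> (\<forall>y\<in>A. \<sigma> y = h y)"
  proof (rule extend_bij[OF C(1)])
    show "A \<subseteq> C" using \<beta> FH cl unfolding A_def bij_betw_def by blast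
    show "h ` A \<subseteq> C" using hh cC unfolding A_def by force
    show "inj_on h A"
    proof (rule inj_onI)
      fix y z assume "y \<in> A" "z \<in> A" "h y = h z"
      then obtain e x e' x' where e: "y = \<beta> (F e)" "col e = Some x" "z = \<beta> (F e')" "col e' = Some x'" unfolding A_def by blast
      have "x = x'" using \<open>h y = h z\<close> hh[OF e(2)] hh[OF e(4)] e(1,3) by simp
      then show "y = z" using m[OF e(2,4)] e(1,3) by simp
    qed
  qed
  then obtain \<sigma> where \<sigma>: "bij_betw \<sigma> C C" "\<forall>y\<in>A. \<sigma> y = h y" by blast
  define ix where "ix = inv_into {..<d} a"
  have ix: "ix i < d" "a (ix i) = i" if "i \<in> D" for i
    using that inv_into_into[of i a "{..<d}"] f_inv_into_f[of i a "{..<d}"] unfolding D ix_def by auto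
  define f where "f x i = \<sigma> (\<beta> (F (mk x (ix i))))" for x i
  have \<sigma>\<beta>: "inj_on (\<lambda>y. \<sigma> (\<beta> y)) ?H" "(\<lambda>y. \<sigma> (\<beta> y)) ` ?H = C"
    using bij_betw_trans[OF \<beta> \<sigma>(1)] unfolding bij_betw_def comp_def by auto
  have "coloring D C f"
    unfolding coloring_def
  proof (intro allI impI conjI ballI)
    fix x assume x: "x \<subseteq> D"
    have "inj_on (f x) D"
    proof (rule inj_onI)
      fix i i' assume h: "i \<in> D" "i' \<in> D" "f x i = f x i'"
      have "F (mk x (ix i)) = F (mk x (ix i'))"
        using inj_onD[OF \<sigma>\<beta>(1), of "F (mk x (ix i))" "F (mk x (ix i'))"] h FH mk_links ix unfolding f_def by auto
      moreover have "shr (mk x (ix i)) (mk x (ix i'))" using shr_mk[OF x x] ix(1) h(1,2) x by blast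
      ultimately have "mk x (ix i) = mk x (ix i')" using Fp mk_links ix(1) h(1,2) by metis
      then show "i = i'" using mk_eq[OF x x ix(1)[OF h(1)] ix(1)[OF h(2)]] ix(2) h(1,2) by metis
    qed
    moreover have "f x ` D \<subseteq> C" unfolding f_def using \<sigma>\<beta>(2) FH mk_links ix(1) by blast
    moreover have "card D = d" unfolding D using card_image[OF a] by simp
    ultimately show "bij_betw (f x) D C" using C unfolding bij_betw_def by (metis card_image card_subset_eq)
    fix i assume i: "i \<in> D"
    have "mk (nb x i) (ix i) = mk x (ix i)" using mk_eq[OF _ x ix(1)[OF i] ix(1)[OF i], of "nb x i"] ix(2)[OF i] i x by simp
    then show "f (nb x i) i = f x i" unfolding f_def by simp
  qed
  moreover have "f v i = c" if "(v, i, c) \<in> P" for v i c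
  proof -
    have iD: "i \<in> D" using precolD(2)[OF P that] .
    have co: "col (mk v (ix i)) = Some c" unfolding col_iff using that ix[OF iD] by (intro exI[of _ v] exI[of _ "ix i"]) simp
    then have "\<beta> (F (mk v (ix i))) \<in> A" unfolding A_def by blast
    then show ?thesis unfolding f_def using \<sigma>(2) hh[OF co] by simp
  qed
  ultimately show ?thesis unfolding ext_def by blast
qed

text \<open>The leaf reached by \<open>chk_sound\<close> has either kept a row, which yields an
  extension, or recorded an obstruction. Goodness excludes blocked vertices and edges, so only the
  exception of dimension three is left.\<close>

lemma base:
  assumes d: "0 < d" "d \<le> 4" and tot: "total d rs" "rows_ok d rs" and cP: "card P = d"
    and gd: "good D C P" and e0: "({}, a 0, c0) \<in> P"
  shows "ext D C P \<or> d = 3 \<and> (\<forall>(v, i, c)\<in>P. i = a 0) \<and> (snd \<circ> snd) ` P = C"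
proof -
  define F where "F r e = the (map_of (zip (links d) r) e)" for r :: "hue list" and e
  let ?Fs = "F ` set rs"
  obtain n where n: "d = Suc n" using d(1) by (cases d) auto
  \<comment> \<open>The first link is the edge of direction 0 at the empty set, which
    \<open>e0\<close> assumes to be coloured.\<close>
  have l0: "\<exists>ls. links d = mk {} 0 # ls"
  proof -
    have v: "\<exists>vs. verts m = replicate m False # vs" for m
    proof (induction m)
      case (Suc m)
      then obtain vs where vs: "List.n_lists m [False, True] = replicate m False # vs" unfolding verts_def by blast
      show ?case unfolding verts_def by (simp add: vs)
    qed (simp add: verts_def)
    obtain vs where vs: "verts d = replicate d False # vs" using v by blast
    have v0: "vl {} = replicate d False" by (rule nth_equalityI) simp_all
    have "vl ({} - {a 0}) = replicate d False" "vl (insert (a 0) {}) = (replicate d False)[0 := True]"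
      using v0 vl_update[OF d(1), of "{}" True] by simp_all
    then show ?thesis unfolding links_def vs mk_def using d(1) n by (simp add: upt_conv_Cons del: upt_Suc)
  qed
  then obtain ls where ls: "links d = mk {} 0 # ls" by blast
  have dl: "distinct (links d)" by (rule distinct_links)
  have c0: "col (mk {} 0) = Some c0" unfolding col_iff using e0 d(1) by blast
  have mapF: "map (F r) (links d) = r" if "length r = length (links d)" for r
    using that dl unfolding F_def
    by (intro nth_equalityI) (auto simp: map_of_zip_nth)
  have ok: "okr [] (links d) r" "set r \<subseteq> set (take d [k0, k1, k2, k3])" if "r \<in> set rs" for r
    using tot(2) that unfolding rows_ok_def by (auto simp: list_all_iff)
  have start: "chk d [0] [(mk {} 0, 0)] [0] (d - 1) (inits rs) ls"
    using tot(1) unfolding total_def ls by simp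
  have tr0: "traced ?Fs col (\<lambda>_. 0) {c0} [(mk {} 0, 0)] [0]" 
    unfolding traced_def
  proof (intro conjI)
    show "\<forall>x\<in>{c0}. \<exists>e. col e = Some x" using c0 by blast
    show "\<forall>(e, c)\<in>set [(mk {} 0, 0)]. \<exists>x\<in>{c0}. col e = Some x \<and> c = 0" using c0 by simp
  qed simp_all
  have fo0: "\<forall>s\<in>set (inits rs). follows ?Fs [(mk {} 0, 0)] [0] s ls"
  proof
    fix s assume "s \<in> set (inits rs)"
    then obtain x r where s: "x # r \<in> set rs" "s = ([x], r)" using in_inits by (metis surj_pair)
    have "map (F (x # r)) (links d) = x # r" using mapF okr_length[OF ok(1)[OF s(1)]] by simp
    then have "F (x # r) (mk {} 0) = x" "map (F (x # r)) ls = r" unfolding ls by auto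
    note F0 = this
    show "follows ?Fs [(mk {} 0, 0)] [0] s ls"
      unfolding follows_def s(2)
    proof (intro conjI bexI[of _ "F (x # r)"])
      show "snd ([x], r) = map (F (x # r)) ls" using F0(2) by simp
      show "\<forall>(e, c)\<in>set [(mk {} 0, 0)]. c < length [0::nat] \<and> F (x # r) e = fst ([x], r) ! c" using F0(1) by simp
      show "F (x # r) \<in> ?Fs" using s(1) by blast
    qed simp_all
  qed
  have dis: "distinct ls" "set ls \<inter> fst ` set [(mk {} 0, 0::nat)] = {}" using dl unfolding ls by auto
  have cnt: "length (filter (\<lambda>e. col e \<noteq> None) ls) = d - 1" using col_count c0 cP unfolding ls by simp
  have "\<exists>\<rho> X ch' cs' fs' es'. traced ?Fs col \<rho> X ch' cs' \<and> (\<forall>s\<in>set fs'. follows ?Fs ch' cs' s es') \<and>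
      lf d cs' ch' fs' \<and>
      fst ` set ch' = fst ` set [(mk {} 0, 0::nat)] \<union> {e \<in> set ls. col e \<noteq> None}"
    by (rule chk_sound[OF col_proper start tr0 fo0 dis cnt]) simp_all
  then obtain \<rho> X ch cs fs es where run: "traced ?Fs col \<rho> X ch cs \<and> (\<forall>s\<in>set fs. follows ?Fs ch cs s es) \<and>
      lf d cs ch fs \<and>
      fst ` set ch = fst ` set [(mk {} 0, 0::nat)] \<union> {e \<in> set ls. col e \<noteq> None}" by (elim exE)
  have tr: "traced ?Fs col \<rho> X ch cs" using run by (elim conjE)
  have fo: "\<forall>s\<in>set fs. follows ?Fs ch cs s es" using run by (elim conjE)
  have leaf: "lf d cs ch fs" using run by (elim conjE)
  have all: "fst ` set ch = fst ` set [(mk {} 0, 0::nat)] \<union> {e \<in> set ls. col e \<noteq> None}"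
    using run by (elim conjE)
  have ch: "(e, c) \<in> set ch \<longleftrightarrow> (\<exists>x. col e = Some x \<and> c = \<rho> x)" for e c
  proof
    assume "(e, c) \<in> set ch"
    then show "\<exists>x. col e = Some x \<and> c = \<rho> x" using tr unfolding traced_def by blast
  next
    assume "\<exists>x. col e = Some x \<and> c = \<rho> x"
    then obtain x where x: "col e = Some x" "c = \<rho> x" by blast
    have "e \<in> set (links d)" using x(1) mk_links unfolding col_iff by blast
    then have "e \<in> fst ` set ch" unfolding all ls using x(1) by auto
    then obtain c' where c': "(e, c') \<in> set ch" by auto
    then obtain y where "col e = Some y" "c' = \<rho> y" using tr unfolding traced_def by blast
    then show "(e, c) \<in> set ch" using c' x by simp
  qed
  have X: "X = {x. \<exists>e. col e = Some x}"
  proof (intro equalityI subsetI)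
    fix x assume "x \<in> {x. \<exists>e. col e = Some x}"
    then obtain e where e: "col e = Some x" by blast
    then have "(e, \<rho> x) \<in> set ch" using ch by blast
    then show "x \<in> X" using tr e unfolding traced_def by fastforce
  qed (use tr in \<open>auto simp: traced_def\<close>)
  have inj: "inj_on \<rho> X" and im: "\<rho> ` X = set cs" and cs: "cs = [0..<length cs]" using tr unfolding traced_def by auto
  have \<rho>_eq: "\<rho> x = \<rho> y \<longleftrightarrow> x = y" if h: "col e = Some x" "col e' = Some y" for e e' x y
  proof -
    have "x \<in> X" "y \<in> X" unfolding X using h by blast+
    then show ?thesis by (rule inj_on_eq_iff[OF inj])
  qed
  have XC: "X \<subseteq> C" unfolding X using precolD(4)[OF P] col_iff by blast
  \<comment> \<open>If the pattern has \<open>d\<close> colours, all of \<open>C\<close> occurs;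
    blocked edges and (C4) are tested only then.\<close>
  have full: "X = C" if "length cs = d"
  proof -
    have "card X = card (set cs)" using card_image[OF inj] im by simp
    also have "\<dots> = d" using cs that by (metis card_atLeastLessThan diff_zero set_upt)
    finally show ?thesis using XC C card_subset_eq by metis
  qed
  have seen': "seen (vl u) (\<rho> x) ch \<longleftrightarrow> (\<exists>i. has P u i x)" if u: "u \<subseteq> D" and x: "x \<in> X" for u x
  proof
    assume "seen (vl u) (\<rho> x) ch"
    then obtain e y where e: "at (vl u) e" "col e = Some y" "\<rho> x = \<rho> y" unfolding seen_iff ch by blast
    have "x = y" using x e(2,3) \<rho>_eq unfolding X by blast
    then obtain v j where v: "j < d" "(v, a j, x) \<in> P" "e = mk v j" using e(2) unfolding col_iff by blast
    have vD: "v \<subseteq> D" "a j \<notin> v" using precolD(1,3)[OF P v(2)] by auto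
    have "u - {a j} = v" using e(1) at_mk[OF vD(1) u v(1)] v(3) vD(2) by simp
    then show "\<exists>i. has P u i x" using v(2) unfolding has_def by blast
  next
    assume "\<exists>i. has P u i x"
    then obtain i where i: "has P u i x" by blast
    obtain j where j: "j < d" "i = a j" using has_at[OF i] by blast
    have "col (mk u j) = Some x" using col_mk[OF u j(1)] i j(2) by simp
    moreover have "at (vl u) (mk u j)" using at_mk[OF u u j(1)] by simp
    ultimately show "seen (vl u) (\<rho> x) ch" unfolding seen_iff ch by blast
  qed
  from leaf consider "fs \<noteq> []" | "badv1 ch [0..<d] cs (verts d)" | "length cs = d" "bade1 ch (links d)"
    | "length cs = d" "d = 3" "along 0 ch" unfolding lf_iff by auto
  then show ?thesis
  proof cases
    case 1
    then obtain s where "s \<in> set fs" by (meson list.set_sel(1))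
    then have f: "follows ?Fs ch cs s es" using fo by blast
    then obtain r where r: "r \<in> set rs" "\<And>e c. (e, c) \<in> set ch \<Longrightarrow> c < length cs \<and> F r e = fst s ! c"
      unfolding follows_def by blast
    have "ext D C P"
    proof (rule ext_of_row[OF d(2) ok[OF r(1)] F_def])
      fix e e' x y assume h: "col e = Some x" "col e' = Some y"
      have "\<rho> x < length cs \<and> F r e = fst s ! \<rho> x" "\<rho> y < length cs \<and> F r e' = fst s ! \<rho> y" using r(2) ch h by blast+
      moreover have "distinct (fst s)" "length (fst s) = length cs" using f unfolding follows_def by auto
      ultimately show "F r e = F r e' \<longleftrightarrow> x = y" using nth_eq_iff_index_eq[of "fst s" "\<rho> x" "\<rho> y"] \<rho>_eq[OF h] by simp
    qed
    then show ?thesis by blast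
  next
    case 2
    then obtain xs c where u: "length xs = d" "c \<in> set cs" "\<not> seen xs c ch" "blocked xs c ch [0..<d]"
      unfolding badv1_iff bad1_iff set_verts by blast
    obtain u where uD: "u \<subseteq> D" "xs = vl u" using vl_surj[OF u(1)] by blast
    obtain x where x: "x \<in> X" "c = \<rho> x" using u(2) im by blast
    have "badv D P u x"
      unfolding badv_def
    proof (intro conjI allI ballI)
      show "u \<subseteq> D" by (rule uD(1))
      show "\<not> has P u i x" for i using u(3) seen'[OF uD(1) x(1)] uD(2) x(2) by blast
      fix i assume "i \<in> D"
      then obtain j where j: "j < d" "i = a j" using D by blast
      have "flip (vl u) j = vl (nb u i)"
        using flip_nth[of j "vl u"] vl_update[OF j(1)] j by (simp add: nb_def)
      moreover have "starred (vl u) j ch \<or> seen (flip (vl u) j) c ch" using u(4) uD(2) j(1) unfolding blocked_iff by simp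
      moreover have "\<exists>e. has P u i e" if "starred (vl u) j ch"
      proof -
        obtain p q y where pq: "col (p, q, j) = Some y" "at (vl u) (p, q, j)" using \<open>starred (vl u) j ch\<close> unfolding starred_iff ch by blast
        obtain v k where v: "k < d" "(v, a k, y) \<in> P" "(p, q, j) = mk v k" using pq(1) unfolding col_iff by blast
        have kj: "k = j" using v(3) unfolding mk_def by simp
        have vD: "v \<subseteq> D" "a k \<notin> v" using precolD(1,3)[OF P v(2)] by auto
        have "u - {a k} = v" using pq(2) at_mk[OF vD(1) uD(1) v(1)] vD(2) unfolding v(3) by simp
        then show ?thesis using v(2) kj j(2) unfolding has_def by blast
      qed
      ultimately show "(\<exists>e. has P u i e) \<or> (\<exists>k. has P (nb u i) k x)"
        using seen'[of "nb u i" x] x uD(1) \<open>i \<in> D\<close> by auto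
    qed
    then show ?thesis using gd XC x(1) unfolding good_def by blast
  next
    case 3
    obtain e where e: "e \<in> set (links d)" "allnear e ch" using 3(2) unfolding bade1_iff by blast
    obtain u j where u: "u \<subseteq> D" "j < d" "e = mk u j" using links_mk[OF e(1)] by blast
    have "bade D C P u (a j)"
      unfolding bade_def
    proof (intro conjI allI ballI)
      show "u \<subseteq> D" "a j \<in> D" using u aD by auto
      show "\<not> has P u (a j) c" for c
      proof
        assume "has P u (a j) c"
        then have "(e, \<rho> c) \<in> set ch" using col_mk[OF u(1,2)] u(3) unfolding ch by blast
        then show False using e(2) unfolding allnear_iff by blast
      qed
      fix c assume "c \<in> C"
      then obtain e' where e': "col e' = Some c" using full[OF 3(1)] unfolding X by blast
      then have "(e', \<rho> c) \<in> set ch" unfolding ch by blast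
      then have s: "shr e e'" using e(2) unfolding allnear_iff by blast
      obtain v k where v: "k < d" "(v, a k, c) \<in> P" "e' = mk v k" using e' unfolding col_iff by blast
      have vD: "v \<subseteq> D" "a k \<notin> v" using precolD(1,3)[OF P v(2)] by auto
      obtain w where w: "w - {a j} = u - {a j}" "w - {a k} = v - {a k}"
        using s shr_mk[OF u(1) vD(1) u(2) v(1)] u(3) v(3) by blast
      have "w = u \<or> w = nb u (a j)" using w(1) Diff_eq_iff_nb by metis
      moreover have "has P w (a k) c" using w(2) vD(2) v(2) unfolding has_def by simp
      ultimately show "\<exists>k. has P u k c \<or> has P (nb u (a j)) k c" by blast
    qed
    then show ?thesis using gd unfolding good_def by blast
  next
    case 4
    have "i = a 0" if p: "(v, i, c) \<in> P" for v i c
    proof -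
      obtain j where j: "j < d" "i = a j" using dirs[OF p] by blast
      have "col (mk v j) = Some c" using p j unfolding col_iff by blast
      then have "((vl (v - {a j}), vl (insert (a j) v), j), \<rho> c) \<in> set ch" unfolding ch mk_def by blast
      then have "j = 0" using 4(3) unfolding along_iff by fastforce
      then show ?thesis using j by simp
    qed
    moreover have "(snd \<circ> snd) ` P = C"
    proof
      show "(snd \<circ> snd) ` P \<subseteq> C" using precolD(4)[OF P] by auto
      show "C \<subseteq> (snd \<circ> snd) ` P"
      proof
        fix c assume "c \<in> C"
        then obtain e where "col e = Some c" using full[OF 4(1)] unfolding X by blast
        then obtain v j where "(v, a j, c) \<in> P" unfolding col_iff by blast
        then show "c \<in> (snd \<circ> snd) ` P" by force
      qed
    qed
    ultimately show ?thesis using 4(2) by blast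
  qed
qed

end

text \<open>Each row lists the colours of the edges of one coloring in the order of \<open>links d\<close>. The rows were found by a
  greedy computer search.\<close>

definition rows1 :: "hue list list" where
 "rows1 =
 [[k0]]"

definition rows2 :: "hue list list" where
 "rows2 =
 [[k0, k1, k1, k0]]"

definition rows3 :: "hue list list" where
 "rows3 =
 [[k0,k1,k2,k2,k1,k0,k2,k1,k0,k1,k2,k0],
  [k0,k2,k1,k2,k1,k1,k0,k0,k0,k2,k2,k1],
  [k0,k2,k1,k2,k1,k0,k1,k1,k2,k0,k0,k2],
  [k0,k2,k1,k2,k1,k0,k1,k1,k0,k2,k2,k0]]"

definition rows4 :: "hue list list" where
 "rows4 =
 [[k0,k1,k2,k3,k1,k2,k3,k0,k2,k3,k2,k3,k0,k1,k3,k1,k3,k3,k0,k0,k0,k2,k1,k2,k1,k0,k1,k1,k0,k2,k2,k3],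
  [k0,k1,k2,k3,k1,k3,k2,k3,k0,k2,k2,k0,k1,k3,k0,k0,k2,k1,k2,k3,k1,k0,k2,k3,k0,k1,k3,k2,k3,k1,k1,k0],
  [k0,k3,k2,k1,k3,k2,k1,k2,k1,k0,k0,k1,k1,k0,k3,k3,k0,k2,k3,k1,k0,k3,k2,k3,k2,k2,k1,k0,k1,k0,k3,k2],
  [k0,k2,k3,k1,k1,k3,k2,k0,k1,k3,k3,k2,k0,k2,k1,k1,k2,k0,k3,k2,k3,k2,k0,k0,k1,k1,k0,k3,k3,k2,k0,k1],
  [k0,k3,k2,k1,k2,k1,k3,k0,k2,k1,k1,k3,k3,k1,k0,k2,k0,k3,k0,k0,k2,k0,k3,k0,k1,k2,k3,k1,k2,k1,k3,k2],
  [k0,k3,k1,k2,k1,k3,k2,k2,k1,k0,k3,k0,k0,k2,k3,k2,k1,k0,k3,k1,k0,k3,k1,k1,k3,k2,k1,k3,k0,k2,k2,k0],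
  [k0,k3,k2,k1,k3,k2,k1,k0,k1,k2,k1,k2,k3,k0,k1,k0,k1,k2,k3,k3,k2,k3,k0,k3,k0,k1,k0,k0,k3,k2,k2,k1],
  [k0,k3,k1,k2,k3,k1,k2,k2,k0,k1,k0,k1,k0,k3,k2,k3,k2,k2,k1,k1,k0,k3,k1,k3,k1,k0,k2,k2,k3,k0,k0,k3],
  [k0,k1,k3,k2,k3,k1,k2,k2,k3,k0,k0,k1,k2,k0,k1,k3,k0,k1,k2,k2,k1,k3,k0,k0,k3,k2,k1,k3,k2,k3,k1,k0],
  [k0,k2,k1,k3,k3,k2,k1,k1,k0,k3,k2,k0,k3,k2,k0,k1,k0,k3,k1,k0,k0,k1,k2,k3,k2,k2,k0,k1,k1,k3,k3,k2],
  [k0,k3,k2,k1,k3,k2,k1,k0,k2,k1,k2,k1,k0,k1,k3,k1,k3,k0,k3,k3,k3,k0,k2,k2,k0,k3,k2,k0,k1,k0,k2,k1],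
  [k0,k1,k2,k3,k1,k2,k3,k2,k3,k0,k3,k0,k3,k1,k0,k0,k1,k2,k0,k1,k0,k2,k1,k1,k2,k3,k1,k2,k3,k2,k0,k3],
  [k0,k2,k1,k3,k3,k2,k1,k1,k0,k3,k0,k2,k0,k2,k3,k3,k1,k1,k3,k2,k2,k1,k0,k3,k0,k0,k2,k1,k2,k1,k3,k0],
  [k0,k2,k3,k1,k1,k2,k3,k0,k3,k1,k2,k3,k1,k0,k2,k0,k3,k1,k2,k3,k2,k0,k3,k0,k1,k2,k3,k1,k0,k1,k2,k0],
  [k0,k2,k1,k3,k1,k3,k2,k3,k0,k1,k0,k2,k0,k3,k2,k2,k1,k1,k2,k3,k0,k2,k1,k1,k3,k3,k0,k0,k0,k3,k2,k1],
  [k0,k3,k1,k2,k2,k1,k3,k1,k2,k0,k3,k0,k3,k0,k2,k2,k0,k1,k3,k0,k0,k1,k3,k1,k2,k3,k2,k2,k1,k0,k3,k1],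
  [k0,k2,k3,k1,k3,k2,k1,k1,k3,k0,k0,k2,k0,k1,k2,k1,k3,k2,k0,k3,k3,k2,k0,k0,k2,k3,k1,k1,k1,k3,k0,k2],
  [k0,k1,k3,k2,k3,k2,k1,k0,k3,k2,k1,k2,k1,k2,k0,k3,k0,k0,k1,k2,k0,k1,k3,k3,k2,k0,k3,k1,k1,k2,k3,k0],
  [k0,k2,k3,k1,k3,k1,k2,k1,k3,k0,k2,k0,k0,k2,k1,k3,k2,k1,k0,k0,k3,k2,k0,k1,k0,k3,k1,k2,k3,k2,k1,k3],
  [k0,k1,k3,k2,k1,k3,k2,k0,k3,k2,k3,k2,k1,k0,k2,k0,k2,k1,k2,k2,k3,k0,k1,k0,k1,k1,k3,k3,k3,k0,k0,k1],
  [k0,k2,k1,k3,k2,k1,k3,k1,k0,k3,k0,k3,k2,k3,k0,k3,k0,k2,k1,k1,k2,k0,k1,k0,k1,k1,k2,k2,k2,k3,k3,k0],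
  [k0,k3,k1,k2,k1,k3,k2,k0,k2,k1,k2,k3,k2,k3,k0,k0,k1,k1,k0,k3,k3,k0,k1,k1,k0,k2,k3,k0,k3,k2,k2,k1],
  [k0,k3,k2,k1,k3,k1,k2,k0,k2,k1,k1,k2,k3,k1,k0,k2,k0,k0,k3,k3,k0,k2,k3,k1,k3,k3,k0,k0,k2,k1,k1,k2],
  [k0,k1,k3,k2,k1,k2,k3,k3,k0,k2,k2,k0,k0,k2,k1,k3,k1,k1,k3,k0,k1,k0,k3,k2,k0,k3,k1,k1,k2,k0,k3,k2],
  [k0,k2,k3,k1,k1,k3,k2,k0,k3,k1,k3,k2,k2,k0,k1,k0,k1,k2,k1,k1,k0,k2,k3,k1,k3,k0,k3,k3,k0,k2,k2,k0],
  [k0,k2,k1,k3,k2,k1,k3,k1,k3,k0,k3,k0,k0,k2,k3,k2,k3,k0,k1,k1,k1,k2,k0,k2,k0,k1,k3,k3,k1,k2,k2,k0],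
  [k0,k2,k1,k3,k1,k3,k2,k0,k3,k1,k2,k3,k0,k2,k3,k1,k2,k0,k1,k3,k1,k0,k2,k0,k3,k2,k3,k1,k1,k0,k0,k2],
  [k0,k2,k3,k1,k2,k1,k3,k0,k3,k1,k1,k3,k2,k0,k1,k3,k0,k2,k1,k0,k2,k3,k0,k0,k1,k2,k0,k1,k2,k3,k3,k2],
  [k0,k3,k1,k2,k3,k2,k1,k2,k1,k0,k0,k1,k0,k3,k2,k3,k1,k2,k0,k1,k0,k1,k3,k3,k2,k2,k3,k0,k0,k1,k3,k2],
  [k0,k1,k2,k3,k2,k1,k3,k3,k0,k2,k1,k0,k3,k1,k0,k0,k2,k3,k2,k2,k0,k1,k2,k2,k1,k3,k0,k1,k3,k1,k0,k3],
  [k0,k3,k2,k1,k1,k2,k3,k0,k1,k2,k3,k2,k1,k0,k3,k0,k3,k2,k3,k1,k0,k3,k2,k1,k2,k0,k1,k3,k1,k0,k0,k2],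
  [k0,k2,k1,k3,k2,k1,k3,k3,k1,k0,k0,k1,k2,k3,k0,k3,k0,k2,k0,k1,k0,k2,k1,k2,k1,k3,k1,k0,k3,k2,k2,k3],
  [k0,k2,k3,k1,k2,k3,k1,k1,k3,k0,k3,k0,k2,k0,k1,k0,k1,k2,k1,k1,k2,k3,k0,k3,k0,k1,k2,k2,k2,k3,k3,k0],
  [k0,k2,k1,k3,k2,k1,k3,k1,k0,k3,k0,k3,k0,k2,k3,k2,k3,k1,k3,k3,k2,k0,k1,k0,k1,k2,k1,k1,k0,k2,k2,k0],
  [k0,k1,k2,k3,k2,k1,k3,k0,k3,k2,k1,k3,k0,k1,k3,k3,k2,k2,k0,k0,k2,k1,k0,k1,k0,k0,k3,k2,k1,k2,k3,k1],
  [k0,k1,k2,k3,k1,k2,k3,k3,k0,k2,k0,k2,k0,k1,k3,k3,k1,k2,k3,k1,k2,k0,k1,k1,k0,k3,k1,k0,k2,k0,k3,k2],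
  [k0,k3,k2,k1,k1,k2,k3,k0,k1,k2,k2,k3,k1,k0,k3,k0,k3,k3,k2,k1,k0,k3,k2,k2,k1,k1,k0,k0,k0,k1,k2,k3],
  [k0,k2,k1,k3,k3,k2,k1,k1,k0,k3,k2,k0,k0,k3,k2,k3,k1,k1,k2,k0,k2,k1,k0,k3,k0,k2,k0,k1,k3,k1,k2,k3],
  [k0,k1,k3,k2,k1,k3,k2,k0,k3,k2,k3,k2,k2,k1,k0,k1,k0,k0,k2,k2,k3,k0,k1,k0,k1,k3,k1,k1,k2,k3,k3,k0],
  [k0,k1,k3,k2,k2,k3,k1,k0,k2,k3,k1,k3,k0,k1,k2,k2,k1,k3,k0,k0,k3,k0,k1,k0,k2,k2,k1,k1,k0,k3,k3,k2],
  [k0,k2,k1,k3,k2,k1,k3,k1,k3,k0,k3,k0,k0,k2,k3,k2,k3,k0,k1,k1,k0,k1,k2,k1,k2,k3,k2,k2,k1,k0,k0,k3],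
  [k0,k2,k3,k1,k2,k3,k1,k0,k3,k1,k3,k1,k1,k2,k0,k0,k2,k1,k0,k2,k0,k2,k3,k2,k3,k0,k3,k3,k1,k2,k0,k1],
  [k0,k1,k2,k3,k1,k2,k3,k2,k0,k3,k0,k3,k0,k3,k1,k1,k3,k2,k1,k3,k2,k1,k0,k0,k1,k2,k0,k1,k2,k3,k0,k2],
  [k0,k3,k2,k1,k3,k1,k2,k1,k0,k2,k0,k2,k3,k1,k0,k2,k0,k3,k2,k1,k0,k3,k2,k1,k3,k0,k1,k3,k1,k3,k2,k0],
  [k0,k3,k1,k2,k1,k3,k2,k0,k2,k1,k2,k3,k2,k0,k3,k1,k0,k3,k1,k0,k0,k3,k1,k1,k3,k0,k2,k2,k2,k0,k1,k3],
  [k0,k3,k1,k2,k2,k1,k3,k0,k1,k2,k1,k3,k2,k0,k3,k0,k3,k2,k3,k3,k1,k3,k0,k2,k0,k0,k1,k1,k1,k2,k2,k0],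
  [k0,k1,k2,k3,k2,k3,k1,k0,k2,k3,k1,k3,k1,k0,k3,k0,k2,k3,k1,k2,k2,k1,k0,k0,k3,k2,k0,k1,k1,k2,k0,k3],
  [k0,k1,k2,k3,k1,k2,k3,k2,k3,k0,k3,k0,k1,k0,k3,k0,k3,k2,k1,k1,k0,k2,k1,k2,k1,k1,k3,k3,k0,k2,k2,k0],
  [k0,k2,k1,k3,k3,k1,k2,k1,k3,k0,k0,k2,k0,k2,k3,k2,k3,k1,k0,k3,k1,k2,k0,k3,k0,k1,k3,k0,k2,k1,k1,k2],
  [k0,k1,k2,k3,k1,k2,k3,k2,k0,k3,k3,k0,k3,k1,k0,k0,k1,k2,k3,k1,k1,k0,k2,k2,k0,k1,k2,k3,k3,k1,k2,k0],
  [k0,k2,k3,k1,k2,k1,k3,k3,k0,k1,k1,k0,k0,k1,k2,k3,k2,k2,k3,k0,k0,k2,k3,k2,k1,k3,k0,k1,k0,k1,k3,k2],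
  [k0,k3,k1,k2,k3,k1,k2,k0,k1,k2,k1,k2,k2,k0,k3,k3,k0,k2,k3,k0,k3,k0,k1,k0,k1,k3,k1,k1,k2,k0,k3,k2],
  [k0,k2,k3,k1,k1,k2,k3,k3,k1,k0,k2,k0,k1,k2,k0,k3,k0,k0,k3,k1,k0,k2,k3,k1,k2,k3,k1,k2,k1,k2,k3,k0],
  [k0,k2,k1,k3,k2,k3,k1,k0,k1,k3,k1,k3,k2,k3,k0,k0,k1,k2,k0,k3,k2,k0,k1,k0,k3,k1,k2,k2,k2,k3,k0,k1],
  [k0,k1,k2,k3,k1,k3,k2,k0,k3,k2,k3,k2,k1,k0,k3,k0,k2,k2,k1,k1,k1,k0,k2,k3,k0,k1,k3,k0,k1,k0,k3,k2],
  [k0,k2,k3,k1,k1,k2,k3,k0,k1,k3,k3,k2,k0,k2,k1,k1,k3,k0,k3,k2,k0,k2,k3,k1,k2,k0,k1,k3,k0,k2,k1,k0],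
  [k0,k1,k2,k3,k2,k1,k3,k3,k0,k2,k0,k1,k0,k1,k3,k2,k3,k3,k2,k1,k1,k0,k2,k0,k2,k3,k1,k2,k1,k0,k0,k3],
  [k0,k1,k3,k2,k3,k1,k2,k0,k3,k2,k1,k2,k0,k1,k2,k3,k2,k0,k2,k2,k1,k3,k0,k3,k0,k1,k0,k0,k3,k1,k1,k3],
  [k0,k3,k2,k1,k3,k2,k1,k2,k0,k1,k0,k1,k1,k3,k0,k3,k0,k1,k2,k2,k0,k2,k3,k2,k3,k3,k0,k0,k2,k1,k1,k3],
  [k0,k2,k3,k1,k1,k3,k2,k3,k1,k0,k0,k2,k1,k0,k2,k2,k0,k3,k2,k1,k3,k2,k0,k0,k1,k1,k3,k3,k3,k1,k2,k0],
  [k0,k3,k2,k1,k2,k3,k1,k1,k0,k2,k0,k3,k1,k3,k0,k2,k0,k1,k2,k3,k2,k0,k3,k0,k3,k1,k3,k2,k2,k1,k1,k0],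
  [k0,k2,k1,k3,k2,k1,k3,k0,k1,k3,k1,k3,k2,k3,k0,k3,k0,k2,k0,k0,k0,k1,k2,k1,k2,k0,k2,k2,k1,k3,k3,k1],
  [k0,k1,k3,k2,k1,k3,k2,k2,k3,k0,k3,k0,k2,k0,k1,k0,k1,k2,k1,k1,k0,k1,k3,k1,k3,k3,k2,k2,k2,k0,k0,k3],
  [k0,k3,k1,k2,k3,k1,k2,k0,k1,k2,k1,k2,k0,k2,k3,k2,k3,k0,k3,k3,k0,k3,k1,k3,k1,k1,k0,k0,k0,k2,k2,k1],
  [k0,k3,k2,k1,k3,k1,k2,k1,k2,k0,k0,k2,k0,k1,k3,k2,k3,k3,k0,k1,k3,k2,k0,k1,k0,k3,k1,k0,k1,k2,k2,k3],
  [k0,k3,k1,k2,k2,k1,k3,k0,k1,k2,k1,k3,k3,k2,k0,k0,k2,k3,k0,k2,k1,k0,k3,k2,k0,k1,k3,k0,k1,k2,k3,k1],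
  [k0,k2,k3,k1,k2,k3,k1,k3,k0,k1,k1,k0,k0,k2,k1,k2,k1,k3,k1,k0,k3,k0,k2,k2,k0,k3,k2,k1,k3,k0,k2,k3],
  [k0,k1,k3,k2,k1,k2,k3,k0,k3,k2,k2,k3,k0,k1,k2,k1,k3,k0,k2,k3,k1,k3,k0,k2,k0,k0,k1,k1,k1,k3,k2,k0],
  [k0,k3,k2,k1,k1,k3,k2,k2,k1,k0,k3,k0,k1,k3,k0,k0,k2,k2,k0,k1,k0,k3,k2,k3,k1,k1,k2,k2,k3,k1,k0,k3],
  [k0,k1,k3,k2,k3,k2,k1,k2,k3,k0,k0,k1,k1,k0,k2,k3,k0,k1,k2,k2,k0,k3,k1,k3,k2,k2,k1,k0,k3,k0,k1,k3],
  [k0,k2,k3,k1,k2,k3,k1,k1,k3,k0,k3,k0,k2,k1,k0,k1,k0,k2,k0,k0,k0,k2,k3,k2,k3,k1,k3,k3,k2,k1,k1,k2],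
  [k0,k3,k1,k2,k1,k3,k2,k0,k1,k2,k3,k2,k0,k3,k2,k2,k1,k0,k2,k1,k1,k0,k3,k0,k3,k1,k3,k3,k0,k1,k2,k0],
  [k0,k3,k2,k1,k2,k3,k1,k1,k0,k2,k3,k0,k1,k3,k0,k0,k2,k2,k1,k1,k2,k0,k3,k3,k0,k1,k3,k2,k1,k2,k3,k0],
  [k0,k2,k3,k1,k2,k3,k1,k3,k0,k1,k1,k0,k2,k1,k0,k0,k1,k2,k3,k3,k3,k0,k2,k2,k0,k3,k2,k1,k3,k1,k2,k0],
  [k0,k1,k3,k2,k3,k2,k1,k2,k3,k0,k1,k0,k0,k1,k2,k3,k1,k2,k0,k0,k0,k3,k1,k3,k2,k1,k2,k2,k0,k3,k3,k1],
  [k0,k2,k1,k3,k2,k1,k3,k1,k0,k3,k0,k3,k0,k3,k2,k2,k3,k1,k2,k3,k0,k2,k1,k1,k2,k0,k1,k2,k0,k3,k1,k0],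
  [k0,k1,k3,k2,k1,k3,k2,k0,k2,k3,k2,k3,k0,k1,k2,k1,k2,k0,k3,k3,k3,k1,k0,k0,k1,k2,k0,k1,k3,k1,k0,k2],
  [k0,k1,k2,k3,k1,k3,k2,k0,k2,k3,k2,k3,k0,k1,k3,k1,k2,k0,k3,k3,k1,k2,k0,k0,k3,k1,k0,k2,k1,k2,k0,k1],
  [k0,k3,k2,k1,k3,k2,k1,k0,k1,k2,k1,k2,k1,k3,k0,k3,k0,k0,k2,k2,k0,k3,k2,k3,k2,k1,k0,k0,k1,k3,k3,k1],
  [k0,k3,k1,k2,k2,k3,k1,k1,k2,k0,k0,k3,k2,k0,k3,k1,k0,k3,k1,k2,k3,k1,k0,k0,k2,k2,k3,k1,k1,k2,k3,k0],
  [k0,k1,k3,k2,k2,k1,k3,k3,k0,k2,k0,k1,k0,k2,k1,k3,k2,k1,k3,k2,k1,k3,k0,k2,k0,k0,k1,k3,k3,k2,k1,k0],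
  [k0,k1,k2,k3,k3,k1,k2,k2,k3,k0,k1,k0,k0,k1,k3,k2,k3,k0,k2,k3,k1,k2,k0,k3,k0,k1,k3,k2,k2,k1,k1,k0],
  [k0,k2,k3,k1,k2,k3,k1,k1,k3,k0,k3,k0,k0,k2,k1,k2,k1,k0,k1,k1,k0,k2,k3,k3,k2,k1,k3,k2,k0,k2,k3,k0],
  [k0,k3,k1,k2,k2,k3,k1,k0,k1,k2,k3,k1,k0,k3,k2,k1,k2,k0,k2,k2,k0,k1,k3,k2,k3,k0,k3,k3,k1,k0,k0,k1],
  [k0,k3,k2,k1,k2,k3,k1,k1,k2,k0,k0,k3,k1,k3,k0,k2,k0,k1,k0,k3,k0,k3,k2,k2,k3,k1,k2,k0,k1,k3,k2,k1],
  [k0,k3,k1,k2,k3,k1,k2,k2,k0,k1,k0,k1,k0,k3,k2,k3,k2,k2,k1,k1,k1,k3,k0,k3,k0,k2,k0,k0,k1,k3,k3,k2],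
  [k0,k2,k3,k1,k2,k3,k1,k0,k1,k3,k1,k3,k1,k2,k0,k2,k0,k0,k3,k3,k2,k0,k3,k0,k3,k1,k2,k2,k2,k1,k1,k0],
  [k0,k3,k2,k1,k3,k1,k2,k1,k2,k0,k0,k2,k3,k0,k1,k2,k0,k1,k3,k3,k3,k2,k0,k0,k1,k3,k1,k1,k3,k2,k2,k0],
  [k0,k1,k2,k3,k1,k2,k3,k0,k3,k2,k3,k2,k3,k0,k1,k0,k1,k1,k2,k2,k1,k0,k2,k0,k2,k3,k1,k1,k0,k3,k3,k0],
  [k0,k2,k1,k3,k1,k2,k3,k3,k0,k1,k2,k0,k3,k2,k0,k1,k0,k3,k1,k0,k0,k2,k1,k2,k1,k3,k0,k1,k2,k3,k3,k2],
  [k0,k3,k1,k2,k3,k1,k2,k0,k2,k1,k2,k1,k0,k3,k2,k3,k2,k1,k0,k0,k1,k3,k0,k3,k0,k0,k2,k2,k1,k3,k3,k1],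
  [k0,k2,k3,k1,k2,k3,k1,k1,k3,k0,k3,k0,k0,k1,k2,k1,k2,k0,k2,k2,k0,k2,k3,k2,k3,k1,k3,k3,k1,k0,k0,k1],
  [k0,k1,k3,k2,k1,k2,k3,k3,k2,k0,k2,k0,k1,k0,k2,k0,k3,k1,k3,k3,k0,k1,k3,k1,k2,k3,k2,k2,k1,k0,k0,k1],
  [k0,k1,k3,k2,k1,k3,k2,k0,k3,k2,k3,k2,k1,k0,k2,k0,k2,k1,k2,k2,k0,k3,k1,k3,k1,k1,k0,k0,k0,k3,k3,k1],
  [k0,k3,k2,k1,k2,k3,k1,k0,k1,k2,k1,k3,k1,k0,k3,k0,k2,k3,k2,k2,k3,k0,k2,k2,k0,k1,k3,k0,k1,k0,k3,k1],
  [k0,k2,k3,k1,k3,k2,k1,k1,k0,k3,k0,k2,k0,k1,k2,k3,k1,k2,k3,k1,k3,k2,k0,k0,k2,k1,k0,k3,k3,k1,k0,k2],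
  [k0,k1,k2,k3,k1,k3,k2,k3,k2,k0,k2,k0,k1,k0,k3,k0,k2,k1,k3,k3,k0,k2,k1,k1,k3,k3,k1,k2,k0,k2,k1,k0],
  [k0,k2,k1,k3,k3,k1,k2,k0,k3,k1,k1,k2,k2,k0,k3,k0,k3,k2,k1,k3,k1,k2,k0,k3,k0,k0,k3,k1,k1,k2,k2,k0],
  [k0,k3,k1,k2,k3,k1,k2,k1,k0,k2,k0,k2,k0,k2,k3,k2,k3,k1,k3,k3,k0,k3,k1,k3,k1,k0,k1,k1,k2,k0,k0,k2],
  [k0,k3,k1,k2,k3,k1,k2,k0,k1,k2,k2,k1,k3,k0,k2,k0,k2,k3,k2,k1,k1,k0,k3,k0,k3,k3,k1,k2,k1,k0,k0,k3],
  [k0,k3,k2,k1,k3,k2,k1,k0,k2,k1,k2,k1,k3,k0,k1,k1,k0,k3,k1,k0,k2,k0,k3,k0,k3,k3,k2,k2,k2,k0,k1,k3],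
  [k0,k1,k3,k2,k1,k2,k3,k3,k0,k2,k2,k0,k0,k1,k2,k1,k3,k3,k2,k0,k1,k0,k3,k2,k0,k3,k1,k1,k1,k0,k2,k3],
  [k0,k1,k3,k2,k1,k3,k2,k0,k3,k2,k3,k2,k1,k2,k0,k2,k0,k0,k1,k1,k1,k0,k3,k0,k3,k1,k3,k3,k1,k2,k2,k0],
  [k0,k3,k1,k2,k2,k1,k3,k1,k0,k2,k0,k3,k0,k3,k2,k2,k3,k1,k2,k3,k0,k1,k3,k1,k2,k0,k3,k2,k1,k0,k0,k1],
  [k0,k1,k3,k2,k1,k2,k3,k0,k3,k2,k2,k3,k1,k0,k2,k0,k3,k1,k2,k3,k1,k3,k0,k2,k0,k0,k1,k1,k1,k3,k2,k0],
  [k0,k3,k2,k1,k3,k2,k1,k1,k2,k0,k2,k0,k1,k0,k3,k0,k3,k1,k3,k3,k0,k3,k2,k3,k2,k1,k2,k2,k0,k1,k1,k0],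
  [k0,k2,k3,k1,k3,k1,k2,k1,k3,k0,k2,k0,k0,k2,k1,k3,k2,k0,k1,k1,k0,k3,k2,k3,k1,k1,k2,k2,k3,k0,k0,k3],
  [k0,k2,k3,k1,k3,k2,k1,k1,k3,k0,k2,k0,k1,k2,k0,k3,k0,k0,k1,k1,k0,k3,k2,k3,k2,k1,k2,k2,k1,k3,k3,k0],
  [k0,k3,k2,k1,k3,k2,k1,k1,k0,k2,k0,k2,k1,k3,k0,k3,k0,k1,k2,k2,k0,k3,k2,k3,k2,k0,k1,k1,k1,k3,k3,k0],
  [k0,k3,k1,k2,k2,k1,k3,k1,k0,k2,k0,k3,k0,k2,k3,k2,k3,k1,k3,k3,k1,k3,k0,k2,k0,k0,k1,k1,k1,k2,k2,k0],
  [k0,k2,k1,k3,k2,k1,k3,k1,k0,k3,k0,k3,k0,k2,k3,k2,k3,k1,k3,k3,k1,k0,k2,k0,k2,k1,k2,k2,k0,k1,k1,k0],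
  [k0,k1,k3,k2,k1,k2,k3,k2,k3,k0,k0,k3,k0,k2,k1,k3,k1,k1,k0,k2,k1,k3,k0,k0,k2,k2,k1,k1,k3,k2,k0,k3],
  [k0,k2,k1,k3,k2,k3,k1,k0,k1,k3,k3,k1,k2,k3,k0,k0,k1,k2,k0,k1,k0,k2,k1,k2,k3,k0,k1,k3,k2,k3,k0,k2],
  [k0,k2,k3,k1,k2,k1,k3,k1,k3,k0,k3,k0,k0,k1,k2,k2,k3,k0,k2,k1,k0,k2,k3,k1,k2,k3,k1,k2,k1,k0,k0,k3],
  [k0,k1,k2,k3,k1,k2,k3,k0,k3,k2,k2,k3,k0,k1,k3,k1,k3,k0,k2,k3,k1,k0,k2,k2,k0,k1,k3,k0,k1,k0,k2,k1],
  [k0,k1,k2,k3,k1,k3,k2,k0,k2,k3,k3,k2,k0,k3,k1,k2,k1,k1,k0,k0,k1,k0,k2,k0,k3,k1,k2,k3,k0,k3,k2,k1],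
  [k0,k1,k2,k3,k1,k3,k2,k0,k3,k2,k3,k2,k1,k0,k3,k0,k2,k1,k2,k2,k1,k0,k2,k0,k3,k1,k3,k3,k0,k1,k1,k0]]"

lemma rows_ok1: "rows_ok 1 rows1" by code_simp

lemma total1: "total 1 rows1" by code_simp

lemma rows_ok2: "rows_ok 2 rows2" by code_simp

lemma total2: "total 2 rows2" by code_simp

lemma rows_ok3: "rows_ok 3 rows3" by code_simp

lemma total3: "total 3 rows3" by code_simp

lemma rows_ok4: "rows_ok 4 rows4" by code_simp

lemma total4: "total 4 rows4" by code_simp

section \<open>The induction\<close>

text \<open>A reflection moves the lower end of a coloured edge to the empty set, and the numbering
  of the directions begins with that of this edge. This is the position from which
  \<open>total\<close> starts.\<close>

lemma small_dimension:
  assumes D: "finite D" and C: "finite C" "card C = card D" and d: "0 < card D" "card D \<le> 4" and P: "precol D C P"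
    and cP: "card P = card D" and gd: "good D C P"
  shows "ext D C P \<or> card D = 3 \<and> (\<exists>i. \<forall>(v, j, c)\<in>P. j = i) \<and> (snd \<circ> snd) ` P = C"
proof -
  obtain n where n: "card D = Suc n" using d(1) by (cases "card D") auto
  have "P \<noteq> {}" using cP d(1) by auto
  then obtain v i c0 where p: "(v, i, c0) \<in> P" by (metis ex_in_conv prod_cases3)
  have v: "v \<subseteq> D" "i \<in> D" using precolD(1,2)[OF P p] .
  let ?Q = "reflect v P"
  have "rx v v - {i} = {}" by auto
  then have e0: "({}, i, c0) \<in> ?Q" unfolding reflect_def using p by force
  have "card (D - {i}) = n" using n v(2) D by simp
  then obtain h where h: "bij_betw h {0..<n} (D - {i})" using ex_bij_betw_nat_finite[of "D - {i}"] D by auto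
  define a where "a j = (case j of 0 \<Rightarrow> i | Suc k \<Rightarrow> h k)" for j
  have hi: "h k \<in> D - {i}" if "k < n" for k by (rule bij_betw_apply[OF h]) (use that in simp)
  have hinj: "h k = h l \<Longrightarrow> k = l" if "k < n" "l < n" for k l using h that unfolding bij_betw_def inj_on_def by auto
  have "inj_on a {..<card D}"
  proof (rule inj_onI)
    fix j k assume jk: "j \<in> {..<card D}" "k \<in> {..<card D}" "a j = a k"
    show "j = k" using jk n hi hinj unfolding a_def by (cases j; cases k) auto
  qed
  moreover have "D = a ` {..<card D}"
  proof -
    have "a ` {..<card D} = insert i (h ` {0..<n})"
      unfolding n lessThan_Suc_eq_insert_0 by (auto simp: a_def image_image)
    then show ?thesis using h v(2) unfolding bij_betw_def by auto
  qed
  moreover have Qp: "precol D C ?Q" using reflect_precol[OF P v(1)] .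
  ultimately have grid: "grid a (card D) D C ?Q" unfolding grid_def using C by simp
  have "card D = 1 \<or> card D = 2 \<or> card D = 3 \<or> card D = 4" using d by linarith
  then have "\<exists>rs. total (card D) rs \<and> rows_ok (card D) rs"
    using rows_ok1 rows_ok2 rows_ok3 rows_ok4 total1 total2 total3 total4 by metis
  then obtain rs where rs: "total (card D) rs" "rows_ok (card D) rs" by blast
  have a0: "({}, a 0, c0) \<in> ?Q" using e0 by (simp add: a_def)
  have cQ: "card ?Q = card D" using reflect_card[OF P] cP by simp
  from grid.base[OF grid d rs cQ reflect_good[OF P v(1) gd] a0]
  show ?thesis
  proof (elim disjE conjE)
    assume "ext D C ?Q"
    then show ?thesis using reflect_ext[OF P v(1)] by blast
  next
    assume h: "card D = 3" "\<forall>(w, j, c)\<in>?Q. j = a 0" "(snd \<circ> snd) ` ?Q = C"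
    have "j = a 0" if "(w, j, c) \<in> P" for w j c
    proof -
      have "(rx w v - {j}, j, c) \<in> ?Q" unfolding reflect_def using that by force
      from bspec[OF h(2) this] show ?thesis by simp
    qed
    moreover have "(snd \<circ> snd) ` P = C" using h(3) unfolding reflect_def by force
    ultimately show ?thesis using h(1) by blast
  qed
qed

lemma (in nonrainbow) reflect_nonrainbow: assumes "B \<subseteq> D" shows "nonrainbow D C (reflect B P)"
  unfolding nonrainbow_def nonrainbow_axioms_def
proof (intro conjI)
  show "step D C (reflect B P)" using reflect_step[OF assms] .
  show "5 \<le> card D" using d5 .
  have im: "(snd \<circ> snd) ` reflect B P = (snd \<circ> snd) ` P" unfolding reflect_def by force
  show "\<not> inj_on (snd \<circ> snd) (reflect B P)"
  proof
    assume "inj_on (snd \<circ> snd) (reflect B P)"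
    then have "card ((snd \<circ> snd) ` P) = card P"
      using card_image im reflect_card[OF P] by metis
    then show False using nrb eq_card_imp_inj_on[OF finP] by blast
  qed
qed (use IH in metis)

lemma (in nonrainbow) nonrainbow_ext: "ext D C P"
proof (cases "\<exists>i\<in>D. \<forall>v e. (v, i, e) \<notin> P")
  case False
  then show ?thesis using no_unused by blast
next
  case True
  then obtain i where i: "i \<in> D" "\<And>v e. (v, i, e) \<notin> P" by blast
  show ?thesis
  proof (cases "\<exists>b. card (side i b) = 1")
    case False
    then show ?thesis using unused_balanced[OF i] by metis
  next
    case True
    then obtain b t where t: "side i b = {t}" by (metis card_1_singletonE)
    obtain W l c1 where tt: "t = (W, l, c1)" by (cases t)
    have "(W, l, c1) \<in> side i b" using t tt by simp
    then have p: "(W, l, c1) \<in> P" "(i \<in> W) = b" by (simp_all add: side_def)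
    have off: "v = W \<and> j = l \<and> e = c1" if "(v, j, e) \<in> P" "(i \<in> v) = b" for v j e
    proof -
      have "(v, j, e) \<in> side i b" using that by (simp add: side_def)
      then show ?thesis using t tt by simp
    qed
    show ?thesis
    proof (cases b)
      case True
      show ?thesis by (rule single_side[OF i p(1)]) (use p(2) off True in auto)
    next
      case False
      interpret R: nonrainbow D C "reflect {i} P" using reflect_nonrainbow i(1) by simp
      have dir: "(v, i, e) \<notin> reflect {i} P" for v e
        using i(2) unfolding reflect_def by auto
      have l: "l \<noteq> i" using i(2) p(1) by blast
      have "ext D C (reflect {i} P)"
      proof (rule R.single_side[of i "nb W i" l c1])
        show "(nb W i, l, c1) \<in> reflect {i} P" using p(1) l by (simp add: reflect1_iff)
        show "i \<in> nb W i" using p(2) False by simp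
        fix v j e assume q: "(v, j, e) \<in> reflect {i} P" "i \<in> v"
        have "j \<noteq> i" using q dir by metis
        then have "nb v i = W \<and> j = l \<and> e = c1"
          using off[of "nb v i" j e] q False by (simp add: reflect1_iff)
        then show "v = nb W i \<and> j = l \<and> e = c1" by (metis nb_nb)
      qed (use i dir in auto)
      then show ?thesis by (intro reflect_ext[OF P, of "{i}"]) (simp add: i(1))
    qed
  qed
qed

text \<open>Dimension four is the base case: there \<open>small_dimension\<close> has no exception
  any more, and from dimension five on both cases of the step apply.\<close>

lemma ext_of_good:
  "finite D \<Longrightarrow> finite C \<Longrightarrow> card C = card D \<Longrightarrow> 4 \<le> card D \<Longrightarrow> precol D C P \<Longrightarrow>
    card P \<le> card D \<Longrightarrow> good D C P \<Longrightarrow> ext D C P"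
proof (induction "card D" arbitrary: D C P rule: less_induct)
  case less
  consider "card P < card D" | "card P = card D" "card D = 4" | "card P = card D" "5 \<le> card D"
    using less.prems by linarith
  then show ?case
  proof cases
    case 1
    then show ?thesis using ext_few[of D C P] less.prems by simp
  next
    case 2
    then show ?thesis using small_dimension[of D C P] less.prems by simp
  next
    case 3
    have IH: "ext D' C' Q" if "finite D'" "finite C'" "card C' = card D'" "Suc (card D') = card D" "precol D' C' Q"
        "card Q \<le> card D'" "good D' C' Q" for D' C' Q
      using less.hyps[of D' C' Q] that 3(2) by simp
    have st: "step D C P" unfolding step_def using less.prems 3 by simp
    show ?thesis
    proof (cases "inj_on (snd \<circ> snd) P")
      case True
      then have "rainbow D C P" unfolding rainbow_def rainbow_axioms_def using st 3(2) IH by metis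
      then show ?thesis by (rule rainbow.rainbow_ext)
    next
      case False
      then have "nonrainbow D C P" unfolding nonrainbow_def nonrainbow_axioms_def using st 3(2) IH by metis
      then show ?thesis by (rule nonrainbow.nonrainbow_ext)
    qed
  qed
qed

section \<open>Translation to graphs and partial maps\<close>

lemma nb_pair: "{x - {i}, insert i x} = {x, nb x i}"
  by (cases "i \<in> x") (auto simp: nb_def insert_absorb)

lemma edge_eq_iff: "{x, nb x i} = {y, nb y j} \<longleftrightarrow> i = j \<and> (y = x \<or> y = nb x i)"
proof
  assume h: "{x, nb x i} = {y, nb y j}"
  then have "x = y \<and> nb x i = nb y j \<or> x = nb y j \<and> nb x i = y" unfolding doubleton_eq_iff .
  then consider "x = y" "nb x i = nb y j" | "x = nb y j" "nb x i = y" by blast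
  then show "i = j \<and> (y = x \<or> y = nb x i)"
  proof cases
    case 1
    then show ?thesis by simp
  next
    case 2
    then have "nb y j = nb y i" by (metis nb_nb)
    then show ?thesis using 2(2) by simp
  qed
next
  assume "i = j \<and> (y = x \<or> y = nb x i)"
  then show "{x, nb x i} = {y, nb y j}" by auto
qed

lemma sym_diff_nb: "sym_diff x (nb x i) = {i}"
  by (auto simp: nb_def)

lemma cube_edges_iff: "e \<in> cube_edges d \<longleftrightarrow> (\<exists>x i. x \<subseteq> {..<d} \<and> i < d \<and> e = {x, nb x i})"
proof
  assume "e \<in> cube_edges d"
  then obtain x y where e: "e = {x, y}" "x \<subseteq> {..<d}" "y \<subseteq> {..<d}" "card (sym_diff x y) = 1"
    unfolding cube_edges_def cube_verts_def by auto
  obtain i where i: "sym_diff x y = {i}" using e(4) by (auto simp: card_1_singleton_iff)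
  have "j \<in> y \<longleftrightarrow> j \<in> nb x i" for j using i by (auto simp: set_eq_iff split: if_splits)
  then have "y = nb x i" by blast
  moreover have "i < d" using i e(2,3) by blast
  ultimately show "\<exists>x i. x \<subseteq> {..<d} \<and> i < d \<and> e = {x, nb x i}" using e by blast
next
  assume "\<exists>x i. x \<subseteq> {..<d} \<and> i < d \<and> e = {x, nb x i}"
  then obtain x i where "x \<subseteq> {..<d}" "i < d" "e = {x, nb x i}" by blast
  moreover have "card (sym_diff x (nb x i)) = 1" unfolding sym_diff_nb by simp
  ultimately show "e \<in> cube_edges d" unfolding cube_edges_def cube_verts_def
    by (intro CollectI exI[of _ x] exI[of _ "nb x i"]) simp
qed

lemma incident_iff:
  assumes "u \<subseteq> {..<d}" shows "e \<in> incident_edges d u \<longleftrightarrow> (\<exists>i<d. e = {u, nb u i})"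
proof
  assume "e \<in> incident_edges d u"
  then obtain x i where x: "i < d" "e = {x, nb x i}" "u \<in> e" unfolding incident_edges_def cube_edges_iff by auto
  have "{x, nb x i} = {u, nb u i}" using x(2,3) unfolding edge_eq_iff by auto
  then show "\<exists>i<d. e = {u, nb u i}" using x by blast
qed (use assms in \<open>auto simp: incident_edges_def cube_edges_iff\<close>)

lemma image_nb:
  assumes "inj_on b S" "x \<subseteq> S" "j \<in> S" shows "b ` nb x j = nb (b ` x) (b j)"
proof -
  have "b j \<in> b ` x \<longleftrightarrow> j \<in> x" using assms by (auto simp: inj_on_def)
  moreover have "b ` (x - {j}) = b ` x - {b j}" using inj_on_image_set_diff[OF assms(1), of x "{j}"] assms by auto
  ultimately show ?thesis unfolding nb_def by auto
qed

text \<open>A vertex is sent to its side of the cut and its other coordinates, renumbered by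
  \<open>b\<close>. This identifies the cube without direction \<open>i\<close> with two copies of
  the smaller one.\<close>

lemma dimensional_matching_direction:
  assumes i: "i < d" shows "dimensional_matching d {{x, nb x i} | x. x \<subseteq> {..<d}}"
proof -
  let ?M = "{{x, nb x i} | x. x \<subseteq> {..<d}}" and ?S = "{..<d} - {i}"
  have "card ?S = card {..<d - 1}" using i by simp
  then obtain b where b: "bij_betw b ?S {..<d - 1}" using finite_same_card_bij[of ?S "{..<d - 1}"] by auto
  then have bi: "inj_on b ?S" and bs: "b ` ?S = {..<d - 1}" unfolding bij_betw_def by auto
  define h where "h x = (i \<in> x, b ` (x - {i}))" for x
  have "perfect_matching (cube_verts d) (cube_edges d) ?M"
    unfolding perfect_matching_def
  proof (intro conjI ballI)
    show "?M \<subseteq> cube_edges d" using i cube_edges_iff by blast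
    fix v assume "v \<in> cube_verts d"
    then have v: "v \<subseteq> {..<d}" by (simp add: cube_verts_def)
    show "\<exists>!e. e \<in> ?M \<and> v \<in> e"
    proof (rule ex1I[of _ "{v, nb v i}"])
      show "{v, nb v i} \<in> ?M \<and> v \<in> {v, nb v i}" using v by blast
      fix e assume "e \<in> ?M \<and> v \<in> e"
      then obtain x where x: "e = {x, nb x i}" "v = x \<or> v = nb x i" by blast
      then show "e = {v, nb v i}" unfolding x(1) edge_eq_iff by simp
    qed
  qed
  moreover have "bij_betw h (cube_verts d) (two_copies_verts (cube_verts (d - 1)))"
    unfolding bij_betw_def
  proof
    show "inj_on h (cube_verts d)"
    proof (rule inj_onI)
      fix x y assume xy: "x \<in> cube_verts d" "y \<in> cube_verts d" "h x = h y"
      have "x - {i} \<subseteq> ?S" "y - {i} \<subseteq> ?S" using xy(1,2) by (auto simp: cube_verts_def)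
      then have "x - {i} = y - {i}" using xy(3) inj_on_image_eq_iff[OF bi] unfolding h_def by auto
      moreover have "i \<in> x \<longleftrightarrow> i \<in> y" using xy(3) unfolding h_def by simp
      ultimately show "x = y" by auto
    qed
    show "h ` cube_verts d = two_copies_verts (cube_verts (d - 1))"
    proof (intro equalityI subsetI)
      fix z assume "z \<in> h ` cube_verts d"
      then obtain x where x: "x \<subseteq> {..<d}" "z = h x" by (auto simp: cube_verts_def)
      have "b ` (x - {i}) \<subseteq> b ` ?S" using x(1) by (intro image_mono) auto
      then show "z \<in> two_copies_verts (cube_verts (d - 1))"
        unfolding x(2) h_def two_copies_verts_def cube_verts_def bs by simp
    next
      fix z assume "z \<in> two_copies_verts (cube_verts (d - 1))"
      then obtain p y where z: "z = (p, y)" "y \<subseteq> b ` ?S" unfolding two_copies_verts_def cube_verts_def bs by auto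
      obtain w where w: "w \<subseteq> ?S" "y = b ` w" using z(2) by (meson subset_imageE)
      define x where "x = (if p then insert i w else w)"
      have "x - {i} = w" "(i \<in> x) = p" using w(1) by (auto simp: x_def)
      then have "h x = z" unfolding h_def z(1) w(2) by simp
      moreover have "x \<in> cube_verts d" using w(1) i by (auto simp: x_def cube_verts_def)
      ultimately show "z \<in> h ` cube_verts d" by blast
    qed
  qed
  moreover have "(\<lambda>e. h ` e) ` (cube_edges d - ?M) = two_copies_edges (cube_edges (d - 1))"
  proof -
    have hE: "h ` {x, nb x j} = Pair (i \<in> x) ` {b ` (x - {i}), nb (b ` (x - {i})) (b j)}"
      if "x \<subseteq> {..<d}" "j < d" "j \<noteq> i" for x j
    proof -
      have "b ` (nb x j - {i}) = nb (b ` (x - {i})) (b j)"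
        unfolding nb_Diff_neq[OF that(3)] by (rule image_nb[OF bi]) (use that in auto)
      then show ?thesis using that(3) unfolding h_def by auto
    qed
    show ?thesis
    proof (intro equalityI subsetI)
      fix f assume "f \<in> (\<lambda>e. h ` e) ` (cube_edges d - ?M)"
      then obtain e where e: "e \<in> cube_edges d" "e \<notin> ?M" "f = h ` e" by blast
      obtain x j where x: "x \<subseteq> {..<d}" "j < d" "e = {x, nb x j}" using e(1)[unfolded cube_edges_iff] by blast
      have ji: "j \<noteq> i" using e(2) x by blast
      have "b ` (x - {i}) \<subseteq> b ` ?S" using x(1) by (intro image_mono) auto
      moreover have "b j \<in> b ` ?S" using x(2) ji by blast
      ultimately have "{b ` (x - {i}), nb (b ` (x - {i})) (b j)} \<in> cube_edges (d - 1)"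
        unfolding bs using cube_edges_iff by blast
      then show "f \<in> two_copies_edges (cube_edges (d - 1))"
        unfolding two_copies_edges_def e(3) x(3) hE[OF x(1,2) ji] by blast
    next
      fix f assume "f \<in> two_copies_edges (cube_edges (d - 1))"
      then obtain p e where f: "f = Pair p ` e" "e \<in> cube_edges (d - 1)" unfolding two_copies_edges_def by blast
      obtain y k where y: "y \<subseteq> b ` ?S" "k \<in> b ` ?S" "e = {y, nb y k}" using f(2) unfolding cube_edges_iff bs by blast
      obtain w where w: "w \<subseteq> ?S" "y = b ` w" using y(1) by (meson subset_imageE)
      obtain j where j: "j < d" "j \<noteq> i" "k = b j" using y(2) by blast
      define x where "x = (if p then insert i w else w)"
      have x: "x - {i} = w" "(i \<in> x) = p" "x \<subseteq> {..<d}" using w(1) i by (auto simp: x_def)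
      have "f = h ` {x, nb x j}" unfolding hE[OF x(3) j(1,2)] x(1,2) f(1) y(3) w(2) j(3) by (rule refl)
      moreover have "{x, nb x j} \<in> cube_edges d" using x(3) j(1) cube_edges_iff by blast
      moreover have "{x, nb x j} \<notin> ?M"
      proof
        assume "{x, nb x j} \<in> ?M"
        then obtain z where "{x, nb x j} = {z, nb z i}" by blast
        then show False using j(2) unfolding edge_eq_iff by simp
      qed
      ultimately show "f \<in> (\<lambda>e. h ` e) ` (cube_edges d - ?M)" by blast
    qed
  qed
  ultimately show ?thesis unfolding dimensional_matching_def graph_isomorphic_def by blast
qed

text \<open>The condition \<open>i \<notin> v\<close> records each coloured edge once, at its lower
  end.\<close>

definition arcs :: "nat \<Rightarrow> (nat set set \<rightharpoonup> nat) \<Rightarrow> precoloring" where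
  "arcs d \<phi> = {(v, i, c). v \<subseteq> {..<d} \<and> i < d \<and> i \<notin> v \<and> \<phi> {v, nb v i} = Some c}"

lemma has_arcs: "x \<subseteq> {..<d} \<Longrightarrow> has (arcs d \<phi>) x i c \<longleftrightarrow> i < d \<and> \<phi> {x, nb x i} = Some c"
proof -
  assume "x \<subseteq> {..<d}"
  moreover have "{x - {i}, nb (x - {i}) i} = {x, nb x i}"
    using nb_pair[of x i] by (auto simp: nb_def)
  ultimately show ?thesis unfolding has_def arcs_def by auto
qed

lemma has_arcsD: "has (arcs d \<phi>) x i c \<Longrightarrow> x \<subseteq> {..<d}"
  unfolding has_def arcs_def by auto

lemma colors_at_arcs:
  assumes u: "u \<subseteq> {..<d}" shows "colors_at d \<phi> u = {c. \<exists>i. has (arcs d \<phi>) u i c}"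
proof -
  have "(\<exists>e\<in>incident_edges d u. \<phi> e = Some c) \<longleftrightarrow> (\<exists>i. has (arcs d \<phi>) u i c)" for c
    unfolding has_arcs[OF u] Bex_def incident_iff[OF u] by blast
  then show ?thesis unfolding colors_at_def by simp
qed

lemma arcs_precol:
  assumes "edge_precoloring d \<phi>" "ran \<phi> \<subseteq> {1..d}" shows "precol {..<d} {1..d} (arcs d \<phi>)"
proof (rule precolI)
  fix v i c assume "(v, i, c) \<in> arcs d \<phi>"
  then have "v \<subseteq> {..<d}" "i < d" "i \<notin> v" "\<phi> {v, nb v i} = Some c" unfolding arcs_def by auto
  then show "v \<subseteq> {..<d} \<and> i \<in> {..<d} \<and> i \<notin> v \<and> c \<in> {1..d}" using assms(2) by (auto intro: ranI)
next
  fix x i j c e assume h: "has (arcs d \<phi>) x i c" "has (arcs d \<phi>) x j e"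
  have x: "x \<subseteq> {..<d}" using has_arcsD[OF h(1)] .
  have p: "\<phi> {x, nb x i} = Some c" "\<phi> {x, nb x j} = Some e" using h has_arcs[OF x] by auto
  have "c \<noteq> e" if "i \<noteq> j"
  proof -
    have "adjacent_edges {x, nb x i} {x, nb x j}"
      unfolding adjacent_edges_def edge_eq_iff using that by auto
    then have "\<phi> {x, nb x i} \<noteq> \<phi> {x, nb x j}" using assms(1) p unfolding edge_precoloring_def by blast
    then show ?thesis using p by simp
  qed
  then show "i = j \<longleftrightarrow> c = e" using p by auto
qed

lemma arcs_image:
  assumes "edge_precoloring d \<phi>" shows "(\<lambda>(v, i, c). {v, nb v i}) ` arcs d \<phi> = dom \<phi>"
proof (intro equalityI subsetI)
  fix e assume "e \<in> dom \<phi>"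
  then obtain c where c: "\<phi> e = Some c" by blast
  have "e \<in> cube_edges d" using assms c unfolding edge_precoloring_def by blast
  then obtain x i where x: "x \<subseteq> {..<d}" "i < d" "e = {x, nb x i}" unfolding cube_edges_iff by blast
  have "has (arcs d \<phi>) x i c" using has_arcs[OF x(1)] x(2,3) c by simp
  then have m: "(x - {i}, i, c) \<in> arcs d \<phi>" by (simp add: has_def)
  have p: "{x - {i}, nb (x - {i}) i} = e" unfolding x(3) using nb_pair[of x i] by (auto simp: nb_def)
  show "e \<in> (\<lambda>(v, i, c). {v, nb v i}) ` arcs d \<phi>"
    by (rule image_eqI[OF _ m]) (simp only: prod.case p)
qed (auto simp: arcs_def)

lemma arcs_card:
  assumes "edge_precoloring d \<phi>" shows "card (arcs d \<phi>) = card (dom \<phi>)"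
proof -
  have "inj_on (\<lambda>(v, i, c). {v, nb v i}) (arcs d \<phi>)"
  proof (rule inj_onI)
    fix s t assume st: "s \<in> arcs d \<phi>" "t \<in> arcs d \<phi>" "(\<lambda>(v, i, c). {v, nb v i}) s = (\<lambda>(v, i, c). {v, nb v i}) t"
    obtain v i c w j e where eq: "s = (v, i, c)" "t = (w, j, e)" by (metis prod_cases3)
    have m: "{v, nb v i} = {w, nb w j}" using st(3) unfolding eq by simp
    have p: "i \<notin> v" "j \<notin> w" "\<phi> {v, nb v i} = Some c" "\<phi> {w, nb w j} = Some e" using st(1,2) unfolding eq arcs_def by auto
    have "i = j" "w = v \<or> w = nb v i" using m unfolding edge_eq_iff by auto
    then have "w = v" using p(1,2) by auto
    then show "s = t" using \<open>i = j\<close> p(3,4) eq by simp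
  qed
  from card_image[OF this] show ?thesis unfolding arcs_image[OF assms] by simp
qed

lemma arcs_colors:
  assumes "edge_precoloring d \<phi>" shows "(snd \<circ> snd) ` arcs d \<phi> = ran \<phi>"
proof (intro equalityI subsetI)
  fix c assume "c \<in> ran \<phi>"
  then obtain e where e: "\<phi> e = Some c" by (auto simp: ran_def)
  then have "e \<in> (\<lambda>(v, i, c). {v, nb v i}) ` arcs d \<phi>" unfolding arcs_image[OF assms] by blast
  then obtain v i c' where v: "(v, i, c') \<in> arcs d \<phi>" "e = {v, nb v i}" by auto
  have "c' = c" using v e unfolding arcs_def by simp
  then show "c \<in> (snd \<circ> snd) ` arcs d \<phi>" using v(1) by force
qed (auto simp: arcs_def ran_def)

lemma adjacent_to_colorI:
  assumes u: "u \<subseteq> {..<d}" and i: "i < d" "{u, nb u i} \<notin> dom \<phi>" and h: "has (arcs d \<phi>) (nb u i) j c"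
  shows "adjacent_to_color d \<phi> {u, nb u i} c"
  unfolding adjacent_to_color_def
proof (rule bexI[of _ "{nb u i, nb (nb u i) j}"])
  have x: "nb u i \<subseteq> {..<d}" using has_arcsD[OF h] .
  have p: "j < d" "\<phi> {nb u i, nb (nb u i) j} = Some c" using h has_arcs[OF x] by auto
  then have "{u, nb u i} \<noteq> {nb u i, nb (nb u i) j}" using i(2) by (metis domI)
  then show "adjacent_edges {u, nb u i} {nb u i, nb (nb u i) j} \<and> \<phi> {nb u i, nb (nb u i) j} = Some c"
    using p(2) unfolding adjacent_edges_def by blast
  show "{nb u i, nb (nb u i) j} \<in> cube_edges d" using x p(1) cube_edges_iff by blast
qed

text \<open>A blocked vertex gives (C2) or (C3), according to whether it meets a coloured edge, and
  a blocked edge gives (C1).\<close>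

lemma arcs_good:
  assumes \<phi>: "edge_precoloring d \<phi>" "ran \<phi> \<subseteq> {1..d}" and n: "\<not> cond_C1 d \<phi>" "\<not> cond_C2 d \<phi>" "\<not> cond_C3 d \<phi>"
  shows "good {..<d} {1..d} (arcs d \<phi>)"
proof -
  let ?P = "arcs d \<phi>"
  have "\<not> badv {..<d} ?P u c" if c: "c \<in> {1..d}" for u c
  proof
    assume bad: "badv {..<d} ?P u c"
    then have u: "u \<subseteq> {..<d}" "\<And>i. \<not> has ?P u i c"
      "\<And>i. i < d \<Longrightarrow> (\<exists>e. has ?P u i e) \<or> (\<exists>j. has ?P (nb u i) j c)" unfolding badv_def by auto
    have uv: "u \<in> cube_verts d" using u(1) by (simp add: cube_verts_def)
    have adj: "adjacent_to_color d \<phi> e c" if e: "e \<in> incident_edges d u" "e \<notin> dom \<phi>" for e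
    proof -
      obtain i where i: "i < d" "e = {u, nb u i}" using e(1) incident_iff[OF u(1)] by blast
      have "\<not> has ?P u i f" for f using e(2) i(2) has_arcs[OF u(1)] by auto
      then obtain j where "has ?P (nb u i) j c" using u(3)[OF i(1)] by blast
      then show ?thesis using adjacent_to_colorI[OF u(1) i(1)] e(2) i(2) by blast
    qed
    show False
    proof (cases "\<exists>e\<in>incident_edges d u. e \<in> dom \<phi>")
      case True
      moreover have "c \<notin> colors_at d \<phi> u" unfolding colors_at_arcs[OF u(1)] using u(2) by blast
      ultimately have "cond_C2 d \<phi>" unfolding cond_C2_def using uv c adj by blast
      then show False using n(2) by contradiction
    next
      case False
      then have "cond_C3 d \<phi>" unfolding cond_C3_def using uv c adj by blast
      then show False using n(3) by contradiction
    qed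
  qed
  moreover have "\<not> bade {..<d} {1..d} ?P u i" for u i
  proof
    assume bad: "bade {..<d} {1..d} ?P u i"
    then have u: "u \<subseteq> {..<d}" "i < d" "\<And>e. \<not> has ?P u i e"
      "\<And>c. c \<in> {1..d} \<Longrightarrow> \<exists>j. has ?P u j c \<or> has ?P (nb u i) j c" unfolding bade_def by auto
    let ?K = "colors_at d \<phi> u" and ?v = "nb u i"
    have v: "?v \<subseteq> {..<d}" using u(1,2) by simp
    have K: "?K \<subseteq> {1..d}"
      unfolding colors_at_arcs[OF u(1)] using precolD(4)[OF arcs_precol[OF \<phi>]] unfolding has_def by blast
    \<comment> \<open>For each colour missing at \<open>u\<close> an edge of this colour is chosen
      at the other end; these are the \<open>d - k\<close> edges of (C1).\<close>
    have "\<exists>g. \<forall>c\<in>{1..d} - ?K. has ?P ?v (g c) c"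
      using u(4) unfolding colors_at_arcs[OF u(1)] by (intro bchoice) blast
    then obtain g where g: "\<And>c. c \<in> {1..d} - ?K \<Longrightarrow> has ?P ?v (g c) c" by blast
    define e where "e c = {?v, nb ?v (g c)}" for c
    have e: "g c < d" "\<phi> (e c) = Some c" if "c \<in> {1..d} - ?K" for c
      using g[OF that] has_arcs[OF v] unfolding e_def by auto
    let ?F = "e ` ({1..d} - ?K)"
    have ie: "inj_on e ({1..d} - ?K)" by (rule inj_onI) (metis e(2) option.inject)
    have "cond_C1 d \<phi>"
      unfolding cond_C1_def
    proof (intro exI conjI)
      show "{u, ?v} \<in> cube_edges d" using u(1,2) cube_edges_iff by blast
      show "{u, ?v} \<notin> dom \<phi>"
      proof
        assume "{u, ?v} \<in> dom \<phi>"
        then obtain c where "\<phi> {u, ?v} = Some c" by blast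
        then have "has ?P u i c" using has_arcs[OF u(1)] u(2) by simp
        then show False using u(3) by blast
      qed
      show "card ?K \<le> d" using card_mono[OF _ K] by simp
      show "card ?K = card ?K" by (rule refl)
      show "?F \<subseteq> incident_edges d ?v \<inter> dom \<phi>"
      proof
        fix f assume "f \<in> ?F"
        then obtain c where c: "c \<in> {1..d} - ?K" "f = e c" by blast
        have "f \<in> incident_edges d ?v" unfolding incident_iff[OF v] c(2) e_def using e(1)[OF c(1)] by blast
        then show "f \<in> incident_edges d ?v \<inter> dom \<phi>" using e(2)[OF c(1)] c(2) by blast
      qed
      show "card ?F = d - card ?K" using card_image[OF ie] K by (simp add: card_Diff_subset finite_subset)
      show "inj_on \<phi> ?F" by (rule inj_onI) (use e(2) in auto)
      show "\<forall>f\<in>?F. the (\<phi> f) \<notin> ?K" using e(2) by auto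
    qed
    then show False using n(1) by contradiction
  qed
  ultimately show ?thesis unfolding good_def by blast
qed

lemma extendable_of_ext:
  assumes \<phi>: "edge_precoloring d \<phi>" and e: "ext {..<d} {1..d} (arcs d \<phi>)"
  shows "extendable d \<phi>"
proof -
  obtain f where f: "coloring {..<d} {1..d} f" and fP: "\<forall>(v, i, c)\<in>arcs d \<phi>. f v i = c"
    using e unfolding ext_def by blast
  \<comment> \<open>The choice is harmless: \<open>f\<close> gives an edge the same colour at both
    ends.\<close>
  define \<psi> where "\<psi> e = (if e \<in> cube_edges d
      then Some (SOME c. \<exists>x i. x \<subseteq> {..<d} \<and> i < d \<and> e = {x, nb x i} \<and> c = f x i) else None)" for e
  have \<psi>: "\<psi> {x, nb x i} = Some (f x i)" if x: "x \<subseteq> {..<d}" "i < d" for x i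
  proof -
    have "(SOME c. \<exists>y j. y \<subseteq> {..<d} \<and> j < d \<and> {x, nb x i} = {y, nb y j} \<and> c = f y j) = f x i"
    proof (rule some_equality)
      show "\<exists>y j. y \<subseteq> {..<d} \<and> j < d \<and> {x, nb x i} = {y, nb y j} \<and> f x i = f y j" using x by blast
      fix c assume "\<exists>y j. y \<subseteq> {..<d} \<and> j < d \<and> {x, nb x i} = {y, nb y j} \<and> c = f y j"
      then obtain y j where y: "{x, nb x i} = {y, nb y j}" "c = f y j" by blast
      then have "j = i" "y = x \<or> y = nb x i" unfolding edge_eq_iff by auto
      then show "c = f x i" using y(2) coloringD(2)[OF f x(1)] x(2) by auto
    qed
    moreover have "{x, nb x i} \<in> cube_edges d" using x cube_edges_iff by blast
    ultimately show ?thesis unfolding \<psi>_def by simp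
  qed
  have dom: "dom \<psi> = cube_edges d" unfolding \<psi>_def dom_def by auto
  have "edge_precoloring d \<psi>"
    unfolding edge_precoloring_def
  proof (intro conjI ballI impI)
    show "dom \<psi> \<subseteq> cube_edges d" using dom by simp
    fix e e' assume ee: "e \<in> dom \<psi>" "e' \<in> dom \<psi>" "adjacent_edges e e'"
    then obtain u where u: "u \<in> e" "u \<in> e'" unfolding adjacent_edges_def by blast
    have "\<Union>(cube_edges d) \<subseteq> cube_verts d" unfolding cube_edges_def by auto
    then have uD: "u \<subseteq> {..<d}" using ee(1) u(1) unfolding dom cube_verts_def by blast
    have "e \<in> incident_edges d u" "e' \<in> incident_edges d u" using ee(1,2) u unfolding dom incident_edges_def by auto
    then obtain i j where ij: "i < d" "e = {u, nb u i}" "j < d" "e' = {u, nb u j}" unfolding incident_iff[OF uD] by blast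
    have "i \<noteq> j" using ee(3) ij unfolding adjacent_edges_def by blast
    then have "f u i \<noteq> f u j" using coloringD(1)[OF f uD] ij(1,3) unfolding bij_betw_def inj_on_def by auto
    then show "\<psi> e \<noteq> \<psi> e'" using \<psi>[OF uD] ij by simp
  qed
  moreover have "ran \<psi> \<subseteq> {1..d}"
  proof
    fix c assume "c \<in> ran \<psi>"
    then obtain e where e: "\<psi> e = Some c" by (auto simp: ran_def)
    then have "e \<in> cube_edges d" using dom by blast
    then obtain x i where x: "x \<subseteq> {..<d}" "i < d" "e = {x, nb x i}" unfolding cube_edges_iff by blast
    have "c = f x i" using e \<psi>[OF x(1,2)] x(3) by simp
    then show "c \<in> {1..d}" using coloringD(1)[OF f x(1)] x(2) unfolding bij_betw_def by blast
  qed
  moreover have "\<psi> e = \<phi> e" if "e \<in> dom \<phi>" for e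
  proof -
    have "e \<in> (\<lambda>(v, i, c). {v, nb v i}) ` arcs d \<phi>" using that unfolding arcs_image[OF \<phi>] .
    then obtain v i c where v: "(v, i, c) \<in> arcs d \<phi>" "e = {v, nb v i}" by auto
    have "f v i = c" using bspec[OF fP v(1)] by simp
    then show ?thesis using v \<psi>[of v i] unfolding arcs_def by simp
  qed
  ultimately show ?thesis unfolding extendable_def proper_edge_coloring_def using dom by blast
qed

theorem theorem3p8:
  fixes d :: nat and \<phi> :: "nat set set \<rightharpoonup> nat"
  assumes "d \<ge> 1"
    and "edge_precoloring d \<phi>"
    and "ran \<phi> \<subseteq> {1..d}"
    and "card (dom \<phi>) = d"
    and "\<phi> \<notin> exceptional_precolorings d"
  shows "extendable d \<phi>"
proof -
  let ?P = "arcs d \<phi>"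
  have n: "\<not> cond_C1 d \<phi>" "\<not> cond_C2 d \<phi>" "\<not> cond_C3 d \<phi>" "\<not> cond_C4 d \<phi>"
    using assms(2,5) unfolding exceptional_precolorings_def by auto
  have P: "precol {..<d} {1..d} ?P" by (rule arcs_precol[OF assms(2,3)])
  have cP: "card ?P = card {..<d}" using arcs_card[OF assms(2)] assms(4) by simp
  have gd: "good {..<d} {1..d} ?P" by (rule arcs_good[OF assms(2,3) n(1-3)])
  have "ext {..<d} {1..d} ?P"
  proof (cases "d \<le> 4")
    case False
    show ?thesis by (rule ext_of_good[OF _ _ _ _ P _ gd]) (use False cP in auto)
  next
    case True
    have "ext {..<d} {1..d} ?P \<or> card {..<d} = 3 \<and> (\<exists>i. \<forall>(v, j, c)\<in>?P. j = i) \<and> (snd \<circ> snd) ` ?P = {1..d}"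
      by (rule small_dimension[OF _ _ _ _ _ P cP gd]) (use True assms(1) in auto)
    then show ?thesis
    proof (elim disjE conjE exE)
      \<comment> \<open>In the exceptional case three edges of one direction show three colours,
        which is (C4).\<close>
      fix i assume h: "card {..<d} = 3" "\<forall>(v, j, c)\<in>?P. j = i" "(snd \<circ> snd) ` ?P = {1..d}"
      have d3: "d = 3" using h(1) by simp
      have r: "ran \<phi> = {1..d}" using h(3) arcs_colors[OF assms(2)] by simp
      have "?P \<noteq> {}" using cP d3 by auto
      then obtain v j c where "(v, j, c) \<in> ?P" by (metis ex_in_conv prod_cases3)
      then have i: "i < d" using h(2) unfolding arcs_def by auto
      have "dom \<phi> \<subseteq> {{x, nb x i} | x. x \<subseteq> {..<d}}"
        unfolding arcs_image[OF assms(2), symmetric] using h(2) unfolding arcs_def by auto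
      then have "cond_C4 d \<phi>"
        unfolding cond_C4_def using dimensional_matching_direction[OF i] d3 r assms(4) by auto
      then show ?thesis using n(4) by contradiction
    qed
  qed
  then show ?thesis by (rule extendable_of_ext[OF assms(2)])
qed

end
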